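(* If $S_\bullet$ is a cactus set, then the simplicial realization $|S_\bullet|$ of $S_\bullet$ has naturally an action of the cactus operad $\mathcal{C}$ (that is, $|S_\bullet|$ is naturally an algebra over the operad $\mathcal{C}$).
   Context: **Cactus operad.** $\mathcal{C}=\{\mathcal{C}(n)\mid n\ge 1\}$ (there is no $\mathcal{C}(0)$) is Voronov's cactus operad. An element of $\mathcal{C}(n)$ (a cactus) is an ordered configuration of $n$ parametrized circles (the lobes), with varying positive radii whose sum is $1$, such that the dual graph of the configuration is a tree, together with: (1) a cyclic ordering of the lobes at each intersection point of the circles; (2) a chosen distinguished point $0_i$ on the $i$-th circle, $i=1,\dots,n$; (3) a chosen distinguished point $0$ (also written $0_c$) for the entire configuration $c$, and, if $0$ is an intersection point of circles, a choice of the particular circle on which it lies. The topology on $\mathcal{C}(n)$ is obtained as a quotient of $(S^1)^n$. Each $c\in\mathcal{C}(n)$ determines a continuous map $f_c:S^1\to c$ from the standard circle of radius $1$: start at $0$ and travel along the circles in the direction of their parametrizations; on arriving at an intersection point, always continue onto the circle that comes after, in the cyclic ordering at that point, the circle through which one arrived. For $c\in\mathcal{C}(n)$ and $d_i\in\mathcal{C}(k_i)$, the operad composition $\gamma(c;d_1,\dots,d_n)\in\mathcal{C}(k_1+\cdots+k_n)$ is obtained by collapsing the $i$-th lobe of $c$ (suitably rescaled) onto $d_i$ via $f_{d_i}$, with $0_i$ identified with the distinguished point of $d_i$; the distinguished point $0_c$ of $c$ is carried along on the lobe to which it belongs. The symmetric group acts by permuting the order of the lobes. **Cyclic sets.** Connes'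 cyclic category $\Lambda$ has objects $[n]=\{0,\dots,n\}$ and morphisms generated by the usual simplicial face and degeneracy maps together with an extra degeneracy $s_{n+1}:[n+1]\to[n]$, such that the composite of $d_0:[n]\to[n+1]$ with $s_{n+1}$ has $(n+1)$-st power the identity of $[n]$. A cyclic set is a functor $S_\bullet:\Lambda^{op}\to \mathrm{Sets}$; it has an underlying simplicial set, and $|S_\bullet|$ denotes the realization of the latter. **Spiny cacti.** For $c\in\mathcal{C}(n)$ and positive integers $j_1,\dots,j_n$, consider pairs $(c,X)$, where $X$ is a finite set of points on $c$ that contains $0$, all the $0_i$, and all intersection points, and such that exactly $j_i$ points of $X$ lie on the $i$-th circle (an intersection point counts as a point on every circle containing it). The points of $X$ on the $i$-th lobe are cyclically ordered starting with $0_i$; the points of $X$ on the entire cactus, each intersection point being counted once for each lobe containing it (so $\sum_i j_i$ points in all), are cyclically ordered via their preimages under $f_c$, starting from $0_c$. Two such pairs $(c_1,X_1)$, $(c_2,X_2)$ (with the same $n$ and $j_i$) are identified if $f_{c_2}$ can be obtained from $f_{c_1}$ by a continuous reparametrization of $S^1$ taking the points of $X_1$ to the points of $X_2$, matching distinguished points and intersection points exactly. Let $\overline{c}_{(j_1-1,\dots,j_n-1)}$ denote the set of the resulting equivalence classes of pairs $(c,X)$ (spiny cacti). For $1\le k\le n$, $0\le i\le j_k-1$: the $(k,i)$-th degeneracy sends $(c,X)$ to $(c,X')$, where $X'$ is obtained by inserting a new point in the $i$-th position between two adjacent points on the $k$-th circle (so $j_k$ is replaced by $j_k+1$); the $(k,i)$-th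 face sends $(c,X)$ to $(c',X')$ obtained by pinching together the adjacent points at the $i$-th and $(i+1)$-st positions on the $k$-th circle (so $j_k$ is replaced by $j_k-1$; the cactus $c'$ may differ from $c$). If $(d_k,Y_k)\in\overline{d_k}_{(r_{k,1}-1,\dots,r_{k,m_k}-1)}$ with $\sum_l r_{k,l}=j_k$ for each $k$, the composition of $(c,X)$ with the $(d_k,Y_k)$ is the spiny cactus with underlying cactus $\gamma(c;d_1,\dots,d_n)$ obtained by matching the $j_k$ cyclically ordered points of $X$ on the $k$-th lobe with the $j_k$ cyclically ordered points of $Y_k$. **Cactus set.** A cactus set is a cyclic set $S_\bullet$ together with, for each spiny cactus $(c,X)\in\overline{c}_{(j_1-1,\dots,j_n-1)}$, a structure map $$\mu_{c,X}:S_{j_1-1}\times\cdots\times S_{j_n-1}\to S_{j_1+\cdots+j_n-1},$$ subject to the following conditions. For $1\le k\le n$ and $0\le i\le j_k-1$ let $f(k,i)$ be the position, in the cyclic ordering of all segments of $X$ over the entire cactus, of the $i$-th segment of the $k$-th lobe. (i) If $(c,X')$ is the $(k,i)$-th degeneracy of $(c,X)$ and $\sigma_i$ denotes the $i$-th degeneracy map of $S_\bullet$ (applied to the $k$-th factor on the left-hand side below), then $\mu_{c,X'}\circ\sigma_i=\sigma_{f(k,i)}\circ\mu_{c,X}$ as maps to $S_{j_1+\cdots+j_n}$. (ii) If $(c',X')$ is the $(k,i)$-th face of $(c,X)$ and $\delta_i$ denotes the $i$-th face map of $S_\bullet$ (applied to the $k$-th factor on the left-hand side below), then $\mu_{c',X'}\circ\delta_i=\delta_{f(k,i)}\circ\mu_{c,X}$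 as maps to $S_{j_1+\cdots+j_n-2}$. (iii) For $(c,X)$ and $(d_k,Y_k)$ as in the definition of composition, the composite of $\mu_{d_1,Y_1}\times\cdots\times\mu_{d_n,Y_n}$ followed by $\mu_{c,X}$ equals the structure map of the composed spiny cactus, as maps $\prod_{k}\prod_{l}S_{r_{k,l}-1}\to S_{\sum_k j_k-1}$.
   Formalization: Conditions (i)–(iii) do not force equivariance or the unit axiom, so the action is proved equivariant only if the structure maps are, and unital only if they are; composition and continuity hold always, with continuity taken on compactly generated products. *)

theory Defs
  imports
    "HOL-Analysis.Analysis"
    "HOL-Combinatorics.Orbits"
    "HOL-Homology.Homology"
begin

section \<open>Cacti\<close>

subsection \<open>Configurations of circles\<close>

text \<open>
  Every circle is \<open>\<real>/\<int>\<close>, with coordinates in \<open>{0..<1}\<close>; the distinguished point \<open>0\<^sub>i\<close>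
  of the \<open>i\<close>-th lobe is its coordinate \<open>0\<close>. Lobes are numbered from \<open>0\<close>.
  Lengths are measured in circumferences of the circle of radius \<open>1\<close>, so a lobe of radius \<open>r\<close>
  has length \<open>r\<close>, and a cactus has total length \<open>1\<close>.
\<close>

type_synonym point = "nat \<times> real"

text \<open>
  A configuration is the quotient of the disjoint union of its circles by the orbits of the
  permutation \<open>turn\<close>, which sends a point of one circle to the same point of the configuration,
  viewed on the circle that comes next in the cyclic ordering there. Intersection points are the
  nontrivial orbits. The field \<open>origin\<close> is the distinguished point \<open>0\<close>, together with the circle
  on which it lies.
\<close>

record cactus =
  lobes :: nat
  radius :: "nat \<Rightarrow> real"
  turn :: "point \<Rightarrow> point"
  origin :: point

definition points :: "cactus \<Rightarrow> point set" where
  "points c = {..<lobes c} \<times> {0..<1}"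

definition intersections :: "cactus \<Rightarrow> point set set" where
  "intersections c = {Orbits.orbit (turn c) p | p. p \<in> points c \<and> turn c p \<noteq> p}"

definition is_tree :: "'v set \<Rightarrow> ('v \<Rightarrow> 'v \<Rightarrow> bool) \<Rightarrow> bool" where
  "is_tree V adj \<longleftrightarrow> V \<noteq> {} \<and>
     (\<forall>u\<in>V. \<forall>v\<in>V. \<exists>!p. p \<noteq> [] \<and> hd p = u \<and> last p = v \<and>
        set p \<subseteq> V \<and> distinct p \<and> successively adj p)"

text \<open>The dual graph: its vertices are the lobes and the intersection points.\<close>

definition dual_verts :: "cactus \<Rightarrow> (nat + point set) set" where
  "dual_verts c = {..<lobes c} <+> intersections c"

fun dual_adj :: "nat + point set \<Rightarrow> nat + point set \<Rightarrow> bool" where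
  "dual_adj (Inl i) (Inr P) \<longleftrightarrow> i \<in> fst ` P"
| "dual_adj (Inr P) (Inl i) \<longleftrightarrow> i \<in> fst ` P"
| "dual_adj _ _ \<longleftrightarrow> False"

text \<open>
  Radii of lobes that do not exist are \<open>0\<close> and \<open>turn\<close> is the identity outside the circles, so
  that equality of records is equality of cacti.
\<close>

definition is_cactus :: "cactus \<Rightarrow> bool" where
  "is_cactus c \<longleftrightarrow>
     (\<forall>i<lobes c. 0 < radius c i) \<and> (\<forall>i\<ge>lobes c. radius c i = 0) \<and>
     (\<Sum>i<lobes c. radius c i) = 1 \<and>
     turn c permutes points c \<and> finite {p. turn c p \<noteq> p} \<and>
     (\<forall>P\<in>intersections c. inj_on fst P) \<and>
     is_tree (dual_verts c) dual_adj \<and>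
     origin c \<in> points c"

definition cacti :: "nat \<Rightarrow> cactus set" where
  "cacti n = {c. is_cactus c \<and> lobes c = n}"

subsection \<open>The path around a cactus\<close>

definition advance :: "cactus \<Rightarrow> point \<Rightarrow> real \<Rightarrow> point" where
  "advance c = (\<lambda>(i, t) h. (i, frac (t + h / radius c i)))"

text \<open>
  The map \<open>f\<^sub>c\<close>, as a function of period \<open>1\<close> on \<open>\<real>\<close>. Its value at a time when
  the path passes an intersection point is this point viewed on the circle along which the path
  leaves; so \<open>circuit c\<close> is a bijection from \<open>{0..<1}\<close> onto \<open>points c\<close>, and the map into the
  configuration itself is its composite with the quotient map.
\<close>

definition is_circuit :: "cactus \<Rightarrow> (real \<Rightarrow> point) \<Rightarrow> bool" where
  "is_circuit c f \<longleftrightarrow>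
     f 0 = origin c \<and> range f \<subseteq> points c \<and>
     (\<forall>s. \<exists>\<epsilon>>0. \<forall>h\<in>{0..<\<epsilon>}. f (s + h) = advance c (f s) h) \<and>
     (\<forall>s. \<exists>\<epsilon>>0. \<exists>p\<in>points c. f s = turn c p \<and> (\<forall>h\<in>{0<..<\<epsilon>}. f (s - h) = advance c p (- h)))"

definition circuit :: "cactus \<Rightarrow> real \<Rightarrow> point" where
  "circuit c = (THE f. is_circuit c f)"

definition visit_time :: "cactus \<Rightarrow> point \<Rightarrow> real" where
  "visit_time c = inv_into {0..<1} (circuit c)"

subsection \<open>Topology\<close>

definition quotient_topology :: "'a topology \<Rightarrow> ('a \<Rightarrow> 'b) \<Rightarrow> 'b topology" where
  "quotient_topology X f =
     topology (\<lambda>U. U \<subseteq> f ` topspace X \<and> openin X {x \<in> topspace X. f x \<in> U})"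

lemma openin_quotient_topology:
  "openin (quotient_topology X f) U \<longleftrightarrow>
     U \<subseteq> f ` topspace X \<and> openin X {x \<in> topspace X. f x \<in> U}"
proof -
  have "istopology (\<lambda>U. U \<subseteq> f ` topspace X \<and> openin X {x \<in> topspace X. f x \<in> U})"
    unfolding istopology_def
  proof (rule conjI; intro allI impI)
    fix S T
    assume "S \<subseteq> f ` topspace X \<and> openin X {x \<in> topspace X. f x \<in> S}"
      and "T \<subseteq> f ` topspace X \<and> openin X {x \<in> topspace X. f x \<in> T}"
    moreover have "{x \<in> topspace X. f x \<in> S \<inter> T} =
        {x \<in> topspace X. f x \<in> S} \<inter> {x \<in> topspace X. f x \<in> T}" by auto
    ultimately show "S \<inter> T \<subseteq> f ` topspace X \<and> openin X {x \<in> topspace X. f x \<in> S \<inter> T}"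
      by auto
  next
    fix \<K>
    assume *: "\<forall>K\<in>\<K>. K \<subseteq> f ` topspace X \<and> openin X {x \<in> topspace X. f x \<in> K}"
    have "{x \<in> topspace X. f x \<in> \<Union>\<K>} = (\<Union>K\<in>\<K>. {x \<in> topspace X. f x \<in> K})" by auto
    with * show "\<Union>\<K> \<subseteq> f ` topspace X \<and> openin X {x \<in> topspace X. f x \<in> \<Union>\<K>}"
      by auto
  qed
  then show ?thesis
    by (simp add: quotient_topology_def)
qed

abbreviation simplex_topology :: "nat \<Rightarrow> (nat \<Rightarrow> real) topology" where
  "simplex_topology n \<equiv> subtopology (powertop_real UNIV) (standard_simplex n)"

text \<open>
  \<open>traces c w l z\<close>: the path around \<open>c\<close> consists of successive arcs of lengths
  \<open>l 0, l 1, \<dots>\<close> on the lobes \<open>w ! 0, w ! 1, \<dots>\<close>, and \<open>z i\<close> (modulo \<open>1\<close>) is the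
  coordinate on the \<open>i\<close>-th lobe at which the path arrives there first. Arcs may have length \<open>0\<close>.
  These data determine \<open>c\<close>.
\<close>

definition traces :: "cactus \<Rightarrow> nat list \<Rightarrow> (nat \<Rightarrow> real) \<Rightarrow> (nat \<Rightarrow> real) \<Rightarrow> bool" where
  "traces c w l z \<longleftrightarrow>
     (\<forall>j<length w. \<forall>u\<in>{0..<l j}.
        circuit c ((\<Sum>a<j. l a) + u) =
          (w ! j, frac (z (w ! j) + ((\<Sum>a | a < j \<and> w ! a = w ! j. l a) + u) / radius c (w ! j))))"

text \<open>
  The space of cacti with \<open>n\<close> lobes is a quotient of a union of parameter spaces, one for each
  sequence \<open>w\<close> of lobes, in which a point gives the lengths of the arcs and the position of
  the arrival point on each of the \<open>n\<close> circles.
\<close>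

definition trace_topology :: "nat \<Rightarrow> nat list \<Rightarrow> ((nat \<Rightarrow> real) \<times> (nat \<Rightarrow> real)) topology" where
  "trace_topology n w =
     subtopology (prod_topology (simplex_topology (length w - 1)) (powertop_real {..<n}))
       {(l, z). \<exists>c\<in>cacti n. traces c w l z}"

definition cactus_space :: "nat \<Rightarrow> cactus topology" where
  "cactus_space n =
     quotient_topology (sum_topology (trace_topology n) {w. w \<noteq> [] \<and> set w \<subseteq> {..<n}})
       (\<lambda>(w, l, z). THE c. c \<in> cacti n \<and> traces c w l z)"

subsection \<open>Operad structure\<close>

text \<open>Pairs \<open>(k, l)\<close> with \<open>l < m k\<close> are numbered lexicographically.\<close>

definition flat :: "(nat \<Rightarrow> nat) \<Rightarrow> nat \<times> nat \<Rightarrow> nat" where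
  "flat m = (\<lambda>(k, l). (\<Sum>a<k. m a) + l)"

definition unflat :: "nat \<Rightarrow> (nat \<Rightarrow> nat) \<Rightarrow> nat \<Rightarrow> nat \<times> nat" where
  "unflat n m = inv_into (SIGMA k:{..<n}. {..<m k}) (flat m)"

definition graft_incl :: "(nat \<Rightarrow> cactus) \<Rightarrow> nat \<Rightarrow> point \<Rightarrow> point" where
  "graft_incl d k = (\<lambda>(l, t). (flat (\<lambda>a. lobes (d a)) (k, l), t))"

text \<open>The collapse of the lobes of the outer cactus onto the inner cacti.\<close>

definition graft_map :: "(nat \<Rightarrow> cactus) \<Rightarrow> point \<Rightarrow> point" where
  "graft_map d = (\<lambda>(k, t). graft_incl d k (circuit (d k) t))"

text \<open>
  The operad composition. To find where the path in the composite continues when it arrives at a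
  point \<open>p\<close> of \<open>d k\<close>: the path around \<open>d k\<close> would continue along \<open>turn (d k) p\<close>, which is the
  image of the point of the \<open>k\<close>-th lobe of \<open>c\<close> with coordinate \<open>visit_time (d k) (turn (d k) p)\<close>;
  the path around \<open>c\<close> turns at that point.
\<close>

definition graft :: "cactus \<Rightarrow> (nat \<Rightarrow> cactus) \<Rightarrow> cactus" where
  "graft c d =
    (let m = \<lambda>k. lobes (d k); N = (\<Sum>k<lobes c. m k) in
     \<lparr>lobes = N,
      radius = (\<lambda>q. if q < N then (case unflat (lobes c) m q of (k, l) \<Rightarrow> radius c k * radius (d k) l)
                    else 0),
      turn = (\<lambda>(q, t). if q < N \<and> t \<in> {0..<1}
                then (case unflat (lobes c) m q of (k, l) \<Rightarrow>
                  graft_map d (turn c (k, visit_time (d k) (turn (d k) (l, t)))))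
                else (q, t)),
      origin = graft_map d (origin c)\<rparr>)"

definition cactus_unit :: cactus where
  "cactus_unit = \<lparr>lobes = 1, radius = (\<lambda>i. if i = 0 then 1 else 0), turn = id, origin = (0, 0)\<rparr>"

text \<open>The \<open>i\<close>-th lobe of \<open>c\<close> becomes the \<open>\<sigma> i\<close>-th lobe of \<open>relabel \<sigma> c\<close>.\<close>

definition relabel :: "(nat \<Rightarrow> nat) \<Rightarrow> cactus \<Rightarrow> cactus" where
  "relabel \<sigma> c =
     \<lparr>lobes = lobes c,
      radius = radius c \<circ> inv_into UNIV \<sigma>,
      turn = map_prod \<sigma> id \<circ> turn c \<circ> map_prod (inv_into UNIV \<sigma>) id,
      origin = map_prod \<sigma> id (origin c)\<rparr>"

section \<open>Spiny cacti\<close>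

text \<open>
  A finite set of points on a cactus that contains all intersection points is represented by its
  preimage in the disjoint union of the circles. Thus intersection points are counted once for each
  lobe containing them.
\<close>

definition spiny :: "cactus \<Rightarrow> point set \<Rightarrow> bool" where
  "spiny c X \<longleftrightarrow> is_cactus c \<and> finite X \<and> X \<subseteq> points c \<and> origin c \<in> X \<and>
     (\<forall>i<lobes c. (i, 0) \<in> X) \<and> {p. turn c p \<noteq> p} \<subseteq> X"

text \<open>
  The reparametrization of the circle is \<open>\<phi>\<close>; the map \<open>h\<close> is the bijection between the two
  configurations that it induces.
\<close>

definition spiny_equiv :: "cactus \<Rightarrow> point set \<Rightarrow> cactus \<Rightarrow> point set \<Rightarrow> bool" where
  "spiny_equiv c X c' X' \<longleftrightarrow> spiny c X \<and> spiny c' X' \<and> lobes c = lobes c' \<and>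
     (\<exists>\<phi> h. continuous_on UNIV \<phi> \<and> strict_mono \<phi> \<and> \<phi> (0::real) = 0 \<and> (\<forall>s. \<phi> (s + 1) = \<phi> s + 1) \<and>
        bij_betw h (points c) (points c') \<and>
        (\<forall>s. circuit c' (\<phi> s) = h (circuit c s)) \<and>
        (\<forall>p\<in>points c. fst (h p) = fst p \<and> h (turn c p) = turn c' (h p)) \<and>
        (\<forall>i<lobes c. h (i, 0) = (i, 0)) \<and>
        h ` X = X')"

definition on_lobe :: "point set \<Rightarrow> nat \<Rightarrow> real set" where
  "on_lobe X k = {t. (k, t) \<in> X}"

definition spines :: "point set \<Rightarrow> nat \<Rightarrow> nat" where
  "spines X k = card (on_lobe X k)"

definition on_circuit :: "cactus \<Rightarrow> point set \<Rightarrow> real set" where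
  "on_circuit c X = {s \<in> {0..<1}. circuit c s \<in> X}"

text \<open>
  For finite \<open>A \<subseteq> {0..<1}\<close> containing \<open>0\<close>: the \<open>i\<close>-th point of \<open>A\<close> on the circle, with the
  convention that the point after the last one is \<open>1\<close>, and the lengths of the segments.
\<close>

definition nth_mark :: "real set \<Rightarrow> nat \<Rightarrow> real" where
  "nth_mark A i = (sorted_list_of_set A @ [1]) ! i"

definition gaps :: "real set \<Rightarrow> nat \<Rightarrow> real" where
  "gaps A i = (if i < card A then nth_mark A (Suc i) - nth_mark A i else 0)"

text \<open>
  The position, on the entire cactus, of the \<open>i\<close>-th segment of the \<open>k\<close>-th lobe. A segment is
  identified by the point at which it starts.
\<close>

definition seg_index :: "cactus \<Rightarrow> point set \<Rightarrow> nat \<Rightarrow> nat \<Rightarrow> nat" where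
  "seg_index c X k i = card {s \<in> on_circuit c X. s < visit_time c (k, nth_mark (on_lobe X k) i)}"

text \<open>
  Pinching the \<open>i\<close>-th segment \<open>[a, b]\<close> of the \<open>k\<close>-th lobe. The circle that remains is
  the image of the old one under \<open>pinch_coord\<close>.
\<close>

definition pinch_coord :: "real \<Rightarrow> real \<Rightarrow> real \<Rightarrow> real" where
  "pinch_coord a b t =
     frac ((if t \<le> a then t else if t \<le> b then a else t - (b - a)) / (1 - (b - a)))"

definition pinch_map :: "point set \<Rightarrow> nat \<Rightarrow> nat \<Rightarrow> point \<Rightarrow> point" where
  "pinch_map X k i = (\<lambda>(l, t). (l, if l = k
     then pinch_coord (nth_mark (on_lobe X k) i) (nth_mark (on_lobe X k) (Suc i)) t else t))"

text \<open>
  A path that was to leave along the pinched segment instead continues as the old path did when it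
  arrived at the end of that segment (\<open>skip\<close>). The pinched point is reached along the
  remaining part of its lobe at the start of the segment (\<open>lift\<close>).
\<close>

definition pinch :: "cactus \<Rightarrow> point set \<Rightarrow> nat \<Rightarrow> nat \<Rightarrow> cactus" where
  "pinch c X k i =
    (let a = nth_mark (on_lobe X k) i; b = nth_mark (on_lobe X k) (Suc i);
         K = pinch_map X k i;
         skip = (\<lambda>p. if p = (k, a) then turn c (k, frac b) else p);
         lift = (\<lambda>q. if q = K (k, a) then (k, a) else inv_into (points c) K q) in
     \<lparr>lobes = lobes c,
      radius = (\<lambda>l. (if l = k then radius c k * (1 - (b - a)) else radius c l) /
                    (1 - radius c k * (b - a))),
      turn = (\<lambda>q. if q \<in> points c then K (skip (turn c (lift q))) else q),
      origin = K (skip (origin c))\<rparr>)"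

definition pinch_spines :: "point set \<Rightarrow> nat \<Rightarrow> nat \<Rightarrow> point set" where
  "pinch_spines X k i = pinch_map X k i ` X"

text \<open>
  Spiny cacti \<open>(c, X)\<close> and \<open>(d k, Y k)\<close> are matched if \<open>f\<^bsub>d k\<^esub>\<close> takes the points of \<open>X\<close> on the
  \<open>k\<close>-th lobe to the points of \<open>Y k\<close>. If only the numbers of these points agree, this can be
  achieved by passing from \<open>(c, X)\<close> to an equivalent pair.
\<close>

definition matched :: "cactus \<Rightarrow> point set \<Rightarrow> (nat \<Rightarrow> cactus) \<Rightarrow> (nat \<Rightarrow> point set) \<Rightarrow> bool" where
  "matched c X d Y \<longleftrightarrow> spiny c X \<and>
     (\<forall>k<lobes c. spiny (d k) (Y k) \<and> on_lobe X k = on_circuit (d k) (Y k))"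

definition graft_spines :: "cactus \<Rightarrow> (nat \<Rightarrow> cactus) \<Rightarrow> (nat \<Rightarrow> point set) \<Rightarrow> point set" where
  "graft_spines c d Y = (\<Union>k<lobes c. graft_incl d k ` Y k)"

section \<open>Cyclic sets and cactus sets\<close>

text \<open>
  The morphisms \<open>[m] \<rightarrow> [n]\<close> of the cyclic category are represented by the monotone maps
  \<open>\<psi> : \<int> \<rightarrow> \<int>\<close> with \<open>\<psi> (x + m + 1) = \<psi> x + n + 1\<close>; two such maps represent the same
  morphism iff they differ by a multiple of \<open>n + 1\<close>.
\<close>

definition cyc_hom :: "nat \<Rightarrow> nat \<Rightarrow> (int \<Rightarrow> int) set" where
  "cyc_hom m n = {\<psi>. mono \<psi> \<and> (\<forall>x. \<psi> (x + int m + 1) = \<psi> x + int n + 1)}"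

text \<open>
  The face map \<open>[n] \<rightarrow> [n + 1]\<close> that omits \<open>i\<close>, and the degeneracy \<open>[n + 1] \<rightarrow> [n]\<close> that takes the
  value \<open>i\<close> twice. The extra degeneracy is the case \<open>i = n + 1\<close>, where \<open>n + 1\<close> is sent to \<open>0\<close>; its
  composite with \<open>coface n 0\<close> is the translation by \<open>1\<close>, which has order \<open>n + 1\<close>.
\<close>

definition coface :: "nat \<Rightarrow> nat \<Rightarrow> int \<Rightarrow> int" where
  "coface n i x =
     (let q = x div (int n + 1); r = x mod (int n + 1)
      in q * (int n + 2) + (if r < int i then r else r + 1))"

definition codegeneracy :: "nat \<Rightarrow> nat \<Rightarrow> int \<Rightarrow> int" where
  "codegeneracy n i x =
     (let q = x div (int n + 2); r = x mod (int n + 2)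
      in q * (int n + 1) + (if r \<le> int i then r else r - 1))"

record 'a cyclic_set =
  cells :: "nat \<Rightarrow> 'a set"
  act :: "nat \<Rightarrow> nat \<Rightarrow> (int \<Rightarrow> int) \<Rightarrow> 'a \<Rightarrow> 'a"

definition is_cyclic_set :: "('a, 'b) cyclic_set_scheme \<Rightarrow> bool" where
  "is_cyclic_set S \<longleftrightarrow>
     (\<forall>m n. \<forall>\<psi>\<in>cyc_hom m n. act S m n \<psi> \<in> cells S n \<rightarrow> cells S m) \<and>
     (\<forall>m n. \<forall>\<psi>\<in>cyc_hom m n. \<forall>s\<in>cells S n. act S m n (\<lambda>x. \<psi> x + int n + 1) s = act S m n \<psi> s) \<and>
     (\<forall>n. \<forall>s\<in>cells S n. act S n n id s = s) \<and>
     (\<forall>l m n. \<forall>\<phi>\<in>cyc_hom l m. \<forall>\<psi>\<in>cyc_hom m n. \<forall>s\<in>cells S n.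
        act S l n (\<psi> \<circ> \<phi>) s = act S l m \<phi> (act S m n \<psi> s))"

definition face :: "('a, 'b) cyclic_set_scheme \<Rightarrow> nat \<Rightarrow> nat \<Rightarrow> 'a \<Rightarrow> 'a" where
  "face S n i = act S n (Suc n) (coface n i)"

definition degeneracy :: "('a, 'b) cyclic_set_scheme \<Rightarrow> nat \<Rightarrow> nat \<Rightarrow> 'a \<Rightarrow> 'a" where
  "degeneracy S n i = act S (Suc n) n (codegeneracy n i)"

text \<open>
  The structure map \<open>smap c X\<close> is given for representatives \<open>(c, X)\<close>; that it depends only on the
  equivalence class is required in the definition of cactus sets.
\<close>

record 'a cactus_set = "'a cyclic_set" +
  smap :: "cactus \<Rightarrow> point set \<Rightarrow> (nat \<Rightarrow> 'a) \<Rightarrow> 'a"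

definition inputs :: "('a, 'b) cyclic_set_scheme \<Rightarrow> cactus \<Rightarrow> point set \<Rightarrow> (nat \<Rightarrow> 'a) set" where
  "inputs S c X = (\<Pi>\<^sub>E k\<in>{..<lobes c}. cells S (spines X k - 1))"

definition is_cactus_set :: "('a, 'b) cactus_set_scheme \<Rightarrow> bool" where
  "is_cactus_set S \<longleftrightarrow>
     is_cyclic_set S \<and>
     (\<forall>c X. spiny c X \<longrightarrow> smap S c X \<in> inputs S c X \<rightarrow> cells S (card X - 1)) \<and>
     (\<forall>c X c' X'. spiny_equiv c X c' X' \<longrightarrow> (\<forall>x\<in>inputs S c X. smap S c X x = smap S c' X' x)) \<and>
     \<comment> \<open>degeneracies\<close>
     (\<forall>c X k i t. spiny c X \<and> k < lobes c \<and> i < spines X k \<and>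
        t \<in> {nth_mark (on_lobe X k) i <..< nth_mark (on_lobe X k) (Suc i)} \<longrightarrow>
        (\<forall>x\<in>inputs S c X.
           smap S c (insert (k, t) X) (x(k := degeneracy S (spines X k - 1) i (x k))) =
           degeneracy S (card X - 1) (seg_index c X k i) (smap S c X x))) \<and>
     \<comment> \<open>faces\<close>
     (\<forall>c X k i. spiny c X \<and> k < lobes c \<and> i < spines X k \<and> 2 \<le> spines X k \<longrightarrow>
        (\<forall>x\<in>inputs S c X.
           smap S (pinch c X k i) (pinch_spines X k i) (x(k := face S (spines X k - 2) i (x k))) =
           face S (card X - 2) (seg_index c X k i) (smap S c X x))) \<and>
     \<comment> \<open>composition\<close>
     (\<forall>c X d Y. matched c X d Y \<longrightarrow>
        (\<forall>x\<in>inputs S (graft c d) (graft_spines c d Y).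
           smap S c X (\<lambda>k\<in>{..<lobes c}. smap S (d k) (Y k)
             (\<lambda>l\<in>{..<lobes (d k)}. x (flat (\<lambda>a. lobes (d a)) (k, l)))) =
           smap S (graft c d) (graft_spines c d Y) x))"

text \<open>
  Compatibility of the structure maps with the symmetric groups and with the unit of the operad.
  Neither is part of the definition of a cactus set, nor does it follow from it.
\<close>

definition equivariant_smap :: "('a, 'b) cactus_set_scheme \<Rightarrow> bool" where
  "equivariant_smap S \<longleftrightarrow>
     (\<forall>c X \<sigma>. spiny c X \<and> \<sigma> permutes {..<lobes c} \<longrightarrow>
        (\<forall>x\<in>inputs S (relabel \<sigma> c) (map_prod \<sigma> id ` X).
           smap S (relabel \<sigma> c) (map_prod \<sigma> id ` X) x = smap S c X (x \<circ> \<sigma>)))"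

definition unital_smap :: "('a, 'b) cactus_set_scheme \<Rightarrow> bool" where
  "unital_smap S \<longleftrightarrow>
     (\<forall>X. spiny cactus_unit X \<longrightarrow> (\<forall>x\<in>inputs S cactus_unit X. smap S cactus_unit X x = x 0))"

definition is_cactus_set_hom ::
    "('a, 'c) cactus_set_scheme \<Rightarrow> ('b, 'd) cactus_set_scheme \<Rightarrow> (nat \<Rightarrow> 'a \<Rightarrow> 'b) \<Rightarrow> bool" where
  "is_cactus_set_hom S T g \<longleftrightarrow>
     (\<forall>n. g n \<in> cells S n \<rightarrow> cells T n) \<and>
     (\<forall>m n. \<forall>\<psi>\<in>cyc_hom m n. \<forall>s\<in>cells S n. g m (act S m n \<psi> s) = act T m n \<psi> (g n s)) \<and>
     (\<forall>c X. spiny c X \<longrightarrow> (\<forall>x\<in>inputs S c X.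
        g (card X - 1) (smap S c X x) =
        smap T c X (\<lambda>k\<in>{..<lobes c}. g (spines X k - 1) (x k))))"

section \<open>Realization\<close>

type_synonym 'a rpoint = "(nat \<times> 'a \<times> (nat \<Rightarrow> real)) set"

definition simplical_degeneracy :: "nat \<Rightarrow> (nat \<Rightarrow> real) \<Rightarrow> nat \<Rightarrow> real" where
  "simplical_degeneracy k x i = (if i < k then x i else if i = k then x k + x (Suc k) else x (Suc i))"

inductive glued :: "('a, 'b) cyclic_set_scheme \<Rightarrow>
    nat \<times> 'a \<times> (nat \<Rightarrow> real) \<Rightarrow> nat \<times> 'a \<times> (nat \<Rightarrow> real) \<Rightarrow> bool" for S where
  glued_face: "\<lbrakk>s \<in> cells S (Suc n); i \<le> Suc n; t \<in> standard_simplex n\<rbrakk> \<Longrightarrow>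
     glued S (n, face S n i s, t) (Suc n, s, simplical_face i t)"
| glued_degeneracy: "\<lbrakk>s \<in> cells S n; i \<le> n; t \<in> standard_simplex (Suc n)\<rbrakk> \<Longrightarrow>
     glued S (Suc n, degeneracy S n i s, t) (n, s, simplical_degeneracy i t)"

definition rclass :: "('a, 'b) cyclic_set_scheme \<Rightarrow> nat \<Rightarrow> 'a \<Rightarrow> (nat \<Rightarrow> real) \<Rightarrow> 'a rpoint" where
  "rclass S n s t = {q. equivclp (glued S) (n, s, t) q}"

definition realization :: "('a, 'b) cyclic_set_scheme \<Rightarrow> 'a rpoint topology" where
  "realization S =
     quotient_topology (sum_topology (\<lambda>(n, s). simplex_topology n) (SIGMA n:UNIV. cells S n))
       (\<lambda>((n, s), t). rclass S n s t)"

definition realization_map ::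
    "('b, 'd) cyclic_set_scheme \<Rightarrow> (nat \<Rightarrow> 'a \<Rightarrow> 'b) \<Rightarrow> 'a rpoint \<Rightarrow> 'b rpoint" where
  "realization_map T g P = (\<Union>(n, s, t)\<in>P. rclass T n (g n s) t)"

section \<open>Actions of the cactus operad\<close>

text \<open>
  Products are formed in the category of compactly generated spaces, as is usual for realizations
  of simplicial sets that are not locally finite.
\<close>

definition cactus_action :: "'x topology \<Rightarrow> (cactus \<Rightarrow> (nat \<Rightarrow> 'x) \<Rightarrow> 'x) \<Rightarrow> bool" where
  "cactus_action X \<theta> \<longleftrightarrow>
     (\<forall>n\<ge>1. continuous_map
        (kification (prod_topology (cactus_space n) (product_topology (\<lambda>_. X) {..<n}))) X
        (\<lambda>(c, x). \<theta> c x)) \<and>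
     (\<forall>n\<ge>1. \<forall>c\<in>cacti n. \<forall>d. (\<forall>k<n. is_cactus (d k)) \<longrightarrow>
        (\<forall>x \<in> {..<lobes (graft c d)} \<rightarrow>\<^sub>E topspace X.
           \<theta> (graft c d) x =
           \<theta> c (\<lambda>k\<in>{..<n}. \<theta> (d k) (\<lambda>l\<in>{..<lobes (d k)}. x (flat (\<lambda>a. lobes (d a)) (k, l))))))"

definition equivariant_action :: "'x topology \<Rightarrow> (cactus \<Rightarrow> (nat \<Rightarrow> 'x) \<Rightarrow> 'x) \<Rightarrow> bool" where
  "equivariant_action X \<theta> \<longleftrightarrow>
     (\<forall>n\<ge>1. \<forall>c\<in>cacti n. \<forall>\<sigma>. \<sigma> permutes {..<n} \<longrightarrow>
        (\<forall>x \<in> {..<n} \<rightarrow>\<^sub>E topspace X. \<theta> (relabel \<sigma> c) x = \<theta> c (x \<circ> \<sigma>)))"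

definition unital_action :: "'x topology \<Rightarrow> (cactus \<Rightarrow> (nat \<Rightarrow> 'x) \<Rightarrow> 'x) \<Rightarrow> bool" where
  "unital_action X \<theta> \<longleftrightarrow> (\<forall>x \<in> {..<1} \<rightarrow>\<^sub>E topspace X. \<theta> cactus_unit x = x 0)"

text \<open>
  The action is induced by the structure maps: if simplices are placed along the lobes of \<open>c\<close> so
  that their barycentric coordinates are the lengths of the segments (relative to the lobe), then
  the result is the value of the structure map, with the lengths of all segments along the
  path around \<open>c\<close> as barycentric coordinates.
\<close>

definition induced_action :: "('a, 'b) cactus_set_scheme \<Rightarrow> (cactus \<Rightarrow> (nat \<Rightarrow> 'a rpoint) \<Rightarrow> 'a rpoint) \<Rightarrow> bool" where
  "induced_action S \<theta> \<longleftrightarrow>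
     (\<forall>c X. spiny c X \<longrightarrow> (\<forall>x\<in>inputs S c X.
        \<theta> c (\<lambda>k\<in>{..<lobes c}. rclass S (spines X k - 1) (x k) (gaps (on_lobe X k))) =
        rclass S (card X - 1) (smap S c X x) (gaps (on_circuit c X))))"

end

(* A point of the realization can be cut at any finite set of points of the circle that contains its
   own vertices; this represents it by a cell with one vertex for each cut. Given a cactus c and a
   point for each lobe, choose spines X that cut every lobe finely enough, apply the structure map of
   (c, X) to the resulting cells, and use the lengths of the segments along the path around c as
   barycentric coordinates. By compatibility with degeneracies the result does not depend on X, and
   compatibility with composition turns this into an operad action.

   For continuity, a compact set meets only finitely many cells of the realization, and a quotient
   map remains one after taking the product with a compact space; so it suffices to consider a
   convergent sequence in one parameter space of cacti times one product of simplices. On a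
   subsequence the combinatorial type of the spines is constant. In the limit some segments may have
   length 0, and compatibility with faces, applied to these segments one at a time, shows that the
   structure map of the sequence also computes the value at the limit.

   The tree condition on the dual graph is used in the form that every lobe can be cut off at each of
   its intersection points (bridges); in terms of the path around the cactus it says that the visits
   to two different lobes are not linked (planarity). *)
theory Submission
  imports Defs
begin

section \<open>Simplicial operators\<close>

text \<open>The dual tree is awkward to follow through composition and pinching, whereas the path
  transforms by explicit formulas. Hence a detour: a configuration without the tree axiom
  (\<open>precactus\<close>) is a cactus iff it is connected and has bridges, and also iff it has a
  periodic bijective path that is \<open>planar\<close>. The first form yields existence of the path
  by a counting argument, which is needed before anything can be computed, since
  \<open>circuit\<close> is a definite description; the second recognizes new cacti.

  At an intersection the value of the path is the point on the outgoing circle. This makes it a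
  bijection onto the disjoint union of the circles, but all arcs become half-open, and arrival has
  to be treated apart from departure throughout.

  The cell of a point at given cuts is read off from any representative by pulling back along
  \<open>segment_at\<close>. That this respects the gluing replaces the uniqueness of nondegenerate
  representatives.

  Continuity passes from simplices to closed cells because characteristic maps are closed with
  Hausdorff image; this is why the gluing relation is shown to be closed under limits.\<close>

definition monotone_op :: "nat => nat => (nat => nat) => bool" where
 "monotone_op m n ph \<longleftrightarrow> (\<forall>i j. i <= j & j <= m --> ph i <= ph j) & (\<forall>i\<le>m. ph i <= n)"

text \<open>The embedding of the simplex category into the cyclic category: a monotone map of [m] to
  [n] is repeated periodically. Only the values up to \<open>m\<close> enter, so total functions on
  the naturals can represent monotone maps.\<close>

definition periodic_ext :: "nat => nat => (nat => nat) => int => int" where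
 "periodic_ext m n ph x = (x div (int m + 1)) * (int n + 1) + int (ph (nat (x mod (int m + 1))))"

definition op_act :: "('a, 'b) cyclic_set_scheme => nat => nat => (nat => nat) => 'a => 'a" where
 "op_act S m n ph = act S m n (periodic_ext m n ph)"

text \<open>The affine map of standard simplices induced by \<open>ph\<close>, or the image under
  \<open>ph\<close> of a measure on m + 1 atoms.\<close>

definition push_forward :: "nat => (nat => nat) => (nat => real) => nat => real" where
 "push_forward m ph u j = (\<Sum>i\<le>m. if ph i = j then u i else 0)"

definition skip_op :: "nat => nat => nat" where
 "skip_op i r = (if r < i then r else Suc r)"

definition repeat_op :: "nat => nat => nat" where
 "repeat_op i r = (if r <= i then r else r - 1)"

lemma mod_bounds:
 fixes x :: int
 shows "nat (x mod (int m + 1)) <= m" "0 <= x mod (int m + 1)" "x mod (int m + 1) < int m + 1"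
proof -
 have "x mod (int m + 1) < int m + 1" by (intro pos_mod_bound) simp
 moreover from this have "x mod (int m + 1) <= int m" by linarith
 ultimately show "nat (x mod (int m + 1)) <= m" "0 <= x mod (int m + 1)" "x mod (int m + 1) < int m + 1"
  by (auto simp: nat_le_iff)
qed

lemma periodic_ext_cong:
 assumes "!!i. i <= m ==> ph i = \<psi> i"
 shows "periodic_ext m n ph = periodic_ext m n \<psi>"
 using assms mod_bounds(1)[of _ m] by (auto simp: periodic_ext_def)

lemma op_act_cong:
 assumes "!!i. i <= m ==> ph i = \<psi> i"
 shows "op_act S m n ph = op_act S m n \<psi>"
 using periodic_ext_cong[OF assms] by (simp add: op_act_def)

lemma periodic_ext_cyc_hom:
 assumes "monotone_op m n ph"
 shows "periodic_ext m n ph \<in> cyc_hom m n"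
proof -
 have "periodic_ext m n ph x <= periodic_ext m n ph y" if "x <= y" for x y
 proof -
  let ?M = "int m + 1" and ?N = "int n + 1"
  have le: "x div ?M <= y div ?M" using that by (intro zdiv_mono1) auto
  show ?thesis
  proof (cases "x div ?M = y div ?M")
   case True
   then have "x mod ?M <= y mod ?M"
    using that by (metis add_le_cancel_left mult_div_mod_eq)
   then have "nat (x mod ?M) <= nat (y mod ?M)" by simp
   then show ?thesis
    using True assms mod_bounds(1)[of y m] unfolding periodic_ext_def monotone_op_def by auto
  next
   case False
   with le have "x div ?M + 1 <= y div ?M" by simp
   then have "(x div ?M + 1) * ?N <= y div ?M * ?N" by (intro mult_right_mono) auto
   moreover have "ph (nat (x mod ?M)) <= n"
    using assms mod_bounds(1)[of x m] by (auto simp: monotone_op_def)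
   ultimately show ?thesis unfolding periodic_ext_def by (simp add: algebra_simps)
  qed
 qed
 moreover have "periodic_ext m n ph (x + int m + 1) = periodic_ext m n ph x + int n + 1" for x
 proof -
  have a: "x + int m + 1 = x + (int m + 1)" by simp
  have d: "(x + int m + 1) div (int m + 1) = x div (int m + 1) + 1" unfolding a
   by (subst div_add_self2) auto
  have e: "(x + int m + 1) mod (int m + 1) = x mod (int m + 1)" unfolding a
   by (subst mod_add_self2) auto
  show ?thesis unfolding periodic_ext_def d e by (simp add: algebra_simps)
 qed
 ultimately show ?thesis by (auto simp: cyc_hom_def mono_def)
qed

lemma monotone_op_comp:
 "monotone_op l m ph ==> monotone_op m n \<psi> ==> monotone_op l n (\<psi> \<circ> ph)"
 by (auto simp: monotone_op_def)

lemma periodic_ext_comp: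
 assumes "monotone_op l m ph"
 shows "periodic_ext m n \<psi> \<circ> periodic_ext l m ph = periodic_ext l n (\<psi> \<circ> ph)"
proof
 fix x
 define q where "q = x div (int l + 1)"
 define r where "r = ph (nat (x mod (int l + 1)))"
 have r: "r <= m" unfolding r_def using assms mod_bounds(1)[of x l] by (auto simp: monotone_op_def)
 have e: "periodic_ext l m ph x = int r + q * (int m + 1)" unfolding periodic_ext_def q_def r_def by simp
 have "(int r + q * (int m + 1)) div (int m + 1) = q" "(int r + q * (int m + 1)) mod (int m + 1) = int r"
  using r by (subst div_mult_self1 mod_mult_self1; simp)+
 then show "(periodic_ext m n \<psi> \<circ> periodic_ext l m ph) x = periodic_ext l n (\<psi> \<circ> ph) x"
  unfolding comp_def e unfolding periodic_ext_def by (simp add: q_def r_def)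
qed

lemma op_act_comp:
 assumes "is_cyclic_set S" "monotone_op l m ph" "monotone_op m n \<psi>" "s \<in> cells S n"
 shows "op_act S l m ph (op_act S m n \<psi> s) = op_act S l n (\<psi> \<circ> ph) s"
 using assms periodic_ext_cyc_hom[OF assms(2)] periodic_ext_cyc_hom[OF assms(3)]
  periodic_ext_comp[OF assms(2), of n \<psi>]
 unfolding is_cyclic_set_def op_act_def by metis

lemma op_act_cells:
 assumes "is_cyclic_set S" "monotone_op m n ph" "s \<in> cells S n"
 shows "op_act S m n ph s \<in> cells S m"
 using assms periodic_ext_cyc_hom[OF assms(2)] unfolding is_cyclic_set_def op_act_def by blast

lemma periodic_ext_id: "periodic_ext n n (%i. i) = id"
proof
 fix x :: int
 show "periodic_ext n n (%i. i) x = id x"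
  unfolding periodic_ext_def using mod_bounds(2)[of x n] by (simp only: int_nat_eq if_True id_apply div_mult_mod_eq)
qed

lemma op_act_id:
 assumes "is_cyclic_set S" "s \<in> cells S n" "!!i. i <= n ==> ph i = i"
 shows "op_act S n n ph s = s"
proof -
 have "op_act S n n ph s = op_act S n n (%i. i) s" using op_act_cong[of n ph "%i. i"] assms(3) by metis
 then show ?thesis using assms(1,2) by (simp add: op_act_def periodic_ext_id is_cyclic_set_def)
qed

lemma face_eq_op_act: "face S n i = op_act S n (Suc n) (skip_op i)"
proof -
 have "coface n i x = periodic_ext n (Suc n) (skip_op i) x" for x
  unfolding coface_def periodic_ext_def Let_def skip_op_def
  using mod_bounds(2)[of x n] by (auto simp: nat_less_iff algebra_simps)
 then have "coface n i = periodic_ext n (Suc n) (skip_op i)" by auto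
 then show ?thesis unfolding face_def op_act_def by metis
qed

lemma degeneracy_eq_op_act: "degeneracy S n i = op_act S (Suc n) n (repeat_op i)"
proof -
 have "codegeneracy n i x = periodic_ext (Suc n) n (repeat_op i) x" for x
 proof -
  have a: "int (Suc n) + 1 = int n + 2" by simp
  show ?thesis
   unfolding codegeneracy_def periodic_ext_def Let_def repeat_op_def a
   using mod_bounds(2)[of x "Suc n"] unfolding a
   by (auto simp: nat_le_iff le_nat_iff algebra_simps of_nat_diff)
 qed
 then have "codegeneracy n i = periodic_ext (Suc n) n (repeat_op i)" by auto
 then show ?thesis unfolding degeneracy_def op_act_def by metis
qed

lemma monotone_skip_op: "monotone_op n (Suc n) (skip_op i)"
 by (auto simp: monotone_op_def skip_op_def)

lemma monotone_repeat_op: "i <= n ==> monotone_op (Suc n) n (repeat_op i)"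
 by (auto simp: monotone_op_def repeat_op_def)

lemma face_cells:
 "is_cyclic_set S ==> s \<in> cells S (Suc n) ==> face S n i s \<in> cells S n"
 by (simp add: face_eq_op_act op_act_cells monotone_skip_op)

lemma degeneracy_cells:
 "is_cyclic_set S ==> s \<in> cells S n ==> i <= n ==> degeneracy S n i s \<in> cells S (Suc n)"
 by (simp add: degeneracy_eq_op_act op_act_cells monotone_repeat_op)

section \<open>The realization\<close>

lemma simplexI:
 assumes "!!i. 0 <= x i" "!!i. p < i ==> x i = 0" "(\<Sum>i\<le>p. x i) = 1"
 shows "x \<in> standard_simplex p"
proof -
 have "x i <= 1" for i
 proof (cases "i <= p")
  case True
  then have "x i <= (\<Sum>i\<le>p. x i)" by (intro member_le_sum) (auto simp: assms)
  then show ?thesis by (simp add: assms)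
 qed (auto simp: assms)
 then show ?thesis using assms by (auto simp: standard_simplex_def)
qed

lemma simplexD:
 assumes "x \<in> standard_simplex p"
 shows "0 <= x i" "x i <= 1" "p < i ==> x i = 0" "(\<Sum>i\<le>p. x i) = 1"
 using assms by (auto simp: standard_simplex_def)

text \<open>An image measure gives a set the mass of its preimage. The predicate is left free
  because total mass (\<open>P\<close> true), initial segments (\<open>P k\<close> iff
  \<open>k < j\<close>) and the arcs on one lobe (\<open>P a\<close> iff \<open>w ! a = k\<close>)
  all occur later.\<close>

lemma sum_push_forward:
 assumes "monotone_op m n ph"
 shows "(\<Sum>j\<in>{j. j <= n & P j}. push_forward m ph u j) = (\<Sum>i\<in>{i. i <= m & P (ph i)}. u i)"
proof -
 have "(\<Sum>j\<in>{j. j <= n & P j}. push_forward m ph u j) =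
   (\<Sum>i\<le>m. \<Sum>j\<in>{j. j <= n & P j}. if ph i = j then u i else 0)"
  unfolding push_forward_def by (rule sum.swap)
 also have "... = (\<Sum>i\<le>m. if P (ph i) then u i else 0)"
  using assms by (intro sum.cong) (auto simp: sum.delta monotone_op_def)
 also have "... = (\<Sum>i\<in>{i. i <= m & P (ph i)}. u i)"
  by (simp add: sum.If_cases Int_def)
 finally show ?thesis .
qed

lemma push_forward_simplex:
 assumes "monotone_op m n ph" "u \<in> standard_simplex m"
 shows "push_forward m ph u \<in> standard_simplex n"
proof (rule simplexI)
 show "0 <= push_forward m ph u i" for i
  using simplexD[OF assms(2)] by (auto simp: push_forward_def intro!: sum_nonneg)
 show "push_forward m ph u i = 0" if "n < i" for i
  using assms(1) that unfolding push_forward_def monotone_op_def by (intro sum.neutral) auto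
 show "(\<Sum>j\<le>n. push_forward m ph u j) = 1"
  using sum_push_forward[OF assms(1), where P = "%_. True" and u = u] simplexD(4)[OF assms(2)]
  by (simp add: atMost_def)
qed

lemma push_forward_comp:
 assumes "monotone_op l m ph"
 shows "push_forward l (\<psi> \<circ> ph) u = push_forward m \<psi> (push_forward l ph u)"
proof
 fix j
 have "push_forward m \<psi> (push_forward l ph u) j = (\<Sum>i\<in>{i. i <= m & \<psi> i = j}. push_forward l ph u i)"
  unfolding push_forward_def[of m] by (simp add: sum.If_cases Int_def)
 also have "... = (\<Sum>i\<in>{i. i <= l & \<psi> (ph i) = j}. u i)"
  by (rule sum_push_forward[OF assms])
 also have "... = push_forward l (\<psi> \<circ> ph) u j"
  unfolding push_forward_def by (simp add: sum.If_cases Int_def)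
 finally show "push_forward l (\<psi> \<circ> ph) u j = push_forward m \<psi> (push_forward l ph u) j" by simp
qed

lemma push_forward_cong:
 assumes "!!i. i <= m ==> ph i = \<psi> i"
 shows "push_forward m ph u = push_forward m \<psi> u"
 unfolding push_forward_def using assms by (auto intro!: ext sum.cong)

lemma push_forward_id:
 assumes "u \<in> standard_simplex n" "!!i. i <= n ==> ph i = i"
 shows "push_forward n ph u = u"
proof
 fix j
 have "push_forward n ph u j = (\<Sum>i\<le>n. if i = j then u i else 0)"
  unfolding push_forward_def using assms(2) by (intro sum.cong) auto
 then show "push_forward n ph u j = u j"
  using simplexD(3)[OF assms(1), of j] by auto
qed

lemma simplical_face_eq_push:
 assumes "u \<in> standard_simplex n"
 shows "simplical_face i u = push_forward n (skip_op i) u"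
proof
 fix j
 have "push_forward n (skip_op i) u j = (\<Sum>r\<in>{r. r <= n & skip_op i r = j}. u r)"
  unfolding push_forward_def by (simp add: sum.If_cases Int_def)
 also have "{r. r <= n & skip_op i r = j} =
   (if j < i then {j} \<inter> {..n} else if j = i then {} else {j - 1} \<inter> {..n})"
  by (auto simp: skip_op_def split: if_splits)
 also have "sum u ... = simplical_face i u j"
  using simplexD(3)[OF assms] by (auto simp: simplical_face_def Int_insert_left)
 finally show "simplical_face i u j = push_forward n (skip_op i) u j" by simp
qed

lemma simplical_degeneracy_eq_push:
 assumes "u \<in> standard_simplex (Suc n)" "i <= n"
 shows "simplical_degeneracy i u = push_forward (Suc n) (repeat_op i) u"
proof
 fix j
 have "push_forward (Suc n) (repeat_op i) u j = (\<Sum>r\<in>{r. r <= Suc n & repeat_op i r = j}. u r)"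
  unfolding push_forward_def by (simp add: sum.If_cases Int_def del: sum.atMost_Suc)
 also have "{r. r <= Suc n & repeat_op i r = j} =
   (if j < i then {j} else if j = i then {i, Suc i} else {Suc j} \<inter> {..Suc n})"
  using assms(2) by (auto simp: repeat_op_def split: if_splits)
 also have "sum u ... = simplical_degeneracy i u j"
  using simplexD(3)[OF assms(1)] by (auto simp: simplical_degeneracy_def Int_insert_left)
 finally show "simplical_degeneracy i u j = push_forward (Suc n) (repeat_op i) u j" by simp
qed

lemma rclass_eqI:
 assumes "equivclp (glued S) (m, s, u) (n, t, v)"
 shows "rclass S m s u = rclass S n t v"
 unfolding rclass_def using equivclp_trans[OF assms] equivclp_trans[OF equivclp_sym[OF assms]]
 by (intro Collect_cong iffI)

lemma rclass_self: "(n, s, t) \<in> rclass S n s t"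
 by (simp add: rclass_def)

lemma rclass_face:
 "s \<in> cells S (Suc n) ==> i <= Suc n ==> t \<in> standard_simplex n ==>
  rclass S n (face S n i s) t = rclass S (Suc n) s (simplical_face i t)"
 by (intro rclass_eqI r_into_equivclp glued_face)

lemma rclass_degeneracy:
 "s \<in> cells S n ==> i <= n ==> t \<in> standard_simplex (Suc n) ==>
  rclass S (Suc n) (degeneracy S n i s) t = rclass S n s (simplical_degeneracy i t)"
 by (intro rclass_eqI r_into_equivclp glued_degeneracy)

lemma strict_op_ge:
 assumes "!!i. i < m ==> ph i < (ph (Suc i) :: nat)" "i <= m"
 shows "i <= ph i"
 using assms(2)
proof (induction i)
 case (Suc i)
 then show ?case using assms(1)[of i] by simp
qed simp

text \<open>Monotone maps factor into cofaces and codegeneracies, which are all that \<open>glued\<close> knows.\<close>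

lemma rclass_op_act:
 assumes S: "is_cyclic_set S"
 shows "monotone_op m n ph ==> s \<in> cells S n ==> u \<in> standard_simplex m ==>
  rclass S m (op_act S m n ph s) u = rclass S n s (push_forward m ph u)"
proof (induction "m + n" arbitrary: m n ph s u rule: less_induct)
 case less
 note mono = less.prems(1)
 show ?case
 proof (cases "\<exists>i<m. ph i = ph (Suc i)")
  case True
  then obtain i where i: "i < m" "ph i = ph (Suc i)" by blast
  obtain p where m: "m = Suc p" using i by (cases m) auto
  \<comment> \<open>A repeated value is split off as a codegeneracy: leaving out the second of the
    two equal positions gives a map with smaller source.\<close>
  let ?\<psi> = "ph \<circ> skip_op (Suc i)"
  have \<psi>: "monotone_op p n ?\<psi>"
   using monotone_op_comp[OF monotone_skip_op[of p "Suc i"]] mono m by blast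
  have eq: "ph j = (?\<psi> \<circ> repeat_op i) j" if "j <= m" for j
  proof (cases "j <= i")
   case False
   then have "j = Suc i | Suc i < j" by linarith
   then show ?thesis using i by (auto simp: repeat_op_def skip_op_def)
  qed (simp add: repeat_op_def skip_op_def)
  have ip: "i <= p" using i m by simp
  have u: "u \<in> standard_simplex (Suc p)" using less.prems m by simp
  have "op_act S m n ph s = op_act S m n (?\<psi> \<circ> repeat_op i) s"
   by (rule fun_cong[OF op_act_cong], rule eq)
  also have "... = degeneracy S p i (op_act S p n ?\<psi> s)"
   using op_act_comp[OF S monotone_repeat_op[OF ip] \<psi> less.prems(2)]
   by (simp add: degeneracy_eq_op_act m)
  finally have "rclass S m (op_act S m n ph s) u =
    rclass S p (op_act S p n ?\<psi> s) (simplical_degeneracy i u)"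
   using rclass_degeneracy[OF op_act_cells[OF S \<psi> less.prems(2)] ip u] m by simp
  also have "... = rclass S n s (push_forward p ?\<psi> (simplical_degeneracy i u))"
   using push_forward_simplex[OF monotone_repeat_op[OF ip] u] simplical_degeneracy_eq_push[OF u ip]
   by (intro less.hyps \<psi> less.prems) (auto simp: m)
  also have "push_forward p ?\<psi> (simplical_degeneracy i u) = push_forward m (?\<psi> \<circ> repeat_op i) u"
   unfolding simplical_degeneracy_eq_push[OF u ip] m
   by (rule push_forward_comp[OF monotone_repeat_op[OF ip], symmetric])
  also have "... = push_forward m ph u"
   by (rule push_forward_cong, rule eq[symmetric])
  finally show ?thesis .
 next
  case False
  then have strict: "ph i < ph (Suc i)" if "i < m" for i
   using that mono by (metis Suc_leI le_add2 le_neq_implies_less monotone_op_def plus_1_eq_Suc)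
  show ?thesis
  proof (cases "{..n} <= ph ` {..m}")
   \<comment> \<open>Strictly increasing and onto forces the identity.\<close>
   case True
   have ge: "i <= ph i" if "i <= m" for i using strict_op_ge[of m ph i] strict that by blast
   have "n = m"
   proof (rule antisym)
    have "card {..n} <= card {..m}" using True by (intro surj_card_le) auto
    then show "n <= m" by simp
    show "m <= n" using ge[of m] mono by (auto simp: monotone_op_def)
   qed
   have id: "ph i = i" if "i <= m" for i
   proof -
    have "ph i + (k - i) <= ph k" if "i <= k" "k <= m" for k
     using that
    proof (induction k rule: dec_induct)
     case (step k)
     then show ?case using strict[of k] by simp
    qed simp
    from this[of m] have "ph i + (m - i) <= ph m" using \<open>i <= m\<close> by simp
    also have "... <= m" using mono \<open>n = m\<close> by (auto simp: monotone_op_def)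
    finally show ?thesis using ge[OF \<open>i <= m\<close>] \<open>i <= m\<close> by simp
   qed
   show ?thesis using op_act_id[OF S less.prems(2)] push_forward_id[OF less.prems(3)] id \<open>n = m\<close>
    by simp
  next
   case False
   then obtain j where j: "j <= n" "j \<notin> ph ` {..m}" by auto
   have "ph 0 <= n" "ph 0 ~= j" using j mono by (auto simp: monotone_op_def)
   then have "n ~= 0" using j(1) by linarith
   then obtain p where n: "n = Suc p" by (cases n) auto
   \<comment> \<open>A missed value \<open>j\<close> is split off as a coface: the values above
     \<open>j\<close> move down by one, so the target shrinks.\<close>
   let ?\<psi> = "%r. if ph r < j then ph r else ph r - 1"
   have ne: "ph r ~= j" if "r <= m" for r using j that by auto
   have \<psi>: "monotone_op m p ?\<psi>"
    unfolding monotone_op_def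
   proof (intro conjI allI impI)
    fix a b assume ab: "a <= b & b <= m"
    then have "ph a <= ph b" "ph a ~= j" "ph b ~= j" using mono ne by (auto simp: monotone_op_def)
    then show "?\<psi> a <= ?\<psi> b" by auto
   next
    fix a assume "a <= m"
    then have "ph a <= n" "ph a ~= j" using mono ne by (auto simp: monotone_op_def)
    then show "?\<psi> a <= p" using j n by auto
   qed
   have eq: "(skip_op j \<circ> ?\<psi>) r = ph r" if "r <= m" for r
    using ne[OF that] by (cases "ph r < j") (simp_all add: skip_op_def)
   have s: "s \<in> cells S (Suc p)" using less.prems n by simp
   have jp: "j <= Suc p" using j n by simp
   have "op_act S m n ph s = op_act S m n (skip_op j \<circ> ?\<psi>) s"
    by (rule fun_cong[OF op_act_cong], rule eq[symmetric])
   also have "... = op_act S m p ?\<psi> (face S p j s)"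
    using op_act_comp[OF S \<psi> monotone_skip_op s] by (simp add: face_eq_op_act n)
   finally have "rclass S m (op_act S m n ph s) u =
     rclass S p (face S p j s) (push_forward m ?\<psi> u)"
    using less.hyps[OF _ \<psi> face_cells[OF S s] less.prems(3)] n by simp
   also have "... = rclass S n s (simplical_face j (push_forward m ?\<psi> u))"
    using rclass_face[OF s jp push_forward_simplex[OF \<psi> less.prems(3)]] n by simp
   also have "simplical_face j (push_forward m ?\<psi> u) = push_forward m (skip_op j \<circ> ?\<psi>) u"
    unfolding simplical_face_eq_push[OF push_forward_simplex[OF \<psi> less.prems(3)]]
    by (rule push_forward_comp[OF \<psi>, symmetric])
   also have "... = push_forward m ph u"
    by (rule push_forward_cong, rule eq)
   finally show ?thesis .
  qed
 qed
qed

section \<open>Evaluation of points of the realization at marks\<close>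

text \<open>Index of the half-open segment containing \<open>a\<close> when the unit interval is cut
  into segments of lengths \<open>t\<close>. Counting the starting points up to \<open>a\<close>,
  except that of segment 0, selects the last of several coinciding starts; so for \<open>a\<close>
  in the half-open unit interval a segment of length 0 is never chosen.\<close>

definition segment_at :: "nat => (nat => real) => real => nat" where
 "segment_at n t a = card {j\<in>{1..n}. sum t {..<j} <= a}"

lemma partial_sum_mono:
 fixes t :: "nat => real"
 assumes "!!i. 0 <= t i" "i <= j"
 shows "sum t {..<i} <= sum t {..<j}"
 using assms by (intro sum_mono2) auto

lemma segment_at_unique:
 assumes t: "t \<in> standard_simplex n" and j: "j <= n" "sum t {..<j} <= a" "a < sum t {..<Suc j}"
 shows "segment_at n t a = j"
proof -
 have "{k\<in>{1..n}. sum t {..<k} <= a} = {1..j}"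
 proof (intro equalityI subsetI)
  fix k assume k: "k \<in> {k\<in>{1..n}. sum t {..<k} <= a}"
  have "~ Suc j <= k"
   using partial_sum_mono[of t "Suc j" k] simplexD(1)[OF t] k j by auto
  then show "k \<in> {1..j}" using k by simp
 next
  fix k assume "k \<in> {1..j}"
  then show "k \<in> {k\<in>{1..n}. sum t {..<k} <= a}"
   using partial_sum_mono[of t k j] simplexD(1)[OF t] j by auto
 qed
 then show ?thesis by (simp add: segment_at_def)
qed

lemma segment_at_bounds:
 assumes t: "t \<in> standard_simplex n" and a: "0 <= a" "a < 1"
 shows "segment_at n t a <= n" "sum t {..<segment_at n t a} <= a"
  "a < sum t {..<Suc (segment_at n t a)}"
proof -
 define j where "j = Max {j. j <= n & sum t {..<j} <= a}"
 have "j \<in> {j. j <= n & sum t {..<j} <= a}"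
  unfolding j_def by (rule Max_in) (use a in \<open>auto intro: exI[of _ 0]\<close>)
 then have j: "j <= n" "sum t {..<j} <= a" by auto
 have lt: "a < sum t {..<Suc j}"
 proof (rule ccontr)
  assume "~ a < sum t {..<Suc j}"
  then have le: "sum t {..<Suc j} <= a" by simp
  show False
  proof (cases "j = n")
   case True
   then show False using le a simplexD(4)[OF t] by (simp add: lessThan_Suc_atMost)
  next
   case False
   then have "Suc j <= j" unfolding j_def
    by (intro Max_ge) (use le j in \<open>auto simp: j_def[symmetric]\<close>)
   then show False by simp
  qed
 qed
 have "segment_at n t a = j" by (rule segment_at_unique[OF t j lt])
 then show "segment_at n t a <= n" "sum t {..<segment_at n t a} <= a"
  "a < sum t {..<Suc (segment_at n t a)}" using j lt by simp_all
qed

text \<open>Segment \<open>ph i\<close> of the push-forward starts at the mass of all indices sent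
  below \<open>ph i\<close>, hence at or before the start of segment \<open>i\<close>, and it ends
  at or after the end of segment \<open>i\<close>. So a point of the circle stays in place while the
  index of its segment moves along \<open>ph\<close>. This is what makes evaluation invariant under
  the gluing.\<close>

lemma segment_at_push_forward:
 assumes ph: "monotone_op m n ph" and u: "u \<in> standard_simplex m" and a: "0 <= a" "a < 1"
 shows "segment_at n (push_forward m ph u) a = ph (segment_at m u a)"
proof (rule segment_at_unique)
 define i where "i = segment_at m u a"
 have i: "i <= m" "sum u {..<i} <= a" "a < sum u {..<Suc i}"
  unfolding i_def using segment_at_bounds[OF u a] by auto
 show "push_forward m ph u \<in> standard_simplex n" by (rule push_forward_simplex[OF ph u])
 show in_le: "ph (segment_at m u a) <= n" using i(1) ph by (auto simp: monotone_op_def i_def)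
 have s: "sum (push_forward m ph u) {..<j} = sum u {i. i <= m & ph i < j}" if "j <= Suc n" for j
 proof -
  have "{..<j} = {k. k <= n & k < j}" using that by auto
  then show ?thesis using sum_push_forward[OF ph, where P = "%k. k < j" and u = u] by simp
 qed
 have "sum (push_forward m ph u) {..<ph i} <= sum u {..<i}"
  unfolding s[OF le_SucI[OF in_le[folded i_def]]]
 proof (rule sum_mono2)
  show "{k. k <= m & ph k < ph i} <= {..<i}"
  proof
   fix k assume k: "k \<in> {k. k <= m & ph k < ph i}"
   then have "~ ph i <= ph k" "k <= m" by auto
   then have "~ i <= k" using ph by (auto simp: monotone_op_def)
   then show "k \<in> {..<i}" by simp
  qed
 qed (use simplexD[OF u] in auto)
 then show "sum (push_forward m ph u) {..<ph (segment_at m u a)} <= a" using i by (simp add: i_def)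
 have "sum u {..<Suc i} <= sum (push_forward m ph u) {..<Suc (ph i)}"
  unfolding s[OF Suc_le_mono[THEN iffD2, OF in_le[folded i_def]]]
 proof (rule sum_mono2)
  show "{..<Suc i} <= {k. k <= m & ph k < Suc (ph i)}"
  proof
   fix k assume "k \<in> {..<Suc i}"
   then have "k <= i" by simp
   then have "ph k <= ph i" using ph i(1) by (auto simp: monotone_op_def)
   then show "k \<in> {k. k <= m & ph k < Suc (ph i)}" using \<open>k <= i\<close> i(1) by simp
  qed
 qed (use simplexD[OF u] in auto)
 then show "a < sum (push_forward m ph u) {..<Suc (ph (segment_at m u a))}"
  using i by (simp add: i_def)
qed

definition sampling :: "nat => (nat => real) => bool" where
 "sampling m a \<longleftrightarrow> (\<forall>i j. i <= j & j <= m --> a i <= a j) & (\<forall>i\<le>m. 0 <= a i & a i < 1)"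

definition valid :: "('a, 'b) cyclic_set_scheme => nat \<times> 'a \<times> (nat => real) => bool" where
 "valid S = (%(n, s, t). s \<in> cells S n & t \<in> standard_simplex n)"

text \<open>The cell is pulled back along the map that sends each sample to its segment. The result
  has one vertex per sample, whatever the dimension of the representative.\<close>

fun eval_at :: "('a, 'b) cyclic_set_scheme => nat => (nat => real) => nat \<times> 'a \<times> (nat => real) => 'a" where
 "eval_at S m a (n, s, t) = op_act S m n (%i. segment_at n t (a i)) s"

text \<open>The choice of a representative is harmless, because \<open>eval_at\<close> is constant
  on the class of a valid triple.\<close>

definition eval :: "('a, 'b) cyclic_set_scheme => nat => (nat => real) => 'a rpoint => 'a" where
 "eval S m a P = eval_at S m a (SOME q. q \<in> P)"

lemma monotone_segment_at:
 assumes "sampling m a" "t \<in> standard_simplex n"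
 shows "monotone_op m n (%i. segment_at n t (a i))"
 unfolding monotone_op_def
proof (intro conjI allI impI)
 fix i j assume "i <= j & j <= m"
 then have "a i <= a j" using assms by (auto simp: sampling_def)
 then show "segment_at n t (a i) <= segment_at n t (a j)"
  unfolding segment_at_def by (intro card_mono) auto
next
 fix i assume "i <= m"
 then show "segment_at n t (a i) <= n"
  using segment_at_bounds(1)[OF assms(2)] assms(1) by (auto simp: sampling_def)
qed

text \<open>With \<open>skip_op\<close> this covers faces and with \<open>repeat_op\<close>
  degeneracies, so one computation gives invariance under both kinds of gluing.\<close>

lemma eval_at_op_act:
 assumes S: "is_cyclic_set S" and a: "sampling l a" and ph: "monotone_op m n ph"
  and s: "s \<in> cells S n" and u: "u \<in> standard_simplex m"
 shows "eval_at S l a (m, op_act S m n ph s, u) = eval_at S l a (n, s, push_forward m ph u)"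
proof -
 have "op_act S l m (%i. segment_at m u (a i)) (op_act S m n ph s) =
   op_act S l n (ph \<circ> (%i. segment_at m u (a i))) s"
  by (rule op_act_comp[OF S monotone_segment_at[OF a u] ph s])
 also have "... = op_act S l n (%i. segment_at n (push_forward m ph u) (a i)) s"
  by (rule fun_cong[OF op_act_cong])
   (use a segment_at_push_forward[OF ph u] in \<open>auto simp: sampling_def\<close>)
 finally show ?thesis by simp
qed

lemma glued_valid:
 assumes "is_cyclic_set S" "glued S p q"
 shows "valid S p" "valid S q"
proof -
 have "valid S p & valid S q"
  using assms(2)
 proof cases
  case (glued_face s n i t)
  then show ?thesis using face_cells[OF assms(1)] simplical_face_in_standard_simplex[of "Suc n" i t]
   by (auto simp: valid_def)
 next
  case (glued_degeneracy s n i t)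
  then show ?thesis using degeneracy_cells[OF assms(1)] simplical_degeneracy_eq_push[of t n i]
    push_forward_simplex[OF monotone_repeat_op, of i n t] by (auto simp: valid_def)
 qed
 then show "valid S p" "valid S q" by auto
qed

lemma glued_eval_at:
 assumes "is_cyclic_set S" "sampling m a" "glued S p q"
 shows "eval_at S m a p = eval_at S m a q"
 using assms(3)
proof cases
 case (glued_face s n i t)
 then show ?thesis
  using eval_at_op_act[OF assms(1,2) monotone_skip_op, of s n t i]
   simplical_face_eq_push[of t n i] face_eq_op_act[of S n i] by simp
next
 case (glued_degeneracy s n i t)
 then show ?thesis
  using eval_at_op_act[OF assms(1,2) monotone_repeat_op, of i n s t]
   simplical_degeneracy_eq_push[of t n i] degeneracy_eq_op_act[of S n i] by simp
qed

lemma equivclp_glued: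
 assumes S: "is_cyclic_set S" and "equivclp (glued S) p q" and p: "valid S p"
 shows "valid S q & (\<forall>m a. sampling m a --> eval_at S m a p = eval_at S m a q)"
 using assms(2)
proof (induction rule: equivclp_induct)
 case base
 then show ?case using p by simp
next
 case (step y z)
 then show ?case
  using glued_eval_at[OF S] glued_valid[OF S] by metis
qed

lemma rclass_valid:
 assumes "is_cyclic_set S" "s \<in> cells S n" "t \<in> standard_simplex n" "q \<in> rclass S n s t"
 shows "valid S q" "sampling m a ==> eval_at S m a q = eval_at S m a (n, s, t)"
proof -
 have "equivclp (glued S) (n, s, t) q" using assms(4) by (simp add: rclass_def)
 moreover have "valid S (n, s, t)" using assms by (simp add: valid_def)
 ultimately show "valid S q" "sampling m a ==> eval_at S m a q = eval_at S m a (n, s, t)"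
  using equivclp_glued[OF assms(1)] by metis+
qed

lemma eval_rclass:
 assumes "is_cyclic_set S" "s \<in> cells S n" "t \<in> standard_simplex n" "sampling m a"
 shows "eval S m a (rclass S n s t) = op_act S m n (%i. segment_at n t (a i)) s"
proof -
 have "(SOME q. q \<in> rclass S n s t) \<in> rclass S n s t"
  using rclass_self[of n s t S] by (rule someI)
 then show ?thesis using rclass_valid(2)[OF assms(1-3) _ assms(4)] by (simp add: eval_def)
qed

lemma topspace_quotient_topology: "topspace (quotient_topology X f) = f ` topspace X"
proof -
 have "{x \<in> topspace X. f x \<in> f ` topspace X} = topspace X" by auto
 then have "openin (quotient_topology X f) (f ` topspace X)"
  by (simp add: openin_quotient_topology)
 then show ?thesis
  by (metis openin_quotient_topology openin_subset openin_topspace subset_antisym)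
qed

lemma topspace_simplex_topology: "topspace (simplex_topology n) = standard_simplex n"
 by simp

lemma topspace_realization:
 "topspace (realization S) = {rclass S n s t | n s t. s \<in> cells S n & t \<in> standard_simplex n}"
 unfolding realization_def topspace_quotient_topology topspace_sum_topology
 by (fastforce simp: image_iff)

section \<open>Marks on the circle\<close>

definition mark_set :: "real set => bool" where
 "mark_set A \<longleftrightarrow> finite A & A <= {0..<1} & 0 \<in> A"

lemma card_mark_set: "mark_set A ==> 0 < card A"
 by (auto simp: mark_set_def card_gt_0_iff)

text \<open>A strictly increasing list is the sorted list of its range. Marks are identified in this
  way whenever a set of marks arises from a formula: by insertion, transport or pinching. The value
  at \<open>N\<close> is the convention that 1 follows the last mark.\<close>

lemma nth_mark_unique:
 assumes "!!i j. i < j ==> j < N ==> a i < a j" "a ` {..<N} = A"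
 shows "card A = N" "!!i. i < N ==> nth_mark A i = a i" "nth_mark A N = 1"
proof -
 have s: "sorted_wrt (<) (map a [0..<N])"
  using assms(1) by (simp add: sorted_wrt_iff_nth_less)
 have "sorted_list_of_set (set (map a [0..<N])) = map a [0..<N]"
  by (rule sorted_list_of_set.idem_if_sorted_distinct)
   (use s in \<open>auto simp: strict_sorted_iff\<close>)
 moreover have "set (map a [0..<N]) = A" using assms(2) by (auto simp: atLeast0LessThan)
 ultimately have e: "sorted_list_of_set A = map a [0..<N]" by simp
 show "card A = N"
  using e by (metis length_map length_sorted_list_of_set length_upt minus_nat.diff_0)
 show "nth_mark A i = a i" if "i < N" for i using that by (simp add: nth_mark_def e nth_append)
 show "nth_mark A N = 1" by (simp add: nth_mark_def e nth_append)
qed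

lemma nth_mark_card: "nth_mark A (card A) = 1"
 unfolding nth_mark_def by (metis length_sorted_list_of_set nth_append_length)

lemma nth_mark_in: "finite A ==> i < card A ==> nth_mark A i \<in> A"
 using nth_mem[of i "sorted_list_of_set A"] by (simp add: nth_mark_def nth_append)

lemma nth_mark_surj:
 assumes "finite A" "x \<in> A"
 obtains i where "i < card A" "nth_mark A i = x"
proof -
 have "x \<in> set (sorted_list_of_set A)" using assms by simp
 then obtain i where "i < length (sorted_list_of_set A)" "sorted_list_of_set A ! i = x"
  by (auto simp: in_set_conv_nth)
 then show thesis using that[of i] by (simp add: nth_mark_def nth_append)
qed

lemma nth_mark_less:
 assumes "mark_set A" "i < j" "j <= card A"
 shows "nth_mark A i < nth_mark A j"
proof (cases "j = card A")
 case True
 then show ?thesis using nth_mark_in[of A i] assms nth_mark_card[of A] by (auto simp: mark_set_def)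
next
 case False
 then have "j < length (sorted_list_of_set A)" using assms by simp
 moreover from this have "sorted_list_of_set A ! i < sorted_list_of_set A ! j"
  using assms(2) by (intro sorted_wrt_nth_less[of "(<)"]) auto
 ultimately show ?thesis using assms(2) by (simp add: nth_mark_def nth_append)
qed

lemma nth_mark_le: "mark_set A ==> i <= j ==> j <= card A ==> nth_mark A i <= nth_mark A j"
 using nth_mark_less[of A i j] by (cases "i = j") auto

lemma nth_mark_less_iff:
 "mark_set A ==> i <= card A ==> j <= card A ==> nth_mark A i < nth_mark A j \<longleftrightarrow> i < j"
 by (metis nth_mark_le nth_mark_less not_le)

lemma nth_mark_eq_iff:
 "mark_set A ==> i <= card A ==> j <= card A ==> nth_mark A i = nth_mark A j \<longleftrightarrow> i = j"
 by (metis nth_mark_less_iff less_irrefl linorder_neq_iff)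

lemma nth_mark_zero: 
 assumes "mark_set A" shows "nth_mark A 0 = 0"
proof -
 obtain i where "i < card A" "nth_mark A i = 0"
  using assms unfolding mark_set_def by (metis nth_mark_surj)
 then have "nth_mark A 0 <= 0" using nth_mark_le[OF assms, of 0 i] by simp
 moreover have "nth_mark A 0 \<in> A"
  using assms card_mark_set[OF assms] by (intro nth_mark_in) (auto simp: mark_set_def)
 ultimately show ?thesis using assms by (force simp: mark_set_def)
qed

lemma nth_mark_range: "mark_set A ==> i < card A ==> 0 <= nth_mark A i & nth_mark A i < 1"
 using nth_mark_in[of A i] by (auto simp: mark_set_def)

lemma sum_gaps: "mark_set A ==> i <= card A ==> sum (gaps A) {..<i} = nth_mark A i"
 by (induction i) (auto simp: nth_mark_zero gaps_def)

lemma gaps_simplex: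
 assumes A: "mark_set A"
 shows "gaps A \<in> standard_simplex (card A - 1)"
proof (rule simplexI)
 show "0 <= gaps A i" for i using nth_mark_le[OF A, of i "Suc i"] by (auto simp: gaps_def)
 show "gaps A i = 0" if "card A - 1 < i" for i using that by (auto simp: gaps_def)
 have "{..card A - 1} = {..<card A}" using card_mark_set[OF A] by auto
 then show "(\<Sum>i\<le>card A - 1. gaps A i) = 1" using sum_gaps[OF A, of "card A"] nth_mark_card by simp
qed

lemma segment_at_gaps:
 assumes "mark_set A" "i < card A" "nth_mark A i <= a" "a < nth_mark A (Suc i)"
 shows "segment_at (card A - 1) (gaps A) a = i"
proof (rule segment_at_unique[OF gaps_simplex[OF assms(1)]])
 show "i <= card A - 1" using assms by simp
 show "sum (gaps A) {..<i} <= a" using sum_gaps[OF assms(1), of i] assms by simp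
 show "a < sum (gaps A) {..<Suc i}" using sum_gaps[OF assms(1), of "Suc i"] assms by simp
qed

lemma sampling_marks: "mark_set A ==> sampling (card A - 1) (nth_mark A)"
 using card_mark_set[of A] nth_mark_le[of A] nth_mark_range[of A] by (auto simp: sampling_def)

text \<open>Meaningful only if the marks of \<open>A\<close> include the vertices of
  \<open>P\<close> (\<open>carried\<close>); otherwise the pull-back forgets part of
  \<open>P\<close>.\<close>

definition cell_on :: "('a, 'b) cyclic_set_scheme => real set => 'a rpoint => 'a" where
 "cell_on S A P = eval S (card A - 1) (nth_mark A) P"

text \<open>The representing cell may be degenerate: \<open>A\<close> may have more points than
  \<open>P\<close> has vertices.\<close>

definition carried :: "('a, 'b) cyclic_set_scheme => real set => 'a rpoint => bool" where
 "carried S A P \<longleftrightarrow> (\<exists>s\<in>cells S (card A - 1). P = rclass S (card A - 1) s (gaps A))"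

text \<open>Each mark is the start of its own segment, so evaluation at the marks is the identity
  operator. In particular the cell in \<open>carried\<close> is unique.\<close>

lemma cell_on_rclass_gaps:
 assumes S: "is_cyclic_set S" and A: "mark_set A" and s: "s \<in> cells S (card A - 1)"
 shows "cell_on S A (rclass S (card A - 1) s (gaps A)) = s"
proof -
 have "cell_on S A (rclass S (card A - 1) s (gaps A)) =
   op_act S (card A - 1) (card A - 1) (%i. segment_at (card A - 1) (gaps A) (nth_mark A i)) s"
  unfolding cell_on_def by (rule eval_rclass[OF S s gaps_simplex[OF A] sampling_marks[OF A]])
 also have "... = s"
 proof (rule op_act_id[OF S s])
  fix i assume "i <= card A - 1"
  then have "i < card A" using card_mark_set[OF A] by simp
  then show "segment_at (card A - 1) (gaps A) (nth_mark A i) = i"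
   using nth_mark_less[OF A, of i "Suc i"] by (intro segment_at_gaps[OF A]) auto
 qed
 finally show ?thesis .
qed

lemma carriedD:
 assumes "is_cyclic_set S" "mark_set A" "carried S A P"
 shows "cell_on S A P \<in> cells S (card A - 1)" "P = rclass S (card A - 1) (cell_on S A P) (gaps A)"
 using assms cell_on_rclass_gaps[OF assms(1,2)] by (auto simp: carried_def)

text \<open>If every vertex of \<open>t\<close> is a mark, then the marks before the start of
  segment \<open>j\<close> are exactly those whose segment is below \<open>j\<close>, so
  \<open>t\<close> and the push-forward of the gaps have the same partial sums. The alternative 1 is
  for vertices followed only by coordinates 0: they lie at the end of the interval, which is not a
  mark.\<close>

lemma push_forward_segment_at:
 assumes t: "t \<in> standard_simplex n" and A: "mark_set A"
  and marks: "!!j. j <= n ==> sum t {..<j} \<in> A \<union> {1}"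
 shows "push_forward (card A - 1) (%i. segment_at n t (nth_mark A i)) (gaps A) = t"
proof -
 let ?ph = "%i. segment_at n t (nth_mark A i)" and ?m = "card A - 1"
 have ph: "monotone_op ?m n ?ph" by (rule monotone_segment_at[OF sampling_marks[OF A] t])
 have simp: "push_forward ?m ?ph (gaps A) \<in> standard_simplex n"
  by (rule push_forward_simplex[OF ph gaps_simplex[OF A]])
 have part: "sum (push_forward ?m ?ph (gaps A)) {..<j} = sum t {..<j}" if "j <= n" for j
 proof -
  obtain k where k: "k <= card A" "nth_mark A k = sum t {..<j}"
  proof (cases "sum t {..<j} = 1")
   case True
   then show ?thesis using that[of "card A"] nth_mark_card by simp
  next
   case False
   then have "sum t {..<j} \<in> A" "finite A" using marks[OF \<open>j <= n\<close>] A by (auto simp: mark_set_def)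
   then show ?thesis using that by (metis nth_mark_surj less_imp_le)
  qed
  have "{..<j} = {i. i <= n & i < j}" using that by auto
  then have "sum (push_forward ?m ?ph (gaps A)) {..<j} = sum (gaps A) {i. i <= ?m & ?ph i < j}"
   using sum_push_forward[OF ph, where P = "%i. i < j" and u = "gaps A"] by simp
  also have "{i. i <= ?m & ?ph i < j} = {..<k}"
  proof (intro equalityI subsetI)
   fix i assume i: "i \<in> {i. i <= ?m & ?ph i < j}"
   then have ic: "i < card A" using card_mark_set[OF A] by auto
   have "nth_mark A i < sum t {..<Suc (?ph i)}"
    using segment_at_bounds(3)[OF t] nth_mark_range[OF A ic] by auto
   also have "... <= sum t {..<j}"
    using i simplexD(1)[OF t] by (intro partial_sum_mono) auto
   finally show "i \<in> {..<k}" using k ic nth_mark_less_iff[OF A, of i k] by simp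
  next
   fix i assume "i \<in> {..<k}"
   then have ic: "i < card A" "nth_mark A i < sum t {..<j}"
    using k nth_mark_less[OF A, of i k] by auto
   have "sum t {..<?ph i} <= nth_mark A i"
    using segment_at_bounds(2)[OF t] nth_mark_range[OF A ic(1)] by auto
   then have "~ j <= ?ph i"
    using ic(2) partial_sum_mono[of t j "?ph i"] simplexD(1)[OF t] by fastforce
   then show "i \<in> {i. i <= ?m & ?ph i < j}" using ic by auto
  qed
  also have "sum (gaps A) {..<k} = sum t {..<j}" using sum_gaps[OF A k(1)] k by simp
  finally show ?thesis .
 qed
 show ?thesis
 proof
  fix j
  let ?v = "push_forward ?m ?ph (gaps A)"
  have full: "sum ?v {..<Suc n} = sum t {..<Suc n}"
   using simplexD(4)[OF simp] simplexD(4)[OF t] by (simp add: lessThan_Suc_atMost)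
  consider "j < n" | "j = n" | "n < j" by linarith
  then show "?v j = t j"
  proof cases
   case 1
   then show ?thesis using part[of j] part[of "Suc j"] by simp
  next
   case 2
   then show ?thesis using part[of j] full by simp
  next
   case 3
   then show ?thesis using simplexD(3)[OF simp] simplexD(3)[OF t] by simp
  qed
 qed
qed

lemma carriedI:
 assumes S: "is_cyclic_set S" and s: "s \<in> cells S n" and t: "t \<in> standard_simplex n"
  and A: "mark_set A" and marks: "!!j. j <= n ==> sum t {..<j} \<in> A \<union> {1}"
 shows "carried S A (rclass S n s t)"
proof -
 let ?ph = "%i. segment_at n t (nth_mark A i)"
 have ph: "monotone_op (card A - 1) n ?ph" by (rule monotone_segment_at[OF sampling_marks[OF A] t])
 have "rclass S n s t = rclass S (card A - 1) (op_act S (card A - 1) n ?ph s) (gaps A)"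
  unfolding rclass_op_act[OF S ph s gaps_simplex[OF A]]
  by (subst push_forward_segment_at[OF t A marks]) auto
 then show ?thesis using op_act_cells[OF S ph s] by (auto simp: carried_def)
qed

lemma insert_mark:
 assumes A: "mark_set A" and i: "i < card A" and t: "nth_mark A i < t" "t < nth_mark A (Suc i)"
 shows "mark_set (insert t A)" "t \<notin> A" "card (insert t A) = Suc (card A)"
  "!!j. j <= Suc (card A) ==> nth_mark (insert t A) j =
   (if j <= i then nth_mark A j else if j = Suc i then t else nth_mark A (j - 1))"
proof -
 let ?a = "%j. if j <= i then nth_mark A j else if j = Suc i then t else nth_mark A (j - 1)"
 have "t < 1" using t nth_mark_le[OF A, of "Suc i" "card A"] nth_mark_card[of A] i by simp
 moreover have "0 <= t" using nth_mark_range[OF A i] t by simp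
 ultimately show B: "mark_set (insert t A)" using A by (auto simp: mark_set_def)
 show tA: "t \<notin> A"
 proof
  assume "t \<in> A"
  then obtain j where j: "j < card A" "nth_mark A j = t"
   using A unfolding mark_set_def by (metis nth_mark_surj)
  then have "i < j" "j < Suc i"
   using t i nth_mark_less_iff[OF A, of i j] nth_mark_less_iff[OF A, of j "Suc i"] by auto
  then show False by simp
 qed
 have fin: "finite A" using A by (simp add: mark_set_def)
 show c: "card (insert t A) = Suc (card A)" using fin tA by simp
 have less: "?a j < ?a k" if "j < k" "k < Suc (card A)" for j k
 proof -
  consider "k <= i" | "k = Suc i" | "Suc i < k" by linarith
  then show ?thesis
  proof cases
   case 1
   then show ?thesis using that i nth_mark_less[OF A, of j k] by auto
  next
   case 2
   then show ?thesis using that i nth_mark_le[OF A, of j i] t by auto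
  next
   case 3
   then have "nth_mark A (Suc i) <= nth_mark A (k - 1)" using that by (intro nth_mark_le[OF A]) auto
   moreover have "nth_mark A (j - 1) < nth_mark A (k - 1)" if "Suc i < j"
    using 3 \<open>j < k\<close> \<open>k < Suc (card A)\<close> that by (intro nth_mark_less[OF A]) auto
   moreover have "nth_mark A j < nth_mark A (k - 1)" if "j <= i"
    using 3 \<open>k < Suc (card A)\<close> that by (intro nth_mark_less[OF A]) auto
   ultimately show ?thesis using 3 t by auto
  qed
 qed
 have img: "?a ` {..<Suc (card A)} = insert t A"
 proof (intro equalityI subsetI)
  fix x assume "x \<in> ?a ` {..<Suc (card A)}"
  then obtain k where "k < Suc (card A)" "x = ?a k" by blast
  then show "x \<in> insert t A" using nth_mark_in[OF fin, of k] nth_mark_in[OF fin, of "k - 1"] i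
   by (auto split: if_splits)
 next
  fix x assume "x \<in> insert t A"
  then consider "x = t" | k where "k < card A" "nth_mark A k = x"
   using fin by (metis insertE nth_mark_surj)
  then show "x \<in> ?a ` {..<Suc (card A)}"
  proof cases
   case 1
   then show ?thesis using i by (intro image_eqI[of _ _ "Suc i"]) auto
  next
   case 2
   show ?thesis
   proof (cases "k <= i")
    case True
    then show ?thesis using 2 by (intro image_eqI[of _ _ k]) auto
   next
    case False
    then show ?thesis using 2 by (intro image_eqI[of _ _ "Suc k"]) auto
   qed
  qed
 qed
 fix j assume "j <= Suc (card A)"
 then consider "j < Suc (card A)" | "j = Suc (card A)" by linarith
 then show "nth_mark (insert t A) j = ?a j"
 proof cases
  case 1
  then show ?thesis using nth_mark_unique(2)[of "Suc (card A)" ?a, OF less img] by simp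
 next
  case 2
  then show ?thesis
   using nth_mark_card[of "insert t A"] c i nth_mark_card[of A] by simp
 qed
qed

lemma simplical_degeneracy_gaps_insert:
 assumes "mark_set A" "i < card A" "nth_mark A i < t" "t < nth_mark A (Suc i)"
 shows "simplical_degeneracy i (gaps (insert t A)) = gaps A"
proof
 fix j
 show "simplical_degeneracy i (gaps (insert t A)) j = gaps A j"
  using insert_mark(3)[OF assms] insert_mark(4)[OF assms, of j] insert_mark(4)[OF assms, of "Suc j"]
   insert_mark(4)[OF assms, of "Suc (Suc j)"] assms(2)
  by (auto simp: simplical_degeneracy_def gaps_def)
qed

text \<open>The new mark and the one before it fall into the same old segment, so evaluation repeats
  the index \<open>i\<close>: refinement by one mark is a degeneracy.\<close>

lemma cell_on_insert:
 assumes S: "is_cyclic_set S" and A: "mark_set A" "i < card A" "nth_mark A i < t" "t < nth_mark A (Suc i)"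
  and P: "carried S A P"
 shows "cell_on S (insert t A) P = degeneracy S (card A - 1) i (cell_on S A P)"
  "carried S (insert t A) P"
proof -
 note ins = insert_mark[OF A]
 obtain s where s: "s \<in> cells S (card A - 1)" "P = rclass S (card A - 1) s (gaps A)"
  using P by (auto simp: carried_def)
 have eq: "segment_at (card A - 1) (gaps A) (nth_mark (insert t A) j) = repeat_op i j"
  if "j <= card A" for j
 proof (rule segment_at_gaps[OF A(1)])
  show "repeat_op i j < card A" using that A(2) by (auto simp: repeat_op_def)
  show "nth_mark A (repeat_op i j) <= nth_mark (insert t A) j"
   "nth_mark (insert t A) j < nth_mark A (Suc (repeat_op i j))"
   using ins(4)[of j] that A nth_mark_less[OF A(1), of j "Suc j"] 
    nth_mark_less[OF A(1), of "j - 1" "j"]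
   by (auto simp: repeat_op_def)
 qed
 have c: "card (insert t A) - 1 = Suc (card A - 1)" using ins(3) A(2) by simp
 have "cell_on S (insert t A) P =
   op_act S (Suc (card A - 1)) (card A - 1)
    (%j. segment_at (card A - 1) (gaps A) (nth_mark (insert t A) j)) s"
  unfolding cell_on_def s(2) 
  using eval_rclass[OF S s(1) gaps_simplex[OF A(1)] sampling_marks[OF ins(1)]] c by simp
 also have "... = op_act S (Suc (card A - 1)) (card A - 1) (repeat_op i) s"
  by (rule fun_cong[OF op_act_cong]) (use eq A(2) in auto)
 also have "... = degeneracy S (card A - 1) i s" by (simp add: degeneracy_eq_op_act)
 finally show "cell_on S (insert t A) P = degeneracy S (card A - 1) i (cell_on S A P)"
  using cell_on_rclass_gaps[OF S A(1) s(1)] s(2) by simp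
 have i: "i <= card A - 1" using A(2) by simp
 have "rclass S (Suc (card A - 1)) (degeneracy S (card A - 1) i s) (gaps (insert t A)) = P"
  using rclass_degeneracy[OF s(1) i] gaps_simplex[OF ins(1)] c
   simplical_degeneracy_gaps_insert[OF A] s(2) by simp
 then show "carried S (insert t A) P"
  using degeneracy_cells[OF S s(1) i] c by (auto simp: carried_def)
qed

section \<open>Trees and bridges\<close>

definition simple_walk :: "'v set => ('v => 'v => bool) => 'v => 'v => 'v list => bool" where
 "simple_walk V adj u v p \<longleftrightarrow>
   p ~= [] & hd p = u & last p = v & set p <= V & distinct p & successively adj p"

lemma is_tree_iff:
 "is_tree V adj \<longleftrightarrow> V ~= {} & (\<forall>u\<in>V. \<forall>v\<in>V. \<exists>!p. simple_walk V adj u v p)"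
 by (simp add: is_tree_def simple_walk_def)

text \<open>If \<open>y\<close> has been visited, the walk is cut off there instead of being
  prolonged. The last conclusion records which case occurred, so that the walk is known explicitly
  when \<open>y\<close> cannot have been visited.\<close>

lemma simple_walk_extend:
 assumes p: "simple_walk V adj u x p" and y: "y \<in> V" "adj x y"
 obtains q where "simple_walk V adj u y q" "set q <= insert y (set p)"
  "q = p @ [y] | y \<in> set p"
proof (cases "y \<in> set p")
 case False
 have "simple_walk V adj u y (p @ [y])"
  using p y False by (auto simp: simple_walk_def successively_append_iff)
 then show thesis using that[of "p @ [y]"] by auto
next
 case True
 then obtain as bs where e: "p = as @ y # bs" by (auto simp: in_set_conv_decomp)
 have "successively adj ((as @ [y]) @ bs)" using p unfolding e by (simp add: simple_walk_def)
 then have "successively adj (as @ [y])" unfolding successively_append_iff by blast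
 then have "simple_walk V adj u y (as @ [y])"
  using p unfolding e by (cases as) (auto simp: simple_walk_def)
 then show thesis using that[of "as @ [y]"] True unfolding e by auto
qed

text \<open>In a tree, the component of \<open>i\<close> after removal of the edge from
  \<open>i\<close> to \<open>P\<close>.\<close>

definition side :: "'v set => ('v => 'v => bool) => 'v => 'v => 'v => bool" where
 "side V adj i P x \<longleftrightarrow> (\<exists>p. simple_walk V adj i x p & P \<notin> set p)"

text \<open>The side of \<open>i\<close> can only be left by the edge from \<open>i\<close> to
  \<open>P\<close>: a walk that avoids \<open>P\<close> and is then prolonged to \<open>P\<close>
  must be this edge, since the simple walk from \<open>i\<close> to \<open>P\<close> is
  unique.\<close>

lemma side_step:
 assumes tree: "is_tree V adj" and V: "i \<in> V" "P \<in> V" "y \<in> V" and e: "adj i P" "i ~= P"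
  and xy: "adj x y" "~ (x = i & y = P)" and x: "side V adj i P x"
 shows "side V adj i P y"
proof -
 obtain p where p: "simple_walk V adj i x p" "P \<notin> set p" using x by (auto simp: side_def)
 obtain q where q: "simple_walk V adj i y q" "set q <= insert y (set p)"
  "q = p @ [y] | y \<in> set p"
  by (rule simple_walk_extend[OF p(1) V(3) xy(1)])
 show ?thesis
 proof (cases "y = P")
  case True
  have "simple_walk V adj i P [i, P]" using V e by (simp add: simple_walk_def)
  then have "q = [i, P]" using q(1) tree V True unfolding is_tree_iff by blast
  then have "p = [i]" using q(3) p(2) True by auto
  then have "x = i" using p(1) by (simp add: simple_walk_def)
  then show ?thesis using xy(2) True by simp
 next
  case False
  then show ?thesis using p(2) q unfolding side_def by blast
 qed
qed

lemma side_start: "i \<in> V ==> i ~= P ==> side V adj i P i"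
 unfolding side_def by (rule exI[of _ "[i]"]) (simp add: simple_walk_def)

lemma not_side_end: "~ side V adj i P P"
proof
 assume "side V adj i P P"
 then obtain p where "p ~= []" "last p = P" "P \<notin> set p" by (auto simp: side_def simple_walk_def)
 then show False using last_in_set[of p] by simp
qed

lemma simple_walk_tl:
 assumes "simple_walk V adj u v (u # a # p)"
 shows "simple_walk V adj a v (a # p)" "adj u a" "u \<notin> set (a # p)"
 using assms by (auto simp: simple_walk_def)

text \<open>The only edge across which \<open>f\<close> may change ends at \<open>u\<close>, which
  the walk avoids.\<close>

lemma bridge_walk:
 assumes bridge: "!!x y. x \<in> V ==> y \<in> V ==> adj x y ==> {x, y} ~= {u, b} ==> f x = f y"
 shows "simple_walk V adj a v p ==> u \<notin> set p ==> f a = f v"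
proof (induction p arbitrary: a)
 case Nil
 then show ?case by (simp add: simple_walk_def)
next
 case (Cons x p)
 have x: "x = a" using Cons.prems by (simp add: simple_walk_def)
 show ?case
 proof (cases p)
  case Nil
  then show ?thesis using Cons.prems by (auto simp: simple_walk_def)
 next
  case c: (Cons z r)
  have pre: "simple_walk V adj a v (a # z # r)" "u \<notin> set (a # z # r)"
   using Cons.prems x c by simp_all
  have "simple_walk V adj z v p" "adj a z" using simple_walk_tl[OF pre(1)] c by auto
  moreover have "u ~= z" "u ~= a" using pre(2) by auto
  moreover have "a \<in> V" "z \<in> V" using pre(1) by (auto simp: simple_walk_def)
  ultimately have w: "simple_walk V adj z v p" "adj a z" "u ~= z" "u ~= a" "a \<in> V" "z \<in> V" by auto
  have "f a = f z" using w by (intro bridge) (auto simp: doubleton_eq_iff)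
  also have "... = f v" using Cons.IH[OF w(1)] Cons.prems by simp
  finally show ?thesis .
 qed
qed

text \<open>Suppose two simple walks with common ends leave \<open>u\<close> for different
  neighbours \<open>a\<close> and \<open>b\<close>. The function that separates the edge from
  \<open>u\<close> to \<open>a\<close> is constant along the rests of both walks, which avoid
  \<open>u\<close>, and across the edge from \<open>u\<close> to \<open>b\<close>; so it agrees at
  \<open>a\<close>, at the common end, at \<open>b\<close> and at \<open>u\<close>, a
  contradiction.\<close>

lemma is_tree_if_bridges:
 assumes ne: "V ~= {}"
  and conn: "!!u v. u \<in> V ==> v \<in> V ==> (%x y. x \<in> V & y \<in> V & adj x y)\<^sup>*\<^sup>* u v"
  and bridge: "!!u b. u \<in> V ==> b \<in> V ==> adj u b ==>
   \<exists>f :: 'v => bool. f u ~= f b & (\<forall>x\<in>V. \<forall>y\<in>V. adj x y & {x, y} ~= {u, b} --> f x = f y)"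
 shows "is_tree V adj"
proof -
 have ex: "\<exists>p. simple_walk V adj u v p" if "u \<in> V" "v \<in> V" for u v
  using conn[OF that]
 proof (induction rule: rtranclp_induct)
  case base
  then show ?case using that by (intro exI[of _ "[u]"]) (simp add: simple_walk_def)
 next
  case (step y z)
  then show ?case by (meson simple_walk_extend)
 qed
 have uniq: "p = q" if "simple_walk V adj u v p" "simple_walk V adj u v q" for u v p q
  using that
 proof (induction p arbitrary: u q)
  case Nil
  then show ?case by (simp add: simple_walk_def)
 next
  case (Cons x p)
  have x: "x = u" using Cons.prems by (simp add: simple_walk_def)
  obtain r where q: "q = u # r" using Cons.prems(2) by (cases q) (auto simp: simple_walk_def)
  consider "p = [] | r = []" | a p' b r' where "p = a # p'" "r = b # r'"
   by (meson neq_Nil_conv)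
  then show ?case
  proof cases
   case 1
   then have "v = u" using Cons.prems x q by (auto simp: simple_walk_def)
   then show ?thesis using Cons.prems x q by (auto simp: simple_walk_def split: if_splits)
  next
   case 2
   have pw: "simple_walk V adj u v (u # a # p')" and rw: "simple_walk V adj u v (u # b # r')"
    using Cons.prems x q 2 by simp_all
   have P: "simple_walk V adj a v p" "adj u a" "u \<notin> set p"
    using simple_walk_tl[OF pw] 2(1) by simp_all
   have R: "simple_walk V adj b v r" "adj u b" "u \<notin> set r"
    using simple_walk_tl[OF rw] 2(2) by simp_all
   have V: "u \<in> V" "a \<in> V" using pw by (simp_all add: simple_walk_def)
   have "b \<in> V" using rw by (simp add: simple_walk_def)
   note V = V this
   have "a = b"
   proof (rule ccontr)
    assume ne: "a ~= b"
    obtain f :: "'v => bool" where f0: "f u ~= f a &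
      (\<forall>x\<in>V. \<forall>y\<in>V. adj x y & {x, y} ~= {u, a} --> f x = f y)"
     using bridge[OF V(1,2) P(2)] by (rule exE)
    then have f: "f u ~= f a"
     "!!x y. x \<in> V ==> y \<in> V ==> adj x y ==> {x, y} ~= {u, a} ==> f x = f y"
     by simp_all
    have "f a = f v" by (rule bridge_walk[OF f(2) P(1,3)])
    moreover have "f b = f v" by (rule bridge_walk[OF f(2) R(1,3)])
    moreover have "f u = f b" using ne R V by (intro f(2)) (auto simp: doubleton_eq_iff)
    ultimately show False using f(1) by simp
   qed
   then show ?thesis using Cons.IH[OF P(1)] R(1) x q by simp
  qed
 qed
 show ?thesis unfolding is_tree_iff using ne ex uniq by blast
qed

section \<open>Cacti without trees\<close>

text \<open>\<open>is_cactus\<close> without the tree axiom and without the condition that an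
  intersection meets each lobe at most once; bridges give both back, the former together with
  connectedness.\<close>

definition precactus :: "cactus => bool" where
 "precactus c \<longleftrightarrow>
   (\<forall>i<lobes c. 0 < radius c i) & (\<forall>i\<ge>lobes c. radius c i = 0) &
   (\<Sum>i<lobes c. radius c i) = 1 &
   turn c permutes points c & finite {p. turn c p ~= p} & origin c \<in> points c"

text \<open>\<open>kap\<close> marks the lobes that stay with the lobe of \<open>p\<close> when this
  lobe is cut off from the intersection point at \<open>p\<close>. It may change only at the turns
  out of and into \<open>p\<close>. In contrast to separation in the dual graph, this speaks of
  \<open>turn\<close> alone.\<close>

definition bridge :: "cactus => point => (nat => bool) => bool" where
 "bridge c p kap \<longleftrightarrow> kap (fst p) & ~ kap (fst (turn c p)) &
   (\<forall>q\<in>points c. turn c q = p --> ~ kap (fst q)) &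
   (\<forall>q\<in>points c. q ~= p & turn c q ~= p --> kap (fst (turn c q)) = kap (fst q))"

definition bridged :: "cactus => bool" where
 "bridged c \<longleftrightarrow> (\<forall>p\<in>points c. turn c p ~= p --> (\<exists>kap. bridge c p kap))"

text \<open>Connectedness of the configuration, expressed through \<open>turn\<close> rather than
  through walks in the dual graph.\<close>

definition joined :: "cactus => bool" where
 "joined c \<longleftrightarrow> (\<forall>L. L <= {..<lobes c} & L ~= {} & (\<forall>p\<in>points c. fst p \<in> L --> fst (turn c p) \<in> L) -->
   L = {..<lobes c})"

lemma precactus_lobes: "precactus c ==> 0 < lobes c"
 by (rule ccontr) (simp add: precactus_def)

lemma turn_permutation:
 assumes "precactus c"
 shows "permutation (turn c)"
 using assms by (auto simp: precactus_def permutation permutes_bij)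

lemma turn_points: "precactus c ==> turn c p \<in> points c \<longleftrightarrow> p \<in> points c"
 by (auto simp: precactus_def permutes_in_image)

lemma turn_inj: "precactus c ==> turn c p = turn c q \<longleftrightarrow> p = q"
 by (meson permutes_inj precactus_def injD)

lemma orbit_points:
 assumes "precactus c" "p \<in> points c" "q \<in> Orbits.orbit (turn c) p"
 shows "q \<in> points c"
 using assms(3) by induction (auto simp: turn_points assms)

lemma orbit_eq:
 assumes "precactus c" "q \<in> Orbits.orbit (turn c) p"
 shows "Orbits.orbit (turn c) q = Orbits.orbit (turn c) p"
 using assms(2) permutation_orbit_step[OF turn_permutation[OF assms(1)]] by induction auto

lemma orbit_self: "precactus c ==> p \<in> Orbits.orbit (turn c) p"
 by (rule permutation_self_in_orbit[OF turn_permutation])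

lemma orbit_moved:
 assumes "precactus c" "turn c p ~= p" "q \<in> Orbits.orbit (turn c) p"
 shows "turn c q ~= q"
 using assms(3,2)
proof induction
 case base
 then show ?case using turn_inj[OF assms(1)] by simp
next
 case (step y)
 then show ?case using turn_inj[OF assms(1)] by simp
qed

lemma intersectionsE:
 assumes "precactus c" "P \<in> intersections c" "q \<in> P"
 shows "P = Orbits.orbit (turn c) q" "q \<in> points c" "turn c q ~= q"
proof -
 obtain p where p: "P = Orbits.orbit (turn c) p" "p \<in> points c" "turn c p ~= p"
  using assms(2) by (auto simp: intersections_def)
 then show "P = Orbits.orbit (turn c) q" "q \<in> points c" "turn c q ~= q"
  using orbit_eq[OF assms(1)] orbit_points[OF assms(1)] orbit_moved[OF assms(1)] assms(3) by auto
qed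

lemma intersectionsI:
 "p \<in> points c ==> turn c p ~= p ==> Orbits.orbit (turn c) p \<in> intersections c"
 unfolding intersections_def by blast

lemma fst_points: "p \<in> points c ==> fst p < lobes c"
 by (auto simp: points_def)

lemma points_iff: "(i, t) \<in> points c \<longleftrightarrow> i < lobes c & 0 <= t & t < 1"
 by (auto simp: points_def)

lemma dual_adj_cases:
 assumes "dual_adj x y"
 obtains j Q where "x = Inl j" "y = Inr Q" "j \<in> fst ` Q"
 | j Q where "x = Inr Q" "y = Inl j" "j \<in> fst ` Q"
 using assms by (cases "(x, y)" rule: dual_adj.cases) auto

lemma cactus_pre: "is_cactus c ==> precactus c"
 by (auto simp: is_cactus_def precactus_def)

text \<open>\<open>kap\<close> is the side of the dual tree on which a lobe lies after removal of
  the edge between the lobe of \<open>p\<close> and the intersection point. The other points of this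
  intersection lie on other lobes, because no intersection meets a lobe twice, so they are on the
  far side.\<close>

lemma is_cactus_bridged:
 assumes c: "is_cactus c"
 shows "bridged c"
 unfolding bridged_def
proof (intro ballI impI)
 fix p assume p: "p \<in> points c" "turn c p ~= p"
 note pre = cactus_pre[OF c]
 define P where "P = Orbits.orbit (turn c) p"
 have P: "P \<in> intersections c" unfolding P_def by (rule intersectionsI[OF p])
 have pP: "p \<in> P" unfolding P_def by (rule orbit_self[OF pre])
 have inj: "inj_on fst Q" if "Q \<in> intersections c" for Q using c that by (auto simp: is_cactus_def)
 let ?V = "dual_verts c"
 have tree: "is_tree ?V dual_adj" using c by (simp add: is_cactus_def)
 define s where "s = side ?V dual_adj (Inl (fst p)) (Inr P)"
 have V: "Inl (fst p) \<in> ?V" "Inr P \<in> ?V" using p P fst_points[OF p(1)] by (auto simp: dual_verts_def)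
 have adj: "dual_adj (Inl (fst p)) (Inr P)" using pP by simp
 have step: "s x = s y" if "x \<in> ?V" "y \<in> ?V" "dual_adj x y" "{x, y} ~= {Inl (fst p), Inr P}" for x y
 proof -
  have "dual_adj y x" using that(3) by (cases rule: dual_adj_cases) auto
  then show ?thesis unfolding s_def
   using side_step[OF tree V that(2) adj _ that(3)] side_step[OF tree V that(1) adj _ \<open>dual_adj y x\<close>]
    that(4) by auto
 qed
 have s0: "s (Inl (fst p))" unfolding s_def by (rule side_start[OF V(1)]) simp
 have sP: "~ s (Inr P)" unfolding s_def by (rule not_side_end)
 have other: "~ s (Inl (fst q))" if "q \<in> P" "q ~= p" for q
 proof -
  have "fst q ~= fst p" using inj[OF P] that pP by (auto dest: inj_onD)
  moreover have "q \<in> points c" using intersectionsE[OF pre P that(1)] by simp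
  ultimately have "s (Inl (fst q)) = s (Inr P)"
   using that P fst_points[of q c] by (intro step) (auto simp: dual_verts_def doubleton_eq_iff)
  then show ?thesis using sP by simp
 qed
 have "bridge c p (%j. s (Inl j))"
  unfolding bridge_def
 proof (intro conjI ballI impI)
  show "s (Inl (fst p))" by (rule s0)
  show "~ s (Inl (fst (turn c p)))" using p unfolding P_def[symmetric]
   by (intro other) (auto simp: P_def intro: orbit.base)
 next
  fix q assume q: "q \<in> points c" "turn c q = p"
  then have "q ~= p" using p by auto
  moreover have "q \<in> P"
   using permutation_orbit_step[OF turn_permutation[OF pre], of q] orbit_self[OF pre, of q] q
   by (simp add: P_def)
  ultimately show "~ s (Inl (fst q))" by (intro other)
 next
  fix q assume q: "q \<in> points c" "q ~= p & turn c q ~= p"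
  define Q where "Q = Orbits.orbit (turn c) q"
  show "s (Inl (fst (turn c q))) = s (Inl (fst q))"
  proof (cases "turn c q = q")
   case False
   have Q: "Q \<in> intersections c" unfolding Q_def by (rule intersectionsI[OF q(1) False])
   have in_Q: "q \<in> Q" "turn c q \<in> Q" unfolding Q_def by (auto intro: orbit_self[OF pre] orbit.base)
   show ?thesis
   proof (cases "Q = P")
    case True
    then show ?thesis using other[of q] other[of "turn c q"] in_Q q by simp
   next
    case False
    have "s (Inl j) = s (Inr Q)" if "j \<in> fst ` Q" for j
     using that Q False intersectionsE(2)[OF pre Q] fst_points[of _ c]
     by (intro step) (auto simp: dual_verts_def doubleton_eq_iff)
    then show ?thesis using in_Q by blast
   qed
  qed simp
 qed
 then show "\<exists>kap. bridge c p kap" by blast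
qed

text \<open>A set of lobes closed under \<open>turn\<close> contains all lobes through any
  intersection that it meets, so it spreads along walks in the dual graph.\<close>

lemma is_cactus_joined:
 assumes c: "is_cactus c"
 shows "joined c"
 unfolding joined_def
proof (intro allI impI)
 fix L assume L: "L <= {..<lobes c} & L ~= {} & (\<forall>p\<in>points c. fst p \<in> L --> fst (turn c p) \<in> L)"
 note pre = cactus_pre[OF c]
 have orbit: "fst q \<in> L" if "q \<in> Orbits.orbit (turn c) p" "p \<in> points c" "fst p \<in> L" for p q
  using that
 proof induction
  case (step y)
  then show ?case using L orbit_points[OF pre] by blast
 qed (use L in blast)
 let ?V = "dual_verts c"
 define good where "good = case_sum (%j. j \<in> L) (%Q :: point set. fst ` Q <= L)"
 have step: "good y" if "good x" "dual_adj x y" "x \<in> ?V" "y \<in> ?V" for x y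
  using that(2)
 proof (cases rule: dual_adj_cases)
  case (1 j Q)
  then obtain q where q: "q \<in> Q" "fst q = j" by auto
  have "Q \<in> intersections c" using 1 that by (auto simp: dual_verts_def)
  then have "Q = Orbits.orbit (turn c) q" "q \<in> points c" using intersectionsE[OF pre _ q(1)] by auto
  moreover have "fst q \<in> L" using 1 q that(1) by (simp add: good_def)
  ultimately have "fst ` Q <= L" using orbit by blast
  then show ?thesis using 1 by (simp add: good_def)
 next
  case (2 j Q)
  then show ?thesis using that by (auto simp: good_def)
 qed
 obtain l where l: "l \<in> L" using L by auto
 have "j \<in> L" if "j < lobes c" for j
 proof -
  have "Inl l \<in> ?V" "Inl j \<in> ?V" using l L that by (auto simp: dual_verts_def)
  then obtain p where w: "simple_walk ?V dual_adj (Inl l) (Inl j) p"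
   using c unfolding is_cactus_def is_tree_iff by blast
  have walk: "good v" if "simple_walk ?V dual_adj u v p" "good u" for u v p
   using that
  proof (induction p arbitrary: u)
   case (Cons x p)
   then show ?case
   proof (cases p)
    case (Cons y q)
    then have "simple_walk ?V dual_adj y v p" "dual_adj u y" "u \<in> ?V" "y \<in> ?V"
     using Cons.prems(1) by (auto simp: simple_walk_def)
    then show ?thesis using Cons.IH step Cons.prems(2) by blast
   qed (auto simp: simple_walk_def)
  qed (simp add: simple_walk_def)
  have "good (Inl j)" by (rule walk[OF w]) (simp add: good_def l)
  then show ?thesis by (simp add: good_def)
 qed
 then show "L = {..<lobes c}" using L by auto
qed

text \<open>After the turn out of \<open>p\<close>, further turns stay on the far side until they
  come back to \<open>p\<close>.\<close>

lemma bridge_orbit: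
 assumes pre: "precactus c" and p: "p \<in> points c" and b: "bridge c p kap"
  and q: "q \<in> Orbits.orbit (turn c) p" "q ~= p"
 shows "~ kap (fst q)"
 using q
proof induction
 case base
 then show ?case using b by (simp add: bridge_def)
next
 case (step y)
 then have "y \<in> points c" using orbit_points[OF pre p] by simp
 then show ?case using step b by (cases "y = p") (auto simp: bridge_def)
qed

text \<open>Bridges give uniqueness of walks in the dual graph. They also show that no intersection
  meets a lobe twice: a second point on the lobe of \<open>p\<close> would put this lobe on both
  sides.\<close>

lemma is_cactusI:
 assumes pre: "precactus c" and br: "bridged c" and jn: "joined c"
 shows "is_cactus c"
proof -
 let ?V = "dual_verts c"
 have inj: "inj_on fst P" if P: "P \<in> intersections c" for P
 proof (rule inj_onI, rule ccontr)
  fix p q assume pq: "p \<in> P" "q \<in> P" "fst p = fst q" "p ~= q"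
  note p = intersectionsE[OF pre P pq(1)]
  obtain kap where kap: "bridge c p kap" using br p by (auto simp: bridged_def)
  then show False using bridge_orbit[OF pre p(2) kap, of q] pq p by (auto simp: bridge_def)
 qed
 have "is_tree ?V dual_adj"
 proof (rule is_tree_if_bridges)
  show "?V ~= {}" using precactus_lobes[OF pre] by (auto simp: dual_verts_def)
 next
  define R where "R = (%x y. x \<in> ?V & y \<in> ?V & dual_adj x y)"
  have sym: "R\<^sup>*\<^sup>* y x" if "R\<^sup>*\<^sup>* x y" for x y
   using that
  proof (induction rule: rtranclp_induct)
   case (step y z)
   have "dual_adj y z" using step(2) by (simp add: R_def)
   then have "dual_adj z y" by (cases rule: dual_adj_cases) auto
   then have "R z y" using step(2) by (simp add: R_def)
   then show ?case using step(3) by (rule converse_rtranclp_into_rtranclp)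
  qed simp
  let ?L = "{j. j < lobes c & R\<^sup>*\<^sup>* (Inl 0) (Inl j)}"
  have moved: "R (Inl (fst p)) (Inr (Orbits.orbit (turn c) p))"
   "R (Inr (Orbits.orbit (turn c) p)) (Inl (fst (turn c p)))"
   if "p \<in> points c" "turn c p ~= p" for p
   using that orbit_self[OF pre, of p] orbit.base[of "turn c" p] intersectionsI[OF that]
    fst_points[of p c] fst_points[of "turn c p" c] turn_points[OF pre, of p]
   unfolding R_def by (auto simp: dual_verts_def)
  have "?L = {..<lobes c}"
  proof (rule jn[unfolded joined_def, rule_format], intro conjI ballI impI)
   show "?L ~= {}" using precactus_lobes[OF pre] by auto
   fix p assume p: "p \<in> points c" "fst p \<in> ?L"
   show "fst (turn c p) \<in> ?L"
   proof (cases "turn c p = p")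
    case False
    have "R\<^sup>*\<^sup>* (Inl 0) (Inl (fst (turn c p)))"
    proof (rule rtranclp.rtrancl_into_rtrancl, rule rtranclp.rtrancl_into_rtrancl)
     show "R\<^sup>*\<^sup>* (Inl 0) (Inl (fst p))" using p(2) by simp
    qed (rule moved[OF p(1) False])+
    then show ?thesis using fst_points[of "turn c p" c] turn_points[OF pre] p by auto
   qed (use p in simp)
  qed auto
  then have lobe: "R\<^sup>*\<^sup>* (Inl 0) (Inl j)" if "j < lobes c" for j using that by blast
  have all: "R\<^sup>*\<^sup>* (Inl 0) x" if "x \<in> ?V" for x
  proof (cases x)
   case (Inl j)
   then show ?thesis using that lobe by (auto simp: dual_verts_def)
  next
   case (Inr Q)
   then have Q: "Q \<in> intersections c" using that by (auto simp: dual_verts_def)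
   then obtain p where p: "Q = Orbits.orbit (turn c) p" "p \<in> points c" "turn c p ~= p"
    unfolding intersections_def by blast
   show ?thesis unfolding Inr p(1)
    by (rule rtranclp.rtrancl_into_rtrancl[OF lobe[OF fst_points[OF p(2)]] moved(1)[OF p(2,3)]])
  qed
  show "(%x y. x \<in> ?V & y \<in> ?V & dual_adj x y)\<^sup>*\<^sup>* u v" if "u \<in> ?V" "v \<in> ?V" for u v
   unfolding R_def[symmetric] using sym[OF all[OF that(1)]] all[OF that(2)] by (rule rtranclp_trans)
 next
  have main: "\<exists>f :: nat + point set => bool. f (Inl i) ~= f (Inr P) &
    (\<forall>x\<in>?V. \<forall>y\<in>?V. dual_adj x y & {x, y} ~= {Inl i, Inr P} --> f x = f y)"
   if P: "P \<in> intersections c" and i: "i \<in> fst ` P" for i P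
  proof -
   obtain p where p: "p \<in> P" "fst p = i" using i by auto
   note pp = intersectionsE[OF pre P p(1)]
   obtain kap where kap: "bridge c p kap" using br pp by (auto simp: bridged_def)
   \<comment> \<open>The separating function, extended to intersection points. All lobes through an
     intersection other than \<open>P\<close> have the same value of \<open>kap\<close>, which it
     takes over; \<open>P\<close> itself is put on the far side.\<close>
   define f where "f = case_sum kap (%Q. Q ~= P & (\<forall>q\<in>Q. kap (fst q)))"
   have edge: "kap j = (Q ~= P & (\<forall>q\<in>Q. kap (fst q)))"
    if jQ: "j \<in> fst ` Q" "Q \<in> intersections c" "j ~= i | Q ~= P" for j Q
   proof (cases "Q = P")
    case True
    obtain q where q: "q \<in> P" "j = fst q" using jQ(1) True by blast
    have "q ~= p" using q p jQ(3) True by metis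
    then have "~ kap (fst q)" using bridge_orbit[OF pre pp(2) kap] q(1) pp(1) by simp
    then show ?thesis using True q by simp
   next
    case False
    obtain q where q: "q \<in> Q" "j = fst q" using jQ(1) by blast
    note qq = intersectionsE[OF pre that(2) q(1)]
    have "p \<notin> Q" using intersectionsE(1)[OF pre that(2), of p] pp(1) False by auto
    have "kap (fst y) = kap (fst q)" if "y \<in> Orbits.orbit (turn c) q" for y
     using that
    proof induction
     case base
     have "turn c q \<in> Q" using orbit.base[of "turn c" q] qq(1) by simp
     then have "q ~= p" "turn c q ~= p" using \<open>p \<notin> Q\<close> q(1) by metis+
     then show ?case using kap qq(2) unfolding bridge_def by blast
    next
     case (step y)
     have yQ: "y \<in> Q" "turn c y \<in> Q" using step(1) orbit.step[OF step(1)] qq(1) by simp_all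
     then have "y ~= p" "turn c y ~= p" using \<open>p \<notin> Q\<close> by metis+
     moreover have "y \<in> points c" by (rule orbit_points[OF pre qq(2) step(1)])
     ultimately have "kap (fst (turn c y)) = kap (fst y)" using kap unfolding bridge_def by blast
     then show ?case using step(2) by simp
    qed
    then have "kap (fst y) = kap j" if "y \<in> Q" for y using that qq(1) q(2) by simp
    then have "(\<forall>y\<in>Q. kap (fst y)) = kap j" using q(1) by blast
    then show ?thesis using False by simp
   qed
   have f1: "f (Inl i) ~= f (Inr P)" using kap p by (simp add: f_def bridge_def)
   have f2: "f x = f y"
    if xy: "x \<in> ?V" "y \<in> ?V" "dual_adj x y" "{x, y} ~= {Inl i, Inr P}" for x y
    using xy(3)
   proof (cases rule: dual_adj_cases)
    case (1 j Q)
    have "Q \<in> intersections c" using xy(2) unfolding 1 dual_verts_def by auto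
    moreover have "j ~= i | Q ~= P" using xy(4) unfolding 1 by auto
    ultimately have "kap j = (Q ~= P & (\<forall>q\<in>Q. kap (fst q)))" by (rule edge[OF 1(3)])
    then show ?thesis unfolding 1 f_def sum.case .
   next
    case (2 j Q)
    have "Q \<in> intersections c" using xy(1) unfolding 2 dual_verts_def by auto
    moreover have "j ~= i | Q ~= P" using xy(4) unfolding 2 by auto
    ultimately have "kap j = (Q ~= P & (\<forall>q\<in>Q. kap (fst q)))" by (rule edge[OF 2(3)])
    then show ?thesis unfolding 2 f_def sum.case by (rule sym)
   qed
   show ?thesis by (intro exI[of _ f] conjI ballI impI, rule f1, rule f2) (elim conjE, assumption)+
  qed
  fix u b assume ub: "u \<in> ?V" "b \<in> ?V" "dual_adj u b"
  show "\<exists>f :: nat + point set => bool. f u ~= f b &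
    (\<forall>x\<in>?V. \<forall>y\<in>?V. dual_adj x y & {x, y} ~= {u, b} --> f x = f y)"
   using ub(3)
  proof (cases rule: dual_adj_cases)
   case (1 i P)
   have "P \<in> intersections c" using ub(2) unfolding 1 dual_verts_def by auto
   from main[OF this 1(3)] show ?thesis unfolding 1 .
  next
   case (2 i P)
   have "P \<in> intersections c" using ub(1) unfolding 2 dual_verts_def by auto
   from main[OF this 2(3)] obtain f :: "nat + point set => bool"
    where f: "f (Inl i) ~= f (Inr P) &
     (\<forall>x\<in>?V. \<forall>y\<in>?V. dual_adj x y & {x, y} ~= {Inl i, Inr P} --> f x = f y)"
    by (rule exE)
   show ?thesis unfolding 2 insert_commute[of "Inr P"]
    by (rule exI[of _ f], rule conjI[OF not_sym[OF conjunct1[OF f]] conjunct2[OF f]])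
  qed
 qed
 then show ?thesis using pre inj by (simp add: is_cactus_def precactus_def)
qed

section \<open>Circuits\<close>

lemma locally_constant_on_connected:
 fixes F :: "real => bool"
 assumes "connected S" "!!u. u \<in> S ==> \<exists>\<epsilon>>0. \<forall>v\<in>S. \<bar>v - u\<bar> < \<epsilon> --> F v = F u"
  and "u \<in> S" "v \<in> S"
 shows "F u = F v"
proof -
 have "F constant_on S"
 proof (rule locally_constant_imp_constant[OF assms(1)])
  fix a assume a: "a \<in> S"
  obtain e where e: "e > 0" "\<forall>v\<in>S. \<bar>v - a\<bar> < e --> F v = F a" using assms(2)[OF a] by blast
  show "\<exists>T. openin (top_of_set S) T & a \<in> T & (\<forall>x\<in>T. F x = F a)"
  proof (intro exI[of _ "S \<inter> ball a e"] conjI ballI)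
   show "openin (top_of_set S) (S \<inter> ball a e)" by (rule openin_open_Int[OF open_ball])
   show "a \<in> S \<inter> ball a e" using a e(1) by simp
   fix x assume "x \<in> S \<inter> ball a e"
   then have "x \<in> S" "\<bar>x - a\<bar> < e" by (simp_all add: dist_real_def abs_minus_commute)
   then show "F x = F a" using e(2) by simp
  qed
 qed
 then show ?thesis using assms(3,4) unfolding constant_on_def by metis
qed

lemma frac_eq_frac_iff:
 fixes x y :: real
 shows "frac x = frac y \<longleftrightarrow> x - y \<in> \<int>"
proof
 assume "frac x = frac y"
 then have "x - y = of_int (\<lfloor>x\<rfloor> - \<lfloor>y\<rfloor>)" by (simp add: frac_def)
 then show "x - y \<in> \<int>" by (metis Ints_of_int)
next
 assume "x - y \<in> \<int>"
 then obtain n where "x = y + of_int n" by (metis Ints_cases add.commute diff_add_cancel)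
 then show "frac x = frac y" by (simp add: frac_def)
qed

lemma frac_add_frac: "frac (frac x + y) = frac (x + y :: real)"
proof -
 have "frac x + y - (x + y) = of_int (- \<lfloor>x\<rfloor>)" by (simp add: frac_def)
 then show ?thesis unfolding frac_eq_frac_iff by (metis Ints_of_int)
qed

lemma frac_range: "frac (x :: real) \<in> {0..<1}"
 by (simp add: frac_lt_1)

lemma frac_id: "0 <= x ==> x < 1 ==> frac x = (x :: real)"
 by (simp add: frac_eq)

lemma advance_pair: "advance c (i, t) h = (i, frac (t + h / radius c i))"
 by (simp add: advance_def)

lemma fst_advance [simp]: "fst (advance c p h) = fst p"
 by (simp add: advance_def split: prod.split)

lemma advance_points: "p \<in> points c ==> advance c p h \<in> points c"
 using frac_range by (cases p) (auto simp: advance_pair points_def)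

lemma advance_add: "advance c (advance c p h) k = advance c p (h + k)"
 by (cases p) (simp add: advance_pair frac_add_frac add_divide_distrib add.assoc)

lemma advance_0: "p \<in> points c ==> advance c p 0 = p"
 by (cases p) (simp add: advance_pair points_def frac_id)

lemma advance_inj:
 assumes "p \<in> points c" "q \<in> points c" "advance c p h = advance c q h"
 shows "p = q"
 using arg_cong[OF assms(3), of "%x. advance c x (- h)"] assms(1,2)
 by (simp add: advance_add advance_0)

lemma advance_eq_iff:
 "p \<in> points c ==> q \<in> points c ==> advance c p h = advance c q h \<longleftrightarrow> p = q"
 using advance_inj by blast

text \<open>For a configuration that is not connected, a solution of \<open>is_circuit\<close> may
  close up early and miss some circles; bijectivity excludes this.\<close>

definition good_circuit :: "cactus => (real => point) => bool" where
 "good_circuit c f \<longleftrightarrow> is_circuit c f & (\<forall>s. f (s + 1) = f s) & bij_betw f {0..<1} (points c)"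

lemma circuit_points: "is_circuit c f ==> f s \<in> points c"
 by (auto simp: is_circuit_def)

lemma circuit_right:
 assumes "is_circuit c f"
 obtains \<epsilon> where "\<epsilon> > 0" "!!h. 0 <= h ==> h < \<epsilon> ==> f (s + h) = advance c (f s) h"
proof -
 have "\<exists>\<epsilon>>0. \<forall>h\<in>{0..<\<epsilon>}. f (s + h) = advance c (f s) h" using assms by (simp add: is_circuit_def)
 then show thesis using that by auto
qed

lemma circuit_left:
 assumes "is_circuit c f"
 obtains \<epsilon> p where "\<epsilon> > 0" "p \<in> points c" "f s = turn c p"
  "!!h. 0 < h ==> h < \<epsilon> ==> f (s - h) = advance c p (- h)"
proof -
 have "\<exists>\<epsilon>>0. \<exists>p\<in>points c. f s = turn c p & (\<forall>h\<in>{0<..<\<epsilon>}. f (s - h) = advance c p (- h))"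
  using assms by (simp add: is_circuit_def)
 then show thesis using that by auto
qed

lemma circuit_arrival:
 assumes "precactus c" "is_circuit c f" "f s = turn c p"
 obtains \<epsilon> where "\<epsilon> > 0" "!!h. 0 < h ==> h < \<epsilon> ==> f (s - h) = advance c p (- h)"
proof -
 obtain e q where q: "e > 0" "q \<in> points c" "f s = turn c q"
  "!!h. 0 < h ==> h < e ==> f (s - h) = advance c q (- h)"
  using circuit_left[OF assms(2), of s] by blast
 have "q = p" using q(3) assms(3) turn_inj[OF assms(1)] by simp
 then show thesis using that q by blast
qed

text \<open>The value at a time determines the path shortly after it and, \<open>turn\<close> being
  injective, also shortly before it. So the set of times at which two paths agree is open and
  closed.\<close>

lemma circuit_unique:
 assumes pre: "precactus c" and f: "is_circuit c f" and g: "is_circuit c g"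
 shows "f = g"
proof
 fix s
 have "(f s = g s) = (f 0 = g 0)"
 proof (rule locally_constant_on_connected[where F = "%s. f s = g s" and S = UNIV])
  fix u :: real
  obtain e1 where e1: "e1 > 0" "!!h. 0 <= h ==> h < e1 ==> f (u + h) = advance c (f u) h"
   using circuit_right[OF f, of u] by blast
  obtain e2 where e2: "e2 > 0" "!!h. 0 <= h ==> h < e2 ==> g (u + h) = advance c (g u) h"
   using circuit_right[OF g, of u] by blast
  obtain e3 p where p: "e3 > 0" "p \<in> points c" "f u = turn c p"
   "!!h. 0 < h ==> h < e3 ==> f (u - h) = advance c p (- h)"
   using circuit_left[OF f, of u] by blast
  obtain e4 q where q: "e4 > 0" "q \<in> points c" "g u = turn c q"
   "!!h. 0 < h ==> h < e4 ==> g (u - h) = advance c q (- h)"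
   using circuit_left[OF g, of u] by blast
  let ?e = "min (min e1 e2) (min e3 e4)"
  have near: "(f v = g v) = (f u = g u)" if "\<bar>v - u\<bar> < ?e" for v
  proof (cases "u <= v")
   case True
   have fv: "f v = advance c (f u) (v - u)" and gv: "g v = advance c (g u) (v - u)"
    using e1(2)[of "v - u"] e2(2)[of "v - u"] that True by auto
   show ?thesis unfolding fv gv by (rule advance_eq_iff[OF circuit_points[OF f] circuit_points[OF g]])
  next
   case False
   have fv: "f v = advance c p (- (u - v))" and gv: "g v = advance c q (- (u - v))"
    using p(4)[of "u - v"] q(4)[of "u - v"] that False by auto
   show ?thesis unfolding fv gv p(3) q(3) advance_eq_iff[OF p(2) q(2)] turn_inj[OF pre] ..
  qed
  have "0 < ?e" using e1(1) e2(1) p(1) q(1) by simp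
  then show "\<exists>\<epsilon>>0. \<forall>v\<in>UNIV. \<bar>v - u\<bar> < \<epsilon> --> (f v = g v) = (f u = g u)"
   by (intro exI[of _ ?e] conjI ballI impI, assumption) (rule near)
 qed auto
 then show "f s = g s" using f g by (simp add: is_circuit_def)
qed

lemma circuit_eqI:
 assumes "precactus c" "is_circuit c f"
 shows "circuit c = f"
 unfolding circuit_def using assms circuit_unique by (intro the_equality) auto

text \<open>Between moved points the path runs along a lobe.\<close>

lemma circuit_travel:
 assumes pre: "precactus c" and f: "is_circuit c f"
  and s: "f s = (k, a)" and ab: "0 <= a" "a < b" "b <= 1"
  and fixed: "!!t. a < t ==> t < b ==> turn c (k, t) = (k, t)"
 shows "!!h. 0 <= h ==> h < radius c k * (b - a) ==> f (s + h) = (k, a + h / radius c k)"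
  "f (s + radius c k * (b - a)) = turn c (k, frac b)"
proof -
 define r where "r = radius c k"
 have k: "k < lobes c" using circuit_points[OF f, of s] s by (simp add: points_iff)
 then have r: "r > 0" using pre by (simp add: precactus_def r_def)
 define L where "L = r * (b - a)"
 have L: "L > 0" using r ab by (simp add: L_def)
 have bound: "a + u / r < b" if "u < L" for u
 proof -
  have "u / r < b - a" using that r by (simp add: L_def pos_divide_less_eq mult.commute)
  then show ?thesis by simp
 qed
 have adv: "advance c (k, a + u / r) h = (k, a + (u + h) / r)"
  if "0 <= u + h" "u + h < L" for u h
 proof -
  have "0 <= (u + h) / r" using that(1) r by simp
  then have "frac (a + (u + h) / r) = a + (u + h) / r"
   using bound[OF that(2)] ab by (intro frac_id) auto
  then show ?thesis
   by (simp add: advance_pair r_def[symmetric] add_divide_distrib add.assoc)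
 qed
 have pt: "(k, a + u / r) \<in> points c" if "0 <= u" "u < L" for u
  using bound[OF that(2)] that(1) r ab k by (simp add: points_iff)
 have main: "f (s + h) = (k, a + h / r)" if h: "0 <= h" "h < L" for h
 proof -
  have "(f (s + h) = (k, a + h / r)) = (f (s + 0) = (k, a + 0 / r))"
  proof (rule locally_constant_on_connected[where F = "%h. f (s + h) = (k, a + h / r)" and S = "{0..<L}"])
   fix u assume u: "u \<in> {0..<L}"
   obtain e1 where e1: "e1 > 0" "!!h. 0 <= h ==> h < e1 ==> f (s + u + h) = advance c (f (s + u)) h"
    using circuit_right[OF f, of "s + u"] by blast
   obtain e2 p where p: "e2 > 0" "p \<in> points c" "f (s + u) = turn c p"
    "!!h. 0 < h ==> h < e2 ==> f (s + u - h) = advance c p (- h)"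
    using circuit_left[OF f, of "s + u"] by blast
   have near: "(f (s + v) = (k, a + v / r)) = (f (s + u) = (k, a + u / r))"
    if v: "v \<in> {0..<L}" "\<bar>v - u\<bar> < min e1 e2" for v
   proof (cases "u <= v")
    case True
    have fv: "f (s + v) = advance c (f (s + u)) (v - u)" using e1(2)[of "v - u"] v True by auto
    have gv: "(k, a + v / r) = advance c (k, a + u / r) (v - u)" using adv[of u "v - u"] v u by simp
    have pu: "(k, a + u / r) \<in> points c" using pt[of u] u by simp
    show ?thesis unfolding fv gv by (rule advance_eq_iff[OF circuit_points[OF f] pu])
   next
    case False
    have fv: "f (s + v) = advance c p (- (u - v))" using p(4)[of "u - v"] v False by auto
    have gv: "(k, a + v / r) = advance c (k, a + u / r) (- (u - v))"
     using adv[of u "- (u - v)"] v u by simp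
    have pu: "(k, a + u / r) \<in> points c" using pt[of u] u by simp
    have e: "(f (s + v) = (k, a + v / r)) = (p = (k, a + u / r))"
     unfolding fv gv by (rule advance_eq_iff[OF p(2) pu])
    have "0 < u" using False v by simp
    then have "turn c (k, a + u / r) = (k, a + u / r)" using bound[of u] u r by (intro fixed) auto
    then have "(turn c p = (k, a + u / r)) = (turn c p = turn c (k, a + u / r))" by simp
    then show ?thesis unfolding e p(3) turn_inj[OF pre] by simp
   qed
   have "0 < min e1 e2" using e1(1) p(1) by simp
   then show "\<exists>\<epsilon>>0. \<forall>v\<in>{0..<L}. \<bar>v - u\<bar> < \<epsilon> -->
     (f (s + v) = (k, a + v / r)) = (f (s + u) = (k, a + u / r))"
    by (intro exI[of _ "min e1 e2"] conjI ballI impI, assumption) (rule near)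
  qed (use h L in auto)
  then show ?thesis using s by simp
 qed
 then show "!!h. 0 <= h ==> h < radius c k * (b - a) ==> f (s + h) = (k, a + h / radius c k)"
  by (simp add: L_def r_def)
 obtain e p where p: "e > 0" "p \<in> points c" "f (s + L) = turn c p"
  "!!h. 0 < h ==> h < e ==> f (s + L - h) = advance c p (- h)"
  using circuit_left[OF f, of "s + L"] by blast
 \<comment> \<open>The point of arrival at the end of the arc is identified from the germ of the
   path just before, where both descriptions of the path are available.\<close>
 define h where "h = min (e / 2) (L / 2)"
 have h: "0 < h" "h < e" "h < L" using p(1) L by (auto simp: h_def)
 have "advance c p (- h) = (k, a + (L - h) / r)" using p(4)[OF h(1,2)] main[of "L - h"] h
  by (simp add: add_diff_eq)
 also have "... = advance c (k, frac b) (- h)"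
 proof -
  have "a + (L - h) / r = b - h / r" using r by (simp add: L_def field_simps)
  moreover have "frac (b - h / r) = b - h / r"
   using \<open>a + (L - h) / r = b - h / r\<close> bound[of "L - h"] h r ab
   by (intro frac_id) (auto intro: add_nonneg_nonneg simp flip: \<open>a + (L - h) / r = b - h / r\<close>)
  moreover have "frac (frac b + - h / r) = frac (b + - h / r)" by (rule frac_add_frac)
  ultimately show ?thesis by (simp add: advance_pair r_def)
 qed
 finally have "p = (k, frac b)"
  using p(2) frac_range[of b] k by (intro advance_inj[of p c "(k, frac b)"]) (auto simp: points_iff)
 then show "f (s + radius c k * (b - a)) = turn c (k, frac b)" using p(3) by (simp add: L_def r_def)
qed

lemma good_circuit_int:
 assumes "good_circuit c f"
 shows "f (s + of_int n) = f s"
proof -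
 have p: "f (s + 1) = f s" for s using assms by (simp add: good_circuit_def)
 have nat: "f (s + of_nat m) = f s" for m s
  by (induction m) (use p[of "s + of_nat _"] in \<open>auto simp: add.assoc[symmetric] add.commute[of 1]\<close>)
 show ?thesis
 proof (cases "0 <= n")
  case True
  then show ?thesis using nat[of s "nat n"] by simp
 next
  case False
  then show ?thesis using nat[of "s + of_int n" "nat (- n)"] by simp
 qed
qed

lemma good_circuit_frac: "good_circuit c f ==> f (frac s) = f s"
 using good_circuit_int[of c f s "- \<lfloor>s\<rfloor>"] by (simp add: frac_def)

lemma good_circuit_eq_iff:
 assumes "good_circuit c f"
 shows "f s = f u \<longleftrightarrow> s - u \<in> \<int>"
proof -
 have "inj_on f {0..<1}" using assms by (simp add: good_circuit_def bij_betw_def)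
 then have "f (frac s) = f (frac u) \<longleftrightarrow> frac s = frac u"
  using frac_range by (auto dest: inj_onD)
 then show ?thesis using good_circuit_frac[OF assms] frac_eq_frac_iff by metis
qed

lemma good_circuit_inj:
 assumes "good_circuit c f" "f s = f u" "\<bar>s - u\<bar> < 1"
 shows "s = u"
proof -
 obtain n where n: "s - u = of_int n" using assms(1,2) good_circuit_eq_iff Ints_cases by metis
 then have "n = 0" using assms(3) by linarith
 then show ?thesis using n by simp
qed

lemma good_circuit_surj:
 assumes "good_circuit c f" "p \<in> points c"
 obtains s where "x <= s" "s < x + 1" "f s = p"
proof -
 have "p \<in> f ` {0..<1}" using assms by (simp add: good_circuit_def bij_betw_def)
 then obtain u where u: "u \<in> {0..<1}" "p = f u" by (rule imageE)
 let ?s = "x + frac (u - x)"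
 have "?s = u + of_int (- \<lfloor>u - x\<rfloor>)" by (simp add: frac_def)
 then have "f ?s = p" using good_circuit_int[OF assms(1)] u(2) by metis
 then show thesis using that[of ?s] frac_range[of "u - x"] by auto
qed

lemma precactus_radius: "precactus c ==> k < lobes c ==> 0 < radius c k"
 by (simp add: precactus_def)

section \<open>Planarity of the path\<close>

definition cyc :: "real => real => real => bool" where
 "cyc a b c \<longleftrightarrow> a < b & b < c | b < c & c < a | c < a & a < b"

text \<open>
 A tree of circles is recognized from its path: along the path every lobe is run through
 monotonically, and no two lobes are visited alternately.
\<close>

definition planar :: "(real => point) => bool" where
 "planar f \<longleftrightarrow>
   (\<forall>s1 s2 s3. s1 < s2 & s2 < s3 & s3 < s1 + 1 & fst (f s1) = fst (f s2) & fst (f s2) = fst (f s3) -->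
    cyc (snd (f s1)) (snd (f s2)) (snd (f s3))) &
   (\<forall>s1 s2 s3 s4. s1 < s2 & s2 < s3 & s3 < s4 & s4 < s1 + 1 & fst (f s1) = fst (f s3) &
    fst (f s2) = fst (f s4) --> fst (f s1) = fst (f s2))"

lemma planarD:
 assumes "planar f"
 shows "s1 < s2 ==> s2 < s3 ==> s3 < s1 + 1 ==> fst (f s1) = fst (f s2) ==> fst (f s2) = fst (f s3) ==>
    cyc (snd (f s1)) (snd (f s2)) (snd (f s3))"
  "s1 < s2 ==> s2 < s3 ==> s3 < s4 ==> s4 < s1 + 1 ==> fst (f s1) = fst (f s3) ==>
    fst (f s2) = fst (f s4) ==> fst (f s1) = fst (f s2)"
 using assms unfolding planar_def by blast+

lemma cyc_before:
 assumes r: "r > 0" and t: "0 <= t" "t < 1" "0 <= t'" "t' < 1" "t' ~= t"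
 obtains dl where "dl > 0" "!!h. 0 < h ==> h < dl ==> ~ cyc (frac (t - h / r)) t' t"
proof (cases "0 < t")
 case True
 show thesis
 proof (rule that[of "r * min t (if t' < t then t - t' else 1)"])
  show "0 < r * min t (if t' < t then t - t' else 1)" using r True by auto
  fix h assume h: "0 < h" "h < r * min t (if t' < t then t - t' else 1)"
  then have lt: "h / r < min t (if t' < t then t - t' else 1)"
   unfolding pos_divide_less_eq[OF r] by (simp only: mult.commute)
  moreover have "0 < h / r" using h r by simp
  ultimately have "frac (t - h / r) = t - h / r" using t by (intro frac_id) auto
  then show "~ cyc (frac (t - h / r)) t' t"
   using lt \<open>0 < h / r\<close> t by (auto simp: cyc_def split: if_splits)
 qed
next
 case False
 then have t0: "t = 0" "t' > 0" using t by auto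
 show thesis
 proof (rule that[of "r * (1 - t')"])
  show "0 < r * (1 - t')" using r t by simp
  fix h assume h: "0 < h" "h < r * (1 - t')"
  then have lt: "h / r < 1 - t'" "0 < h / r" using r by (auto simp: pos_divide_less_eq mult.commute)
  have "frac (t - h / r) = frac (1 - h / r)" by (simp add: frac_eq_frac_iff t0)
  also have "... = 1 - h / r" using lt t t0 by (intro frac_id) auto
  finally show "~ cyc (frac (t - h / r)) t' t" using lt t0 by (auto simp: cyc_def)
 qed
qed

text \<open>The path arrives at \<open>p\<close> and turns off at time \<open>a\<close>, and comes
  back to leave along \<open>p\<close> at time \<open>d\<close>. During this excursion it stays off
  the lobe of \<open>p\<close> by monotonicity along that lobe, and no lobe seen during the
  excursion is seen in the rest of the period, since visits do not alternate. So the lobes not seen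
  during the excursion form a bridge.\<close>

lemma bridged_if_planar:
 assumes pre: "precactus c" and f: "good_circuit c f" and pl: "planar f"
 shows "bridged c"
 unfolding bridged_def
proof (intro ballI impI)
 fix p assume p: "p \<in> points c" "turn c p ~= p"
 note circ = f[unfolded good_circuit_def, THEN conjunct1]
 obtain a where a: "f a = turn c p"
  using good_circuit_surj[OF f, of "turn c p" 0] p turn_points[OF pre] by blast
 obtain d where d0: "a <= d" "d < a + 1" "f d = p" using good_circuit_surj[OF f p(1), of a] by blast
 have "a ~= d" using a d0(3) p(2) by auto
 then have d: "a < d" "d < a + 1" using d0 by auto
 obtain i t where it: "p = (i, t)" by (cases p)
 then have t: "i < lobes c" "0 <= t" "t < 1" using p(1) by (auto simp: points_iff)
 note r = precactus_radius[OF pre t(1)]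
 obtain e where e: "e > 0" "!!h. 0 < h ==> h < e ==> f (a - h) = advance c p (- h)"
  using circuit_arrival[OF pre circ a] by blast
 have free: "fst (f s) ~= i" if s: "a <= s" "s < d" for s
 proof
  assume i: "fst (f s) = i"
  define t' where "t' = snd (f s)"
  have fs: "f s = (i, t')" using i by (simp add: t'_def prod_eq_iff)
  have "t' ~= t"
  proof
   assume "t' = t"
   then have "f s = f d" using fs d0 it by simp
   then show False using good_circuit_inj[OF f, of s d] s d by auto
  qed
  moreover have "0 <= t'" "t' < 1" using circuit_points[OF circ, of s] fs by (auto simp: points_iff)
  ultimately obtain dl where dl: "dl > 0" "!!h. 0 < h ==> h < dl ==> ~ cyc (frac (t - h / radius c i)) t' t"
   using cyc_before[OF r t(2,3)] by blast
  \<comment> \<open>Shortly before \<open>a\<close> the path is on the lobe of \<open>p\<close> at a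
    coordinate just below \<open>t\<close>; together with \<open>s\<close> and \<open>d\<close> this
    gives three visits in the wrong cyclic order. The last bound keeps them within one
    period.\<close>
  define h where "h = min (min (e/2) (dl/2)) ((a + 1 - d)/2)"
  have h: "0 < h" "h < e" "h < dl" "h < a + 1 - d" using e(1) dl(1) d by (auto simp: h_def min_less_iff_disj)
  have "f (a - h) = (i, frac (t - h / radius c i))" using e(2)[OF h(1,2)] by (simp add: it advance_pair)
  then have "cyc (frac (t - h / radius c i)) t' t"
   using planarD(1)[OF pl, of "a - h" s d] h s fs d0 it by simp
  then show False using dl(2) h by simp
 qed
 define kap where "kap = (%j. ~ (\<exists>s. a <= s & s < d & fst (f s) = j))"
 have outside: "kap (fst (f s'))" if s': "d < s'" "s' < a + 1" for s'
 proof (rule ccontr)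
  assume "~ kap (fst (f s'))"
  then obtain s where s: "a <= s" "s < d" "fst (f s) = fst (f s')" by (auto simp: kap_def)
  \<comment> \<open>Visits to the common lobe at \<open>s\<close> and \<open>s'\<close> would
    alternate with those to the lobe of \<open>p\<close> at \<open>d\<close> and shortly before
    \<open>a + 1\<close>.\<close>
  define h where "h = min (e/2) ((a + 1 - s')/2)"
  have h: "0 < h" "h < e" "h < a + 1 - s'" using e(1) s' by (auto simp: h_def min_less_iff_disj)
  have "f (a + 1 - h) = f (a - h)"
   using good_circuit_int[OF f, of "a - h" 1] by (simp add: algebra_simps)
  then have "fst (f (a + 1 - h)) = i" using e(2)[OF h(1,2)] it by simp
  then have "fst (f s) = i"
   using planarD(2)[OF pl, of s d s' "a + 1 - h"] h s s' d d0 it by simp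
  then show False using free s by blast
 qed
 have "bridge c p kap"
  unfolding bridge_def
 proof (intro conjI ballI impI)
  show "kap (fst p)" using free it by (auto simp: kap_def)
  show "~ kap (fst (turn c p))" using a d by (auto simp: kap_def intro!: exI[of _ a])
 next
  fix q assume q: "q \<in> points c" "turn c q = p"
  obtain e' where e': "e' > 0" "!!h. 0 < h ==> h < e' ==> f (d - h) = advance c q (- h)"
   using circuit_arrival[OF pre circ, of d q] d0 q by metis
  define h where "h = min (e'/2) ((d - a)/2)"
  have h: "0 < h" "h < e'" "h < d - a" using e'(1) d by (auto simp: h_def min_less_iff_disj)
  then show "~ kap (fst q)" using e'(2)[OF h(1,2)] unfolding kap_def
   by (auto intro!: exI[of _ "d - h"])
 next
  fix q assume q: "q \<in> points c" "q ~= p & turn c q ~= p"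
  obtain s where s: "a <= s" "s < a + 1" "f s = turn c q"
   using good_circuit_surj[OF f, of "turn c q" a] q turn_points[OF pre] by blast
  have "s ~= a" using s a q turn_inj[OF pre] by metis
  moreover have "s ~= d" using s d0 q by auto
  ultimately consider "a < s" "s < d" | "d < s" using s by linarith
  then show "kap (fst (turn c q)) = kap (fst q)"
  proof cases
   case 1
   obtain e' where e': "e' > 0" "!!h. 0 < h ==> h < e' ==> f (s - h) = advance c q (- h)"
    using circuit_arrival[OF pre circ s(3)] by blast
   define h where "h = min (e'/2) ((s - a)/2)"
   have h: "0 < h" "h < e'" "h < s - a" using e'(1) 1 by (auto simp: h_def min_less_iff_disj)
   then have "~ kap (fst q)" using e'(2)[OF h(1,2)] 1 unfolding kap_def
    by (auto intro!: exI[of _ "s - h"])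
   moreover have "~ kap (fst (turn c q))" using 1 s unfolding kap_def by (auto intro!: exI[of _ s])
   ultimately show ?thesis by simp
  next
   case 2
   obtain e' where e': "e' > 0" "!!h. 0 < h ==> h < e' ==> f (s - h) = advance c q (- h)"
    using circuit_arrival[OF pre circ s(3)] by blast
   define h where "h = min (e'/2) ((s - d)/2)"
   have h: "0 < h" "h < e'" "h < s - d" using e'(1) 2 by (auto simp: h_def min_less_iff_disj)
   then have "kap (fst q)" using e'(2)[OF h(1,2)] outside[of "s - h"] s by simp
   moreover have "kap (fst (turn c q))" using outside[of s] 2 s by simp
   ultimately show ?thesis by simp
  qed
 qed
 then show "\<exists>kap. bridge c p kap" by blast
qed

text \<open>The path visits every lobe, and it cannot enter or leave \<open>L\<close>: along a lobe
  trivially, and at turns because the orbits of \<open>turn\<close> are finite, so that a set of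
  lobes closed under \<open>turn\<close> is also closed under its inverse.\<close>

lemma joined_if_circuit:
 assumes pre: "precactus c" and f: "good_circuit c f"
 shows "joined c"
 unfolding joined_def
proof (intro allI impI)
 fix L assume L: "L <= {..<lobes c} & L ~= {} & (\<forall>p\<in>points c. fst p \<in> L --> fst (turn c p) \<in> L)"
 note circ = f[unfolded good_circuit_def, THEN conjunct1]
 have orbit: "fst q \<in> L" if "q \<in> Orbits.orbit (turn c) p" "p \<in> points c" "fst p \<in> L" for p q
  using that
 proof induction
  case (step y)
  then show ?case using L orbit_points[OF pre] by blast
 qed (use L in blast)
 have lobe_turn: "fst (turn c q) \<in> L \<longleftrightarrow> fst q \<in> L" if "q \<in> points c" for q
  using orbit[of q "turn c q"] L that turn_points[OF pre, of q] orbit_self[OF pre, of q]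
   permutation_orbit_step[OF turn_permutation[OF pre], of q] by auto
 have const: "(fst (f s) \<in> L) = (fst (f u) \<in> L)" for s u
 proof (rule locally_constant_on_connected[where F = "%s. fst (f s) \<in> L" and S = UNIV])
  fix u :: real
  obtain e1 where e1: "e1 > 0" "!!h. 0 <= h ==> h < e1 ==> f (u + h) = advance c (f u) h"
   using circuit_right[OF circ, of u] by blast
  obtain e2 p where p: "e2 > 0" "p \<in> points c" "f u = turn c p"
   "!!h. 0 < h ==> h < e2 ==> f (u - h) = advance c p (- h)"
   using circuit_left[OF circ, of u] by blast
  have near: "(fst (f v) \<in> L) = (fst (f u) \<in> L)" if "\<bar>v - u\<bar> < min e1 e2" for v
  proof (cases "u <= v")
   case True
   then show ?thesis using e1(2)[of "v - u"] that by simp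
  next
   case False
   then show ?thesis using p(4)[of "u - v"] that lobe_turn[OF p(2)] p(3) by simp
  qed
  have "0 < min e1 e2" using e1(1) p(1) by simp
  then show "\<exists>\<epsilon>>0. \<forall>v\<in>UNIV. \<bar>v - u\<bar> < \<epsilon> --> (fst (f v) \<in> L) = (fst (f u) \<in> L)"
   by (intro exI[of _ "min e1 e2"] conjI ballI impI, assumption) (rule near)
 qed auto
 have vis: "\<exists>s. fst (f s) = j" if "j < lobes c" for j
 proof -
  have "(j, 0) \<in> points c" using that by (simp add: points_iff)
  then obtain s where "f s = (j, 0)" using good_circuit_surj[OF f, of "(j, 0)" 0] by blast
  then show ?thesis by (metis fst_conv)
 qed
 obtain l where "l \<in> L" using L by auto
 then have "j \<in> L" if "j < lobes c" for j
  using vis[of l] vis[OF that] const L by (metis lessThan_iff subsetD)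
 then show "L = {..<lobes c}" using L by auto
qed

theorem is_cactus_if_planar:
 "precactus c ==> good_circuit c f ==> planar f ==> is_cactus c"
 by (intro is_cactusI bridged_if_planar joined_if_circuit)

section \<open>The circuit of a cactus\<close>

definition mark_rank :: "real set => real => nat" where
 "mark_rank A a = card {t \<in> A. t < a}"

definition next_mark :: "real set => real => real" where
 "next_mark A a = nth_mark A (Suc (mark_rank A a))"

lemma mark_rank_nth:
 assumes A: "mark_set A" and i: "i <= card A"
 shows "mark_rank A (nth_mark A i) = i"
proof -
 have fin: "finite A" using A by (simp add: mark_set_def)
 have "{t \<in> A. t < nth_mark A i} = nth_mark A ` {..<i}"
 proof (intro equalityI subsetI)
  fix t assume t: "t \<in> {t \<in> A. t < nth_mark A i}"
  then obtain j where j: "j < card A" "nth_mark A j = t" using nth_mark_surj[OF fin] by blast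
  then have "j < i" using nth_mark_less_iff[OF A, of j i] i t by simp
  then show "t \<in> nth_mark A ` {..<i}" using j by blast
 next
  fix t assume "t \<in> nth_mark A ` {..<i}"
  then obtain j where "t = nth_mark A j" "j < i" by blast
  then show "t \<in> {t \<in> A. t < nth_mark A i}"
   using nth_mark_in[OF fin, of j] nth_mark_less[OF A, of j i] i by simp
 qed
 moreover have "inj_on (nth_mark A) {..<i}"
  by (rule inj_onI) (use nth_mark_eq_iff[OF A] i in auto)
 ultimately show ?thesis by (simp add: mark_rank_def card_image)
qed

lemma nth_mark_rank:
 assumes A: "mark_set A" and a: "a \<in> A"
 shows "nth_mark A (mark_rank A a) = a" "mark_rank A a < card A"
proof -
 obtain j where j: "j < card A" "nth_mark A j = a"
  using nth_mark_surj[of A a] a A unfolding mark_set_def by blast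
 then have "mark_rank A a = j" using mark_rank_nth[OF A, of j] by simp
 then show "nth_mark A (mark_rank A a) = a" "mark_rank A a < card A" using j by simp_all
qed

lemma next_mark_nth:
 "mark_set A ==> i < card A ==> next_mark A (nth_mark A i) = nth_mark A (Suc i)"
 by (simp add: next_mark_def mark_rank_nth)

lemma next_mark_bounds:
 assumes A: "mark_set A" and a: "a \<in> A"
 shows "a < next_mark A a" "next_mark A a <= 1" "frac (next_mark A a) \<in> A"
  "!!b. b \<in> A ==> a < b ==> next_mark A a <= b"
proof -
 note i = nth_mark_rank[OF A a]
 let ?i = "mark_rank A a"
 show "a < next_mark A a" using nth_mark_less[OF A, of ?i "Suc ?i"] i by (simp add: next_mark_def)
 show "next_mark A a <= 1"
  using nth_mark_le[OF A, of "Suc ?i" "card A"] i nth_mark_card[of A] by (simp add: next_mark_def)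
 show "frac (next_mark A a) \<in> A"
 proof (cases "Suc ?i = card A")
  case True
  then have "next_mark A a = 1" by (simp add: next_mark_def nth_mark_card)
  then show ?thesis using A by (simp add: mark_set_def)
 next
  case False
  then have "Suc ?i < card A" using i by simp
  then have "next_mark A a \<in> A" "0 <= next_mark A a" "next_mark A a < 1"
   using nth_mark_in[of A "Suc ?i"] nth_mark_range[OF A, of "Suc ?i"] A
   by (simp_all add: next_mark_def mark_set_def)
  then show ?thesis by (simp add: frac_id)
 qed
 fix b assume b: "b \<in> A" "a < b"
 note j = nth_mark_rank[OF A b(1)]
 have "?i < mark_rank A b"
  using nth_mark_less_iff[OF A, of ?i "mark_rank A b"] i j b(2) by simp
 then show "next_mark A a <= b"
  using nth_mark_le[OF A, of "Suc ?i" "mark_rank A b"] j by (simp add: next_mark_def)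
qed

lemma next_mark_inj:
 assumes A: "mark_set A" and "a \<in> A" "b \<in> A" "frac (next_mark A a) = frac (next_mark A b)"
 shows "a = b"
proof -
 have next_eq: "next_mark A a = next_mark A b"
 proof -
  have "0 < next_mark A a" "next_mark A a <= 1" "0 < next_mark A b" "next_mark A b <= 1"
   using next_mark_bounds[OF A] assms(2,3) A by (force simp: mark_set_def)+
  moreover obtain n where "next_mark A a - next_mark A b = of_int n"
   using assms(4) unfolding frac_eq_frac_iff by (rule Ints_cases)
  moreover from calculation have "n = 0" by linarith
  ultimately show ?thesis by simp
 qed
 show ?thesis
 proof (rule ccontr)
  assume "a ~= b"
  then consider "a < b" | "b < a" by linarith
  then show False
   using next_mark_bounds(1,4)[OF A assms(2)] next_mark_bounds(1,4)[OF A assms(3)] assms(2,3) next_eq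
   by cases force+
 qed
qed

lemma mark_below:
 assumes A: "mark_set A" and t: "0 <= t" "t < 1"
 obtains a where "a \<in> A" "a <= t" "t < next_mark A a"
proof -
 let ?i = "segment_at (card A - 1) (gaps A) t"
 note b = segment_at_bounds[OF gaps_simplex[OF A] t]
 have i: "?i < card A" using b(1) card_mark_set[OF A] by linarith
 have "nth_mark A ?i <= t" "t < nth_mark A (Suc ?i)"
  using b(2,3) sum_gaps[OF A, of ?i] sum_gaps[OF A, of "Suc ?i"] i by simp_all
 moreover have "nth_mark A ?i \<in> A" using A i by (intro nth_mark_in) (simp_all add: mark_set_def)
 ultimately show thesis using that next_mark_nth[OF A i] by simp
qed

lemma sum_next_mark:
 assumes A: "mark_set A"
 shows "(\<Sum>a\<in>A. next_mark A a - a) = 1"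
proof -
 have fin: "finite A" using A by (simp add: mark_set_def)
 have "bij_betw (nth_mark A) {..<card A} A"
  unfolding bij_betw_def
 proof
  show "inj_on (nth_mark A) {..<card A}"
   by (rule inj_onI) (use nth_mark_eq_iff[OF A] in auto)
  show "nth_mark A ` {..<card A} = A"
  proof (intro equalityI subsetI)
   fix t assume "t \<in> A"
   then obtain i where "i < card A" "nth_mark A i = t" using nth_mark_surj[OF fin] by blast
   then show "t \<in> nth_mark A ` {..<card A}" by blast
  qed (use nth_mark_in[OF fin] in blast)
 qed
 then have "(\<Sum>a\<in>A. next_mark A a - a) = (\<Sum>i<card A. next_mark A (nth_mark A i) - nth_mark A i)"
  by (rule sum.reindex_bij_betw[symmetric])
 also have "... = (\<Sum>i<card A. gaps A i)"
  by (rule sum.cong) (use next_mark_nth[OF A] in \<open>auto simp: gaps_def\<close>)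
 also have "... = 1" using sum_gaps[OF A, of "card A"] nth_mark_card[of A] by simp
 finally show ?thesis .
qed

text \<open>\<open>spiny\<close> without the tree condition, for configurations that are only known
  to satisfy \<open>precactus\<close>.\<close>

definition marked :: "cactus => point set => bool" where
 "marked c X \<longleftrightarrow> finite X & X <= points c & origin c \<in> X &
   (\<forall>i<lobes c. (i, 0) \<in> X) & {p. turn c p ~= p} <= X"

lemma spiny_iff: "spiny c X \<longleftrightarrow> is_cactus c & marked c X"
 by (auto simp: spiny_def marked_def)

lemma lobe_marks:
 assumes "marked c X" "k < lobes c"
 shows "mark_set (on_lobe X k)"
proof -
 have "on_lobe X k <= snd ` X" by (force simp: on_lobe_def)
 then have "finite (on_lobe X k)" using assms by (auto simp: marked_def intro: finite_subset)
 then show ?thesis using assms by (auto simp: marked_def on_lobe_def mark_set_def points_def)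
qed

lemma ex_marked:
 assumes "precactus c" "finite Y" "Y <= points c"
 shows "marked c (Y \<union> insert (origin c) ({p. turn c p ~= p} \<union> (%k. (k, 0)) ` {..<lobes c}))"
proof -
 have "p \<in> points c" if "turn c p ~= p" for p
  using assms(1) that unfolding precactus_def permutes_def by blast
 then show ?thesis using assms by (auto simp: marked_def precactus_def points_def)
qed

text \<open>A segment is represented by its starting point. \<open>lobe_next\<close> is the end of
  the segment, still on the same lobe, and \<open>walk_next\<close> the start of the segment that
  follows it along the path.\<close>

definition lobe_next :: "point set => point => point" where
 "lobe_next X p = (fst p, frac (next_mark (on_lobe X (fst p)) (snd p)))"

definition walk_next :: "cactus => point set => point => point" where
 "walk_next c X p = turn c (lobe_next X p)"

definition seg_length :: "cactus => point set => point => real" where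
 "seg_length c X p = radius c (fst p) * (next_mark (on_lobe X (fst p)) (snd p) - snd p)"

lemma fst_lobe_next [simp]: "fst (lobe_next X p) = fst p"
 by (simp add: lobe_next_def)

lemma on_lobe_iff: "t \<in> on_lobe X k \<longleftrightarrow> (k, t) \<in> X"
 by (simp add: on_lobe_def)

context
 fixes c X
 assumes pre: "precactus c" and X: "marked c X"
begin

lemma marked_lobe: "p \<in> X ==> fst p < lobes c"
 using X fst_points unfolding marked_def by blast

lemma snd_on_lobe: "p \<in> X ==> snd p \<in> on_lobe X (fst p)"
 by (simp add: on_lobe_iff)

lemma lobe_next_in: "p \<in> X ==> lobe_next X p \<in> X"
 using next_mark_bounds(3)[OF lobe_marks[OF X marked_lobe[of p]] snd_on_lobe[of p]]
 by (simp add: lobe_next_def on_lobe_iff)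

lemma lobe_next_inj: "inj_on (lobe_next X) X"
proof (rule inj_onI)
 fix p q assume pq: "p \<in> X" "q \<in> X" "lobe_next X p = lobe_next X q"
 have fst: "fst p = fst q" using arg_cong[OF pq(3), of fst] by simp
 then have "frac (next_mark (on_lobe X (fst p)) (snd p)) = frac (next_mark (on_lobe X (fst p)) (snd q))"
  using pq(3) by (simp add: lobe_next_def)
 then have "snd p = snd q"
  by (rule next_mark_inj[OF lobe_marks[OF X marked_lobe[OF pq(1)]]
     snd_on_lobe[OF pq(1)] snd_on_lobe[OF pq(2), folded fst]])
 then show "p = q" using fst by (simp add: prod_eq_iff)
qed

lemma turn_in_marked: "p \<in> X ==> turn c p \<in> X"
proof (cases "turn c p = p")
 case False
 then have "turn c (turn c p) ~= turn c p" using turn_inj[OF pre] by simp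
 then show ?thesis using X unfolding marked_def by blast
qed simp

lemma walk_next_in: "p \<in> X ==> walk_next c X p \<in> X"
 by (simp add: walk_next_def turn_in_marked lobe_next_in)

lemma walk_next_inj: "inj_on (walk_next c X) X"
 using lobe_next_inj turn_inj[OF pre] by (simp add: walk_next_def inj_on_def)

lemma seg_length_pos: "p \<in> X ==> 0 < seg_length c X p"
 using next_mark_bounds(1)[OF lobe_marks[OF X marked_lobe[of p]] snd_on_lobe[of p]]
  precactus_radius[OF pre marked_lobe[of p]] by (simp add: seg_length_def)

lemma sum_seg_length: "sum (seg_length c X) X = 1"
proof -
 have "X = Sigma {..<lobes c} (on_lobe X)"
  using marked_lobe by (force simp: on_lobe_iff)
 then have "sum (seg_length c X) X = sum (seg_length c X) (Sigma {..<lobes c} (on_lobe X))" by simp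
 also have "... = (\<Sum>k<lobes c. \<Sum>t\<in>on_lobe X k. seg_length c X (k, t))"
  using lobe_marks[OF X] by (subst sum.Sigma) (auto simp: mark_set_def)
 also have "... = (\<Sum>k<lobes c. radius c k * (\<Sum>t\<in>on_lobe X k. next_mark (on_lobe X k) t - t))"
  by (simp add: seg_length_def sum_distrib_left)
 also have "... = (\<Sum>k<lobes c. radius c k)"
  by (rule sum.cong) (simp_all add: sum_next_mark lobe_marks[OF X])
 also have "... = 1" using pre by (simp add: precactus_def)
 finally show ?thesis .
qed

lemma lobe_next_nth:
 assumes "k < lobes c" "i < card (on_lobe X k)"
 shows "lobe_next X (k, nth_mark (on_lobe X k) i) = (k, nth_mark (on_lobe X k) (Suc i mod card (on_lobe X k)))"
proof -
 note A = lobe_marks[OF X assms(1)]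
 show ?thesis
 proof (cases "Suc i = card (on_lobe X k)")
  case True
  then show ?thesis using next_mark_nth[OF A assms(2)] nth_mark_card[of "on_lobe X k"] nth_mark_zero[OF A]
   by (simp add: lobe_next_def)
 next
  case False
  then have "Suc i < card (on_lobe X k)" using assms(2) by simp
  then show ?thesis using next_mark_nth[OF A assms(2)] nth_mark_range[OF A, of "Suc i"]
   by (simp add: lobe_next_def frac_id)
 qed
qed

lemma advance_seg_length: "p \<in> X ==> advance c p (seg_length c X p) = lobe_next X p"
 using precactus_radius[OF pre marked_lobe[of p]]
 by (cases p) (simp add: advance_pair seg_length_def lobe_next_def)

lemma advance_in_segment:
 assumes p: "p \<in> X" and e: "0 <= e" "e < seg_length c X p"
 shows "advance c p e = (fst p, snd p + e / radius c (fst p))"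
  "snd p + e / radius c (fst p) < next_mark (on_lobe X (fst p)) (snd p)"
  "e > 0 ==> advance c p e \<notin> X" "e > 0 ==> turn c (advance c p e) = advance c p e"
proof -
 note A = lobe_marks[OF X marked_lobe[OF p]] and a = snd_on_lobe[OF p]
 note r = precactus_radius[OF pre marked_lobe[OF p]]
 let ?t = "snd p + e / radius c (fst p)"
 have "e / radius c (fst p) < next_mark (on_lobe X (fst p)) (snd p) - snd p"
  using e(2) unfolding seg_length_def pos_divide_less_eq[OF r] by (simp only: mult.commute)
 then show lt: "?t < next_mark (on_lobe X (fst p)) (snd p)" by simp
 moreover have "0 <= e / radius c (fst p)" using e r by simp
 moreover have "0 <= snd p" using A a unfolding mark_set_def by auto
 ultimately show adv: "advance c p e = (fst p, ?t)"
  using next_mark_bounds(2)[OF A a] by (cases p) (simp add: advance_pair frac_id)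
 show notin: "advance c p e \<notin> X" if "e > 0"
 proof
  assume "advance c p e \<in> X"
  then have "?t \<in> on_lobe X (fst p)" by (simp add: adv on_lobe_iff)
  moreover have "snd p < ?t" using that r by simp
  ultimately show False using next_mark_bounds(4)[OF A a, of ?t] lt by simp
 qed
 show "turn c (advance c p e) = advance c p e" if "e > 0"
  using notin[OF that] X unfolding marked_def by blast
qed

text \<open>
 A closed walk crosses every bridge equally often in both directions. Hence an orbit of
 \<open>walk_next\<close> that contains one of the two segments ending or starting at a given point of a lobe
 contains the other one as well.
\<close>

lemma walk_orbit_lobe_next:
 assumes br: "bridged c" and sub: "Y <= X" and Y: "walk_next c X ` Y = Y"
 shows "lobe_next X ` Y = Y"
proof -
 have fin: "finite Y" using X sub by (auto simp: marked_def intro: finite_subset)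
 have inj: "inj_on (walk_next c X) Y" "inj_on (lobe_next X) Y"
  using walk_next_inj lobe_next_inj sub inj_on_subset by blast+
 have mem: "p \<in> Y \<longleftrightarrow> p \<in> lobe_next X ` Y" if p: "p \<in> X" for p
 proof (cases "turn c p = p")
  case True
  have "p \<in> Y \<longleftrightarrow> p \<in> walk_next c X ` Y" using Y by simp
  also have "... \<longleftrightarrow> (\<exists>x\<in>Y. walk_next c X x = p)" by blast
  also have "... \<longleftrightarrow> (\<exists>x\<in>Y. lobe_next X x = p)"
   unfolding walk_next_def using turn_inj[OF pre, of _ p] True by metis
  finally show ?thesis by blast
 next
  case False
  have "p \<in> points c" using p X unfolding marked_def by blast
  then obtain kap where kap: "bridge c p kap" using br False unfolding bridged_def by blast
  let ?b = "%P. of_bool P :: int"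
  \<comment> \<open>The walk changes to the side of \<open>p\<close> exactly when it enters at
    \<open>p\<close>, and to the far side exactly when a segment ends at \<open>p\<close>.\<close>
  have step: "?b (kap (fst (walk_next c X x))) - ?b (kap (fst x)) =
    ?b (walk_next c X x = p) - ?b (lobe_next X x = p)" if x: "x \<in> Y" for x
  proof -
   define y where "y = lobe_next X x"
   have y: "y \<in> points c" "fst y = fst x" "walk_next c X x = turn c y"
    using lobe_next_in[of x] sub x X unfolding marked_def y_def walk_next_def by auto
   consider "y = p" | "turn c y = p" "y ~= p" | "y ~= p" "turn c y ~= p" by blast
   then show ?thesis
   proof cases
    case 1
    then show ?thesis using kap False y(2,3) unfolding bridge_def y_def[symmetric] by simp
   next
    case 2
    then have "~ kap (fst y)" "kap (fst p)" using kap y(1) unfolding bridge_def by blast+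
    then show ?thesis using 2 y(2,3) unfolding y_def[symmetric] by simp
   next
    case 3
    then have "kap (fst (turn c y)) = kap (fst y)" using kap y(1) unfolding bridge_def by blast
    then show ?thesis using 3 y(2,3) unfolding y_def[symmetric] by simp
   qed
  qed
  \<comment> \<open>\<open>walk_next\<close> permutes \<open>Y\<close>, so the changes of side add
    up to 0: as many segments of \<open>Y\<close> are followed by one starting at \<open>p\<close>
    as end at \<open>p\<close>.\<close>
  have "(\<Sum>x\<in>Y. ?b (kap (fst (walk_next c X x)))) = (\<Sum>x\<in>walk_next c X ` Y. ?b (kap (fst x)))"
   using sum.reindex[OF inj(1), of "%x. ?b (kap (fst x))"] by (simp add: comp_def)
  then have "0 = (\<Sum>x\<in>Y. ?b (kap (fst (walk_next c X x))) - ?b (kap (fst x)))"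
   unfolding sum_subtractf Y by simp
  also have "... = (\<Sum>x\<in>Y. ?b (walk_next c X x = p) - ?b (lobe_next X x = p))"
   by (rule sum.cong) (use step in auto)
  finally have eq: "(\<Sum>x\<in>Y. ?b (walk_next c X x = p)) = (\<Sum>x\<in>Y. ?b (lobe_next X x = p))"
   unfolding sum_subtractf by simp
  have pos: "(\<Sum>x\<in>Y. ?b (g x = p)) ~= 0 \<longleftrightarrow> p \<in> g ` Y" for g
  proof -
   have "(\<Sum>x\<in>Y. ?b (g x = p)) = 0 \<longleftrightarrow> (\<forall>x\<in>Y. ?b (g x = p) = 0)"
    by (rule sum_nonneg_eq_0_iff[OF fin]) simp
   then show ?thesis unfolding image_iff of_bool_eq_0_iff by blast
  qed
  have "p \<in> Y \<longleftrightarrow> p \<in> walk_next c X ` Y" unfolding Y ..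
  also have "... \<longleftrightarrow> p \<in> lobe_next X ` Y" unfolding pos[symmetric] eq ..
  finally show ?thesis .
 qed
 have im: "lobe_next X ` Y <= X" using lobe_next_in sub by blast
 show ?thesis
 proof (intro equalityI subsetI)
  fix p assume p: "p \<in> lobe_next X ` Y"
  then show "p \<in> Y" using mem[of p] im by blast
 next
  fix p assume p: "p \<in> Y"
  then show "p \<in> lobe_next X ` Y" using mem[of p] sub by blast
 qed
qed

text \<open>An invariant set of segments is closed under \<open>lobe_next\<close>, hence under
  \<open>turn\<close>. By the former it contains every lobe that it meets, by the latter and
  connectedness it meets every lobe. So the walk is a single cycle.\<close>

lemma walk_transitive:
 assumes br: "bridged c" and jn: "joined c" and sub: "Y <= X" "Y ~= {}" and Y: "walk_next c X ` Y = Y"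
 shows "Y = X"
proof -
 note ln = walk_orbit_lobe_next[OF br sub(1) Y]
 have turn: "turn c y \<in> Y" if y: "y \<in> Y" for y
 proof -
  have "y \<in> lobe_next X ` Y" using y ln by simp
  then obtain x where x: "y = lobe_next X x" "x \<in> Y" by (rule imageE)
  have "walk_next c X x \<in> walk_next c X ` Y" by (rule imageI[OF x(2)])
  then show ?thesis unfolding Y by (simp add: walk_next_def x(1))
 qed
 have lobe: "(k, t) \<in> Y" if "(k, a) \<in> Y" "(k, t) \<in> X" for k a t
 proof -
  let ?A = "on_lobe X k"
  have k: "k < lobes c" using marked_lobe[of "(k, t)"] that by simp
  note A = lobe_marks[OF X k]
  have "(k, a) \<in> X" using that sub by blast
  then have "a \<in> ?A" "t \<in> ?A" using that by (simp_all add: on_lobe_iff)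
  define i j where "i = mark_rank ?A a" and "j = mark_rank ?A t"
  have i: "nth_mark ?A i = a" "i < card ?A" and j: "nth_mark ?A j = t" "j < card ?A"
   using nth_mark_rank[OF A \<open>a \<in> ?A\<close>] nth_mark_rank[OF A \<open>t \<in> ?A\<close>] by (simp_all add: i_def j_def)
  have N: "0 < card ?A" using i by simp
  have "(k, nth_mark ?A ((i + m) mod card ?A)) \<in> Y" for m
  proof (induction m)
   case 0
   then show ?case using that i by simp
  next
   case (Suc m)
   have "lobe_next X (k, nth_mark ?A ((i + m) mod card ?A)) \<in> lobe_next X ` Y"
    using Suc by (rule imageI)
   then have "lobe_next X (k, nth_mark ?A ((i + m) mod card ?A)) \<in> Y" unfolding ln .
   then show ?case using lobe_next_nth[OF k, of "(i + m) mod card ?A"] N by (simp add: mod_Suc_eq)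
  qed
  \<comment> \<open>Rotation from index \<open>i\<close> to index \<open>j\<close>:
    \<open>card ?A - i\<close> steps lead to 0, and \<open>j\<close> more to
    \<open>j\<close>.\<close>
  from this[of "card ?A - i + j"] show ?thesis using i j by simp
 qed
 define L where "L = fst ` Y"
 have L_all: "L = {..<lobes c}"
 proof (rule jn[unfolded joined_def, rule_format], intro conjI ballI impI)
  show "L <= {..<lobes c}" using marked_lobe sub unfolding L_def by auto
  show "L ~= {}" using sub by (simp add: L_def)
  fix p assume p: "p \<in> points c" "fst p \<in> L"
  show "fst (turn c p) \<in> L"
  proof (cases "turn c p = p")
   case False
   then have "p \<in> X" using X unfolding marked_def by blast
   obtain y where y: "y \<in> Y" "fst p = fst y" using p(2) unfolding L_def by blast
   have "(fst p, snd y) \<in> Y" using y by simp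
   then have "(fst p, snd p) \<in> Y" by (rule lobe) (simp add: \<open>p \<in> X\<close>)
   then have "turn c p \<in> Y" using turn by simp
   then show ?thesis by (simp add: L_def)
  qed (use p in simp)
 qed
 have "X <= Y"
 proof
  fix p assume p: "p \<in> X"
  then have "fst p \<in> L" using marked_lobe[OF p] L_all by simp
  then obtain y where "y \<in> Y" "fst p = fst y" unfolding L_def by blast
  then have "(fst p, snd y) \<in> Y" by simp
  then have "(fst p, snd p) \<in> Y" by (rule lobe) (simp add: p)
  then show "p \<in> Y" by simp
 qed
 then show ?thesis using sub by blast
qed

text \<open>The orbit of the origin is invariant, hence everything. Its length is
  \<open>funpow_dist1\<close>, so that the first powers enumerate it without repetition.\<close>

lemma walk_enumeration:
 assumes br: "bridged c" and jn: "joined c"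
 obtains x where "bij_betw x {..<card X} X" "x 0 = origin c" "0 < card X"
  "!!j. Suc j < card X ==> x (Suc j) = walk_next c X (x j)"
  "walk_next c X (x (card X - 1)) = origin c"
proof -
 let ?r = "walk_next c X" and ?o = "origin c"
 let ?O = "{(?r ^^ n) ?o | n. True}"
 have o: "?o \<in> X" using X by (simp add: marked_def)
 have sub: "?O <= X"
 proof -
  have "(?r ^^ n) ?o \<in> X" for n by (induction n) (simp_all add: o walk_next_in)
  then show ?thesis by blast
 qed
 have "?r ` ?O <= ?O"
 proof
  fix y assume "y \<in> ?r ` ?O"
  then obtain n where "y = ?r ((?r ^^ n) ?o)" by blast
  then have "y = (?r ^^ Suc n) ?o" by simp
  then show "y \<in> ?O" by blast
 qed
 moreover have "finite ?O" using sub X by (auto simp: marked_def intro: finite_subset)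
 ultimately have im: "?r ` ?O = ?O"
  using walk_next_inj sub inj_on_subset by (intro endo_inj_surj) auto
 have O: "?O = X" by (rule walk_transitive[OF br jn sub _ im]) blast
 have "?o \<in> ?r ` ?O" unfolding im by (rule CollectI, rule exI[of _ 0]) simp
 then obtain y where y: "?o = ?r y" "y \<in> ?O" by (rule imageE)
 obtain n where n: "y = (?r ^^ n) ?o" using y(2) by blast
 have "?o = (?r ^^ Suc n) ?o" using y(1) unfolding n by simp
 then have self: "?o \<in> Orbits.orbit ?r ?o" unfolding orbit_altdef
  by (intro CollectI exI[of _ "Suc n"] conjI) simp_all
 define N where "N = funpow_dist1 ?r ?o ?o"
 have orb: "Orbits.orbit ?r ?o = X" unfolding orbit_altdef_self_in[OF self] by (rule O)
 have img: "(%n. (?r ^^ n) ?o) ` {..<N} = X"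
  unfolding N_def atLeast0LessThan[symmetric] orbit_conv_funpow_dist1[OF self, symmetric] by (rule orb)
 have inj: "inj_on (%n. (?r ^^ n) ?o) {..<N}"
  unfolding N_def atLeast0LessThan[symmetric] by (rule inj_on_funpow_dist1[OF self])
 have card: "card X = N" using card_image[OF inj] img by simp
 have "(?r ^^ N) ?o = ?o" unfolding N_def by (rule funpow_dist1_prop[OF self])
 moreover have "0 < N" unfolding N_def by (rule zero_less_Suc)
 ultimately have last: "?r ((?r ^^ (N - 1)) ?o) = ?o" by (cases N) simp_all
 show thesis
 proof (rule that[of "%n. (?r ^^ n) ?o"])
  show "bij_betw (%n. (?r ^^ n) ?o) {..<card X} X" unfolding bij_betw_def card using inj img by blast
  show "0 < card X" unfolding card by (rule \<open>0 < N\<close>)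
  show "?r ((?r ^^ (card X - 1)) ?o) = ?o" unfolding card by (rule last)
 qed simp_all
qed

text \<open>The segments are concatenated in the order of the walk. Their lengths add up to 1, and
  the last one leads back to the origin.\<close>

lemma ex_good_circuit:
 assumes br: "bridged c" and jn: "joined c"
 shows "\<exists>f. good_circuit c f"
proof -
 obtain x where bij: "bij_betw x {..<card X} X" and x0: "x 0 = origin c" and N0: "0 < card X"
  and step: "!!j. Suc j < card X ==> x (Suc j) = walk_next c X (x j)"
  and last: "walk_next c X (x (card X - 1)) = origin c"
  using walk_enumeration[OF br jn] by blast
 define N where "N = card X"
 define u where "u = (%j. if j < N then seg_length c X (x j) else 0)"
 define T where "T = (%j. sum u {..<j})"
 have xX: "x j \<in> X" if "j < N" for j using bij that by (auto simp: bij_betw_def N_def)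
 have u_pos: "0 < u j" if "j < N" for j using seg_length_pos[OF xX[OF that]] that by (simp add: u_def)
 have u0: "0 <= u j" for j using u_pos[of j] by (cases "j < N") (auto simp: u_def)
 have TN: "T N = 1"
 proof -
  have "T N = (\<Sum>j<card X. seg_length c X (x j))" by (simp add: T_def u_def N_def)
  also have "... = sum (seg_length c X) X" by (rule sum.reindex_bij_betw[OF bij])
  finally show ?thesis using sum_seg_length by simp
 qed
 have u_simplex: "u \<in> standard_simplex (N - 1)"
 proof (rule simplexI)
  have "{..N - 1} = {..<N}" using N0 by (auto simp: N_def)
  then show "(\<Sum>i\<le>N - 1. u i) = 1" using TN by (simp add: T_def)
 qed (use u0 in \<open>auto simp: u_def\<close>)
 have T_mono: "T i <= T j" if "i <= j" for i j unfolding T_def by (rule partial_sum_mono[OF u0 that])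
 have TSuc: "T (Suc j) = T j + u j" for j by (simp add: T_def)
 have T_ge: "0 <= T j" for j using T_mono[of 0 j] by (simp add: T_def)
 define seg where "seg = (%s :: real. segment_at (N - 1) u (frac s))"
 define f where "f = (%s. advance c (x (seg s)) (frac s - T (seg s)))"
 have seg: "seg s < N" "T (seg s) <= frac s" "frac s < T (seg s) + u (seg s)" for s
  using segment_at_bounds[OF u_simplex, of "frac s"] N0 frac_range[of s]
  by (auto simp: seg_def T_def N_def)
 have f_eq: "f (of_int m + T j + e) = advance c (x j) e" if j: "j < N" "0 <= e" "e < u j" for m j e
 proof -
  have "T j + e < 1" using T_mono[of "Suc j" N] TSuc[of j] TN j by simp
  then have fr: "frac (of_int m + T j + e) = T j + e"
   using T_ge[of j] j by (simp add: frac_unique_iff)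
  have "seg (of_int m + T j + e) = j"
   unfolding seg_def fr using j T_def TSuc[of j] by (intro segment_at_unique[OF u_simplex]) auto
  then show ?thesis unfolding f_def fr by simp
 qed
 have decomp: "\<exists>m j e. s = of_int m + T j + e & j < N & 0 <= e & e < u j" for s :: real
  using seg[of s] by (intro exI[of _ "\<lfloor>s\<rfloor>"] exI[of _ "seg s"] exI[of _ "frac s - T (seg s)"])
   (auto simp: frac_def)
 have xp: "x j \<in> points c" if "j < N" for j using xX[OF that] X unfolding marked_def by blast
 have fpts: "f s \<in> points c" for s unfolding f_def by (rule advance_points[OF xp[OF seg(1)]])
 \<comment> \<open>Arrival at the end of segment \<open>j\<close>: the point arrived at is the
   \<open>lobe_next\<close> of its start, and \<open>turn\<close> makes it the start of the
   following segment.\<close>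
 have left: "\<exists>\<epsilon>>0. \<exists>p\<in>points c. f s = turn c p & (\<forall>h\<in>{0<..<\<epsilon>}. f (s - h) = advance c p (- h))"
  if s: "s = of_int m + T j + u j" "j < N" "f s = walk_next c X (x j)" for s m j
 proof (intro exI[of _ "u j"] conjI bexI[of _ "lobe_next X (x j)"] ballI)
  show "0 < u j" by (rule u_pos[OF s(2)])
  show "f s = turn c (lobe_next X (x j))" using s(3) by (simp add: walk_next_def)
  show "lobe_next X (x j) \<in> points c"
   using lobe_next_in[OF xX[OF s(2)]] X unfolding marked_def by blast
  fix h assume h: "h \<in> {0<..<u j}"
  have "f (s - h) = f (of_int m + T j + (u j - h))" by (simp add: s(1) algebra_simps)
  also have "... = advance c (x j) (u j - h)" using h s(2) by (intro f_eq) auto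
  also have "... = advance c (advance c (x j) (u j)) (- h)" by (simp add: advance_add)
  also have "advance c (x j) (u j) = lobe_next X (x j)"
   using advance_seg_length[OF xX[OF s(2)]] s(2) by (simp add: u_def)
  finally show "f (s - h) = advance c (lobe_next X (x j)) (- h)" .
 qed
 have "is_circuit c f"
  unfolding is_circuit_def
 proof (intro conjI allI)
  show "f 0 = origin c"
   using f_eq[of 0 0 0] N0 u_pos[of 0] x0 xp[of 0] by (simp add: T_def N_def advance_0)
  show "range f <= points c" using fpts by blast
 next
  fix s
  obtain m j e where s: "s = of_int m + T j + e" "j < N" "0 <= e" "e < u j" using decomp by blast
  show "\<exists>\<epsilon>>0. \<forall>h\<in>{0..<\<epsilon>}. f (s + h) = advance c (f s) h"
  proof (intro exI[of _ "u j - e"] conjI ballI)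
   show "0 < u j - e" using s by simp
   fix h assume h: "h \<in> {0..<u j - e}"
   have "f (s + h) = f (of_int m + T j + (e + h))" by (simp add: s(1) algebra_simps)
   also have "... = advance c (x j) (e + h)" using h s by (intro f_eq) auto
   also have "... = advance c (advance c (x j) e) h" by (simp add: advance_add)
   also have "advance c (x j) e = f s" using f_eq[OF s(2-4), of m] s(1) by simp
   finally show "f (s + h) = advance c (f s) h" .
  qed
  show "\<exists>\<epsilon>>0. \<exists>p\<in>points c. f s = turn c p & (\<forall>h\<in>{0<..<\<epsilon>}. f (s - h) = advance c p (- h))"
  proof (cases "e = 0")
   case False
   then have e: "0 < e" using s(3) by simp
   have fs: "f s = advance c (x j) e" using f_eq[OF s(2-4), of m] s(1) by simp
   have eu: "e < seg_length c X (x j)" using s(2,4) by (simp add: u_def)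
   show ?thesis
   proof (intro exI[of _ e] conjI bexI[of _ "f s"] ballI)
    show "f s = turn c (f s)" unfolding fs
     using advance_in_segment(4)[OF xX[OF s(2)] s(3) eu e] by simp
    fix h assume h: "h \<in> {0<..<e}"
    have "f (s - h) = f (of_int m + T j + (e - h))" by (simp add: s(1) algebra_simps)
    also have "... = advance c (x j) (e - h)" using h s by (intro f_eq) auto
    finally show "f (s - h) = advance c (f s) (- h)" by (simp add: fs advance_add)
   qed (use e fpts in auto)
  next
   case True
   have fs: "f s = x j" using f_eq[OF s(2-4), of m] s(1) True advance_0[OF xp[OF s(2)]] by simp
   show ?thesis
   proof (cases j)
    \<comment> \<open>The start of segment 0 is reached at the end of segment \<open>N - 1\<close>
      of the preceding period.\<close>
    case 0
    show ?thesis
    proof (rule left)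
     show "s = of_int (m - 1) + T (N - 1) + u (N - 1)"
      using TSuc[of "N - 1"] TN N0 s(1) True 0 by (simp add: N_def T_def)
     show "N - 1 < N" using N0 by (simp add: N_def)
     show "f s = walk_next c X (x (N - 1))" using fs last x0 0 by (simp add: N_def)
    qed
   next
    case (Suc i)
    show ?thesis
    proof (rule left)
     show "s = of_int m + T i + u i" using TSuc[of i] s(1) True Suc by simp
     show "i < N" using s(2) Suc by simp
     show "f s = walk_next c X (x i)" using fs step[of i] s(2) Suc by (simp add: N_def)
    qed
   qed
  qed
 qed
 moreover have "f (s + 1) = f s" for s
 proof -
  have "frac (s + 1) = frac s" by (simp add: frac_eq_frac_iff)
  then show ?thesis by (simp add: f_def seg_def)
 qed
 moreover have "bij_betw f {0..<1} (points c)"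
  unfolding bij_betw_def
 proof
  \<comment> \<open>If two segments reached the same point, the one with the earlier start on the
    lobe would contain the start of the other, but no spine lies inside a segment.\<close>
  show "inj_on f {0..<1}"
  proof (rule inj_onI)
   fix s s' :: real assume ss: "s \<in> {0..<1}" "s' \<in> {0..<1}" "f s = f s'"
   define e e' where "e = frac s - T (seg s)" and "e' = frac s' - T (seg s')"
   let ?p = "x (seg s)" and ?q = "x (seg s')"
   have e: "0 <= e" "e < seg_length c X ?p" "0 <= e'" "e' < seg_length c X ?q"
    using seg[of s] seg[of s'] by (auto simp: e_def e'_def u_def)
   note p = advance_in_segment(1,2)[OF xX[OF seg(1)] e(1,2)]
    and q = advance_in_segment(1,2)[OF xX[OF seg(1)] e(3,4)]
   have "advance c ?p e = advance c ?q e'" using ss(3) by (simp only: f_def e_def e'_def)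
   then have eq: "fst ?p = fst ?q" "snd ?p + e / radius c (fst ?p) = snd ?q + e' / radius c (fst ?q)"
    unfolding p(1) q(1) by blast+
   let ?A = "on_lobe X (fst ?p)"
   note A = lobe_marks[OF X marked_lobe[OF xX[OF seg(1)], of s]]
   have r: "0 < radius c (fst ?p)" by (rule precactus_radius[OF pre marked_lobe[OF xX[OF seg(1)]]])
   have in_A: "snd ?p \<in> ?A" "snd ?q \<in> ?A"
    using snd_on_lobe[OF xX[OF seg(1)], of s] snd_on_lobe[OF xX[OF seg(1)], of s'] eq(1) by simp_all
   have nn: "0 <= e / radius c (fst ?p)" "0 <= e' / radius c (fst ?q)" using e r eq(1) by simp_all
   have "~ snd ?p < snd ?q"
    using next_mark_bounds(4)[OF A in_A(1) in_A(2)] p(2) nn eq(2) by linarith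
   moreover have "~ snd ?q < snd ?p"
    using next_mark_bounds(4)[OF A in_A(2) in_A(1)] q(2) nn eq by (simp only: eq(1)) linarith
   ultimately have "?p = ?q" using eq(1) by (simp add: prod_eq_iff)
   then have "seg s = seg s'" using bij seg(1)[of s] seg(1)[of s']
    unfolding bij_betw_def N_def by (auto dest: inj_onD)
   moreover have "e = e'" using eq(2) \<open>?p = ?q\<close> r by simp
   ultimately have "frac s = frac s'" by (simp add: e_def e'_def)
   then show "s = s'" using ss by (simp add: frac_id)
  qed
  show "f ` {0..<1} = points c"
  proof (intro equalityI subsetI)
   fix p assume p: "p \<in> points c"
   then have k: "fst p < lobes c" and t: "0 <= snd p" "snd p < 1" by (auto simp: points_def)
   note A = lobe_marks[OF X k] and r = precactus_radius[OF pre k]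
   obtain a where a: "a \<in> on_lobe X (fst p)" "a <= snd p" "snd p < next_mark (on_lobe X (fst p)) a"
    using mark_below[OF A t] by blast
   then have "(fst p, a) \<in> x ` {..<card X}" using bij by (simp add: bij_betw_def on_lobe_iff)
   then obtain j where j: "(fst p, a) = x j" "j < N" by (auto simp: N_def)
   define e where "e = radius c (fst p) * (snd p - a)"
   have xj: "fst (x j) = fst p" "snd (x j) = a" unfolding j(1)[symmetric] by simp_all
   have e: "0 <= e" "e < u j" using a r j(2) by (auto simp: e_def u_def seg_length_def xj)
   have "f (of_int 0 + T j + e) = advance c (x j) e" by (rule f_eq[OF j(2) e])
   also have "... = p"
    using advance_in_segment(1)[OF xX[OF j(2)] e(1)] e(2) j(2) r
    by (simp add: u_def xj e_def prod_eq_iff)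
   finally have "f (T j + e) = p" by simp
   moreover have "T j + e \<in> {0..<1}"
    using T_ge[of j] e T_mono[of "Suc j" N] TSuc[of j] TN j(2) by simp
   ultimately show "p \<in> f ` {0..<1}" by blast
  qed (use fpts in blast)
 qed
 ultimately show ?thesis unfolding good_circuit_def by blast
qed

end

section \<open>From bridges to planarity\<close>

lemma strict_mono_if_locally:
 fixes G :: "real => real"
 assumes right: "!!u. 0 <= u ==> u < 1 ==> \<exists>e>0. \<forall>h. 0 < h & h < e --> G u < G (u + h)"
  and left: "!!u. 0 < u ==> u < 1 ==> \<exists>e>0. \<forall>h. 0 < h & h < e --> G (u - h) < G u"
  and xy: "0 <= x" "x < y" "y < 1"
 shows "G x < G y"
proof -
 \<comment> \<open>Real induction: the supremum of the arguments up to which all values exceed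
   \<open>G x\<close>. One-sided comparisons take the place of continuity.\<close>
 define S where "S = {z. x <= z & z <= y & (\<forall>w. x < w & w <= z --> G x < G w)}"
 define Z where "Z = Sup S"
 have xS: "x \<in> S" using xy by (simp add: S_def)
 have bdd: "bdd_above S" by (rule bdd_aboveI[of _ y]) (simp add: S_def)
 have Zx: "x <= Z" unfolding Z_def by (rule cSup_upper[OF xS bdd])
 have Zy: "Z <= y" unfolding Z_def by (rule cSup_least) (use xS in \<open>auto simp: S_def\<close>)
 have below: "G x < G w" if w: "x < w" "w < Z" for w
 proof -
  obtain z where "z \<in> S" "w < z" using less_cSupD[of S w] w xS unfolding Z_def by blast
  then show ?thesis using w by (simp add: S_def)
 qed
 have atZ: "G x < G Z" if xZ: "x < Z"
 proof -
  have "0 < Z" "Z < 1" using xZ xy Zy by auto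
  then obtain e where e: "e > 0" "!!h. 0 < h & h < e ==> G (Z - h) < G Z"
   using left[of Z] by blast
  define h where "h = min (e/2) ((Z - x)/2)"
  have h: "0 < h" "h < e" "h < Z - x" using e(1) xZ by (auto simp: h_def min_less_iff_disj)
  have "G x < G (Z - h)" using h by (intro below) auto
  also have "... < G Z" using h by (intro e(2)) simp
  finally show ?thesis .
 qed
 have le: "G x <= G Z" using atZ Zx by (cases "x = Z") auto
 have "Z = y"
 proof (rule ccontr)
  assume "Z ~= y"
  then have "Z < y" using Zy by simp
  have "0 <= Z" "Z < 1" using Zx xy Zy by auto
  then obtain e where e: "e > 0" "!!h. 0 < h & h < e ==> G Z < G (Z + h)"
   using right[of Z] by blast
  define h where "h = min (e/2) (y - Z)"
  have h: "0 < h" "h < e" "h <= y - Z" using e(1) \<open>Z < y\<close> by (auto simp: h_def min_less_iff_disj)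
  have "Z + h \<in> S"
  proof -
   have "G x < G w" if w: "x < w" "w <= Z + h" for w
   proof -
    consider "w < Z" | "w = Z" | "Z < w" by linarith
    then show ?thesis
    proof cases
     case 3
     then have "G Z < G (Z + (w - Z))" using w h by (intro e(2)) auto
     then show ?thesis using le by simp
    qed (use w below atZ in auto)
   qed
   then show ?thesis using h Zx by (auto simp: S_def)
  qed
  then have "Z + h <= Z" unfolding Z_def by (rule cSup_upper[OF _ bdd])
  then show False using h by simp
 qed
 then show ?thesis using atZ xy by simp
qed

lemma cyc_frac:
 assumes "0 <= t" "t < 1" "0 < u" "u < v" "v < 1"
 shows "cyc t (frac (t + u)) (frac (t + v))"
proof -
 have f: "frac (t + w) = (if t + w < 1 then t + w else t + w - 1)" if "0 < w" "w < 1" for w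
 proof (cases "t + w < 1")
  case True
  then show ?thesis using that assms by (simp add: frac_id)
 next
  case False
  have "frac (t + w) = frac (t + w - 1)" by (simp add: frac_eq_frac_iff)
  also have "... = t + w - 1" using False that assms by (intro frac_id) auto
  finally show ?thesis using False by simp
 qed
 show ?thesis using f[of u] f[of v] assms by (auto simp: cyc_def)
qed

context
 fixes c f
 assumes pre: "precactus c" and f: "good_circuit c f"
begin

lemma circ: "is_circuit c f" using f by (simp add: good_circuit_def)

lemma no_revisit:
 assumes "f x = q" "x ~= u" "\<bar>u - x\<bar> < 1"
 shows "f u ~= q"
proof
 assume "f u = q"
 then have "f u = f x" using assms(1) by simp
 then have "u = x" by (rule good_circuit_inj[OF f _ assms(3)])
 then show False using assms(2) by simp
qed

text \<open>A turn between the two sides leads into or out of \<open>p\<close>, and then the path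
  would be at \<open>p\<close> or at \<open>turn c p\<close>.\<close>

lemma bridge_constant:
 assumes kap: "bridge c p kap" and p: "p \<in> points c"
  and none: "!!u. x < u ==> u < y ==> f u ~= p & f u ~= turn c p"
  and s: "x <= s" "s < y"
 shows "kap (fst (f s)) = kap (fst (f x))"
proof (rule locally_constant_on_connected[where F = "%s. kap (fst (f s))" and S = "{x..<y}"])
 fix u assume u: "u \<in> {x..<y}"
 obtain e1 where e1: "e1 > 0" "!!h. 0 <= h ==> h < e1 ==> f (u + h) = advance c (f u) h"
  using circuit_right[OF circ, of u] by blast
 obtain e2 q where q: "e2 > 0" "q \<in> points c" "f u = turn c q"
  "!!h. 0 < h ==> h < e2 ==> f (u - h) = advance c q (- h)"
  using circuit_left[OF circ, of u] by blast
 have near: "kap (fst (f v)) = kap (fst (f u))" if v: "v \<in> {x..<y}" "\<bar>v - u\<bar> < min e1 e2" for v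
 proof (cases "u <= v")
  case True
  have "f v = advance c (f u) (v - u)" using e1(2)[of "v - u"] v True by simp
  then show ?thesis by simp
 next
  case False
  have "f v = advance c q (- (u - v))" using q(4)[of "u - v"] v False by simp
  then have "fst (f v) = fst q" by simp
  moreover have "x < u" "u < y" using False u v by auto
  then have "turn c q ~= p" "turn c q ~= turn c p" using none[of u] q(3) by simp_all
  moreover from this have "q ~= p" by metis
  ultimately have "kap (fst (turn c q)) = kap (fst q)" "fst (f v) = fst q"
   using kap q(2) by (simp_all add: bridge_def)
  then show ?thesis using q(3) by simp
 qed
 have "0 < min e1 e2" using e1(1) q(1) by simp
 then show "\<exists>\<epsilon>>0. \<forall>v\<in>{x..<y}. \<bar>v - u\<bar> < \<epsilon> --> kap (fst (f v)) = kap (fst (f u))"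
  by (intro exI[of _ "min e1 e2"] conjI ballI impI, assumption) (rule near)
qed (use s in auto)

text \<open>The period splits into the excursion at \<open>p\<close>, from \<open>a\<close> to
  \<open>d\<close>, and the rest.\<close>

lemma bridge_sides:
 assumes kap: "bridge c p kap" and p: "p \<in> points c"
  and a: "f a = turn c p" and d: "f d = p" "a < d" "d < a + 1"
 shows "a <= s ==> s < d ==> ~ kap (fst (f s))" "d <= s ==> s < a + 1 ==> kap (fst (f s))"
proof -
 assume s: "a <= s" "s < d"
 have "kap (fst (f s)) = kap (fst (f a))"
 proof (rule bridge_constant[OF kap p _ s])
  fix u assume u: "a < u" "u < d"
  show "f u ~= p & f u ~= turn c p"
  proof
   show "f u ~= p" by (rule no_revisit[OF d(1)]) (use u d in auto)
   show "f u ~= turn c p" by (rule no_revisit[OF a]) (use u d in auto)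
  qed
 qed
 then show "~ kap (fst (f s))" using kap a by (simp add: bridge_def)
next
 assume s: "d <= s" "s < a + 1"
 have "kap (fst (f s)) = kap (fst (f d))"
 proof (rule bridge_constant[OF kap p _ s])
  fix u assume u: "d < u" "u < a + 1"
  show "f u ~= p & f u ~= turn c p"
  proof
   show "f u ~= p" by (rule no_revisit[OF d(1)]) (use u d in auto)
   show "f u ~= turn c p" by (rule no_revisit[OF a]) (use u d in auto)
  qed
 qed
 then show "kap (fst (f s))" using kap d by (simp add: bridge_def)
qed

text \<open>There is a bridge at the last exit from the lobe of \<open>s1\<close> before
  \<open>s2\<close>. The path stays on the far side until it returns to the exit point at time
  \<open>d\<close>. The common lobe of \<open>s2\<close> and \<open>s4\<close> is on the far side,
  so both times precede \<open>d\<close>, and so does \<open>s3\<close> between them, although its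
  lobe is on the near side.\<close>

lemma noncrossing_if_bridged:
 assumes br: "bridged c" and s: "s1 < s2" "s2 < s3" "s3 < s4" "s4 < s1 + 1"
  and lobe: "fst (f s1) = fst (f s3)" "fst (f s2) = fst (f s4)"
 shows "fst (f s1) = fst (f s2)"
proof (rule ccontr)
 assume ne: "fst (f s1) ~= fst (f s2)"
 define i where "i = fst (f s1)"
 define S where "S = {s. s1 <= s & s <= s2 & fst (f s) = i}"
 define a where "a = Sup S"
 have s1S: "s1 \<in> S" using s by (simp add: S_def i_def)
 have bdd: "bdd_above S" by (rule bdd_aboveI[of _ s2]) (simp add: S_def)
 have a1: "s1 <= a" unfolding a_def by (rule cSup_upper[OF s1S bdd])
 have a2: "a <= s2" unfolding a_def by (rule cSup_least) (use s1S in \<open>auto simp: S_def\<close>)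
 have above: "fst (f u) ~= i" if u: "a < u" "u <= s2" for u
 proof
  assume "fst (f u) = i"
  then have "u \<in> S" using u a1 by (simp add: S_def)
  then have "u <= a" unfolding a_def by (rule cSup_upper[OF _ bdd])
  then show False using u by simp
 qed
 \<comment> \<open>The supremum is not attained: after a time on the lobe the path stays on it for a
   while. So at \<open>a\<close> the path has already turned off, whereas the point of arrival
   \<open>p\<close> is still on the lobe.\<close>
 have a_not: "fst (f a) ~= i"
 proof
  assume ai: "fst (f a) = i"
  have "a ~= s2" using ai ne by (auto simp: i_def)
  then have "a < s2" using a2 by simp
  obtain e where e: "e > 0" "!!h. 0 <= h ==> h < e ==> f (a + h) = advance c (f a) h"
   using circuit_right[OF circ, of a] by blast
  define h where "h = min (e/2) (s2 - a)"
  have h: "0 < h" "h < e" "h <= s2 - a" using e(1) \<open>a < s2\<close> by (auto simp: h_def min_less_iff_disj)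
  have "fst (f (a + h)) = i" using e(2)[of h] h ai by simp
  then show False using above[of "a + h"] h by simp
 qed
 obtain e p where p: "e > 0" "p \<in> points c" "f a = turn c p"
  "!!h. 0 < h ==> h < e ==> f (a - h) = advance c p (- h)"
  using circuit_left[OF circ, of a] by blast
 have "fst p = i"
 proof -
  have "a - e < Sup S" using p(1) by (simp add: a_def)
  then obtain z where z: "z \<in> S" "a - e < z" using less_cSupD[of S "a - e"] s1S by blast
  have "z <= a" unfolding a_def by (rule cSup_upper[OF z(1) bdd])
  moreover have "z ~= a" using z(1) a_not by (auto simp: S_def)
  ultimately have "f (a - (a - z)) = advance c p (- (a - z))" using z by (intro p(4)) auto
  then show ?thesis using z(1) by (simp add: S_def)
 qed
 then have moved: "turn c p ~= p" using a_not p(3) by auto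
 then obtain kap where kap: "bridge c p kap" using br p(2) unfolding bridged_def by blast
 obtain d where d: "a <= d" "d < a + 1" "f d = p" using good_circuit_surj[OF f p(2), of a] by blast
 have "a ~= d" using d(3) p(3) moved by auto
 then have ad: "a < d" using d by simp
 note sides = bridge_sides[OF kap p(2) p(3) d(3) ad d(2)]
 have "s2 < d" using above[of d] ad d(3) \<open>fst p = i\<close> by (cases "d <= s2") auto
 then have "~ kap (fst (f s4))" using sides(1)[of s2] a2 lobe by simp
 then have "s4 < d" using sides(2)[of s4] s a1 by (cases "d <= s4") auto
 then have "~ kap (fst (f s3))" using sides(1)[of s3] s a2 by simp
 then show False using kap \<open>fst p = i\<close> lobe(1) by (simp add: bridge_def i_def)
qed

text \<open>\<open>G u\<close> is the time of the visit to the point whose coordinate is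
  \<open>u\<close> beyond that of the starting point, modulo 1. It increases to the right because
  the path runs along the lobe, and to the left because the path arrives at a point of the lobe no
  later than it leaves it. Otherwise the excursion at that point would contain the starting time
  \<open>s1\<close>, at which the path is on the lobe itself.\<close>

lemma monotone_if_bridged:
 assumes br: "bridged c" and s: "s1 < s2" "s2 < s3" "s3 < s1 + 1"
  and lobe: "fst (f s1) = fst (f s2)" "fst (f s2) = fst (f s3)"
 shows "cyc (snd (f s1)) (snd (f s2)) (snd (f s3))"
proof -
 define k where "k = fst (f s1)"
 define t where "t = snd (f s1)"
 have kt: "(k, t) = f s1" by (simp add: k_def t_def)
 have k: "k < lobes c" and t: "0 <= t" "t < 1"
 proof -
  have "(k, t) \<in> points c" unfolding kt by (rule circuit_points[OF circ])
  then show "k < lobes c" "0 <= t" "t < 1" by (simp_all add: points_iff)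
 qed
 note r = precactus_radius[OF pre k]
 let ?r = "radius c k"
 define G where "G = (%u. SOME s. s1 <= s & s < s1 + 1 & f s = (k, frac (t + u)))"
 have G: "s1 <= G u" "G u < s1 + 1" "f (G u) = (k, frac (t + u))" for u
 proof -
  have "(k, frac (t + u)) \<in> points c" using k frac_range[of "t + u"] by (simp add: points_iff)
  then obtain s where "s1 <= s" "s < s1 + 1" "f s = (k, frac (t + u))"
   using good_circuit_surj[OF f, of "(k, frac (t + u))" s1] by blast
  then have "\<exists>s. s1 <= s & s < s1 + 1 & f s = (k, frac (t + u))" by blast
  then have "s1 <= G u & G u < s1 + 1 & f (G u) = (k, frac (t + u))"
   unfolding G_def by (rule someI_ex)
  then show "s1 <= G u" "G u < s1 + 1" "f (G u) = (k, frac (t + u))" by auto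
 qed
 have G_eq: "G u = s" if "s1 <= s" "s < s1 + 1" "f s = (k, frac (t + u))" for s u
 proof (rule good_circuit_inj[OF f])
  show "f (G u) = f s" using G(3)[of u] that(3) by simp
  show "\<bar>G u - s\<bar> < 1" using G(1,2)[of u] that(1,2) by auto
 qed
 have right: "\<exists>e>0. \<forall>h. 0 < h & h < e --> G u < G (u + h)" for u
 proof -
  obtain e where e: "e > 0" "!!h. 0 <= h ==> h < e ==> f (G u + h) = advance c (f (G u)) h"
   using circuit_right[OF circ, of "G u"] by blast
  define e' where "e' = min e (s1 + 1 - G u) / ?r"
  have "G u < G (u + h)" if h: "0 < h" "h < e'" for h
  proof -
   have "h * ?r < min e (s1 + 1 - G u)" using h(2) unfolding e'_def pos_less_divide_eq[OF r] .
   then have hr: "0 < h * ?r" "h * ?r < e" "h * ?r < s1 + 1 - G u" using h r by simp_all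
   have "f (G u + h * ?r) = advance c (k, frac (t + u)) (h * ?r)" using e(2)[of "h * ?r"] hr G(3) by simp
   also have "... = (k, frac (t + (u + h)))" using r by (simp add: advance_pair frac_add_frac add.assoc)
   finally have "G (u + h) = G u + h * ?r" using hr G(1)[of u] by (intro G_eq) auto
   then show ?thesis using hr by simp
  qed
  moreover have "0 < e'" using e(1) G(2)[of u] r by (simp add: e'_def)
  ultimately show ?thesis by blast
 qed
 have left: "\<exists>e>0. \<forall>h. 0 < h & h < e --> G (u - h) < G u" if u: "0 < u" "u < 1" for u
 proof -
  let ?p = "(k, frac (t + u))"
  have p: "?p \<in> points c" using k frac_range[of "t + u"] by (simp add: points_iff)
  obtain a0 where a0: "s1 <= a0" "a0 < s1 + 1" "f a0 = turn c ?p"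
   using good_circuit_surj[OF f, of "turn c ?p" s1] p turn_points[OF pre] by blast
  \<comment> \<open>Arrivals are sought after \<open>s1\<close> and up to \<open>s1 + 1\<close>
    inclusive: an arrival at time \<open>s1\<close> counts as one at the end of the period.\<close>
  define a where "a = (if a0 = s1 then s1 + 1 else a0)"
  have a: "s1 < a" "a <= s1 + 1" "f a = turn c ?p"
   using a0 f by (auto simp: a_def good_circuit_def)
  obtain e where e: "e > 0" "!!h. 0 < h ==> h < e ==> f (a - h) = advance c ?p (- h)"
   using circuit_arrival[OF pre circ a(3)] by blast
  have "frac (t + u) ~= t"
  proof
   assume "frac (t + u) = t"
   then have "frac (t + u) = frac t" using t by (simp add: frac_id)
   then have "u \<in> \<int>" by (simp add: frac_eq_frac_iff)
   then obtain n where "u = of_int n" by (rule Ints_cases)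
   then show False using u by simp
  qed
  then have "G u ~= s1" using G(3)[of u] kt by auto
  then have Gs: "s1 < G u" using G(1)[of u] by simp
  have "a <= G u"
  proof (rule ccontr)
   assume "~ a <= G u"
   then have lt: "G u < a" by simp
   have "turn c ?p ~= ?p"
    using no_revisit[OF a(3), of "G u"] G(3)[of u] lt Gs a(2) by auto
   then obtain kap where kap: "bridge c ?p kap" using br p unfolding bridged_def by blast
   have a': "f (a - 1) = turn c ?p" using good_circuit_int[OF f, of a "- 1"] a(3) by simp
   have "~ kap (fst (f s1))"
    by (rule bridge_sides(1)[OF kap p a' G(3)]) (use a lt Gs in auto)
   then show False using kap by (simp add: bridge_def k_def)
  qed
  define e' where "e' = min e (a - s1) / ?r"
  have "G (u - h) < G u" if h: "0 < h" "h < e'" for h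
  proof -
   have "h * ?r < min e (a - s1)" using h(2) unfolding e'_def pos_less_divide_eq[OF r] .
   then have hr: "0 < h * ?r" "h * ?r < e" "h * ?r < a - s1" using h r by simp_all
   have "f (a - h * ?r) = advance c ?p (- (h * ?r))" by (rule e(2)[OF hr(1,2)])
   also have "... = (k, frac (frac (t + u) + - h))" using r by (simp add: advance_pair)
   also have "... = (k, frac (t + (u - h)))" unfolding frac_add_frac by (simp add: algebra_simps)
   finally have "G (u - h) = a - h * ?r" using hr a by (intro G_eq) auto
   then show ?thesis using hr \<open>a <= G u\<close> by simp
  qed
  moreover have "0 < e'" using e(1) a(1) r by (simp add: e'_def)
  ultimately show ?thesis by blast
 qed
 \<comment> \<open>Coordinates relative to that of \<open>s1\<close>, which turns the cyclic order
   into the usual order of \<open>u\<close>.\<close>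
 define u where "u = (%s. frac (snd (f s) - t))"
 have u: "0 <= u s" "u s < 1" for s using frac_range[of "snd (f s) - t"] by (simp_all add: u_def)
 have tu: "frac (t + u s) = snd (f s)" for s
 proof -
  have "snd (f s) \<in> {0..<1}" using circuit_points[OF circ, of s] unfolding points_def by auto
  moreover have "frac (t + u s) = frac (snd (f s))"
   using frac_add_frac[of "snd (f s) - t" t] by (simp add: u_def add.commute)
  ultimately show ?thesis by (simp add: frac_id)
 qed
 have Gu: "G (u s) = s" if "s1 <= s" "s < s1 + 1" "fst (f s) = k" for s
  using that by (intro G_eq) (simp_all add: tu prod_eq_iff)
 have G2: "G (u s2) = s2" "G (u s3) = s3" using s lobe by (auto intro!: Gu simp: k_def)
 have G0: "G 0 = s1" by (rule G_eq) (use t in \<open>simp_all add: kt[symmetric] frac_id\<close>)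
 note mono = strict_mono_if_locally[of G, OF right left]
 have "0 < u s2" using G0 G2 s u(1)[of s2] by (cases "u s2 = 0") auto
 moreover have "u s2 < u s3"
 proof (rule ccontr)
  assume "~ u s2 < u s3"
  then consider "u s3 = u s2" | "u s3 < u s2" by linarith
  then show False
  proof cases
   case 2
   then have "G (u s3) < G (u s2)" using u by (intro mono) auto
   then show False using G2 s by simp
  qed (use G2 s in simp)
 qed
 ultimately have "cyc t (frac (t + u s2)) (frac (t + u s3))" using t u by (intro cyc_frac) auto
 then show ?thesis by (simp only: tu) (simp add: t_def)
qed

lemma planar_if_bridged: "bridged c ==> planar f"
 unfolding planar_def using monotone_if_bridged noncrossing_if_bridged by blast

end

lemma cactus_circuit:
 assumes c: "is_cactus c"
 shows "good_circuit c (circuit c)" "planar (circuit c)"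
proof -
 note pre = cactus_pre[OF c]
 have X: "marked c ({} \<union> insert (origin c) ({p. turn c p ~= p} \<union> (%k. (k, 0)) ` {..<lobes c}))"
  by (rule ex_marked[OF pre]) auto
 obtain f where f: "good_circuit c f"
  using ex_good_circuit[OF pre X is_cactus_bridged[OF c] is_cactus_joined[OF c]] by blast
 have "circuit c = f" using circuit_eqI[OF pre] f by (simp add: good_circuit_def)
 then show "good_circuit c (circuit c)" "planar (circuit c)"
  using f planar_if_bridged[OF pre f is_cactus_bridged[OF c]] by simp_all
qed

text \<open>The path shows that \<open>turn\<close> is a permutation: every point of
  \<open>F\<close> is reached by the path and so is a value of \<open>turn\<close>, with argument in
  \<open>F\<close> because \<open>turn\<close> fixes everything else; a map of a finite set onto
  itself is bijective.\<close>

lemma cactus_from_circuit: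
 assumes rad: "!!i. i < lobes c ==> 0 < radius c i" "!!i. lobes c <= i ==> radius c i = 0"
  "(\<Sum>i<lobes c. radius c i) = 1"
  and F: "finite F" "F <= points c" "!!q. q \<notin> F ==> turn c q = q" "!!q. q \<in> F ==> turn c q \<in> F"
  and f: "good_circuit c f" and pl: "planar f"
 shows "is_cactus c & circuit c = f"
proof -
 have circ: "is_circuit c f" using f by (simp add: good_circuit_def)
 have "F <= turn c ` F"
 proof
  fix q assume q: "q \<in> F"
  obtain s where s: "f s = q" using good_circuit_surj[OF f, of q 0] q F(2) by blast
  obtain p where p: "p \<in> points c" "f s = turn c p" using circuit_left[OF circ, of s] by blast
  have "p \<in> F" using F(3)[of p] q s p by (cases "p \<in> F") auto
  then show "q \<in> turn c ` F" using s p by blast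
 qed
 then have im: "turn c ` F = F" using F(4) by blast
 then have "inj_on (turn c) F" using F(1) by (intro eq_card_imp_inj_on) simp_all
 then have "turn c permutes F" using im F(3) by (intro bij_imp_permutes) (simp_all add: bij_betw_def)
 then have perm: "turn c permutes points c" by (rule permutes_subset[OF _ F(2)])
 have "{p. turn c p ~= p} <= F" using F(3) by blast
 then have "finite {p. turn c p ~= p}" by (rule finite_subset[OF _ F(1)])
 moreover have "origin c \<in> points c"
  using circ circuit_points[OF circ, of 0] by (simp add: is_circuit_def)
 ultimately have pre: "precactus c" using rad perm by (simp add: precactus_def)
 show ?thesis using is_cactus_if_planar[OF pre f pl] circuit_eqI[OF pre circ] by blast
qed

section \<open>Composition and relabelling of cacti\<close>

lemma flat_bij:
 "bij_betw (flat m) (SIGMA k:{..<n}. {..<m k}) {..<(\<Sum>k<n. m k)}"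
proof (induction n)
 case 0
 then show ?case by (simp add: bij_betw_def)
next
 case (Suc n)
 let ?S = "\<Sum>k<n. m k"
 have e: "(SIGMA k:{..<Suc n}. {..<m k}) = (SIGMA k:{..<n}. {..<m k}) \<union> ({n} \<times> {..<m n})"
  by (auto simp: less_Suc_eq)
 have "bij_betw (flat m) ({n} \<times> {..<m n}) {?S..<?S + m n}"
  unfolding bij_betw_def
 proof
  show "inj_on (flat m) ({n} \<times> {..<m n})" by (auto simp: inj_on_def flat_def)
  show "flat m ` ({n} \<times> {..<m n}) = {?S..<?S + m n}"
  proof (intro equalityI subsetI)
   fix q assume "q \<in> {?S..<?S + m n}"
   then have "q = flat m (n, q - ?S)" "(n, q - ?S) \<in> {n} \<times> {..<m n}" by (auto simp: flat_def)
   then show "q \<in> flat m ` ({n} \<times> {..<m n})" by (rule image_eqI)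
  qed (auto simp: flat_def)
 qed
 moreover have "{..<?S} \<union> {?S..<?S + m n} = {..<(\<Sum>k<Suc n. m k)}" by auto
 moreover have "{..<?S} \<inter> {?S..<?S + m n} = {}" by auto
 ultimately show ?case unfolding e using bij_betw_combine[OF Suc] by metis
qed

lemma unflat_flat: "k < n ==> l < m k ==> unflat n m (flat m (k, l)) = (k, l)"
 unfolding unflat_def using flat_bij[of m n] by (intro inv_into_f_f) (auto simp: bij_betw_def)

lemma flat_less: "k < n ==> l < m k ==> flat m (k, l) < (\<Sum>k<n. m k)"
 using bij_betw_apply[OF flat_bij[of m n], of "(k, l)"] by simp

lemma flat_surj:
 assumes "q < (\<Sum>k<n. m k)"
 obtains k l where "k < n" "l < m k" "q = flat m (k, l)"
proof -
 have "q \<in> flat m ` (SIGMA k:{..<n}. {..<m k})" using flat_bij[of m n] assms by (simp add: bij_betw_def)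
 then obtain x where x: "q = flat m x" "x \<in> (SIGMA k:{..<n}. {..<m k})" by (rule imageE)
 obtain k l where kl: "x = (k, l)" by (cases x)
 show thesis by (rule that[of k l]) (use x kl in auto)
qed

lemma flat_inj:
 assumes "k < n" "l < m k" "k' < n" "l' < m k'" "flat m (k, l) = flat m (k', l')"
 shows "k = k'" "l = l'"
proof -
 have "(k, l) = (k', l')" using unflat_flat[of k n l m] unflat_flat[of k' n l' m] assms by metis
 then show "k = k'" "l = l'" by auto
qed

text \<open>For coordinates in the half-open unit interval, the representative of \<open>u\<close>
  after \<open>t\<close> and up to \<open>t + 1\<close> inclusive. It turns the cyclic order of
  coordinates on an outer lobe into the linear order of times for the path around the inner
  cactus.\<close>

definition lift :: "real => real => real" where
 "lift t u = (if t < u then u else u + 1)"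

lemma cyc_lift:
 assumes "cyc t u v" "t < 1" "0 <= t" "0 <= u" "u < 1" "0 <= v" "v < 1"
 shows "t < lift t u" "lift t u < lift t v" "lift t v < t + 1"
 using assms by (auto simp: cyc_def lift_def)

lemma visit_time_circuit:
 assumes "good_circuit c f" "circuit c = f" "0 <= t" "t < 1"
 shows "visit_time c (f t) = t"
 using assms unfolding visit_time_def good_circuit_def bij_betw_def
 by (simp add: inv_into_f_f)

lemma circuit_visit_time:
 assumes "good_circuit c f" "circuit c = f" "p \<in> points c"
 shows "f (visit_time c p) = p" "0 <= visit_time c p" "visit_time c p < 1"
proof -
 have p: "p \<in> f ` {0..<1}" using assms by (simp add: good_circuit_def bij_betw_def)
 show "f (visit_time c p) = p" unfolding visit_time_def assms(2) by (rule f_inv_into_f[OF p])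
 have "visit_time c p \<in> {0..<1}" unfolding visit_time_def assms(2) by (rule inv_into_into[OF p])
 then show "0 <= visit_time c p" "visit_time c p < 1" by auto
qed

lemma circuit_lift:
 "good_circuit c f ==> f (lift t u) = f u"
 by (simp add: lift_def good_circuit_def)

context
 fixes c d
 assumes c: "is_cactus c" and d: "!!k. k < lobes c ==> is_cactus (d k)"
begin

lemmas gc = cactus_circuit(1)[OF c] and gd = cactus_circuit(1)[OF d]

abbreviation (input) G where "G \<equiv> graft c d"
abbreviation (input) fl where "fl \<equiv> flat (%k. lobes (d k))"

lemma lobes_graft: "lobes G = (\<Sum>k<lobes c. lobes (d k))"
 by (simp add: graft_def Let_def)

lemma radius_graft:
 assumes "k < lobes c" "l < lobes (d k)"
 shows "radius G (fl (k, l)) = radius c k * radius (d k) l"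
 using flat_less[of k "lobes c" l "%k. lobes (d k)"] unflat_flat[of k "lobes c" l "%k. lobes (d k)"] assms
 by (simp add: graft_def Let_def)

lemma graft_incl_points:
 assumes "k < lobes c" "p \<in> points (d k)"
 shows "graft_incl d k p \<in> points G"
 using assms flat_less[of k "lobes c" "fst p" "%k. lobes (d k)"]
 by (cases p) (simp add: graft_incl_def points_iff lobes_graft)

lemma turn_graft:
 assumes "k < lobes c" "p \<in> points (d k)"
 shows "turn G (graft_incl d k p) = graft_map d (turn c (k, visit_time (d k) (turn (d k) p)))"
 using flat_less[of k "lobes c" "fst p" "%k. lobes (d k)"]
  unflat_flat[of k "lobes c" "fst p" "%k. lobes (d k)"] assms
 by (cases p) (simp add: graft_def Let_def graft_incl_def points_iff)

lemma turn_graft_outside: "q \<notin> points G ==> turn G q = q"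
 by (cases q) (auto simp: graft_def Let_def points_def)

lemma points_graftE:
 assumes "q \<in> points G"
 obtains k p where "k < lobes c" "p \<in> points (d k)" "q = graft_incl d k p"
proof -
 obtain i t where q: "q = (i, t)" by (cases q)
 have i: "i < (\<Sum>k<lobes c. lobes (d k))" "0 <= t" "t < 1"
  using assms unfolding q points_iff lobes_graft by auto
 obtain k l where kl: "k < lobes c" "l < lobes (d k)" "i = fl (k, l)" by (rule flat_surj[OF i(1)])
 show thesis by (rule that[of k "(l, t)"]) (use kl i q in \<open>auto simp: graft_incl_def points_iff\<close>)
qed

lemma graft_incl_inj:
 assumes "k < lobes c" "p \<in> points (d k)" "k' < lobes c" "p' \<in> points (d k')"
  "graft_incl d k p = graft_incl d k' p'"
 shows "k = k'" "p = p'"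
proof -
 have e: "fl (k, fst p) = fl (k', fst p')" "snd p = snd p'"
  using assms(5) by (auto simp: graft_incl_def split: prod.splits)
 note fl = flat_inj[of k "lobes c" "fst p" "%k. lobes (d k)" k' "fst p'",
   OF assms(1) fst_points[OF assms(2)] assms(3) fst_points[OF assms(4)] e(1)]
 show "k = k'" "p = p'" using fl e(2) by (simp_all add: prod_eq_iff)
qed

lemma fst_graft_incl: "fst (graft_incl d k p) = fl (k, fst p)"
 by (simp add: graft_incl_def split: prod.split)

lemma snd_graft_incl: "snd (graft_incl d k p) = snd p"
 by (simp add: graft_incl_def split: prod.split)

lemma graft_map_points: "p \<in> points c ==> graft_map d p \<in> points G"
proof -
 assume p: "p \<in> points c"
 have "circuit (d (fst p)) (snd p) \<in> points (d (fst p))"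
  using gd[OF fst_points[OF p]] circuit_points by (simp add: good_circuit_def)
 then show ?thesis using graft_incl_points[OF fst_points[OF p]] by (simp add: graft_map_def split_beta)
qed

lemma graft_map_bij: "bij_betw (graft_map d) (points c) (points G)"
 unfolding bij_betw_def
proof
 have cp: "circuit (d k) t \<in> points (d k)" if "k < lobes c" for k t
  using gd[OF that] circuit_points by (simp add: good_circuit_def)
 show "inj_on (graft_map d) (points c)"
 proof (rule inj_onI)
  fix p q assume pq: "p \<in> points c" "q \<in> points c" "graft_map d p = graft_map d q"
  have e: "graft_incl d (fst p) (circuit (d (fst p)) (snd p)) =
    graft_incl d (fst q) (circuit (d (fst q)) (snd q))"
   using pq(3) by (simp add: graft_map_def split_beta)
  note i = graft_incl_inj[OF fst_points[OF pq(1)] cp[OF fst_points[OF pq(1)]]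
    fst_points[OF pq(2)] cp[OF fst_points[OF pq(2)]] e]
  have "snd p = snd q"
  proof (rule good_circuit_inj[OF gd[OF fst_points[OF pq(1)]]])
   show "circuit (d (fst p)) (snd p) = circuit (d (fst p)) (snd q)" using i by simp
   show "\<bar>snd p - snd q\<bar> < 1" using pq(1,2) by (auto simp: points_def)
  qed
  then show "p = q" using i(1) by (simp add: prod_eq_iff)
 qed
 show "graft_map d ` points c = points G"
 proof (intro equalityI subsetI)
  fix q assume "q \<in> points G"
  then obtain k p where kp: "k < lobes c" "p \<in> points (d k)" "q = graft_incl d k p"
   by (rule points_graftE)
  note v = circuit_visit_time[OF gd[OF kp(1)] refl kp(2)]
  have "q = graft_map d (k, visit_time (d k) p)" using v kp(3) by (simp add: graft_map_def)
  moreover have "(k, visit_time (d k) p) \<in> points c" using v kp(1) by (simp add: points_iff)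
  ultimately show "q \<in> graft_map d ` points c" by (rule image_eqI)
 qed (use graft_map_points in blast)
qed

lemma advance_graft:
 assumes k: "k < lobes c" and p: "p \<in> points (d k)"
 shows "graft_incl d k (advance (d k) p (h / radius c k)) = advance G (graft_incl d k p) h"
 using radius_graft[OF k fst_points[OF p]]
 by (cases p) (simp add: graft_incl_def advance_pair)

text \<open>The path around the composite is the path around \<open>c\<close> followed by the
  collapse. Visits to one lobe of the composite are visits to one lobe of \<open>c\<close>, whose
  coordinates are times for \<open>d k\<close>. Planarity of \<open>c\<close> puts these times in
  order, and planarity of \<open>d k\<close> does the rest.\<close>

lemma graft_cactus:
 shows "is_cactus G" "circuit G = graft_map d \<circ> circuit c"
proof -
 define f where "f = graft_map d \<circ> circuit c"
 note circ = gc[unfolded good_circuit_def, THEN conjunct1]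
 have circd: "is_circuit (d k) (circuit (d k))" if "k < lobes c" for k
  using gd[OF that] by (simp add: good_circuit_def)
 note pre = cactus_pre[OF c] and pred = cactus_pre[OF d]
 have fs: "f s = graft_incl d (fst (circuit c s)) (circuit (d (fst (circuit c s))) (snd (circuit c s)))" for s
  by (simp add: f_def graft_map_def split_beta)
 have step: "f s' = advance G (graft_incl d k p) h"
  if "circuit c s' = advance c (k, t) h" "k < lobes c"
   "circuit (d k) (t + h / radius c k) = advance (d k) p (h / radius c k)" "p \<in> points (d k)"
  for s' k t h p
  using advance_graft[OF that(2,4), of h] that good_circuit_frac[OF gd[OF that(2)]]
  by (simp add: fs advance_pair)
 have is_circ: "is_circuit G f"
  unfolding is_circuit_def
 proof (intro conjI allI)
  show "f 0 = origin G" using circ by (simp add: f_def is_circuit_def graft_def Let_def)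
  show "range f <= points G"
   using graft_map_points[OF circuit_points[OF circ]] by (simp add: f_def image_subset_iff)
 next
  fix s
  obtain k t where kt: "circuit c s = (k, t)" by (cases "circuit c s")
  then have k: "k < lobes c" using circuit_points[OF circ, of s] by (simp add: points_iff)
  note r = precactus_radius[OF pre k]
  obtain e1 where e1: "e1 > 0" "!!h. 0 <= h ==> h < e1 ==> circuit c (s + h) = advance c (circuit c s) h"
   using circuit_right[OF circ, of s] by blast
  obtain e2 where e2: "e2 > 0"
   "!!h. 0 <= h ==> h < e2 ==> circuit (d k) (t + h) = advance (d k) (circuit (d k) t) h"
   using circuit_right[OF circd[OF k], of t] by blast
  show "\<exists>\<epsilon>>0. \<forall>h\<in>{0..<\<epsilon>}. f (s + h) = advance G (f s) h"
  proof (intro exI[of _ "min e1 (e2 * radius c k)"] conjI ballI)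
   show "0 < min e1 (e2 * radius c k)" using e1(1) e2(1) r by simp
   fix h assume h: "h \<in> {0..<min e1 (e2 * radius c k)}"
   have "h / radius c k < e2" unfolding pos_divide_less_eq[OF r] using h by simp
   then have "circuit (d k) (t + h / radius c k) = advance (d k) (circuit (d k) t) (h / radius c k)"
    using h r by (intro e2(2)) auto
   moreover have "circuit c (s + h) = advance c (k, t) h" using e1(2)[of h] h kt by simp
   ultimately have "f (s + h) = advance G (graft_incl d k (circuit (d k) t)) h"
    using k circuit_points[OF circd[OF k]] by (intro step)
   then show "f (s + h) = advance G (f s) h" by (simp add: fs kt)
  qed
 next
  fix s
  obtain e1 p where p: "e1 > 0" "p \<in> points c" "circuit c s = turn c p"
   "!!h. 0 < h ==> h < e1 ==> circuit c (s - h) = advance c p (- h)"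
   using circuit_left[OF circ, of s] by blast
  obtain k t where kt: "p = (k, t)" by (cases p)
  have k: "k < lobes c" and t: "0 <= t" "t < 1" using p(2) by (simp_all add: kt points_iff)
  note r = precactus_radius[OF pre k]
  obtain e2 q where q: "e2 > 0" "q \<in> points (d k)" "circuit (d k) t = turn (d k) q"
   "!!h. 0 < h ==> h < e2 ==> circuit (d k) (t - h) = advance (d k) q (- h)"
   using circuit_left[OF circd[OF k], of t] by blast
  show "\<exists>\<epsilon>>0. \<exists>p\<in>points G. f s = turn G p & (\<forall>h\<in>{0<..<\<epsilon>}. f (s - h) = advance G p (- h))"
  proof (intro exI[of _ "min e1 (e2 * radius c k)"] conjI bexI[of _ "graft_incl d k q"] ballI)
   show "0 < min e1 (e2 * radius c k)" using p(1) q(1) r by simp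
   show "f s = turn G (graft_incl d k q)"
    unfolding turn_graft[OF k q(2)] q(3)[symmetric] visit_time_circuit[OF gd[OF k] refl t]
    by (simp add: f_def p(3) kt)
   show "graft_incl d k q \<in> points G" by (rule graft_incl_points[OF k q(2)])
   fix h assume h: "h \<in> {0<..<min e1 (e2 * radius c k)}"
   have "h / radius c k < e2" unfolding pos_divide_less_eq[OF r] using h by simp
   then have "circuit (d k) (t - h / radius c k) = advance (d k) q (- (h / radius c k))"
    using h r by (intro q(4)) auto
   then have "circuit (d k) (t + - h / radius c k) = advance (d k) q (- h / radius c k)" by simp
   moreover have "circuit c (s - h) = advance c (k, t) (- h)" using p(4)[of h] h kt by simp
   ultimately show "f (s - h) = advance G (graft_incl d k q) (- h)"
    using k q(2) by (intro step)
  qed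
 qed
 have good: "good_circuit G f"
  unfolding good_circuit_def
 proof (intro conjI allI is_circ)
  show "f (s + 1) = f s" for s using gc by (simp add: f_def good_circuit_def)
  show "bij_betw f {0..<1} (points G)" unfolding f_def
   using gc graft_map_bij by (auto simp: good_circuit_def intro: bij_betw_trans)
 qed
 define K where "K = (%s. fst (circuit c s))"
 define M where "M = (%s. fst (circuit (d (K s)) (snd (circuit c s))))"
 have lobe: "fst (f s) = fst (f s') \<longleftrightarrow> K s = K s' & M s = M s'" for s s'
 proof -
  have k: "K s < lobes c" for s unfolding K_def by (rule fst_points[OF circuit_points[OF circ]])
  have l: "M s < lobes (d (K s))" for s
   unfolding M_def by (rule fst_points[OF circuit_points[OF circd[OF k]]])
  have "fst (f s) = fl (K s, M s)" for s by (simp only: fs fst_graft_incl K_def M_def)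
  then show ?thesis using flat_inj[of _ "lobes c" _ "%k. lobes (d k)", OF k l k l] by metis
 qed
 have rng: "0 <= snd (circuit c s)" "snd (circuit c s) < 1" for s
  using circuit_points[OF circ, of s] by (auto simp: points_def)
 note plc = cactus_circuit(2)[OF c] and pld = cactus_circuit(2)[OF d]
 have planar: "planar f"
  unfolding planar_def
 proof (intro conjI allI impI)
  fix s1 s2 s3
  assume s: "s1 < s2 & s2 < s3 & s3 < s1 + 1 & fst (f s1) = fst (f s2) & fst (f s2) = fst (f s3)"
  define k where "k = K s1"
  have k: "k < lobes c" unfolding k_def K_def by (rule fst_points[OF circuit_points[OF circ]])
  have e: "K s2 = k" "K s3 = k" "M s1 = M s2" "M s2 = M s3"
   using s unfolding lobe k_def by metis+
  have lb: "fst (circuit c s1) = k" "fst (circuit c s2) = k" "fst (circuit c s3) = k"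
   using e unfolding k_def K_def by simp_all
  have lm: "fst (circuit (d k) (snd (circuit c s1))) = fst (circuit (d k) (snd (circuit c s2)))"
   "fst (circuit (d k) (snd (circuit c s2))) = fst (circuit (d k) (snd (circuit c s3)))"
   using e(3,4) unfolding M_def e(1,2) k_def[symmetric] by simp_all
  have "cyc (snd (circuit c s1)) (snd (circuit c s2)) (snd (circuit c s3))"
   using s lb by (intro planarD(1)[OF plc]) simp_all
  \<comment> \<open>Cyclically ordered coordinates on the lobe of \<open>c\<close> become increasing
    times for \<open>d k\<close> within one period.\<close>
  note L = cyc_lift[OF this rng(2,1) rng rng]
  have "cyc (snd (circuit (d k) (snd (circuit c s1))))
    (snd (circuit (d k) (lift (snd (circuit c s1)) (snd (circuit c s2)))))
    (snd (circuit (d k) (lift (snd (circuit c s1)) (snd (circuit c s3)))))"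
   using L lm by (intro planarD(1)[OF pld[OF k]]) (simp_all only: circuit_lift[OF gd[OF k]])
  then show "cyc (snd (f s1)) (snd (f s2)) (snd (f s3))"
   by (simp only: fs snd_graft_incl circuit_lift[OF gd[OF k]] lb)
 next
  fix s1 s2 s3 s4
  assume s: "s1 < s2 & s2 < s3 & s3 < s4 & s4 < s1 + 1 & fst (f s1) = fst (f s3) &
    fst (f s2) = fst (f s4)"
  define k where "k = K s1"
  have k: "k < lobes c" unfolding k_def K_def by (rule fst_points[OF circuit_points[OF circ]])
  have e: "K s3 = k" "K s4 = K s2" "M s1 = M s3" "M s2 = M s4"
   using s unfolding lobe k_def by metis+
  \<comment> \<open>The visits to lobes of \<open>c\<close> alternate as well, so by planarity of
    \<open>c\<close> all four are visits to the same lobe of \<open>c\<close>.\<close>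
  have "K s1 = K s2" unfolding K_def
   using s e(1,2) by (intro planarD(2)[OF plc, of s1 s2 s3 s4]) (simp_all add: k_def K_def)
  then have e2: "K s2 = k" "K s4 = k" using e(2) by (simp_all add: k_def)
  have lb: "fst (circuit c s1) = k" "fst (circuit c s2) = k" "fst (circuit c s3) = k" "fst (circuit c s4) = k"
   using e(1) e2 unfolding k_def K_def by simp_all
  have lm: "fst (circuit (d k) (snd (circuit c s1))) = fst (circuit (d k) (snd (circuit c s3)))"
   "fst (circuit (d k) (snd (circuit c s2))) = fst (circuit (d k) (snd (circuit c s4)))"
   using e(3,4) unfolding M_def e(1) e2 k_def[symmetric] by simp_all
  have "cyc (snd (circuit c s1)) (snd (circuit c s2)) (snd (circuit c s3))"
   using s lb by (intro planarD(1)[OF plc]) simp_all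
  note L1 = cyc_lift[OF this rng(2,1) rng rng]
  have "cyc (snd (circuit c s1)) (snd (circuit c s3)) (snd (circuit c s4))"
   using s lb by (intro planarD(1)[OF plc]) simp_all
  note L2 = cyc_lift[OF this rng(2,1) rng rng]
  let ?l = "lift (snd (circuit c s1))"
  have "fst (circuit (d k) (snd (circuit c s1))) = fst (circuit (d k) (?l (snd (circuit c s2))))"
  proof (rule planarD(2)[OF pld[OF k]])
   show "snd (circuit c s1) < ?l (snd (circuit c s2))" by (rule L1(1))
   show "?l (snd (circuit c s2)) < ?l (snd (circuit c s3))" by (rule L1(2))
   show "?l (snd (circuit c s3)) < ?l (snd (circuit c s4))" by (rule L2(2))
   show "?l (snd (circuit c s4)) < snd (circuit c s1) + 1" by (rule L2(3))
  qed (simp_all only: circuit_lift[OF gd[OF k]] lm)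
  then show "fst (f s1) = fst (f s2)"
   unfolding lobe M_def e2(1) k_def[symmetric] by (simp only: circuit_lift[OF gd[OF k]] simp_thms)
 qed
 \<comment> \<open>Points of the circles of \<open>c\<close> whose images may be moved by the new
   \<open>turn\<close>: either \<open>c\<close> turns there, or the coordinate is the time of a
   visit to an intersection of \<open>d k\<close>.\<close>
 define D where "D = {p. turn c p ~= p} \<union>
  (\<Union>k<lobes c. (%p. (k, visit_time (d k) p)) ` {p. turn (d k) p ~= p})"
 have moved: "p \<in> points c" if "precactus c" "turn c p ~= p" for c p
  using that unfolding precactus_def permutes_def by blast
 have D_sub: "D <= points c"
 proof
  fix y assume "y \<in> D"
  then consider "turn c y ~= y" | k p where "k < lobes c" "turn (d k) p ~= p" "y = (k, visit_time (d k) p)"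
   unfolding D_def by blast
  then show "y \<in> points c"
  proof cases
   case 1
   then show ?thesis by (rule moved[OF pre])
  next
   case 2
   then show ?thesis
    using circuit_visit_time[OF gd[OF 2(1)] refl moved[OF pred[OF 2(1)] 2(2)]] by (simp add: points_iff)
  qed
 qed
 have fixed: "y \<in> D" if "turn c y ~= y" for y using that by (simp add: D_def)
 have turn_D: "turn c y \<in> D" if "y \<in> D" for y
  using that fixed[of "turn c y"] turn_inj[OF pre, of "turn c y" y] by (cases "turn c y = y") auto
 have turn_map: "turn G (graft_map d y) = graft_map d (turn c (fst y, visit_time (d (fst y))
   (turn (d (fst y)) (circuit (d (fst y)) (snd y)))))" if "y \<in> points c" for y
  using turn_graft[OF fst_points[OF that], of "circuit (d (fst y)) (snd y)"]
   circuit_points[OF circd[OF fst_points[OF that]]] by (simp add: graft_map_def split_beta)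
 have visit: "visit_time (d (fst y)) (circuit (d (fst y)) (snd y)) = snd y" if "y \<in> points c" for y
  using that by (intro visit_time_circuit[OF gd[OF fst_points[OF that]] refl]) (auto simp: points_def)
 have res: "is_cactus G & circuit G = f"
 proof (rule cactus_from_circuit[where F = "graft_map d ` D", OF _ _ _ _ _ _ _ good planar])
  fix i assume "i < lobes G"
  then obtain k l where "k < lobes c" "l < lobes (d k)" "i = fl (k, l)"
   unfolding lobes_graft by (rule flat_surj)
  then show "0 < radius G i"
   using radius_graft precactus_radius[OF pre] precactus_radius[OF pred] by simp
 next
  fix i assume "lobes G <= i"
  then show "radius G i = 0" by (simp add: lobes_graft) (simp add: graft_def Let_def)
 next
  have "(\<Sum>i<lobes G. radius G i) = (\<Sum>x\<in>(SIGMA k:{..<lobes c}. {..<lobes (d k)}). radius G (fl x))"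
   unfolding lobes_graft by (rule sum.reindex_bij_betw[OF flat_bij, symmetric])
  also have "... = (\<Sum>k<lobes c. \<Sum>l<lobes (d k). radius G (fl (k, l)))"
   by (subst sum.Sigma) auto
  also have "... = (\<Sum>k<lobes c. \<Sum>l<lobes (d k). radius c k * radius (d k) l)"
   by (intro sum.cong refl radius_graft) auto
  also have "... = (\<Sum>k<lobes c. radius c k * (\<Sum>l<lobes (d k). radius (d k) l))"
   by (simp add: sum_distrib_left)
  also have "... = (\<Sum>k<lobes c. radius c k)"
   by (intro sum.cong refl) (use pred in \<open>simp add: precactus_def\<close>)
  also have "... = 1" using pre by (simp add: precactus_def)
  finally show "(\<Sum>i<lobes G. radius G i) = 1" .
 next
  have "finite D" using pre pred by (auto simp: D_def precactus_def)
  then show "finite (graft_map d ` D)" by simp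
  show "graft_map d ` D <= points G" using D_sub graft_map_points by blast
 next
  fix q assume q: "q \<notin> graft_map d ` D"
  show "turn G q = q"
  proof (cases "q \<in> points G")
   case True
   then obtain y where y: "q = graft_map d y" "y \<in> points c"
    using graft_map_bij unfolding bij_betw_def by blast
   then have yD: "y \<notin> D" using q by blast
   let ?k = "fst y"
   note k = fst_points[OF y(2)]
   have "turn (d ?k) (circuit (d ?k) (snd y)) = circuit (d ?k) (snd y)"
   proof (rule ccontr)
    assume "turn (d ?k) (circuit (d ?k) (snd y)) ~= circuit (d ?k) (snd y)"
    then have "(?k, visit_time (d ?k) (circuit (d ?k) (snd y))) \<in> D" using k unfolding D_def by blast
    then show False using visit[OF y(2)] yD by simp
   qed
   moreover have "turn c y = y" using fixed[of y] yD by blast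
   ultimately show ?thesis using turn_map[OF y(2)] visit[OF y(2)] y(1) by simp
  qed (rule turn_graft_outside)
 next
  fix q assume "q \<in> graft_map d ` D"
  then obtain y where y: "q = graft_map d y" "y \<in> D" by (rule imageE)
  let ?k = "fst y"
  have yp: "y \<in> points c" using D_sub y(2) by blast
  note k = fst_points[OF yp]
  let ?p = "circuit (d ?k) (snd y)"
  have "(?k, visit_time (d ?k) (turn (d ?k) ?p)) \<in> D"
  proof (cases "turn (d ?k) ?p = ?p")
   case True
   then show ?thesis using visit[OF yp] y(2) by simp
  next
   case False
   then have "turn (d ?k) (turn (d ?k) ?p) ~= turn (d ?k) ?p" using turn_inj[OF pred[OF k]] by simp
   then show ?thesis using k unfolding D_def by blast
  qed
  then show "turn G q \<in> graft_map d ` D" using turn_map[OF yp] turn_D y(1) by simp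
 qed
 then show "is_cactus G" "circuit G = graft_map d \<circ> circuit c" by (simp_all add: f_def)
qed

end

section \<open>Relabelling and the unit cactus\<close>

lemma relabel_cactus:
 assumes c: "is_cactus c" and sg: "sg permutes {..<lobes c}"
 shows "is_cactus (relabel sg c)" "circuit (relabel sg c) = map_prod sg id \<circ> circuit c"
proof -
 let ?R = "relabel sg c" and ?h = "map_prod sg (id :: real => real)"
 let ?i = "inv_into UNIV sg"
 define f where "f = ?h \<circ> circuit c"
 note pre = cactus_pre[OF c] and gc = cactus_circuit(1)[OF c] and pl = cactus_circuit(2)[OF c]
 have circ: "is_circuit c (circuit c)" using gc by (simp add: good_circuit_def)
 have inv: "?i (sg x) = x" "sg (?i x) = x" for x
  using permutes_inverses[OF sg] by auto
 have less: "sg x < lobes c \<longleftrightarrow> x < lobes c" for x using permutes_in_image[OF sg, of x] by simp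
 have R: "lobes ?R = lobes c" "!!x. radius ?R (sg x) = radius c x"
  "!!p. turn ?R (?h p) = ?h (turn c p)" "origin ?R = ?h (origin c)"
  by (simp_all add: relabel_def inv map_prod.comp o_def prod.map_comp split: prod.splits)
 have h_pts: "?h p \<in> points ?R \<longleftrightarrow> p \<in> points c" for p by (cases p) (simp add: points_iff R less)
 have h_adv: "?h (advance c p x) = advance ?R (?h p) x" for p x
  by (cases p) (simp add: advance_pair R)
 have h_surj: "\<exists>p. q = ?h p" for q
  by (rule exI[of _ "(?i (fst q), snd q)"]) (simp add: inv prod_eq_iff)
 have h_inj: "?h p = ?h q \<longleftrightarrow> p = q" for p q
  using inv(1) by (cases p; cases q) (auto, metis)
 have "is_circuit ?R f"
  unfolding is_circuit_def
 proof (intro conjI allI)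
  show "f 0 = origin ?R" using circ by (simp add: f_def R is_circuit_def)
  show "range f <= points ?R"
   using circuit_points[OF circ] by (simp add: f_def image_subset_iff h_pts)
 next
  fix s
  obtain e where e: "e > 0" "!!h. 0 <= h ==> h < e ==> circuit c (s + h) = advance c (circuit c s) h"
   using circuit_right[OF circ, of s] by blast
  show "\<exists>\<epsilon>>0. \<forall>h\<in>{0..<\<epsilon>}. f (s + h) = advance ?R (f s) h"
   by (intro exI[of _ e] conjI ballI e(1)) (simp add: f_def e(2) h_adv)
  obtain e p where p: "e > 0" "p \<in> points c" "circuit c s = turn c p"
   "!!h. 0 < h ==> h < e ==> circuit c (s - h) = advance c p (- h)"
   using circuit_left[OF circ, of s] by blast
  show "\<exists>\<epsilon>>0. \<exists>p\<in>points ?R. f s = turn ?R p & (\<forall>h\<in>{0<..<\<epsilon>}. f (s - h) = advance ?R p (- h))"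
   by (intro exI[of _ e] conjI bexI[of _ "?h p"] ballI p(1)) (simp_all add: f_def p(2-4) h_adv R h_pts)
 qed
 then have good: "good_circuit ?R f"
  unfolding good_circuit_def
 proof (intro conjI allI)
  show "f (s + 1) = f s" for s using gc by (simp add: f_def good_circuit_def)
  have "bij_betw ?h (points c) (points ?R)"
   unfolding bij_betw_def
  proof
   show "inj_on ?h (points c)" by (rule inj_onI) (simp only: h_inj)
   show "?h ` points c = points ?R"
   proof (intro equalityI subsetI)
    fix q assume q: "q \<in> points ?R"
    obtain p where "q = ?h p" using h_surj by blast
    then show "q \<in> ?h ` points c" using q h_pts by blast
   next
    fix q assume "q \<in> ?h ` points c"
    then obtain p where "q = ?h p" "p \<in> points c" by (rule imageE)
    then show "q \<in> points ?R" by (simp only: h_pts)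
   qed
  qed
  then show "bij_betw f {0..<1} (points ?R)" unfolding f_def
   using gc by (auto simp: good_circuit_def intro: bij_betw_trans)
 qed
 have fst_eq: "fst (f s) = fst (f s') \<longleftrightarrow> fst (circuit c s) = fst (circuit c s')" for s s'
  using inv(1) by (simp add: f_def) metis
 have snd_eq: "snd (f s) = snd (circuit c s)" for s by (simp add: f_def)
 have planar: "planar f" using pl unfolding planar_def fst_eq snd_eq .
 let ?F = "?h ` {p. turn c p ~= p}"
 have res: "is_cactus ?R & circuit ?R = f"
 proof (rule cactus_from_circuit[where F = ?F, OF _ _ _ _ _ _ _ good planar])
  fix i assume i: "i < lobes ?R"
  have "radius ?R i = radius c (?i i)" using R(2)[of "?i i"] by (simp add: inv)
  moreover have "?i i < lobes c" using i less[of "?i i"] by (simp add: inv R)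
  ultimately show "0 < radius ?R i" using precactus_radius[OF pre] by simp
 next
  fix i assume i: "lobes ?R <= i"
  have "radius ?R i = radius c (?i i)" using R(2)[of "?i i"] by (simp add: inv)
  moreover have "~ ?i i < lobes c" using i less[of "?i i"] by (simp add: inv R)
  ultimately show "radius ?R i = 0" using pre by (simp add: precactus_def)
 next
  have "(\<Sum>i<lobes ?R. radius ?R i) = (\<Sum>i<lobes c. radius ?R (sg i))"
   unfolding R(1) by (rule sum.permute[OF sg, unfolded comp_def])
  then show "(\<Sum>i<lobes ?R. radius ?R i) = 1" using pre by (simp add: R precactus_def)
 next
  show "finite ?F" using pre by (simp add: precactus_def)
  show "?F <= points ?R"
  proof
   fix q assume "q \<in> ?F"
   then obtain p where "q = ?h p" "p \<in> {p. turn c p ~= p}" by (rule imageE)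
   then have "q = ?h p" "turn c p ~= p" by simp_all
   moreover from this have "p \<in> points c" using pre unfolding precactus_def permutes_def by blast
   ultimately show "q \<in> points ?R" using h_pts by simp
  qed
 next
  fix q assume q: "q \<notin> ?F"
  obtain p where p: "q = ?h p" using h_surj by blast
  then have "turn c p = p" using q by blast
  then show "turn ?R q = q" using R(3) p by simp
 next
  fix q assume "q \<in> ?F"
  then obtain p where p: "q = ?h p" "p \<in> {p. turn c p ~= p}" by (rule imageE)
  then have "turn c (turn c p) ~= turn c p" using turn_inj[OF pre] by simp
  then show "turn ?R q \<in> ?F" using R(3) p by simp
 qed
 then show "is_cactus ?R" "circuit ?R = map_prod sg id \<circ> circuit c" by (simp_all add: f_def)
qed

lemma unit_cactus:
 shows "is_cactus cactus_unit" "circuit cactus_unit = (%s. (0, frac s))"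
proof -
 let ?f = "%s :: real. (0 :: nat, frac s)"
 have pts: "points cactus_unit = {0} \<times> {0..<1}" by (auto simp: points_def cactus_unit_def)
 have adv: "advance cactus_unit (?f s) h = ?f (s + h)" for s h
  by (simp add: advance_pair cactus_unit_def frac_add_frac)
 have "is_circuit cactus_unit ?f"
  unfolding is_circuit_def
 proof (intro conjI allI)
  show "?f 0 = origin cactus_unit" by (simp add: cactus_unit_def)
  show "range ?f <= points cactus_unit" using frac_range by (auto simp: pts)
  fix s
  show "\<exists>\<epsilon>>0. \<forall>h\<in>{0..<\<epsilon>}. ?f (s + h) = advance cactus_unit (?f s) h"
   by (intro exI[of _ 1]) (simp only: adv, simp)
  show "\<exists>\<epsilon>>0. \<exists>p\<in>points cactus_unit. ?f s = turn cactus_unit p &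
    (\<forall>h\<in>{0<..<\<epsilon>}. ?f (s - h) = advance cactus_unit p (- h))"
  proof (intro exI[of _ 1] conjI bexI[of _ "?f s"] ballI)
   show "?f s = turn cactus_unit (?f s)" by (simp add: cactus_unit_def)
   show "?f s \<in> points cactus_unit" using frac_range by (auto simp: pts)
  qed (simp_all only: adv, simp_all)
 qed
 moreover have "?f (s + 1) = ?f s" for s by (simp add: frac_eq_frac_iff)
 moreover have "bij_betw ?f {0..<1} (points cactus_unit)"
  unfolding bij_betw_def pts
 proof
  show "inj_on ?f {0..<1}" by (rule inj_onI) (simp add: frac_id)
  show "?f ` {0..<1} = {0} \<times> {0..<1}"
  proof (intro equalityI subsetI)
   fix p assume "p \<in> {0 :: nat} \<times> {0..<1 :: real}"
   then have "p = ?f (snd p)" "snd p \<in> {0..<1}" by (auto simp: frac_id prod_eq_iff)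
   then show "p \<in> ?f ` {0..<1}" by (rule image_eqI)
  qed (use frac_range in auto)
 qed
 ultimately have good: "good_circuit cactus_unit ?f" unfolding good_circuit_def by blast
 have "cyc (frac s1) (frac s2) (frac s3)" if "s1 < s2" "s2 < s3" "s3 < s1 + 1" for s1 s2 s3 :: real
 proof -
  have "cyc (frac s1) (frac (frac s1 + (s2 - s1))) (frac (frac s1 + (s3 - s1)))"
   using that frac_range[of s1] by (intro cyc_frac) auto
  then show ?thesis by (simp only: frac_add_frac) simp
 qed
 then have planar: "planar ?f" unfolding planar_def by simp
 have "is_cactus cactus_unit & circuit cactus_unit = ?f"
  by (rule cactus_from_circuit[where F = "{}", OF _ _ _ _ _ _ _ good planar]) (simp_all add: cactus_unit_def)
 then show "is_cactus cactus_unit" "circuit cactus_unit = ?f" by simp_all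
qed

section \<open>Pinching\<close>

text \<open>On a half-open interval of length 1 the fractional part is a cyclic rotation, which
  keeps the cyclic order.\<close>

lemma cyc_frac_iff:
 assumes "!!u. u \<in> {u1, u2, u3} ==> x <= u & u < x + 1"
 shows "cyc (frac u1) (frac u2) (frac u3) \<longleftrightarrow> cyc u1 u2 u3"
proof -
 have f: "frac u = (if u < of_int \<lfloor>x\<rfloor> + 1 then u - of_int \<lfloor>x\<rfloor> else u - of_int \<lfloor>x\<rfloor> - 1)"
  if u: "x <= u" "u < x + 1" for u
 proof (cases "u < of_int \<lfloor>x\<rfloor> + 1")
  case True
  then have "\<lfloor>u\<rfloor> = \<lfloor>x\<rfloor>" using u by (intro floor_unique) linarith+
  then show ?thesis using True by (simp add: frac_def)
 next
  case False
  then have "\<lfloor>u\<rfloor> = \<lfloor>x\<rfloor> + 1" using u by (intro floor_unique) (simp_all, linarith+)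
  then show ?thesis using False by (simp add: frac_def)
 qed
 have b: "x <= u1" "u1 < x + 1" "x <= u2" "u2 < x + 1" "x <= u3" "u3 < x + 1" using assms by auto
 have "of_int \<lfloor>x\<rfloor> <= x" by simp
 then show ?thesis unfolding f[OF b(1,2)] f[OF b(3,4)] f[OF b(5,6)] using b by (auto simp: cyc_def)
qed

lemma floor_right:
 fixes x :: real
 obtains e where "e > 0" "!!h. 0 <= h ==> h < e ==> frac (x + h) = frac x + h"
proof (rule that[of "1 - frac x"])
 show "0 < 1 - frac x" using frac_lt_1[of x] by simp
 fix h assume h: "0 <= h" "h < 1 - frac x"
 have "frac (x + h) = frac (frac x + h)" by (simp add: frac_add_frac)
 also have "... = frac x + h" using h frac_ge_0[of x] by (intro frac_id) auto
 finally show "frac (x + h) = frac x + h" .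
qed

lemma frac_minus:
 fixes x :: real
 assumes "0 < h" "h <= (if frac x = 0 then 1 else frac x)"
 shows "frac (x - h) = (if frac x = 0 then 1 - h else frac x - h)"
proof -
 have e: "frac (x - h) = frac (frac x - h)" using frac_add_frac[of x "- h"] by simp
 show ?thesis
 proof (cases "frac x = 0")
  case True
  have "frac (x - h) = frac (1 - h)" unfolding e True by (simp add: frac_eq_frac_iff)
  also have "... = 1 - h" using assms True by (intro frac_id) auto
  finally show ?thesis using True by simp
 next
  case False
  then show ?thesis unfolding e using assms frac_lt_1[of x] by (simp add: frac_id)
 qed
qed

section \<open>Segments of the lobes and segments of the path\<close>

lemma circuit_marks:
 assumes c: "is_cactus c" and X: "marked c X"
 shows "mark_set (on_circuit c X)" "card (on_circuit c X) = card X" "bij_betw (circuit c) (on_circuit c X) X"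
proof -
 note gc = cactus_circuit(1)[OF c]
 have bij: "bij_betw (circuit c) {0..<1} (points c)" using gc by (simp add: good_circuit_def)
 have sub: "X <= circuit c ` {0..<1}" using bij X by (simp add: bij_betw_def marked_def)
 have img: "circuit c ` on_circuit c X = X"
 proof (intro equalityI subsetI)
  fix p assume "p \<in> X"
  then obtain s where "p = circuit c s" "s \<in> {0..<1}" using sub by blast
  then show "p \<in> circuit c ` on_circuit c X" using \<open>p \<in> X\<close> by (simp add: on_circuit_def)
 qed (auto simp: on_circuit_def)
 have inj: "inj_on (circuit c) (on_circuit c X)"
  using bij by (auto simp: bij_betw_def on_circuit_def inj_on_def)
 show b: "bij_betw (circuit c) (on_circuit c X) X" using img inj by (simp add: bij_betw_def)
 show "card (on_circuit c X) = card X" by (rule bij_betw_same_card[OF b])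
 have "finite (on_circuit c X)" using bij_betw_finite[OF b] X by (simp add: marked_def)
 moreover have "circuit c 0 = origin c" using gc by (simp add: good_circuit_def is_circuit_def)
 ultimately show "mark_set (on_circuit c X)" using X by (auto simp: mark_set_def on_circuit_def marked_def)
qed

lemma seg_index_eq: "seg_index c X k i = mark_rank (on_circuit c X) (visit_time c (k, nth_mark (on_lobe X k) i))"
 by (simp add: seg_index_def mark_rank_def)

lemma seg_index_props:
 assumes c: "is_cactus c" and X: "marked c X" and k: "k < lobes c" and i: "i < spines X k"
 shows "seg_index c X k i < card X"
  "nth_mark (on_circuit c X) (seg_index c X k i) = visit_time c (k, nth_mark (on_lobe X k) i)"
  "circuit c (nth_mark (on_circuit c X) (seg_index c X k i)) = (k, nth_mark (on_lobe X k) i)"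
proof -
 note T = circuit_marks[OF c X] and A = lobe_marks[OF X k]
 have "nth_mark (on_lobe X k) i \<in> on_lobe X k"
  using A i by (intro nth_mark_in) (simp_all add: mark_set_def spines_def)
 then have x: "(k, nth_mark (on_lobe X k) i) \<in> X" by (simp add: on_lobe_iff)
 then have xp: "(k, nth_mark (on_lobe X k) i) \<in> points c" using X by (auto simp: marked_def)
 note v = circuit_visit_time[OF cactus_circuit(1)[OF c] refl xp]
 have in_T: "visit_time c (k, nth_mark (on_lobe X k) i) \<in> on_circuit c X"
  using v x by (simp add: on_circuit_def)
 show "seg_index c X k i < card X"
  using nth_mark_rank(2)[OF T(1) in_T] T(2) by (simp add: seg_index_eq)
 show e: "nth_mark (on_circuit c X) (seg_index c X k i) = visit_time c (k, nth_mark (on_lobe X k) i)"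
  using nth_mark_rank(1)[OF T(1) in_T] by (simp add: seg_index_eq)
 show "circuit c (nth_mark (on_circuit c X) (seg_index c X k i)) = (k, nth_mark (on_lobe X k) i)"
  unfolding e by (rule v)
qed

lemma seg_index_eqI:
 assumes c: "is_cactus c" and X: "marked c X" and j: "j < card X"
  and e: "circuit c (nth_mark (on_circuit c X) j) = (k, nth_mark (on_lobe X k) i)"
 shows "seg_index c X k i = j"
proof -
 note T = circuit_marks[OF c X]
 have r: "0 <= nth_mark (on_circuit c X) j" "nth_mark (on_circuit c X) j < 1"
  using nth_mark_range[OF T(1)] j T(2) by simp_all
 have "visit_time c (k, nth_mark (on_lobe X k) i) = nth_mark (on_circuit c X) j"
  unfolding e[symmetric] by (rule visit_time_circuit[OF cactus_circuit(1)[OF c] refl r])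
 then show ?thesis using mark_rank_nth[OF T(1), of j] j T(2) by (simp add: seg_index_eq)
qed

text \<open>Together with \<open>seg_index_inj\<close>: the positions along the path number the
  segments of all lobes, each exactly once.\<close>

lemma seg_index_surj:
 assumes c: "is_cactus c" and X: "marked c X" and j: "j < card X"
 obtains k i where "k < lobes c" "i < spines X k" "seg_index c X k i = j"
proof -
 note T = circuit_marks[OF c X]
 obtain k t where kt: "circuit c (nth_mark (on_circuit c X) j) = (k, t)" by fastforce
 have "nth_mark (on_circuit c X) j \<in> on_circuit c X"
  using T j by (intro nth_mark_in) (simp_all add: mark_set_def)
 then have "(k, t) \<in> X" using kt by (simp add: on_circuit_def)
 then have k: "k < lobes c" and t: "t \<in> on_lobe X k"
  using X by (auto simp: marked_def on_lobe_iff points_def)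
 note A = lobe_marks[OF X k]
 obtain i where i: "i < card (on_lobe X k)" "nth_mark (on_lobe X k) i = t"
  using nth_mark_surj[of "on_lobe X k" t] A t unfolding mark_set_def by blast
 have "seg_index c X k i = j" by (rule seg_index_eqI[OF c X j]) (simp add: kt i)
 then show thesis using that[of k i] k i by (simp add: spines_def)
qed

lemma seg_index_inj:
 assumes c: "is_cactus c" and X: "marked c X" and "k < lobes c" "i < spines X k" "k' < lobes c" "i' < spines X k'"
  and e: "seg_index c X k i = seg_index c X k' i'"
 shows "k = k'" "i = i'"
proof -
 have e2: "(k, nth_mark (on_lobe X k) i) = (k', nth_mark (on_lobe X k') i')"
  using seg_index_props(3)[OF c X assms(3,4)] seg_index_props(3)[OF c X assms(5,6)]
  unfolding e by (rule trans[OF sym])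
 show kk: "k = k'" using e2 by (rule Pair_inject)
 have "nth_mark (on_lobe X k) i = nth_mark (on_lobe X k') i'" using e2 by (rule Pair_inject)
 then have "nth_mark (on_lobe X k) i = nth_mark (on_lobe X k) i'" unfolding kk .
 then show "i = i'"
  using nth_mark_eq_iff[OF lobe_marks[OF X assms(3)], of i i'] assms(4,6) kk by (simp add: spines_def)
qed

lemma seg_travel:
 assumes c: "is_cactus c" and X: "marked c X" and k: "k < lobes c" and i: "i < spines X k"
  and s: "circuit c s = (k, nth_mark (on_lobe X k) i)"
 defines "a \<equiv> nth_mark (on_lobe X k) i" and "b \<equiv> nth_mark (on_lobe X k) (Suc i)"
 shows "!!h. 0 <= h ==> h < radius c k * (b - a) ==> circuit c (s + h) = (k, a + h / radius c k)"
  "circuit c (s + radius c k * (b - a)) = turn c (k, frac b)"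
  "!!t. a < t ==> t < b ==> (k, t) \<notin> X" "0 <= a" "a < b" "b <= 1"
proof -
 note A = lobe_marks[OF X k]
 have circ: "is_circuit c (circuit c)" using cactus_circuit(1)[OF c] by (simp add: good_circuit_def)
 have i': "i < card (on_lobe X k)" using i by (simp add: spines_def)
 have aA: "a \<in> on_lobe X k" unfolding a_def using A i' by (intro nth_mark_in) (simp_all add: mark_set_def)
 have b: "b = next_mark (on_lobe X k) a" unfolding a_def b_def by (rule next_mark_nth[OF A i', symmetric])
 note nm = next_mark_bounds[OF A aA, folded b]
 show notin: "(k, t) \<notin> X" if "a < t" "t < b" for t
  using nm(4)[of t] that by (auto simp: on_lobe_iff)
 have fixed: "turn c (k, t) = (k, t)" if "a < t" "t < b" for t
  using notin[OF that] X by (auto simp: marked_def)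
 show a0: "0 <= a" using aA A by (auto simp: mark_set_def)
 show "a < b" "b <= 1" using nm by auto
 note tr = circuit_travel[OF cactus_pre[OF c] circ s[folded a_def] a0 nm(1,2) fixed]
 show "!!h. 0 <= h ==> h < radius c k * (b - a) ==> circuit c (s + h) = (k, a + h / radius c k)"
  "circuit c (s + radius c k * (b - a)) = turn c (k, frac b)"
  using tr by blast+
qed

text \<open>The next mark in time cannot come before the end of the segment, as no spine lies inside
  a segment of a lobe, and it cannot come later, as the end of the segment is a spine and
  \<open>turn\<close> takes spines to spines.\<close>

lemma gaps_on_circuit:
 assumes c: "is_cactus c" and X: "marked c X" and k: "k < lobes c" and i: "i < spines X k"
 shows "gaps (on_circuit c X) (seg_index c X k i) = radius c k * gaps (on_lobe X k) i"
proof -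
 let ?j = "seg_index c X k i" and ?T = "on_circuit c X" and ?A = "on_lobe X k"
 note T = circuit_marks[OF c X] and A = lobe_marks[OF X k] and p = seg_index_props[OF c X k i]
 note gc = cactus_circuit(1)[OF c] and tr = seg_travel[OF c X k i p(3)]
 have r: "0 < radius c k" by (rule precactus_radius[OF cactus_pre[OF c] k])
 let ?L = "radius c k * (nth_mark ?A (Suc i) - nth_mark ?A i)"
 have L: "0 < ?L" using r tr(5) by simp
 let ?s = "nth_mark ?T ?j"
 have j: "?j < card ?T" using p(1) T(2) by simp
 have sT: "?s \<in> ?T" using T j by (intro nth_mark_in) (simp_all add: mark_set_def)
 have nxt: "nth_mark ?T (Suc ?j) = next_mark ?T ?s" by (rule next_mark_nth[OF T(1) j, symmetric])
 note nm = next_mark_bounds[OF T(1) sT]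
 have inner: "circuit c (?s + h) \<notin> X" if "0 < h" "h < ?L" for h
 proof -
  have "h / radius c k < nth_mark ?A (Suc i) - nth_mark ?A i"
   unfolding pos_divide_less_eq[OF r] using that by (simp add: mult.commute)
  moreover have "0 < h / radius c k" using that r by simp
  ultimately show ?thesis using tr(1)[of h] tr(3) that by simp
 qed
 have frac_T: "frac (next_mark ?T ?s) \<in> ?T" by (rule nm(3))
 have "circuit c (next_mark ?T ?s) \<in> X"
  using frac_T good_circuit_frac[OF gc, of "next_mark ?T ?s"] by (simp add: on_circuit_def)
 then have "~ next_mark ?T ?s - ?s < ?L" using inner[of "next_mark ?T ?s - ?s"] nm(1) by auto
 moreover have "~ ?L < next_mark ?T ?s - ?s"
 proof
  assume lt: "?L < next_mark ?T ?s - ?s"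
  have "(k, frac (nth_mark ?A (Suc i))) \<in> X"
  proof -
   have "nth_mark ?A i \<in> ?A" using A i by (intro nth_mark_in) (simp_all add: mark_set_def spines_def)
   then have "frac (next_mark ?A (nth_mark ?A i)) \<in> ?A" by (rule next_mark_bounds(3)[OF A])
   then show ?thesis using next_mark_nth[OF A, of i] i by (simp add: spines_def on_lobe_iff)
  qed
  then have "circuit c (?s + ?L) \<in> X"
   unfolding tr(2) by (rule turn_in_marked[OF cactus_pre[OF c] X])
  moreover have "0 <= ?s + ?L" "?s + ?L < 1" using lt nm(2) L nth_mark_range[OF T(1) j] by auto
  ultimately have "?s + ?L \<in> ?T" by (simp add: on_circuit_def)
  then show False using nm(4)[of "?s + ?L"] L lt by simp
 qed
 ultimately have "next_mark ?T ?s - ?s = ?L" by simp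
 then show ?thesis using nxt j i by (simp add: gaps_def spines_def)
qed

section \<open>The pinched cactus and its path\<close>

definition pinch_inv :: "real => real => real => real" where
 "pinch_inv a b u = (u - (b - a)) / (1 - (b - a))"

text \<open>On the remaining arc, lifted to the interval from \<open>b\<close> to
  \<open>a + 1\<close>, pinching is the affine map \<open>pinch_inv a b\<close> modulo 1. The two
  cases of \<open>pinch_coord\<close> beyond the pinched segment and before it differ by a full
  turn.\<close>

lemma pinch_coord_arc:
 assumes "0 <= a" "a < b" "b <= 1" "b - a < 1" "b <= u" "u <= a + 1"
 shows "pinch_coord a b (frac u) = frac (pinch_inv a b u)"
proof (cases "u < 1")
 case True
 then have "frac u = u" using assms by (intro frac_id) auto
 then show ?thesis using assms by (auto simp: pinch_coord_def pinch_inv_def)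
next
 case False
 then have "frac u = u - 1"
 proof -
  have "frac u = frac (u - 1)" by (simp add: frac_eq_frac_iff)
  also have "... = u - 1"
  proof (cases "u = 2")
   case True
   then show ?thesis using assms by simp
  qed (use False assms in \<open>auto intro!: frac_id\<close>)
  finally show ?thesis .
 qed
 moreover have "(u - (b - a)) / (1 - (b - a)) = (u - 1) / (1 - (b - a)) + 1"
  using assms by (simp add: field_simps)
 ultimately show ?thesis using assms False
  by (simp add: pinch_coord_def pinch_inv_def frac_eq_frac_iff)
qed

context
 fixes c X k i
 assumes c: "is_cactus c" and X: "marked c X" and k: "k < lobes c" and i: "i < spines X k"
  and two: "2 <= spines X k"
begin

private definition "a = nth_mark (on_lobe X k) i"
private definition "b = nth_mark (on_lobe X k) (Suc i)"
private definition "w = b - a"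
private definition "dl = radius c k * (b - a)"
private definition "f = circuit c"
private definition "sg = visit_time c (k, a)"
private definition "K = pinch_map X k i"
private definition "P = pinch c X k i"
private definition "skip = (%p. if p = (k, a) then turn c (k, frac b) else p)"
private definition "lft = (%q. if q = K (k, a) then (k, a) else inv_into (points c) K q)"
text \<open>The old path with the time interval from \<open>sg\<close> to \<open>sg + dl\<close> cut
  out, rescaled to period 1 and started at the end of the gap. The new path \<open>f'\<close> leaves
  the pinched point at time \<open>sg / (1 - dl)\<close> modulo 1, so that time 0 still belongs to
  the origin.\<close>

private definition "g x = f (sg + dl + (1 - dl) * frac x)"
private definition "f' s = K (g (s - sg / (1 - dl)))"

private lemma pre: "precactus c" by (rule cactus_pre[OF c])
private lemma gc_9: "good_circuit c f" unfolding f_def by (rule cactus_circuit(1)[OF c])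
private lemma circ_9: "is_circuit c f" using gc_9 by (simp add: good_circuit_def)
private lemma A: "mark_set (on_lobe X k)" by (rule lobe_marks[OF X k])
private lemma r: "0 < radius c k" by (rule precactus_radius[OF pre k])

private lemma f_sigma: "f sg = (k, a)" and sigma: "0 <= sg" "sg < 1" and aX: "(k, a) \<in> X"
proof -
 have "a \<in> on_lobe X k" unfolding a_def using A i by (intro nth_mark_in) (simp_all add: mark_set_def spines_def)
 then show "(k, a) \<in> X" by (simp add: on_lobe_iff)
 then have "(k, a) \<in> points c" using X by (auto simp: marked_def)
 note v = circuit_visit_time[OF gc_9[unfolded f_def] refl this]
 show "f sg = (k, a)" "0 <= sg" "sg < 1" using v by (simp_all add: f_def sg_def)
qed

private lemma travel:
 "!!h. 0 <= h ==> h < dl ==> f (sg + h) = (k, a + h / radius c k)"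
 "f (sg + dl) = turn c (k, frac b)"
 "!!t. a < t ==> t < b ==> (k, t) \<notin> X" "0 <= a" "a < b" "b <= 1"
 using seg_travel[OF c X k i f_sigma[unfolded f_def a_def]] unfolding dl_def f_def a_def b_def by blast+

private lemma bX: "(k, frac b) \<in> X"
proof -
 have "a \<in> on_lobe X k" using aX by (simp add: on_lobe_iff)
 then have "frac (next_mark (on_lobe X k) a) \<in> on_lobe X k" by (rule next_mark_bounds(3)[OF A])
 then show ?thesis using next_mark_nth[OF A, of i] i by (simp add: spines_def on_lobe_iff a_def b_def)
qed

private lemma w: "0 < w" "w < 1"
proof -
 show "0 < w" using travel(5) by (simp add: w_def)
 \<comment> \<open>A second spine on the lobe prevents the segment from being the whole
   circle.\<close>
 have "a ~= 0 | b ~= 1"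
 proof (cases "i = 0")
  case True
  then have "Suc i < card (on_lobe X k)" using two by (simp add: spines_def)
  then show ?thesis using nth_mark_range[OF A, of "Suc i"] by (auto simp: b_def)
 next
  case False
  then show ?thesis using nth_mark_less[OF A, of 0 i] nth_mark_zero[OF A] i by (auto simp: a_def spines_def)
 qed
 then show "w < 1" using travel(4-6) by (auto simp: w_def)
qed

private lemma radius_le: "radius c k <= 1"
proof -
 have "radius c k <= (\<Sum>l<lobes c. radius c l)"
  using k precactus_radius[OF pre] by (intro member_le_sum) (auto intro: less_imp_le)
 then show ?thesis using pre by (simp add: precactus_def)
qed

private lemma delta: "0 < dl" "dl < 1"
proof -
 show "0 < dl" using r w by (simp add: dl_def w_def)
 have "dl <= 1 * w" unfolding dl_def w_def[symmetric] using radius_le w by (intro mult_right_mono) auto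
 then show "dl < 1" using w by simp
qed

private lemma not_in_X: "f (sg + h) \<notin> X" if "0 < h" "h < dl"
proof -
 have "h / radius c k < b - a" unfolding pos_divide_less_eq[OF r] using that by (simp add: dl_def mult.commute)
 moreover have "0 < h / radius c k" using that r by simp
 ultimately show ?thesis using travel(1)[of h] travel(3) that by simp
qed

text \<open>The origin is a spine, so time 1 cannot fall strictly inside the pinched
  segment.\<close>

private lemma sigma_delta: "sg + dl <= 1"
proof (rule ccontr)
 assume "~ sg + dl <= 1"
 then have "f (sg + (1 - sg)) \<notin> X" using sigma by (intro not_in_X) auto
 moreover have "f 1 = f 0" using good_circuit_int[OF gc_9, of 0 1] by simp
 moreover have "f 0 \<in> X" using circ_9 X by (simp add: is_circuit_def marked_def)
 ultimately show False by simp
qed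

text \<open>The part of the pinched lobe that remains is the arc from \<open>b\<close> to \<open>a + 1\<close>.\<close>

private definition "remains p \<longleftrightarrow> p \<in> points c & (fst p = k --> snd p < a | b <= snd p)"
text \<open>The same arc with the other end closed: it contains \<open>a\<close> instead of
  \<open>b\<close>. \<open>remains\<close> describes where the path leaves from,
  \<open>arrives\<close> where it comes from; the collapse \<open>K\<close> is injective on
  either.\<close>

private definition "arrives p \<longleftrightarrow> p \<in> points c & (fst p = k --> snd p <= a | b < snd p) & p ~= (k, frac b)"

private lemma K_pair: "K (l, t) = (l, if l = k then pinch_coord a b t else t)"
 by (simp add: K_def pinch_map_def a_def b_def)

private lemma fst_K: "fst (K p) = fst p" by (cases p) (simp add: K_pair)

private lemma K_other: "fst p ~= k ==> K p = p" by (cases p) (simp add: K_pair)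

private lemma K_arc: "b <= u ==> u <= a + 1 ==> K (k, frac u) = (k, frac (pinch_inv a b u))"
 using pinch_coord_arc[of a b u] travel(4-6) w by (simp add: K_pair w_def)

private lemma pinch_inv_less: "u < v ==> pinch_inv a b u < pinch_inv a b v"
 using w by (simp add: pinch_inv_def w_def divide_strict_right_mono)

private lemma pinch_inv_add: "pinch_inv a b (u + x) = pinch_inv a b u + x / (1 - w)"
 by (simp add: pinch_inv_def w_def diff_divide_distrib add_divide_distrib)

private lemma pinch_inv_diff: "pinch_inv a b (a + 1) = pinch_inv a b b + 1"
 using w by (simp add: pinch_inv_def w_def field_simps)

private lemma remains_arc:
 assumes "remains p" "fst p = k"
 obtains u where "b <= u" "u < a + 1" "p = (k, frac u)"
proof (cases "snd p < a")
 case True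
 then show thesis using that[of "snd p + 1"] assms travel(4-6)
  by (auto simp: remains_def points_def frac_eq_frac_iff prod_eq_iff frac_1_eq frac_id)
next
 case False
 then show thesis using that[of "snd p"] assms travel(4-6)
  by (auto simp: remains_def points_def prod_eq_iff frac_id)
qed

private lemma arrives_arc:
 assumes "arrives p" "fst p = k"
 obtains u where "b < u" "u <= a + 1" "p = (k, frac u)"
proof (cases "snd p <= a")
 case True
 have "b < snd p + 1"
 proof (rule ccontr)
  assume "~ b < snd p + 1"
  then have "b = 1" "snd p = 0" using assms travel(6) by (auto simp: arrives_def points_def)
  then show False using assms by (auto simp: arrives_def prod_eq_iff)
 qed
 then show thesis using that[of "snd p + 1"] True assms
  by (auto simp: arrives_def points_def prod_eq_iff frac_1_eq frac_id)
next
 case False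
 then show thesis using that[of "snd p"] assms travel(4-6)
  by (auto simp: arrives_def points_def prod_eq_iff frac_id)
qed

private lemma inv_arc_inj:
 assumes "pinch_inv a b u - pinch_inv a b v \<in> \<int>" "\<bar>u - v\<bar> < 1 - w"
 shows "u = v"
proof -
 have e: "pinch_inv a b u - pinch_inv a b v = (u - v) / (1 - w)"
  by (simp add: pinch_inv_def w_def diff_divide_distrib)
 obtain n where n: "(u - v) / (1 - w) = of_int n" using assms(1) unfolding e by (rule Ints_cases)
 then have uv: "u - v = of_int n * (1 - w)" using w by (simp add: field_simps)
 then have "\<bar>of_int n :: real\<bar> * (1 - w) < 1 * (1 - w)" using assms(2) w by (simp add: abs_mult)
 then have "\<bar>of_int n :: real\<bar> < 1" using w by (simp only: mult_less_cancel_right)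
 then have "n = 0" by linarith
 then show ?thesis using uv by simp
qed

private lemma K_inj_remains:
 assumes "remains p" "remains q" "K p = K q"
 shows "p = q"
proof (cases "fst p = k")
 case True
 then have "fst q = k" using assms(3) fst_K by metis
 obtain u where u: "b <= u" "u < a + 1" "p = (k, frac u)" using remains_arc[OF assms(1) True] .
 obtain v where v: "b <= v" "v < a + 1" "q = (k, frac v)" using remains_arc[OF assms(2) \<open>fst q = k\<close>] .
 have "frac (pinch_inv a b u) = frac (pinch_inv a b v)"
  using assms(3) K_arc[of u] K_arc[of v] u v by simp
 then have "u = v" unfolding frac_eq_frac_iff
  by (rule inv_arc_inj) (use u v in \<open>auto simp: w_def\<close>)
 then show ?thesis using u v by simp
next
 case False
 then have "fst q ~= k" using assms(3) fst_K by metis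
 then show ?thesis using assms(3) False by (simp add: K_other)
qed

private lemma K_pinched:
 assumes "p \<in> points c" "~ remains p | p = (k, frac b)"
 shows "K p = K (k, a)" "fst p = k"
proof -
 have Kb: "K (k, frac b) = K (k, a)"
 proof (cases "b < 1")
  case True
  then have "frac b = b" using travel(4-6) by (intro frac_id) auto
  then show ?thesis using travel(5) by (simp add: K_pair pinch_coord_def)
 next
  case False
  then have "b = 1" using travel(6) by simp
  moreover have "a ~= 0" using w \<open>b = 1\<close> by (auto simp: w_def)
  ultimately show ?thesis using travel(4) by (simp add: K_pair pinch_coord_def frac_eq_frac_iff)
 qed
 show "fst p = k" using assms by (auto simp: remains_def)
 show "K p = K (k, a)"
 proof (cases "p = (k, frac b)")
  case False
  then have "~ remains p" using assms by simp
  then have "fst p = k" "a <= snd p" "snd p < b" using assms(1) by (auto simp: remains_def)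
  then show ?thesis by (cases p) (simp add: K_pair pinch_coord_def)
 qed (simp add: Kb)
qed

private lemma remains_b: "remains (k, frac b)"
 using travel(4-6) k w by (cases "b = 1") (auto simp: remains_def points_iff frac_id w_def)

private lemma arrives_remains: "arrives p ==> p = (k, a) | remains p"
 by (auto simp: arrives_def remains_def prod_eq_iff)

private lemma a_pts: "(k, a) \<in> points c" using aX X by (auto simp: marked_def)

private lemma K_points: "p \<in> points c ==> K p \<in> points c"
 using frac_range by (cases p) (auto simp: K_pair points_iff pinch_coord_def)

text \<open>Away from the pinched point \<open>K\<close> is injective on the remaining arc; over the
  pinched point \<open>lft\<close> picks \<open>a\<close>, its only preimage in
  \<open>arrives\<close>.\<close>

private lemma lft_K: "arrives p ==> lft (K p) = p"
proof -
 assume p: "arrives p"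
 show ?thesis
 proof (cases "p = (k, a)")
  case False
  then have rp: "remains p" using arrives_remains[OF p] by simp
  have ne: "K p ~= K (k, a)"
  proof
   assume "K p = K (k, a)"
   then have "K p = K (k, frac b)" using K_pinched(1)[of "(k, frac b)"] remains_b by (simp add: remains_def)
   then have "p = (k, frac b)" by (rule K_inj_remains[OF rp remains_b])
   then show False using p by (simp add: arrives_def)
  qed
  have img: "K p \<in> K ` points c" using rp by (simp add: remains_def)
  define q where "q = inv_into (points c) K (K p)"
  have q: "q \<in> points c" "K q = K p"
   unfolding q_def by (rule inv_into_into[OF img], rule f_inv_into_f[OF img])
  have "remains q" using K_pinched(1)[OF q(1)] q(2) ne by metis
  then have "q = p" using K_inj_remains[OF _ rp q(2)] by simp
  then show ?thesis using ne by (simp add: lft_def q_def)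
 qed (simp add: lft_def)
qed

private lemma pinch_simps:
 "lobes P = lobes c" "origin P = K (skip (origin c))"
 "q \<in> points c ==> turn P q = K (skip (turn c (lft q)))" "q \<notin> points c ==> turn P q = q"
 "radius P l = (if l = k then radius c k * (1 - w) else radius c l) / (1 - dl)"
 unfolding P_def pinch_def Let_def skip_def lft_def K_def a_def b_def w_def dl_def by simp_all

private lemma points_P: "points P = points c" by (simp add: points_def pinch_simps)

private lemma advance_remains:
 assumes "remains p"
 obtains e where "e > 0" "!!h. 0 <= h ==> h < e ==> K (advance c p ((1 - dl) * h)) = advance P (K p) h"
proof (cases "fst p = k")
 case False
 show thesis
 proof (rule that[of 1])
  fix h :: real
  have "fst (advance c p ((1 - dl) * h)) ~= k" using False by simp
  then show "K (advance c p ((1 - dl) * h)) = advance P (K p) h"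
   using False delta by (cases p) (simp add: K_other advance_pair pinch_simps mult.commute)
 qed simp
next
 case True
 obtain u where u: "b <= u" "u < a + 1" "p = (k, frac u)" using remains_arc[OF assms True] .
 show thesis
 proof (rule that[of "radius c k * (a + 1 - u) / (1 - dl)"])
  show "0 < radius c k * (a + 1 - u) / (1 - dl)" using r delta u by simp
  fix h assume h: "0 <= h" "h < radius c k * (a + 1 - u) / (1 - dl)"
  let ?x = "(1 - dl) * h / radius c k"
  have "h * (1 - dl) < radius c k * (a + 1 - u)" using h(2) delta by (simp add: pos_less_divide_eq)
  then have x: "0 <= ?x" "?x < a + 1 - u"
   using h r delta by (simp_all add: pos_divide_less_eq mult.commute)
  have "advance c p ((1 - dl) * h) = (k, frac (u + ?x))" by (simp add: u(3) advance_pair frac_add_frac)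
  then have "K (advance c p ((1 - dl) * h)) = (k, frac (pinch_inv a b (u + ?x)))"
   using K_arc[of "u + ?x"] u x by simp
  also have "pinch_inv a b (u + ?x) = pinch_inv a b u + ?x / (1 - w)"
   by (rule pinch_inv_add)
  also have "?x / (1 - w) = h / radius P k" by (simp add: pinch_simps mult.commute)
  also have "(k, frac (pinch_inv a b u + h / radius P k)) = advance P (K p) h"
   using K_arc[of u] u by (simp add: advance_pair frac_add_frac)
  finally show "K (advance c p ((1 - dl) * h)) = advance P (K p) h" .
 qed
qed

private lemma advance_arrives:
 assumes "arrives p"
 obtains e where "e > 0" "!!h. 0 <= h ==> h < e ==> K (advance c p (- ((1 - dl) * h))) = advance P (K p) (- h)"
proof (cases "fst p = k")
 case False
 show thesis
 proof (rule that[of 1])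
  fix h :: real
  have "fst (advance c p (- ((1 - dl) * h))) ~= k" using False by simp
  then show "K (advance c p (- ((1 - dl) * h))) = advance P (K p) (- h)"
   using False delta by (cases p) (simp add: K_other advance_pair pinch_simps mult.commute)
 qed simp
next
 case True
 obtain u where u: "b < u" "u <= a + 1" "p = (k, frac u)" using arrives_arc[OF assms True] .
 show thesis
 proof (rule that[of "radius c k * (u - b) / (1 - dl)"])
  show "0 < radius c k * (u - b) / (1 - dl)" using r delta u by simp
  fix h assume h: "0 <= h" "h < radius c k * (u - b) / (1 - dl)"
  let ?x = "(1 - dl) * h / radius c k"
  have "h * (1 - dl) < radius c k * (u - b)" using h(2) delta by (simp add: pos_less_divide_eq)
  then have x: "0 <= ?x" "?x < u - b"
   using h r delta by (simp_all add: pos_divide_less_eq mult.commute)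
  have "advance c p (- ((1 - dl) * h)) = (k, frac (u - ?x))"
   using frac_add_frac[of u "- ?x"] by (simp add: u(3) advance_pair)
  then have "K (advance c p (- ((1 - dl) * h))) = (k, frac (pinch_inv a b (u - ?x)))"
   using K_arc[of "u - ?x"] u x by simp
  also have "pinch_inv a b (u - ?x) = pinch_inv a b u - ?x / (1 - w)"
   using pinch_inv_add[of u "- ?x"] by simp
  also have "pinch_inv a b u - ?x / (1 - w) = pinch_inv a b u + - h / radius P k"
   by (simp add: pinch_simps mult.commute)
  also have "(k, frac (pinch_inv a b u + - h / radius P k)) = advance P (K p) (- h)"
   using K_arc[of u] u frac_add_frac[of "pinch_inv a b u" "- h / radius P k"] by (simp add: advance_pair)
  finally show "K (advance c p (- ((1 - dl) * h))) = advance P (K p) (- h)" .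
 qed
qed

text \<open>The pinched segment is run through between the times \<open>sg\<close> and
  \<open>sg + dl\<close>, and the path visits every point only once per period.\<close>

private lemma f_remains: "0 <= y ==> y < 1 - dl ==> remains (f (sg + dl + y))"
proof -
 assume y: "0 <= y" "y < 1 - dl"
 let ?p = "f (sg + dl + y)"
 have pts: "?p \<in> points c" by (rule circuit_points[OF circ_9])
 have False if t: "fst ?p = k" "a <= snd ?p" "snd ?p < b"
 proof -
  let ?h = "radius c k * (snd ?p - a)"
  have h: "0 <= ?h" "?h < dl" using t r by (auto simp: dl_def)
  have "f (sg + ?h) = ?p" using travel(1)[OF h] r t(1) by (simp add: prod_eq_iff)
  then have "sg + ?h = sg + dl + y" using h y delta by (intro good_circuit_inj[OF gc_9]) auto
  then show False using h y by simp
 qed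
 then have "~ (fst ?p = k & a <= snd ?p & snd ?p < b)" by blast
 then show ?thesis using pts unfolding remains_def by (metis not_le)
qed

private lemma g_remains: "remains (g x)"
 unfolding g_def
proof (rule f_remains)
 show "0 <= (1 - dl) * frac x" using delta frac_ge_0[of x] by simp
 have "(1 - dl) * frac x < (1 - dl) * 1" using delta frac_lt_1[of x] by (intro mult_strict_left_mono) auto
 then show "(1 - dl) * frac x < 1 - dl" by simp
qed

text \<open>If the old path passes from \<open>q\<close> to a point reached after
  \<open>sg + dl\<close>, then \<open>q\<close> is not the end of the pinched segment, which is
  reached at time \<open>sg + dl\<close>, and does not lie inside the segment, where nothing
  turns.\<close>

private lemma arrivesI:
 assumes q: "q \<in> points c" and t: "turn c q = f (sg + dl + y)" and y: "0 < y" "y <= 1 - dl"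
 shows "arrives q"
proof -
 have "q ~= (k, frac b)"
 proof
  assume "q = (k, frac b)"
  then have "f (sg + dl) = f (sg + dl + y)" using t travel(2) by simp
  then have "sg + dl = sg + dl + y" using y delta by (intro good_circuit_inj[OF gc_9]) auto
  then show False using y by simp
 qed
 moreover have False if k: "fst q = k" "a < snd q" "snd q < b"
 proof -
  have kq: "q = (k, snd q)" using k(1) by (simp add: prod_eq_iff)
  have "(k, snd q) \<notin> X" by (rule travel(3)[OF k(2,3)])
  then have "turn c q = q" using X kq by (auto simp: marked_def)
  then have fq: "q = f (sg + dl + y)" using t by simp
  let ?h = "radius c k * (snd q - a)"
  have h: "0 < ?h" "?h < dl" using k r by (auto simp: dl_def)
  have "f (sg + ?h) = q" using travel(1)[of ?h] h r kq by simp
  then have "f (sg + ?h) = f (sg + dl + y)" using fq by simp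
  then have "sg + ?h = sg + dl + y" using h y delta by (intro good_circuit_inj[OF gc_9]) auto
  then show False using h y by simp
 qed
 moreover have "snd q ~= b" if "fst q = k"
 proof
  assume "snd q = b"
  then have "frac b = b" using q by (intro frac_id) (auto simp: points_def)
  then show False using \<open>q ~= (k, frac b)\<close> that \<open>snd q = b\<close> by (auto simp: prod_eq_iff)
 qed
 ultimately show ?thesis using q unfolding arrives_def by force
qed

private lemma circuit_P: "is_circuit P f'"
 unfolding is_circuit_def
proof (intro conjI allI)
 show "f' 0 = origin P"
 proof -
  have o: "f 0 = origin c" using circ_9 by (simp add: is_circuit_def)
  have f1: "f 1 = f 0" using good_circuit_int[OF gc_9, of 0 1] by simp
  let ?s = "sg / (1 - dl)"
  \<comment> \<open>If the pinched segment starts at the origin, the origin slides to its end. If it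
    comes last in the period, time 0 of the new path is time 1 of the old one.\<close>
  consider "sg = 0" | "0 < sg" "sg < 1 - dl" | "sg = 1 - dl" using sigma sigma_delta by linarith
  then show ?thesis
  proof cases
   case 1
   have "skip (origin c) = turn c (k, frac b)" using o f_sigma 1 by (simp add: skip_def)
   then show ?thesis using travel(2) 1 by (simp add: f'_def g_def pinch_simps)
  next
   case 2
   then have s: "0 < ?s" "?s < 1" using delta by simp_all
   have "frac (- ?s) = 1 - ?s" using frac_minus[of ?s 0] s by simp
   then have "sg + dl + (1 - dl) * frac (- ?s) = 1" using delta by (simp add: field_simps)
   moreover have "origin c ~= (k, a)"
    using good_circuit_inj[OF gc_9, of 0 sg] 2 sigma o f_sigma by auto
   ultimately show ?thesis using f1 o by (simp add: f'_def g_def pinch_simps skip_def)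
  next
   case 3
   then have "?s = 1" using delta by simp
   then have fr: "frac (0 - ?s) = 0" by simp
   have "sg + dl = 1" using 3 by simp
   then have "f' 0 = K (f 1)" unfolding f'_def g_def fr by simp
   moreover have "origin c ~= (k, a)"
    using good_circuit_inj[OF gc_9, of 0 sg] 3 sigma delta o f_sigma by auto
   ultimately show ?thesis using f1 o by (simp add: pinch_simps skip_def)
  qed
 qed
 show "range f' <= points P"
  using g_remains K_points by (auto simp: f'_def points_P remains_def image_subset_iff)
next
 fix s
 define x where "x = s - sg / (1 - dl)"
 have f's: "f' (s + h) = K (g (x + h))" for h by (simp add: f'_def x_def algebra_simps)
 define y where "y = (1 - dl) * frac x"
 have gx: "g x = f (sg + dl + y)" by (simp add: g_def y_def)
 show "\<exists>\<epsilon>>0. \<forall>h\<in>{0..<\<epsilon>}. f' (s + h) = advance P (f' s) h"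
 proof -
  obtain e1 where e1: "e1 > 0" "!!h. 0 <= h ==> h < e1 ==> frac (x + h) = frac x + h"
   using floor_right[of x] by blast
  obtain e2 where e2: "e2 > 0" "!!h. 0 <= h ==> h < e2 ==> f (sg + dl + y + h) = advance c (f (sg + dl + y)) h"
   using circuit_right[OF circ_9, of "sg + dl + y"] by blast
  obtain e3 where e3: "e3 > 0"
   "!!h. 0 <= h ==> h < e3 ==> K (advance c (g x) ((1 - dl) * h)) = advance P (K (g x)) h"
   using advance_remains[OF g_remains] by blast
  show ?thesis
  proof (intro exI[of _ "min (min e1 e2) e3"] conjI ballI)
   show "0 < min (min e1 e2) e3" using e1(1) e2(1) e3(1) by simp
   fix h assume h: "h \<in> {0..<min (min e1 e2) e3}"
   have "(1 - dl) * h <= h" using delta h by (simp add: mult_left_le_one_le)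
   then have h2: "0 <= (1 - dl) * h" "(1 - dl) * h < e2" using h delta by auto
   have "g (x + h) = f (sg + dl + y + (1 - dl) * h)"
    using e1(2)[of h] h by (simp add: g_def y_def algebra_simps)
   also have "... = advance c (g x) ((1 - dl) * h)" using e2(2)[OF h2] by (simp add: gx)
   finally have "f' (s + h) = advance P (K (g x)) h" using e3(2)[of h] h by (simp add: f's)
   then show "f' (s + h) = advance P (f' s) h" using f's[of 0] by simp
  qed
 qed
 \<comment> \<open>At the pinched point the path arrives with offset \<open>1 - dl\<close>, at the
   end of the shortened period, but leaves with offset 0.\<close>
 define y' where "y' = (if frac x = 0 then 1 - dl else y)"
 have y': "0 < y'" "y' <= 1 - dl"
  using delta frac_ge_0[of x] frac_lt_1[of x] by (auto simp: y'_def y_def)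
 obtain e2 q where q: "e2 > 0" "q \<in> points c" "f (sg + dl + y') = turn c q"
  "!!h. 0 < h ==> h < e2 ==> f (sg + dl + y' - h) = advance c q (- h)"
  using circuit_left[OF circ_9, of "sg + dl + y'"] by blast
 have arr: "arrives q" by (rule arrivesI[OF q(2) q(3)[symmetric] y'])
 \<comment> \<open>Here \<open>skip\<close> enters: where the old path would leave along the pinched
   segment, the new one continues as the old one did at its end.\<close>
 have leave: "g x = skip (turn c q)"
 proof (cases "frac x = 0")
  case True
  have "f (sg + dl + y') = f sg" using good_circuit_int[OF gc_9, of sg 1] True by (simp add: y'_def)
  moreover have "g x = f (sg + dl)" unfolding g_def True by simp
  ultimately show ?thesis using q(3) f_sigma travel(2) by (simp add: skip_def)
 next
  case False
  then have "y' = y" "y < 1 - dl" using delta frac_lt_1[of x] by (auto simp: y'_def y_def)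
  then have "remains (turn c q)" using f_remains[of y] y' q(3) by simp
  then have "turn c q ~= (k, a)" using travel(5) by (auto simp: remains_def)
  then show ?thesis using q(3) gx \<open>y' = y\<close> by (simp add: skip_def)
 qed
 show "\<exists>\<epsilon>>0. \<exists>p\<in>points P. f' s = turn P p & (\<forall>h\<in>{0<..<\<epsilon>}. f' (s - h) = advance P p (- h))"
 proof -
  obtain e3 where e3: "e3 > 0"
   "!!h. 0 <= h ==> h < e3 ==> K (advance c q (- ((1 - dl) * h))) = advance P (K q) (- h)"
   using advance_arrives[OF arr] by blast
  define e1 where "e1 = (if frac x = 0 then 1 else frac x)"
  have e1: "0 < e1" using frac_ge_0[of x] by (auto simp: e1_def less_le)
  have Kq: "K q \<in> points c" by (rule K_points[OF q(2)])
  show ?thesis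
  proof (intro exI[of _ "min (min e1 e2) e3"] conjI bexI[of _ "K q"] ballI)
   show "0 < min (min e1 e2) e3" using e1 q(1) e3(1) by simp
   show "f' s = turn P (K q)"
    using f's[of 0] leave pinch_simps(3)[OF Kq] lft_K[OF arr] by simp
   show "K q \<in> points P" using Kq by (simp add: points_P)
   fix h assume h: "h \<in> {0<..<min (min e1 e2) e3}"
   have le: "(1 - dl) * h <= h" using delta h by (simp add: mult_left_le_one_le)
   have "h < e2" "0 < h" using h by auto
   then have h2: "0 < (1 - dl) * h" "(1 - dl) * h < e2" using le delta by (simp, linarith)
   have "frac (x - h) = (if frac x = 0 then 1 - h else frac x - h)"
    using h by (intro frac_minus) (auto simp: e1_def)
   then have "(1 - dl) * frac (x - h) = y' - (1 - dl) * h"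
    by (simp add: y'_def y_def algebra_simps)
   then have "g (x - h) = f (sg + dl + y' - (1 - dl) * h)" by (simp add: g_def add_diff_eq)
   also have "... = advance c q (- ((1 - dl) * h))" by (rule q(4)[OF h2])
   finally show "f' (s - h) = advance P (K q) (- h)" using e3(2)[of h] f's[of "- h"] h by simp
  qed
 qed
qed

private lemma remains_surj:
 assumes "remains p"
 obtains y where "0 <= y" "y < 1 - dl" "p = f (sg + dl + y)"
proof -
 have "p \<in> points c" using assms by (simp add: remains_def)
 then obtain s where s: "sg + dl <= s" "s < sg + dl + 1" "f s = p"
  using good_circuit_surj[OF gc_9, of p "sg + dl"] by blast
 have "s < sg + 1"
 proof (rule ccontr)
  assume n: "~ s < sg + 1"
  let ?h = "s - 1 - sg"
  have h: "0 <= ?h" "?h < dl" using n s by auto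
  have "f s = f (sg + ?h)" using good_circuit_int[OF gc_9, of "sg + ?h" 1] by simp
  then have "p = (k, a + ?h / radius c k)" using travel(1)[OF h] s by simp
  moreover have "?h / radius c k < b - a"
   unfolding pos_divide_less_eq[OF r] using h by (simp add: dl_def mult.commute)
  moreover have "0 <= ?h / radius c k" using h r by simp
  ultimately show False using assms by (auto simp: remains_def)
 qed
 then show thesis using that[of "s - sg - dl"] s by simp
qed

private lemma K_surj:
 assumes "q \<in> points c"
 obtains p where "remains p" "K p = q"
proof (cases "fst q = k")
 case False
 then show thesis using that[of q] assms by (simp add: remains_def K_other)
next
 case True
 then have q: "q = (k, snd q)" "0 <= snd q" "snd q < 1" using assms by (auto simp: points_def)
 define t where "t = snd q * (1 - w)"
 have t: "0 <= t" "t < 1 - w" "t / (1 - w) = snd q" using q w by (simp_all add: t_def)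
 have d: "1 - (b - a) = 1 - w" by (simp add: w_def)
 show thesis
 proof (cases "t < a")
  case True
  have "remains (k, t)" using True t k travel(4-6) w by (auto simp: remains_def points_iff)
  moreover have "K (k, t) = q" using True t q by (simp add: K_pair pinch_coord_def d frac_id)
  ultimately show thesis by (rule that)
 next
  case False
  have "remains (k, t + w)" using False t k travel(4-6) w by (auto simp: remains_def points_iff w_def)
  moreover have "K (k, t + w) = q"
  proof (cases "t = a")
   case True
   then have "t + w = b" by (simp add: w_def)
   then show ?thesis using True t q travel(5) by (simp add: K_pair pinch_coord_def d frac_id)
  next
   case False
   then have "b < t + w" using \<open>~ t < a\<close> by (simp add: w_def)
   then show ?thesis using t q travel(5) by (simp add: K_pair pinch_coord_def d w_def[symmetric] frac_id)
  qed
  ultimately show thesis by (rule that)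
 qed
qed

private lemma g_inj: "g x = g x' ==> frac x = frac x'"
proof -
 assume e: "g x = g x'"
 have b: "0 <= (1 - dl) * frac z" "(1 - dl) * frac z < 1 - dl" for z
  using delta frac_ge_0[of z] frac_lt_1[of z] by simp_all
 have "sg + dl + (1 - dl) * frac x = sg + dl + (1 - dl) * frac x'"
  by (rule good_circuit_inj[OF gc_9 e[unfolded g_def]]) (use b[of x] b[of x'] delta in linarith)
 then show ?thesis using delta by simp
qed

private lemma good_P: "good_circuit P f'"
 unfolding good_circuit_def
proof (intro conjI allI circuit_P)
 show "f' (s + 1) = f' s" for s
 proof -
  have "frac (s + 1 - sg / (1 - dl)) = frac (s - sg / (1 - dl))" by (simp add: frac_eq_frac_iff)
  then show ?thesis by (simp add: f'_def g_def)
 qed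
 show "bij_betw f' {0..<1} (points P)"
  unfolding bij_betw_def
 proof
  show "inj_on f' {0..<1}"
  proof (rule inj_onI)
   fix s s' :: real assume s: "s \<in> {0..<1}" "s' \<in> {0..<1}" "f' s = f' s'"
   have "g (s - sg / (1 - dl)) = g (s' - sg / (1 - dl))"
    using s(3) unfolding f'_def by (rule K_inj_remains[OF g_remains g_remains])
   then have "frac (s - sg / (1 - dl)) = frac (s' - sg / (1 - dl))" by (rule g_inj)
   then have "frac s = frac s'" by (simp add: frac_eq_frac_iff)
   then show "s = s'" using s by (simp add: frac_id)
  qed
  show "f' ` {0..<1} = points P"
  proof (intro equalityI subsetI)
   fix q assume q: "q \<in> points P"
   obtain p where p: "remains p" "K p = q" using K_surj q unfolding points_P by blast
   obtain y where y: "0 <= y" "y < 1 - dl" "p = f (sg + dl + y)" using remains_surj[OF p(1)] .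
   define s where "s = frac (y / (1 - dl) + sg / (1 - dl))"
   have "frac (s - sg / (1 - dl)) = frac (y / (1 - dl) + sg / (1 - dl) + - (sg / (1 - dl)))"
    using frac_add_frac[of "y / (1 - dl) + sg / (1 - dl)" "- (sg / (1 - dl))"] by (simp add: s_def)
   also have "... = y / (1 - dl)" using y delta by (simp add: frac_id)
   finally have "f' s = q" using y p delta by (simp add: f'_def g_def)
   moreover have "s \<in> {0..<1}" unfolding s_def by (rule frac_range)
   ultimately show "q \<in> f' ` {0..<1}" by blast
  qed (use circuit_points[OF circuit_P] in blast)
 qed
qed

text \<open>\<open>H\<close> is an increasing correspondence of times that jumps over the pinched
  intervals and commutes with the shift by 1, so conditions on the order of times are inherited. On
  the pinched lobe the cyclic order is kept because \<open>pinch_inv\<close> is increasing on the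
  remaining arc.\<close>

private lemma planar_P: "planar f'"
proof -
 define H where "H = (%s. sg + dl + of_int \<lfloor>s - sg / (1 - dl)\<rfloor> + (1 - dl) * frac (s - sg / (1 - dl)))"
 have f'H: "f' s = K (f (H s))" for s
 proof -
  have "f (H s) = f (sg + dl + (1 - dl) * frac (s - sg / (1 - dl)) + of_int \<lfloor>s - sg / (1 - dl)\<rfloor>)"
   by (simp add: H_def algebra_simps)
  then show ?thesis by (simp add: f'_def g_def good_circuit_int[OF gc_9])
 qed
 have H_mono: "H s < H s'" if "s < s'" for s s'
 proof -
  have H2: "H s = sg + dl + (1 - dl) * (s - sg / (1 - dl)) + dl * of_int \<lfloor>s - sg / (1 - dl)\<rfloor>" for s
   by (simp add: H_def frac_def algebra_simps)
  have "\<lfloor>s - sg / (1 - dl)\<rfloor> <= \<lfloor>s' - sg / (1 - dl)\<rfloor>" using that by (intro floor_mono) simp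
  then have "dl * of_int \<lfloor>s - sg / (1 - dl)\<rfloor> <= dl * of_int \<lfloor>s' - sg / (1 - dl)\<rfloor>"
   using delta by (intro mult_left_mono) auto
  moreover have "(1 - dl) * (s - sg / (1 - dl)) < (1 - dl) * (s' - sg / (1 - dl))"
   using that delta by (intro mult_strict_left_mono) auto
  ultimately show ?thesis unfolding H2 by linarith
 qed
 have H1: "H (s + 1) = H s + 1" for s
 proof -
  have e: "s + 1 - sg / (1 - dl) = (s - sg / (1 - dl)) + 1" by simp
  show ?thesis unfolding H_def e by (simp add: frac_def)
 qed
 have H_last: "H s' < H s + 1" if "s' < s + 1" for s s' using H_mono[OF that] H1 by simp
 have rem: "remains (f (H s))" for s
  using g_remains[of "s - sg / (1 - dl)"] good_circuit_int[OF gc_9, of "H s" "- \<lfloor>s - sg / (1 - dl)\<rfloor>"]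
  by (simp add: H_def g_def algebra_simps)
 note pl = cactus_circuit(2)[OF c, folded f_def]
 show ?thesis
  unfolding planar_def
 proof (intro conjI allI impI)
  fix s1 s2 s3
  assume s: "s1 < s2 & s2 < s3 & s3 < s1 + 1 & fst (f' s1) = fst (f' s2) & fst (f' s2) = fst (f' s3)"
  have cy: "cyc (snd (f (H s1))) (snd (f (H s2))) (snd (f (H s3)))"
   using s H_mono H_last by (intro planarD(1)[OF pl]) (simp_all add: f'H fst_K)
  show "cyc (snd (f' s1)) (snd (f' s2)) (snd (f' s3))"
  proof (cases "fst (f (H s1)) = k")
   case False
   then have "f' s1 = f (H s1)" "f' s2 = f (H s2)" "f' s3 = f (H s3)"
    using s by (simp_all add: f'H fst_K K_other)
   then show ?thesis using cy by simp
  next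
   case True
   have arc: "\<exists>u. b <= u & u < a + 1 & f (H s) = (k, frac u)" if "fst (f (H s)) = k" for s
    using remains_arc[OF rem that] by blast
   have kk: "fst (f (H s2)) = k" "fst (f (H s3)) = k" using s True by (simp_all add: f'H fst_K)
   obtain u1 where u1: "b <= u1" "u1 < a + 1" "f (H s1) = (k, frac u1)" using arc[OF True] by blast
   obtain u2 where u2: "b <= u2" "u2 < a + 1" "f (H s2) = (k, frac u2)" using arc[OF kk(1)] by blast
   obtain u3 where u3: "b <= u3" "u3 < a + 1" "f (H s3) = (k, frac u3)" using arc[OF kk(2)] by blast
   have rg: "b <= u & u < b + 1" if "u \<in> {u1, u2, u3}" for u
    using that u1 u2 u3 travel(5) by auto
   have "cyc (frac u1) (frac u2) (frac u3)" using cy u1(3) u2(3) u3(3) by simp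
   then have "cyc u1 u2 u3" by (rule cyc_frac_iff[where x = b, THEN iffD1, rotated]) (erule rg)
   then have "cyc (pinch_inv a b u1) (pinch_inv a b u2) (pinch_inv a b u3)"
    using pinch_inv_less unfolding cyc_def by blast
   moreover have "pinch_inv a b b <= pinch_inv a b u & pinch_inv a b u < pinch_inv a b b + 1"
    if "b <= u" "u < a + 1" for u
    using that pinch_inv_less[of b u] pinch_inv_less[of u "a + 1"] pinch_inv_diff
    by (cases "u = b") auto
   ultimately have "cyc (frac (pinch_inv a b u1)) (frac (pinch_inv a b u2)) (frac (pinch_inv a b u3))"
    using u1 u2 u3 by (subst cyc_frac_iff[where x = "pinch_inv a b b"]) auto
   then show ?thesis using u1 u2 u3 by (simp add: f'H K_arc)
  qed
 next
  fix s1 s2 s3 s4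
  assume s: "s1 < s2 & s2 < s3 & s3 < s4 & s4 < s1 + 1 & fst (f' s1) = fst (f' s3) &
    fst (f' s2) = fst (f' s4)"
  have "fst (f (H s1)) = fst (f (H s2))"
   using s H_mono H_last by (intro planarD(2)[OF pl, of "H s1" "H s2" "H s3" "H s4"]) (simp_all add: f'H fst_K)
  then show "fst (f' s1) = fst (f' s2)" by (simp add: f'H fst_K)
 qed
qed

private lemma lft_X:
 assumes "p \<in> X"
 shows "lft (K p) \<in> X"
proof (cases "K p = K (k, a)")
 case False
 have pp: "p \<in> points c" using assms X by (auto simp: marked_def)
 have "arrives p"
 proof -
  have "remains p" "p ~= (k, frac b)" using K_pinched(1)[OF pp] False by metis+
  moreover have "snd p ~= b" if "fst p = k"
  proof
   assume "snd p = b"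
   then have "frac b = b" using pp by (intro frac_id) (auto simp: points_def)
   then show False using \<open>p ~= (k, frac b)\<close> that \<open>snd p = b\<close> by (auto simp: prod_eq_iff)
  qed
  ultimately show ?thesis unfolding arrives_def remains_def by force
 qed
 then show ?thesis using lft_K assms by simp
qed (simp add: lft_def aX)

text \<open>The images of the spines serve as the finite set outside of which the new
  \<open>turn\<close> fixes everything.\<close>

lemma pinch_cactus:
 shows "is_cactus (pinch c X k i)" "marked (pinch c X k i) (pinch_spines X k i)"
  "!!s. circuit (pinch c X k i) s = f' s"
proof -
 have lt: "skip p \<in> X" if "p \<in> X" for p
  using that turn_in_marked[OF pre X bX] by (simp add: skip_def)
 have XF: "K ` X <= points c" using K_points X by (auto simp: marked_def)
 have fin: "finite (K ` X)" using X by (simp add: marked_def)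
 have fixed: "turn P q = q" if q: "q \<notin> K ` X" for q
 proof (cases "q \<in> points c")
  case True
  obtain p where p: "remains p" "K p = q" using K_surj[OF True] .
  have pX: "p \<notin> X" using p(2) q by blast
  then have "p ~= (k, frac b)" "p ~= (k, a)" using aX bX by auto
  moreover have "snd p ~= b" if "fst p = k"
  proof
   assume "snd p = b"
   then have "frac b = b" using p(1) by (intro frac_id) (auto simp: points_def remains_def)
   then show False using \<open>p ~= (k, frac b)\<close> that \<open>snd p = b\<close> by (auto simp: prod_eq_iff)
  qed
  ultimately have "arrives p" using p(1) unfolding arrives_def remains_def by force
  then have "lft (K p) = p" by (rule lft_K)
  then have "lft q = p" unfolding p(2) .
  moreover have "turn c p = p" using pX X by (auto simp: marked_def)
  ultimately show ?thesis
   using pinch_simps(3)[OF True] \<open>p ~= (k, a)\<close> p(2) by (simp add: skip_def)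
 qed (rule pinch_simps(4))
 have stable: "turn P q \<in> K ` X" if q: "q \<in> K ` X" for q
 proof -
  obtain p where p: "q = K p" "p \<in> X" using q by (rule imageE)
  have "skip (turn c (lft q)) \<in> X"
   unfolding p(1) by (rule lt[OF turn_in_marked[OF pre X lft_X[OF p(2)]]])
  moreover have "q \<in> points c" using XF q by blast
  ultimately show ?thesis using pinch_simps(3) by simp
 qed
 have sum: "(\<Sum>l<lobes P. radius P l) = 1"
 proof -
  have "(\<Sum>l<lobes c. if l = k then radius c k * (1 - w) else radius c l) =
    (\<Sum>l<lobes c. radius c l - (if l = k then dl else 0))"
   by (rule sum.cong) (auto simp: dl_def w_def algebra_simps)
  also have "... = 1 - dl" using pre k by (simp add: sum_subtractf precactus_def)
  finally show ?thesis
   using delta unfolding pinch_simps sum_divide_distrib[symmetric] by simp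
 qed
 have res: "is_cactus P & circuit P = f'"
 proof (rule cactus_from_circuit[where F = "K ` X", OF _ _ sum fin _ fixed stable good_P planar_P])
  show "0 < radius P l" if "l < lobes P" for l
   using that precactus_radius[OF pre, of l] r w delta by (auto simp: pinch_simps)
  show "radius P l = 0" if "lobes P <= l" for l
   using that pre k by (auto simp: pinch_simps precactus_def)
  show "K ` X <= points P" using XF by (simp add: points_P)
 qed
 then show "is_cactus (pinch c X k i)" "!!s. circuit (pinch c X k i) s = f' s"
  by (simp_all add: P_def)
 have KX: "pinch_spines X k i = K ` X" by (simp add: pinch_spines_def K_def)
 have "origin P \<in> K ` X" unfolding pinch_simps using lt X by (auto simp: marked_def)
 moreover have "(l, 0) \<in> K ` X" if "l < lobes P" for l
 proof -
  have "(l, 0) \<in> X" using that X by (simp add: marked_def pinch_simps)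
  moreover have "K (l, 0) = (l, 0)" using travel(4) by (simp add: K_pair pinch_coord_def)
  ultimately show ?thesis by (metis image_eqI)
 qed
 moreover have "{p. turn P p ~= p} <= K ` X" using fixed by blast
 ultimately show "marked (pinch c X k i) (pinch_spines X k i)"
  unfolding KX P_def[symmetric] marked_def points_P using fin XF by blast
qed

text \<open>Pinching a segment removes it from the enumerations of the segments.\<close>

lemma pinch_segments:
 defines "Q \<equiv> pinch c X k i" and "Y \<equiv> pinch_spines X k i"
 shows "lobes Q = lobes c" "card Y = card X - 1"
  "!!l. l < lobes c ==> spines Y l = (if l = k then spines X k - 1 else spines X l)"
  "!!l m. l < lobes c ==> m < spines Y l ==>
    skip_op (seg_index c X k i) (seg_index Q Y l m) = seg_index c X l (if l = k then skip_op i m else m)"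
proof -
 note T = circuit_marks[OF c X] and j = seg_index_props[OF c X k i]
 note Qc = pinch_cactus(1,2)[folded Q_def Y_def]
 have QP: "Q = P" by (simp add: Q_def P_def)
 show lob: "lobes Q = lobes c" by (simp add: QP pinch_simps)
 have Y: "Y = K ` X" by (simp add: Y_def pinch_spines_def K_def)
 let ?j = "seg_index c X k i" and ?T = "nth_mark (on_circuit c X)"
 have Tj: "?T ?j = sg" using j(2) by (simp add: sg_def a_def)
 have Tj': "?T (Suc ?j) = sg + dl"
  using gaps_on_circuit[OF c X k i] Tj j(1) T(2) i by (simp add: gaps_def dl_def a_def b_def spines_def)
 have card2: "spines X k <= card X"
 proof -
  have "on_lobe X k = snd ` {p \<in> X. fst p = k}" by (force simp: on_lobe_def)
  then have "spines X k <= card {p \<in> X. fst p = k}" using X by (simp add: spines_def card_image_le marked_def)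
  also have "... <= card X" using X by (intro card_mono) (auto simp: marked_def)
  finally show ?thesis .
 qed
 define N where "N = card X - 1"
 have N: "card X = Suc N" "0 < N" using card2 two by (simp_all add: N_def)
 \<comment> \<open>The new time of a visit that took place at the old time \<open>t\<close>, where
   \<open>t\<close> lies outside the pinched interval.\<close>
 define unpinch where "unpinch = (%t. (if t <= sg then t else t - dl) / (1 - dl))"
 define \<tau> where "\<tau> = (%j'. unpinch (?T (skip_op ?j j')))"
 have skipN: "skip_op ?j j' < card X" "skip_op ?j j' ~= ?j" if "j' < N" for j'
  using that N j(1) by (auto simp: skip_op_def)
 have Tskip: "0 <= ?T (skip_op ?j j')" "?T (skip_op ?j j') < 1"
  "?T (skip_op ?j j') < sg | sg + dl <= ?T (skip_op ?j j')" if "j' < N" for j'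
 proof -
  show "0 <= ?T (skip_op ?j j')" "?T (skip_op ?j j') < 1"
   using nth_mark_range[OF T(1)] skipN[OF that] T(2) by simp_all
  show "?T (skip_op ?j j') < sg | sg + dl <= ?T (skip_op ?j j')"
  proof (cases "j' < ?j")
   case True
   then show ?thesis using nth_mark_less[OF T(1), of j' ?j] Tj j(1) T(2) by (simp add: skip_op_def)
  next
   case False
   then show ?thesis using nth_mark_le[OF T(1), of "Suc ?j" "Suc j'"] Tj' T(2) that N
    by (simp add: skip_op_def)
  qed
 qed
 have f'unpinch: "f' (unpinch t) = K (f t)" if t: "0 <= t" "t < 1" "t < sg | sg + dl <= t" for t
 proof -
  let ?x = "unpinch t - sg / (1 - dl)"
  have d: "1 - dl > 0" using delta by simp
  consider "t < sg" | "sg + dl <= t" using t by blast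
  then have "\<exists>n. sg + dl + (1 - dl) * frac ?x = t + of_int n"
  proof cases
   case 1
   have x: "?x = (t - sg) / (1 - dl)" using 1 by (simp add: unpinch_def diff_divide_distrib)
   have "- 1 < ?x | ?x = - 1" "?x < 0"
    unfolding x using 1 t sigma_delta d by (auto simp: pos_less_divide_eq divide_less_0_iff field_simps)
   then have "frac ?x = frac (?x + 1)" "0 <= ?x + 1" "?x + 1 < 1" by (auto simp: frac_eq_frac_iff)
   then have "frac ?x = ?x + 1" by (simp add: frac_id)
   then have "sg + dl + (1 - dl) * frac ?x = t + of_int 1"
    unfolding x using d by (simp add: field_simps)
   then show ?thesis by blast
  next
   case 2
   have x: "?x = (t - dl - sg) / (1 - dl)" using 2 delta by (simp add: unpinch_def diff_divide_distrib)
   have "0 <= ?x" "?x < 1" unfolding x using 2 t d sigma by (auto simp: pos_divide_less_eq)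
   then have "frac ?x = ?x" by (rule frac_id)
   then have "sg + dl + (1 - dl) * frac ?x = t + of_int 0" unfolding x using d by simp
   then show ?thesis by blast
  qed
  then obtain n where "sg + dl + (1 - dl) * frac ?x = t + of_int n" by blast
  then show ?thesis using good_circuit_int[OF gc_9] by (simp add: f'_def g_def)
 qed
 have unpinch_range: "0 <= unpinch t" "unpinch t < 1" if "0 <= t" "t < 1" "t < sg | sg + dl <= t" for t
  using that sigma_delta sigma delta by (auto simp: unpinch_def pos_divide_less_eq)
 have unpinch_mono: "unpinch t < unpinch t'" if "t < t'" "t < sg | sg + dl <= t" "t' < sg | sg + dl <= t'" for t t'
  unfolding unpinch_def using that delta by (intro divide_strict_right_mono) auto
 have skip_mono: "skip_op ?j m < skip_op ?j n" if "m < n" for m n using that by (simp add: skip_op_def)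
 have f'\<tau>: "f' (\<tau> j') = K (f (?T (skip_op ?j j')))" if "j' < N" for j'
  unfolding \<tau>_def by (rule f'unpinch[OF Tskip[OF that]])
 have mono: "\<tau> m < \<tau> n" if "m < n" "n < N" for m n
  unfolding \<tau>_def
 proof (rule unpinch_mono)
  show "?T (skip_op ?j m) < ?T (skip_op ?j n)"
   using skip_mono[OF that(1)] skipN[OF that(2)] T(2) by (intro nth_mark_less[OF T(1)]) auto
 qed (use Tskip(3) that in auto)
 have fX: "f (?T m) \<in> X" if "m < card X" for m
  using bij_betw_apply[OF T(3), of "?T m"] nth_mark_in[of "on_circuit c X" m] T that
  by (simp add: mark_set_def f_def)
 have img: "\<tau> ` {..<N} = on_circuit Q Y"
 proof (intro equalityI subsetI)
  fix s assume "s \<in> \<tau> ` {..<N}"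
  then obtain m where m: "s = \<tau> m" "m < N" by auto
  have "f' s \<in> Y" unfolding m(1) f'\<tau>[OF m(2)] Y by (rule imageI[OF fX[OF skipN(1)[OF m(2)]]])
  moreover have "0 <= s" "s < 1" unfolding m(1) \<tau>_def by (rule unpinch_range[OF Tskip[OF m(2)]])+
  ultimately show "s \<in> on_circuit Q Y" by (simp add: on_circuit_def Q_def pinch_cactus(3))
 next
  fix s assume "s \<in> on_circuit Q Y"
  then have s: "0 <= s" "s < 1" "f' s \<in> K ` X" by (simp_all add: on_circuit_def Q_def pinch_cactus(3) Y)
  then obtain p0 where p0: "f' s = K p0" "p0 \<in> X" by blast
  \<comment> \<open>Both ends of the pinched segment are spines over the pinched point; the start is
    replaced by the end, which is the one that remains.\<close>
  define p where "p = (if p0 = (k, a) then (k, frac b) else p0)"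
  have p0p: "p0 \<in> points c" using p0(2) X by (auto simp: marked_def)
  have "~ (fst p0 = k & a < snd p0 & snd p0 < b)"
   using travel(3)[of "snd p0"] p0(2) by (metis prod.collapse)
  then have p: "p \<in> X" "remains p"
   using p0(2) bX remains_b p0p unfolding p_def by (auto simp: remains_def prod_eq_iff)
  have Kp: "K p = f' s"
   using p0(1) K_pinched(1)[of "(k, frac b)"] remains_b by (simp add: p_def remains_def)
  have "p \<in> circuit c ` on_circuit c X" using T(3) p(1) by (simp add: bij_betw_def)
  then obtain t where t: "p = f t" "t \<in> on_circuit c X" by (auto simp: f_def)
  then obtain m where m: "m < card X" "?T m = t"
   using nth_mark_surj[of "on_circuit c X" t] T(1,2) unfolding mark_set_def by metis
  have "m ~= ?j"
  proof
   assume "m = ?j"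
   then have "p = (k, a)" using t m Tj f_sigma by simp
   then show False using p(2) travel(5) by (simp add: remains_def)
  qed
  then obtain m' where m': "m' < N" "skip_op ?j m' = m"
  proof (cases "m < ?j")
   case True
   then show thesis using that[of m] j(1) N by (simp add: skip_op_def)
  next
   case False
   then show thesis using that[of "m - 1"] \<open>m ~= ?j\<close> m(1) N by (auto simp: skip_op_def)
  qed
  have "f' (\<tau> m') = f' s" using f'\<tau>[OF m'(1)] m'(2) m(2) t(1) Kp by simp
  moreover have "0 <= \<tau> m'" "\<tau> m' < 1"
   unfolding \<tau>_def by (rule unpinch_range[OF Tskip[OF m'(1)]])+
  ultimately have "\<tau> m' = s" using s(1,2) by (intro good_circuit_inj[OF good_P]) simp_all
  then show "s \<in> \<tau> ` {..<N}" using m'(1) by blast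
 qed
 have uniq1: "card (on_circuit Q Y) = N"
  by (rule nth_mark_unique(1)[of N \<tau>, OF _ img]) (erule (1) mono)
 have uniq: "nth_mark (on_circuit Q Y) n = \<tau> n" if "n < N" for n
  by (rule nth_mark_unique(2)[of N \<tau>, OF _ img that]) (erule (1) mono)
 have cardY: "card Y = N" using uniq1 circuit_marks(2)[OF Qc] by simp
 then show "card Y = card X - 1" by (simp add: N_def)
 let ?A = "on_lobe X k"
 have Ak: "card ?A = spines X k" by (simp add: spines_def)
 obtain M where M: "spines X k = Suc M" "0 < M" using two by (cases "spines X k") auto
 \<comment> \<open>The pinched coordinates of the marks other than the one with index
   \<open>i\<close>, without the final \<open>frac\<close>, since the values stay below 1.\<close>
 define \<alpha> where "\<alpha> = (%m. (if nth_mark ?A (skip_op i m) <= a then nth_mark ?A (skip_op i m)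
   else nth_mark ?A (skip_op i m) - w) / (1 - w))"
 have lobe_skip: "skip_op i m < Suc M" "nth_mark ?A (skip_op i m) < a | b <= nth_mark ?A (skip_op i m)"
  "0 <= nth_mark ?A (skip_op i m)" "nth_mark ?A (skip_op i m) < 1" if "m < M" for m
 proof -
  show lt: "skip_op i m < Suc M" using that by (auto simp: skip_op_def)
  show "0 <= nth_mark ?A (skip_op i m)" "nth_mark ?A (skip_op i m) < 1"
   using nth_mark_range[OF A, of "skip_op i m"] lt M Ak by simp_all
  show "nth_mark ?A (skip_op i m) < a | b <= nth_mark ?A (skip_op i m)"
  proof (cases "m < i")
   case True
   then show ?thesis using nth_mark_less[OF A, of m i] i Ak by (simp add: skip_op_def a_def)
  next
   case False
   then show ?thesis using nth_mark_le[OF A, of "Suc i" "Suc m"] that M Ak by (simp add: skip_op_def b_def)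
  qed
 qed
 have d: "1 - (b - a) = 1 - w" by (simp add: w_def)
 have K\<alpha>: "K (k, nth_mark ?A (skip_op i m)) = (k, \<alpha> m)" if "m < M" for m
 proof -
  let ?t = "nth_mark ?A (skip_op i m)"
  have *: "0 <= \<alpha> m" "\<alpha> m < 1"
   using lobe_skip[OF that] w travel(4-6) by (auto simp: \<alpha>_def pos_divide_less_eq w_def)
  have "pinch_coord a b ?t = frac (\<alpha> m)"
   using lobe_skip[OF that] w travel(5) by (auto simp: \<alpha>_def pinch_coord_def d) (simp_all add: w_def)
  then show ?thesis using * by (simp add: K_pair frac_id)
 qed
 have \<alpha>_mono: "\<alpha> m < \<alpha> n" if "m < n" "n < M" for m n
 proof -
  have "skip_op i m < skip_op i n" using that by (simp add: skip_op_def)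
  then have "nth_mark ?A (skip_op i m) < nth_mark ?A (skip_op i n)"
   using lobe_skip(1)[OF that(2)] M Ak by (intro nth_mark_less[OF A]) auto
  then show ?thesis
   unfolding \<alpha>_def using w lobe_skip(2)[of m] lobe_skip(2)[of n] that
   by (intro divide_strict_right_mono) (auto simp: w_def)
 qed
 have lobe_img: "\<alpha> ` {..<M} = on_lobe Y k"
 proof (intro equalityI subsetI)
  fix t assume "t \<in> \<alpha> ` {..<M}"
  then obtain m where m: "t = \<alpha> m" "m < M" by auto
  have "nth_mark ?A (skip_op i m) \<in> ?A"
   using A lobe_skip(1)[OF m(2)] M Ak by (intro nth_mark_in) (simp_all add: mark_set_def)
  then have "(k, \<alpha> m) \<in> Y" unfolding Y K\<alpha>[OF m(2), symmetric] by (intro imageI) (simp add: on_lobe_iff)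
  then show "t \<in> on_lobe Y k" by (simp add: on_lobe_iff m)
 next
  fix t assume "t \<in> on_lobe Y k"
  then obtain p0 where p0: "(k, t) = K p0" "p0 \<in> X" unfolding on_lobe_iff Y by (rule imageE)
  have fk: "fst p0 = k" using fst_K[of p0] p0(1) by (metis fst_conv)
  define p where "p = (if p0 = (k, a) then (k, frac b) else p0)"
  have p: "p \<in> X" "fst p = k" using p0(2) bX fk by (auto simp: p_def)
  have Kp: "K p = (k, t)"
   using p0(1) K_pinched(1)[of "(k, frac b)"] remains_b by (simp add: p_def remains_def)
  have "snd p ~= a"
  proof
   assume "snd p = a"
   then have "p = (k, a)" using p(2) by (simp add: prod_eq_iff)
   moreover have "remains p" if "p0 = (k, a)" using that remains_b by (simp add: p_def)
   ultimately show False using travel(5) by (auto simp: p_def remains_def split: if_splits)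
  qed
  have "snd p \<in> ?A" using p by (metis on_lobe_iff prod.collapse)
  then obtain n where n: "n < Suc M" "nth_mark ?A n = snd p"
   using nth_mark_surj[of ?A "snd p"] A M Ak unfolding mark_set_def by metis
  have "n ~= i" using n \<open>snd p ~= a\<close> by (auto simp: a_def)
  then obtain m where m: "m < M" "skip_op i m = n"
  proof (cases "n < i")
   case True
   then show thesis using that[of n] i M by (simp add: skip_op_def)
  next
   case False
   then show thesis using that[of "n - 1"] \<open>n ~= i\<close> n(1) by (auto simp: skip_op_def)
  qed
  have "(k, nth_mark ?A (skip_op i m)) = p" using m(2) n(2) p(2) by (simp add: prod_eq_iff)
  then have "(k, \<alpha> m) = (k, t)" using K\<alpha>[OF m(1)] Kp by simp
  then show "t \<in> \<alpha> ` {..<M}" using m(1) by blast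
 qed
 have uniq_k1: "card (on_lobe Y k) = M"
  by (rule nth_mark_unique(1)[of M \<alpha>, OF _ lobe_img]) (erule (1) \<alpha>_mono)
 have uniq_k: "nth_mark (on_lobe Y k) m = \<alpha> m" if "m < M" for m
  by (rule nth_mark_unique(2)[of M \<alpha>, OF _ lobe_img that]) (erule (1) \<alpha>_mono)
 have other: "on_lobe Y l = on_lobe X l" if "l ~= k" for l
 proof -
  have "(l, t) \<in> K ` X \<longleftrightarrow> (l, t) \<in> X" for t
  proof
   assume "(l, t) \<in> K ` X"
   then obtain p where p: "(l, t) = K p" "p \<in> X" by (rule imageE)
   then have "fst p = l" using fst_K[of p] by (metis fst_conv)
   then show "(l, t) \<in> X" using p K_other[of p] that by simp
  next
   assume "(l, t) \<in> X"
   moreover have "K (l, t) = (l, t)" using that by (simp add: K_pair)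
   ultimately show "(l, t) \<in> K ` X" by (metis imageI)
  qed
  then show ?thesis by (simp add: on_lobe_def Y)
 qed
 show sp: "spines Y l = (if l = k then spines X k - 1 else spines X l)" if "l < lobes c" for l
  using uniq_k1 other[of l] M by (simp add: spines_def)
 fix l m assume l: "l < lobes c" and m: "m < spines Y l"
 define m' where "m' = (if l = k then skip_op i m else m)"
 have m': "m' < spines X l" "l = k ==> m' ~= i"
  using m sp[OF l] M by (auto simp: m'_def skip_op_def split: if_splits)
 note s = seg_index_props[OF c X l m'(1)]
 have "seg_index c X l m' ~= ?j"
 proof
  assume e: "seg_index c X l m' = ?j"
  show False using seg_index_inj[OF c X l m'(1) k i e] m'(2) by simp
 qed
 then obtain n where n: "n < N" "skip_op ?j n = seg_index c X l m'"
 proof (cases "seg_index c X l m' < ?j")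
  case True
  then show thesis using that[of "seg_index c X l m'"] j(1) N by (simp add: skip_op_def)
 next
  case False
  then show thesis
   using that[of "seg_index c X l m' - 1"] \<open>seg_index c X l m' ~= ?j\<close> s(1) N by (auto simp: skip_op_def)
 qed
 have "seg_index Q Y l m = n"
 proof (rule seg_index_eqI[OF Qc])
  show "n < card Y" using n cardY by simp
  have "circuit Q (nth_mark (on_circuit Q Y) n) = K (f (?T (skip_op ?j n)))"
   using uniq[OF n(1)] f'\<tau>[OF n(1)] by (simp add: Q_def pinch_cactus(3))
  also have "... = K (l, nth_mark (on_lobe X l) m')" using s(3) n(2) by (simp add: f_def)
  also have "... = (l, nth_mark (on_lobe Y l) m)"
  proof (cases "l = k")
   case True
   then have mM: "m < M" using m sp[OF l] M by simp
   then show ?thesis using True K\<alpha>[OF mM] uniq_k[OF mM] by (simp add: m'_def)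
  next
   case False
   then show ?thesis using other[OF False] by (simp add: m'_def K_pair)
  qed
  finally show "circuit Q (nth_mark (on_circuit Q Y) n) = (l, nth_mark (on_lobe Y l) m)" .
 qed
 then show "skip_op ?j (seg_index Q Y l m) = seg_index c X l (if l = k then skip_op i m else m)"
  using n(2) by (simp add: m'_def)
qed

end

section \<open>The action\<close>

definition carries :: "('a, 'b) cyclic_set_scheme => cactus => point set => (nat => 'a rpoint) => bool" where
 "carries S c X x \<longleftrightarrow> marked c X & (\<forall>k<lobes c. carried S (on_lobe X k) (x k))"

definition lobe_cells :: "('a, 'b) cyclic_set_scheme => cactus => point set => (nat => 'a rpoint) => nat => 'a" where
 "lobe_cells S c X x = (\<lambda>k\<in>{..<lobes c}. cell_on S (on_lobe X k) (x k))"

definition value_at :: "('a, 'b) cactus_set_scheme => cactus => point set => (nat => 'a rpoint) => 'a rpoint" where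
 "value_at S c X x = rclass S (card X - 1) (smap S c X (lobe_cells S c X x)) (gaps (on_circuit c X))"

text \<open>Any spines that carry all inputs give the same value, by \<open>cactus_act_eq\<close>,
  so the choice is harmless.\<close>

definition cactus_act :: "('a, 'b) cactus_set_scheme => cactus => (nat => 'a rpoint) => 'a rpoint" where
 "cactus_act S c x = value_at S c (SOME X. carries S c X x) x"

lemma carried_mono:
 assumes S: "is_cyclic_set S" and A: "mark_set A" and B: "mark_set B" "A <= B" and P: "carried S A P"
 shows "carried S B P"
proof -
 obtain s where s: "s \<in> cells S (card A - 1)" "P = rclass S (card A - 1) s (gaps A)"
  using P by (auto simp: carried_def)
 show ?thesis unfolding s(2)
 proof (rule carriedI[OF S s(1) gaps_simplex[OF A] B(1)])
  fix j assume "j <= card A - 1"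
  then have j: "j < card A" using card_mark_set[OF A] by simp
  then have "sum (gaps A) {..<j} = nth_mark A j" using sum_gaps[OF A, of j] by simp
  moreover have "nth_mark A j \<in> A" using A j by (intro nth_mark_in) (simp_all add: mark_set_def)
  ultimately show "sum (gaps A) {..<j} \<in> B \<union> {1}" using B(2) by auto
 qed
qed

lemma marked_union:
 assumes "marked c X" "finite Y" "Y <= points c"
 shows "marked c (X \<union> Y)"
 using assms by (auto simp: marked_def)

lemma carries_union:
 assumes S: "is_cyclic_set S" and X: "carries S c X x" and Y: "finite Y" "Y <= points c"
 shows "carries S c (X \<union> Y) x"
proof -
 have m: "marked c X" using X by (simp add: carries_def)
 note mu = marked_union[OF m Y]
 have "carried S (on_lobe (X \<union> Y) k) (x k)" if k: "k < lobes c" for k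
 proof (rule carried_mono[OF S lobe_marks[OF m k] lobe_marks[OF mu k]])
  show "on_lobe X k <= on_lobe (X \<union> Y) k" by (auto simp: on_lobe_def)
  show "carried S (on_lobe X k) (x k)" using X k by (simp add: carries_def)
 qed
 then show ?thesis using mu by (simp add: carries_def)
qed

lemma ex_carries:
 assumes S: "is_cyclic_set S" and c: "is_cactus c" and x: "!!k. k < lobes c ==> x k \<in> topspace (realization S)"
 obtains X where "carries S c X x"
proof -
 have "\<forall>k. \<exists>n s t. k < lobes c --> x k = rclass S n s t & s \<in> cells S n & t \<in> standard_simplex n"
  using x unfolding topspace_realization by blast
 then obtain n s t where nst: "!!k. k < lobes c ==>
   x k = rclass S (n k) (s k) (t k) & s k \<in> cells S (n k) & t k \<in> standard_simplex (n k)" by metis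
 \<comment> \<open>The vertices of the chosen simplices, except those at 1, which coincide with 0 on
   the circle.\<close>
 define M where "M = (%k. (%j. sum (t k) {..<j}) ` {..n k} \<inter> {0..<1})"
 define Y where "Y = Sigma {..<lobes c} M"
 have Y: "finite Y" "Y <= points c" unfolding Y_def M_def points_def by auto
 define X where "X = Y \<union> insert (origin c) ({p. turn c p ~= p} \<union> (%k. (k, 0)) ` {..<lobes c})"
 have m: "marked c X" unfolding X_def by (rule ex_marked[OF cactus_pre[OF c] Y])
 have "carried S (on_lobe X k) (x k)" if k: "k < lobes c" for k
 proof -
  note nk = nst[OF k]
  have "carried S (on_lobe X k) (rclass S (n k) (s k) (t k))"
  proof (rule carriedI[OF S _ _ lobe_marks[OF m k]])
   fix j assume j: "j <= n k"
   have t: "t k \<in> standard_simplex (n k)" using nk by simp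
   have "sum (t k) {..<j} <= sum (t k) {..<Suc (n k)}"
    using j simplexD(1)[OF t] by (intro partial_sum_mono) auto
   also have "... = 1" using simplexD(4)[OF t] by (simp add: lessThan_Suc_atMost)
   finally have "sum (t k) {..<j} < 1 | sum (t k) {..<j} = 1" by linarith
   moreover have "0 <= sum (t k) {..<j}" using simplexD(1)[OF t] by (simp add: sum_nonneg)
   ultimately show "sum (t k) {..<j} \<in> on_lobe X k \<union> {1}"
    using k j by (auto simp: on_lobe_def X_def Y_def M_def)
  qed (use nk in auto)
  then show ?thesis using nk by simp
 qed
 then show thesis using that[of X] m by (simp add: carries_def)
qed

lemma lobe_cells_inputs:
 assumes S: "is_cyclic_set S" and X: "carries S c X x"
 shows "lobe_cells S c X x \<in> inputs S c X"
proof -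
 have m: "marked c X" using X by (simp add: carries_def)
 have "cell_on S (on_lobe X k) (x k) \<in> cells S (spines X k - 1)" if k: "k < lobes c" for k
  using carriedD(1)[OF S lobe_marks[OF m k]] X k by (simp add: carries_def spines_def)
 then show ?thesis by (auto simp: inputs_def lobe_cells_def)
qed

lemma cactus_setD:
 assumes "is_cactus_set S"
 shows "is_cyclic_set S"
  "spiny c X ==> x \<in> inputs S c X ==> smap S c X x \<in> cells S (card X - 1)"
  "spiny_equiv c X c' X' ==> x \<in> inputs S c X ==> smap S c X x = smap S c' X' x"
  "spiny c X ==> k < lobes c ==> i < spines X k ==>
    nth_mark (on_lobe X k) i < t ==> t < nth_mark (on_lobe X k) (Suc i) ==> x \<in> inputs S c X ==>
    smap S c (insert (k, t) X) (x(k := degeneracy S (spines X k - 1) i (x k))) =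
    degeneracy S (card X - 1) (seg_index c X k i) (smap S c X x)"
  "spiny c X ==> k < lobes c ==> i < spines X k ==> 2 <= spines X k ==> x \<in> inputs S c X ==>
    smap S (pinch c X k i) (pinch_spines X k i) (x(k := face S (spines X k - 2) i (x k))) =
    face S (card X - 2) (seg_index c X k i) (smap S c X x)"
  "matched c X d Y ==> x \<in> inputs S (graft c d) (graft_spines c d Y) ==>
    smap S c X (\<lambda>k\<in>{..<lobes c}. smap S (d k) (Y k)
       (\<lambda>l\<in>{..<lobes (d k)}. x (flat (%a. lobes (d a)) (k, l)))) =
    smap S (graft c d) (graft_spines c d Y) x"
proof -
 note D = assms[unfolded is_cactus_set_def]
 show "is_cyclic_set S" by (rule D[THEN conjunct1])
 show "smap S c X x \<in> cells S (card X - 1)" if "spiny c X" "x \<in> inputs S c X"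
  using D[THEN conjunct2, THEN conjunct1, rule_format, OF that(1)] that(2) by (rule funcset_mem)
 show "smap S c X x = smap S c' X' x" if "spiny_equiv c X c' X'" "x \<in> inputs S c X"
  by (rule D[THEN conjunct2, THEN conjunct2, THEN conjunct1, rule_format]) (rule that)+
 show "smap S c (insert (k, t) X) (x(k := degeneracy S (spines X k - 1) i (x k))) =
    degeneracy S (card X - 1) (seg_index c X k i) (smap S c X x)"
  if "spiny c X" "k < lobes c" "i < spines X k" "nth_mark (on_lobe X k) i < t"
   "t < nth_mark (on_lobe X k) (Suc i)" "x \<in> inputs S c X"
  by (rule D[THEN conjunct2, THEN conjunct2, THEN conjunct2, THEN conjunct1, rule_format]) (use that in simp_all)
 show "smap S (pinch c X k i) (pinch_spines X k i) (x(k := face S (spines X k - 2) i (x k))) =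
    face S (card X - 2) (seg_index c X k i) (smap S c X x)"
  if "spiny c X" "k < lobes c" "i < spines X k" "2 <= spines X k" "x \<in> inputs S c X"
  by (rule D[THEN conjunct2, THEN conjunct2, THEN conjunct2, THEN conjunct2, THEN conjunct1, rule_format]) (use that in simp_all)
 show "smap S c X (\<lambda>k\<in>{..<lobes c}. smap S (d k) (Y k)
       (\<lambda>l\<in>{..<lobes (d k)}. x (flat (%a. lobes (d a)) (k, l)))) =
    smap S (graft c d) (graft_spines c d Y) x"
  if "matched c X d Y" "x \<in> inputs S (graft c d) (graft_spines c d Y)"
  by (rule D[THEN conjunct2, THEN conjunct2, THEN conjunct2, THEN conjunct2, THEN conjunct2, rule_format]) (rule that)+
qed

lemma marked_card: "is_cactus c ==> marked c X ==> 0 < card X"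
 using circuit_marks[of c X] card_mark_set[of "on_circuit c X"] by simp

lemma gaps_circuit_simplex:
 "is_cactus c ==> marked c X ==> gaps (on_circuit c X) \<in> standard_simplex (card X - 1)"
 using circuit_marks[of c X] gaps_simplex[of "on_circuit c X"] by simp

text \<open>A new spine refines one segment of a lobe and the corresponding segment of the path. The
  input cell changes by the degeneracy at \<open>i\<close>, hence the output cell by the degeneracy
  at \<open>seg_index c X k i\<close>, and the gluing cancels the latter against the refined lengths
  along the path.\<close>

lemma value_at_insert:
 assumes S: "is_cactus_set S" and c: "is_cactus c" and X: "carries S c X x"
  and p: "p \<in> points c" "p \<notin> X"
 shows "value_at S c (insert p X) x = value_at S c X x"
proof -
 note cyc = cactus_setD(1)[OF S]
 have m: "marked c X" using X by (simp add: carries_def)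
 have sp: "spiny c X" using c m by (simp add: spiny_iff)
 obtain k t where kt: "p = (k, t)" by (cases p)
 have k: "k < lobes c" and t: "0 <= t" "t < 1" using p(1) by (simp_all add: kt points_iff)
 note A = lobe_marks[OF m k] and T = circuit_marks[OF c m]
 let ?A = "on_lobe X k" and ?T = "on_circuit c X"
 obtain a where a: "a \<in> ?A" "a <= t" "t < next_mark ?A a" using mark_below[OF A t] by blast
 define i where "i = mark_rank ?A a"
 note ri = nth_mark_rank[OF A a(1), folded i_def]
 have i: "i < spines X k" using ri(2) by (simp add: spines_def)
 have "a ~= t" using a(1) p(2) kt by (auto simp: on_lobe_iff)
 then have ti: "nth_mark ?A i < t" "t < nth_mark ?A (Suc i)"
  using a ri next_mark_nth[OF A ri(2)] by simp_all
 let ?j = "seg_index c X k i"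
 note j = seg_index_props[OF c m k i]
 have r: "0 < radius c k" by (rule precactus_radius[OF cactus_pre[OF c] k])
 have on_k: "on_lobe (insert p X) k = insert t ?A" by (auto simp: on_lobe_def kt)
 have on_l: "on_lobe (insert p X) l = on_lobe X l" if "l ~= k" for l
  using that by (auto simp: on_lobe_def kt)
 have P: "carried S ?A (x k)" using X k by (simp add: carries_def)
 have cells: "lobe_cells S c (insert p X) x =
   (lobe_cells S c X x)(k := degeneracy S (spines X k - 1) i (lobe_cells S c X x k))"
 proof
  fix l
  show "lobe_cells S c (insert p X) x l =
    ((lobe_cells S c X x)(k := degeneracy S (spines X k - 1) i (lobe_cells S c X x k))) l"
   using cell_on_insert(1)[OF cyc A ri(2) ti P] on_k on_l[of l] k
   by (auto simp: lobe_cells_def spines_def)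
 qed
 have smap: "smap S c (insert p X) (lobe_cells S c (insert p X) x) =
   degeneracy S (card X - 1) ?j (smap S c X (lobe_cells S c X x))"
  unfolding cells unfolding kt
  by (rule cactus_setD(4)[OF S sp k i ti lobe_cells_inputs[OF cyc X]])
 let ?s = "nth_mark ?T ?j"
 let ?h = "radius c k * (t - nth_mark ?A i)"
 have jT: "?j < card ?T" using j(1) T(2) by simp
 have g1: "gaps ?A i = nth_mark ?A (Suc i) - nth_mark ?A i" using ri(2) by (simp add: gaps_def)
 have g2: "gaps ?T ?j = nth_mark ?T (Suc ?j) - ?s" using jT by (simp add: gaps_def)
 have nxt: "nth_mark ?T (Suc ?j) = ?s + radius c k * (nth_mark ?A (Suc i) - nth_mark ?A i)"
  using gaps_on_circuit[OF c m k i] unfolding g1 g2 by simp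
 have h: "0 < ?h" "?h < radius c k * (nth_mark ?A (Suc i) - nth_mark ?A i)" using r ti by simp_all
 have fp: "circuit c (?s + ?h) = p"
  using seg_travel(1)[OF c m k i j(3), of ?h] h r by (simp add: kt)
 have lt1: "?s + ?h < 1"
 proof -
  have "nth_mark ?T (Suc ?j) <= 1"
   using nth_mark_le[OF T(1), of "Suc ?j" "card ?T"] jT nth_mark_card[of ?T] by simp
  then show ?thesis using h nxt by linarith
 qed
 have ge0: "0 <= ?s + ?h" using nth_mark_range[OF T(1) jT] h by simp
 have on_T: "on_circuit c (insert p X) = insert (?s + ?h) ?T"
 proof -
  have "circuit c u = p \<longleftrightarrow> u = ?s + ?h" if "0 <= u" "u < 1" for u
  proof
   assume "circuit c u = p"
   then have "circuit c u = circuit c (?s + ?h)" using fp by simp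
   then show "u = ?s + ?h"
    using that lt1 ge0 by (intro good_circuit_inj[OF cactus_circuit(1)[OF c]]) auto
  qed (use fp in simp)
  then show ?thesis using fp lt1 ge0 by (auto simp: on_circuit_def)
 qed
 have between: "?s < ?s + ?h" "?s + ?h < nth_mark ?T (Suc ?j)" using h nxt by simp_all
 have card: "card (insert p X) - 1 = Suc (card X - 1)"
  using p(2) m marked_card[OF c m] by (simp add: marked_def)
 have j': "?j <= card X - 1" using j(1) by simp
 have ins: "mark_set (insert (?s + ?h) ?T)" "card (insert (?s + ?h) ?T) = Suc (card ?T)"
  using insert_mark(1,3)[OF T(1) jT between] by simp_all
 have "gaps (insert (?s + ?h) ?T) \<in> standard_simplex (Suc (card X - 1))"
  using gaps_simplex[OF ins(1)] ins(2) T(2) marked_card[OF c m] by simp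
 then have "rclass S (Suc (card X - 1)) (degeneracy S (card X - 1) ?j (smap S c X (lobe_cells S c X x)))
   (gaps (insert (?s + ?h) ?T)) =
   rclass S (card X - 1) (smap S c X (lobe_cells S c X x))
    (simplical_degeneracy ?j (gaps (insert (?s + ?h) ?T)))"
  by (rule rclass_degeneracy[OF cactus_setD(2)[OF S sp lobe_cells_inputs[OF cyc X]] j'])
 then show ?thesis
  unfolding value_at_def smap card on_T simplical_degeneracy_gaps_insert[OF T(1) jT between] .
qed

lemma value_at_union:
 assumes S: "is_cactus_set S" and c: "is_cactus c" and X: "carries S c X x"
  and Y: "finite Y" "Y <= points c"
 shows "value_at S c (X \<union> Y) x = value_at S c X x"
 using Y
proof (induction Y rule: finite_induct)
 case (insert p Y)
 note cyc = cactus_setD(1)[OF S]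
 have XY: "carries S c (X \<union> Y) x" using insert by (intro carries_union[OF cyc X]) auto
 show ?case
 proof (cases "p \<in> X \<union> Y")
  case True
  then have "X \<union> insert p Y = X \<union> Y" by auto
  then show ?thesis using insert by simp
 next
  case False
  have e: "X \<union> insert p Y = insert p (X \<union> Y)" by auto
  have "value_at S c (insert p (X \<union> Y)) x = value_at S c (X \<union> Y) x"
   using insert False by (intro value_at_insert[OF S c XY]) auto
  then show ?thesis unfolding e using insert by simp
 qed
qed simp

text \<open>Two choices of spines are both compared with their union.\<close>

lemma cactus_act_eq:
 assumes S: "is_cactus_set S" and c: "is_cactus c" and X: "carries S c X x"
 shows "cactus_act S c x = value_at S c X x"
proof -
 define Y where "Y = (SOME X. carries S c X x)"
 have Y: "carries S c Y x" unfolding Y_def by (rule someI[of "%X. carries S c X x", OF X])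
 have fin: "finite X" "X <= points c" "finite Y" "Y <= points c"
  using X Y by (auto simp: carries_def marked_def)
 have "cactus_act S c x = value_at S c Y x" by (simp add: cactus_act_def Y_def)
 also have "... = value_at S c (Y \<union> X) x" by (rule value_at_union[OF S c Y fin(1,2), symmetric])
 also have "... = value_at S c (X \<union> Y) x" by (simp add: Un_commute)
 also have "... = value_at S c X x" by (rule value_at_union[OF S c X fin(3,4)])
 finally show ?thesis .
qed

lemma cactus_act_cells:
 assumes S: "is_cactus_set S" and c: "is_cactus c" and X: "marked c X"
  and s: "!!k. k < lobes c ==> s k \<in> cells S (spines X k - 1)"
  and x: "!!k. k < lobes c ==> x k = rclass S (spines X k - 1) (s k) (gaps (on_lobe X k))"
 shows "cactus_act S c x =
  rclass S (card X - 1) (smap S c X (\<lambda>k\<in>{..<lobes c}. s k)) (gaps (on_circuit c X))"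
  "carries S c X x" "(\<lambda>k\<in>{..<lobes c}. s k) \<in> inputs S c X"
proof -
 note cyc = cactus_setD(1)[OF S]
 show car: "carries S c X x"
  using X s x unfolding carries_def carried_def spines_def by blast
 have "lobe_cells S c X x = (\<lambda>k\<in>{..<lobes c}. s k)"
 proof
  fix k
  show "lobe_cells S c X x k = (\<lambda>k\<in>{..<lobes c}. s k) k"
   using cell_on_rclass_gaps[OF cyc lobe_marks[OF X], of k "s k"] s[of k] x[of k]
   by (simp add: lobe_cells_def spines_def)
 qed
 then show "cactus_act S c x =
   rclass S (card X - 1) (smap S c X (\<lambda>k\<in>{..<lobes c}. s k)) (gaps (on_circuit c X))"
  "(\<lambda>k\<in>{..<lobes c}. s k) \<in> inputs S c X"
  using cactus_act_eq[OF S c car] lobe_cells_inputs[OF cyc car] by (simp_all add: value_at_def)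
qed

lemma cactus_act_topspace:
 assumes S: "is_cactus_set S" and c: "is_cactus c" and x: "!!k. k < lobes c ==> x k \<in> topspace (realization S)"
 shows "cactus_act S c x \<in> topspace (realization S)"
proof -
 note cyc = cactus_setD(1)[OF S]
 obtain X where X: "carries S c X x" by (rule ex_carries[OF cyc c x])
 have m: "marked c X" using X by (simp add: carries_def)
 have "smap S c X (lobe_cells S c X x) \<in> cells S (card X - 1)"
  using c m by (intro cactus_setD(2)[OF S _ lobe_cells_inputs[OF cyc X]]) (simp add: spiny_iff)
 then show ?thesis
  unfolding cactus_act_eq[OF S c X] value_at_def topspace_realization
  using gaps_circuit_simplex[OF c m] by blast
qed

section \<open>Composition, symmetry, unit and naturality of the action\<close>

lemma induced_cactus_act:
 assumes S: "is_cactus_set S"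
 shows "induced_action S (cactus_act S)"
 unfolding induced_action_def
proof (intro allI impI ballI)
 fix c X x assume sp: "spiny c X" and x: "x \<in> inputs S c X"
 have c: "is_cactus c" and m: "marked c X" using sp by (simp_all add: spiny_iff)
 have ext: "(\<lambda>k\<in>{..<lobes c}. x k) = x"
  using x unfolding inputs_def by (auto simp: PiE_def extensional_restrict)
 have cells: "x k \<in> cells S (spines X k - 1)" if "k < lobes c" for k
  using x that unfolding inputs_def by (auto dest: PiE_mem)
 show "cactus_act S c (\<lambda>k\<in>{..<lobes c}. rclass S (spines X k - 1) (x k) (gaps (on_lobe X k))) =
    rclass S (card X - 1) (smap S c X x) (gaps (on_circuit c X))"
  using cactus_act_cells(1)[OF S c m cells, of "\<lambda>k\<in>{..<lobes c}. rclass S (spines X k - 1) (x k) (gaps (on_lobe X k))"]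
  unfolding ext by simp
qed

lemma cactus_act_restrict:
 assumes "!!k. k < lobes c ==> x k = y k"
 shows "cactus_act S c x = cactus_act S c y"
proof -
 have a: "carries S c X x = carries S c X y" for X using assms by (simp add: carries_def)
 have b: "lobe_cells S c X x = lobe_cells S c X y" for X
  using assms by (auto simp: lobe_cells_def intro!: ext)
 show ?thesis by (simp only: cactus_act_def value_at_def a b)
qed

text \<open>The composition axiom applies only to matched spines. So spines of \<open>d k\<close>
  that carry the inputs are enlarged by the images of some spines of \<open>c\<close>, and then
  \<open>X\<close> is taken as the preimage of the resulting sets \<open>Y k\<close>.\<close>

lemma cactus_act_graft:
 assumes S: "is_cactus_set S" and c: "is_cactus c" and d: "!!k. k < lobes c ==> is_cactus (d k)"
  and x: "!!q. q < lobes (graft c d) ==> x q \<in> topspace (realization S)"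
 shows "cactus_act S (graft c d) x =
  cactus_act S c (\<lambda>k\<in>{..<lobes c}. cactus_act S (d k)
   (\<lambda>l\<in>{..<lobes (d k)}. x (flat (%a. lobes (d a)) (k, l))))"
proof -
 note cyc = cactus_setD(1)[OF S]
 let ?fl = "flat (%a. lobes (d a))" and ?G = "graft c d"
 have lobG: "lobes ?G = (\<Sum>k<lobes c. lobes (d k))" by (rule lobes_graft[OF c d])
 have fl: "?fl (k, l) < lobes ?G" if "k < lobes c" "l < lobes (d k)" for k l
  unfolding lobG by (rule flat_less[where m = "%k. lobes (d k)", OF that])
 define y where "y = (%k. \<lambda>l\<in>{..<lobes (d k)}. x (?fl (k, l)))"
 have "\<exists>Y. carries S (d k) Y (y k)" if k: "k < lobes c" for k
 proof -
  have "y k l \<in> topspace (realization S)" if "l < lobes (d k)" for l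
   using x[OF fl[OF k that]] that by (simp add: y_def)
  then show ?thesis using ex_carries[OF cyc d[OF k]] by metis
 qed
 then obtain Y0 where Y0: "!!k. k < lobes c ==> carries S (d k) (Y0 k) (y k)" by metis
 obtain X0 where X0: "marked c X0" using ex_marked[OF cactus_pre[OF c], of "{}"] by auto
 have finX0: "finite (on_lobe X0 k)" if "k < lobes c" for k
  using lobe_marks[OF X0 that] by (simp add: mark_set_def)
 have circd: "is_circuit (d k) (circuit (d k))" if "k < lobes c" for k
  using cactus_circuit(1)[OF d[OF that]] by (simp add: good_circuit_def)
 define Y where "Y = (%k. Y0 k \<union> circuit (d k) ` on_lobe X0 k)"
 have Y: "carries S (d k) (Y k) (y k)" if "k < lobes c" for k
  unfolding Y_def using finX0[OF that] circuit_points[OF circd[OF that]]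
  by (intro carries_union[OF cyc Y0[OF that]]) auto
 have mY: "marked (d k) (Y k)" if "k < lobes c" for k using Y[OF that] by (simp add: carries_def)
 define X where "X = Sigma {..<lobes c} (%k. on_circuit (d k) (Y k))"
 have onX: "on_lobe X k = on_circuit (d k) (Y k)" if "k < lobes c" for k
  using that by (auto simp: X_def on_lobe_def)
 have X0X: "X0 <= X"
 proof
  fix p assume p: "p \<in> X0"
  then have "p \<in> points c" using X0 by (auto simp: marked_def)
  then show "p \<in> X" using p by (cases p) (auto simp: X_def on_circuit_def Y_def points_iff on_lobe_def)
 qed
 have finT: "finite (on_circuit (d k) (Y k))" "on_circuit (d k) (Y k) <= {0..<1}" if "k < lobes c" for k
  using circuit_marks(1)[OF d[OF that] mY[OF that]] by (simp_all add: mark_set_def)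
 have X: "marked c X"
 proof -
  have "marked c (X0 \<union> X)"
   using finT by (intro marked_union[OF X0]) (auto simp: X_def points_def)
  then show ?thesis using X0X by (simp add: Un_absorb1)
 qed
 have mat: "matched c X d Y"
  using c d X mY onX by (auto simp: matched_def spiny_iff)
 define GS where "GS = graft_spines c d Y"
 have inGS: "graft_incl d k p \<in> GS \<longleftrightarrow> p \<in> Y k" if k: "k < lobes c" and p: "p \<in> points (d k)" for k p
 proof
  assume "graft_incl d k p \<in> GS"
  then obtain k' p' where kp: "k' < lobes c" "p' \<in> Y k'" "graft_incl d k p = graft_incl d k' p'"
   unfolding GS_def graft_spines_def by blast
  have "p' \<in> points (d k')" using kp mY[OF kp(1)] by (auto simp: marked_def)
  then have "k = k'" "p = p'" using graft_incl_inj[OF c d k p kp(1) _ kp(3)] by simp_all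
  then show "p \<in> Y k" using kp by simp
 qed (use k in \<open>auto simp: GS_def graft_spines_def\<close>)
 have gmGS: "graft_map d p \<in> GS \<longleftrightarrow> p \<in> X" if p: "p \<in> points c" for p
 proof -
  have k: "fst p < lobes c" and t: "0 <= snd p" "snd p < 1" using p by (auto simp: points_def)
  have "graft_map d p = graft_incl d (fst p) (circuit (d (fst p)) (snd p))"
   by (simp add: graft_map_def split_beta)
  then have "graft_map d p \<in> GS \<longleftrightarrow> circuit (d (fst p)) (snd p) \<in> Y (fst p)"
   using inGS[OF k circuit_points[OF circd[OF k]]] by simp
  also have "... \<longleftrightarrow> p \<in> X" using k t by (cases p) (simp add: X_def on_circuit_def)
  finally show ?thesis .
 qed
 have Gc: "is_cactus ?G" and Gcirc: "circuit ?G = graft_map d \<circ> circuit c"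
  using graft_cactus[OF c d] by simp_all
 have circ_9: "is_circuit c (circuit c)" using cactus_circuit(1)[OF c] by (simp add: good_circuit_def)
 have onT: "on_circuit ?G GS = on_circuit c X"
  using gmGS[OF circuit_points[OF circ_9]] by (simp add: on_circuit_def Gcirc)
 have mG: "marked ?G GS"
  unfolding marked_def
 proof (intro conjI allI impI subsetI)
  show "finite GS" using mY by (auto simp: GS_def graft_spines_def marked_def)
  show "p \<in> points ?G" if pGS: "p \<in> GS" for p
  proof -
   obtain k q where kq: "k < lobes c" "q \<in> Y k" "p = graft_incl d k q"
    using pGS unfolding GS_def graft_spines_def by blast
   then have qd: "q \<in> points (d k)" using mY[OF kq(1)] by (auto simp: marked_def)
   show ?thesis unfolding kq(3) by (intro graft_incl_points c kq(1) qd) (erule d)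
  qed
  have "origin c \<in> points c" "origin c \<in> X" using X by (auto simp: marked_def)
  then show "origin ?G \<in> GS" using gmGS by (simp add: graft_def Let_def)
  fix i assume "i < lobes ?G"
  then obtain k l where kl: "k < lobes c" "l < lobes (d k)" "i = ?fl (k, l)"
   unfolding lobG by (rule flat_surj)
  have "(l, 0) \<in> Y k" "(l, 0) \<in> points (d k)" using mY[OF kl(1)] kl(2) by (auto simp: marked_def)
  then show "(i, 0) \<in> GS" using inGS[OF kl(1), of "(l, 0)"] by (simp add: graft_incl_def kl(3))
 next
  fix q assume "q \<in> {p. turn ?G p ~= p}"
  then have moved: "turn ?G q ~= q" by simp
  have qG: "q \<in> points ?G"
  proof (rule ccontr)
   assume "q \<notin> points ?G"
   then have "turn ?G q = q" by (intro turn_graft_outside c) (erule d)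
   then show False using moved by simp
  qed
  obtain k p where kp: "k < lobes c" "p \<in> points (d k)" "q = graft_incl d k p"
   using points_graftE[of c d q, OF c d qG] by blast
  show "q \<in> GS"
  proof (rule ccontr)
   assume "q \<notin> GS"
   then have pY: "p \<notin> Y k" using inGS kp by simp
   then have "turn (d k) p = p" using mY[OF kp(1)] by (auto simp: marked_def)
   note v = circuit_visit_time[OF cactus_circuit(1)[OF d[OF kp(1)]] refl kp(2)]
   have "(k, visit_time (d k) p) \<notin> X" using pY v by (simp add: X_def on_circuit_def)
   then have "turn c (k, visit_time (d k) p) = (k, visit_time (d k) p)" using X by (auto simp: marked_def)
   moreover have "turn ?G q = graft_map d (turn c (k, visit_time (d k) (turn (d k) p)))"
    unfolding kp(3) by (intro turn_graft c kp(1,2)) (erule d)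
   ultimately have "turn ?G q = q"
    unfolding kp(3) \<open>turn (d k) p = p\<close> using v by (simp add: graft_map_def)
   then show False using moved by simp
  qed
 qed
 have onGS: "on_lobe GS (?fl (k, l)) = on_lobe (Y k) l" if k: "k < lobes c" and l: "l < lobes (d k)" for k l
 proof -
  have "(?fl (k, l), t) \<in> GS \<longleftrightarrow> (l, t) \<in> Y k" for t
  proof (cases "0 <= t & t < 1")
   case True
   then show ?thesis using inGS[OF k, of "(l, t)"] l by (simp add: points_iff graft_incl_def)
  next
   case False
   then have "(?fl (k, l), t) \<notin> points ?G" "(l, t) \<notin> points (d k)" by (auto simp: points_iff)
   then show ?thesis using mG mY[OF k] by (auto simp: marked_def)
  qed
  then show ?thesis by (simp add: on_lobe_def)
 qed
 have carG: "carries S ?G GS x"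
  unfolding carries_def
 proof (intro conjI allI impI mG)
  fix q assume "q < lobes ?G"
  then obtain k l where kl: "k < lobes c" "l < lobes (d k)" "q = ?fl (k, l)"
   unfolding lobG by (rule flat_surj)
  have "carried S (on_lobe (Y k) l) (y k l)" using Y[OF kl(1)] kl(2) by (simp add: carries_def)
  then show "carried S (on_lobe GS q) (x q)" using kl onGS[OF kl(1,2)] by (simp add: y_def)
 qed
 define z where "z = (%k. smap S (d k) (Y k) (lobe_cells S (d k) (Y k) (y k)))"
 have spines: "spines X k = card (Y k)" if "k < lobes c" for k
  using circuit_marks(2)[OF d[OF that] mY[OF that]] by (simp add: spines_def onX[OF that])
 have zc: "z k \<in> cells S (spines X k - 1)" if k: "k < lobes c" for k
  unfolding z_def spines[OF k] using d[OF k] mY[OF k]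
  by (intro cactus_setD(2)[OF S _ lobe_cells_inputs[OF cyc Y[OF k]]]) (simp add: spiny_iff)
 \<comment> \<open>The inner action produces a cell with one vertex for each point of
   \<open>Y k\<close>, placed at the visit times of these points; by the matching this is a cell on
   the segments of the k-th lobe of \<open>c\<close>.\<close>
 let ?w = "\<lambda>k\<in>{..<lobes c}. cactus_act S (d k) (y k)"
 have w: "?w k = rclass S (spines X k - 1) (z k) (gaps (on_lobe X k))" if k: "k < lobes c" for k
  using cactus_act_eq[OF S d[OF k] Y[OF k]] k by (simp add: value_at_def z_def spines onX)
 have "cactus_act S c ?w = rclass S (card X - 1) (smap S c X (\<lambda>k\<in>{..<lobes c}. z k)) (gaps (on_circuit c X))"
  by (rule cactus_act_cells(1)[OF S c X zc w])
 also have "smap S c X (\<lambda>k\<in>{..<lobes c}. z k) = smap S ?G GS (lobe_cells S ?G GS x)"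
 proof -
  have "(\<lambda>l\<in>{..<lobes (d k)}. lobe_cells S ?G GS x (?fl (k, l))) = lobe_cells S (d k) (Y k) (y k)"
   if k: "k < lobes c" for k
  proof
   fix l
   show "(\<lambda>l\<in>{..<lobes (d k)}. lobe_cells S ?G GS x (?fl (k, l))) l = lobe_cells S (d k) (Y k) (y k) l"
    using fl[OF k, of l] onGS[OF k, of l] by (simp add: lobe_cells_def y_def)
  qed
  then have "(\<lambda>k\<in>{..<lobes c}. smap S (d k) (Y k)
    (\<lambda>l\<in>{..<lobes (d k)}. lobe_cells S ?G GS x (?fl (k, l)))) = (\<lambda>k\<in>{..<lobes c}. z k)"
   by (auto simp: z_def intro!: restrict_ext)
  moreover note cactus_setD(6)[OF S mat, of "lobe_cells S ?G GS x"]
  moreover have "lobe_cells S ?G GS x \<in> inputs S ?G (graft_spines c d Y)"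
   using lobe_cells_inputs[OF cyc carG] by (simp add: GS_def)
  ultimately show ?thesis by (simp add: GS_def)
 qed
 also have "card X = card GS" using circuit_marks(2)[OF c X] circuit_marks(2)[OF Gc mG] onT by simp
 also have "on_circuit c X = on_circuit ?G GS" by (rule onT[symmetric])
 also have "rclass S (card GS - 1) (smap S ?G GS (lobe_cells S ?G GS x)) (gaps (on_circuit ?G GS)) =
   cactus_act S ?G x"
  unfolding cactus_act_eq[OF S Gc carG] value_at_def ..
 finally show ?thesis unfolding y_def by (rule sym)
qed

lemma cactus_act_relabel:
 assumes S: "is_cactus_set S" and eq: "equivariant_smap S" and c: "is_cactus c"
  and sg: "sg permutes {..<lobes c}" and x: "!!k. k < lobes c ==> x k \<in> topspace (realization S)"
 shows "cactus_act S (relabel sg c) x = cactus_act S c (x \<circ> sg)"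
proof -
 note cyc = cactus_setD(1)[OF S]
 let ?R = "relabel sg c" and ?h = "map_prod sg (id :: real => real)"
 have less: "sg k < lobes c \<longleftrightarrow> k < lobes c" for k using permutes_in_image[OF sg, of k] by simp
 have inj: "sg k = sg l \<longleftrightarrow> k = l" for k l using permutes_inj[OF sg] by (auto dest: injD)
 have surj: "\<exists>k. q = sg k" for q using permutes_surj[OF sg] by (metis surjD)
 have lob: "lobes ?R = lobes c" by (simp add: relabel_def)
 have Rc: "is_cactus ?R" and Rcirc: "circuit ?R = ?h \<circ> circuit c" using relabel_cactus[OF c sg] by simp_all
 have xs: "(x \<circ> sg) k \<in> topspace (realization S)" if "k < lobes c" for k using x[of "sg k"] that less by simp
 obtain X where X: "carries S c X (x \<circ> sg)" by (rule ex_carries[OF cyc c xs])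
 have m: "marked c X" using X by (simp add: carries_def)
 have hX: "(sg k, t) \<in> ?h ` X \<longleftrightarrow> (k, t) \<in> X" for k t
 proof
  assume "(sg k, t) \<in> ?h ` X"
  then obtain p where p: "(sg k, t) = ?h p" "p \<in> X" by (rule imageE)
  then have "p = (k, t)" by (cases p) (simp add: inj)
  then show "(k, t) \<in> X" using p by simp
 next
  assume "(k, t) \<in> X"
  then have "?h (k, t) \<in> ?h ` X" by (rule imageI)
  then show "(sg k, t) \<in> ?h ` X" by simp
 qed
 have mem: "?h p \<in> ?h ` X \<longleftrightarrow> p \<in> X" for p using hX[of "fst p" "snd p"] by (cases p) simp
 have on: "on_lobe (?h ` X) (sg k) = on_lobe X k" for k unfolding on_lobe_def hX ..
 have onT: "on_circuit ?R (?h ` X) = on_circuit c X" unfolding on_circuit_def Rcirc comp_def mem ..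
 have mR: "marked ?R (?h ` X)"
  unfolding marked_def
 proof (intro conjI allI impI subsetI)
  show "finite (?h ` X)" using m by (simp add: marked_def)
  fix p assume "p \<in> ?h ` X"
  then obtain q where "p = ?h q" "q \<in> X" by (rule imageE)
  moreover from this have "q \<in> points c" using m by (auto simp: marked_def)
  ultimately show "p \<in> points ?R" using less lob by (cases q) (simp add: points_iff)
 next
  show "origin ?R \<in> ?h ` X" using m by (simp add: relabel_def marked_def)
  fix i assume "i < lobes ?R"
  moreover obtain k where "i = sg k" using surj by blast
  ultimately show "(i, 0) \<in> ?h ` X" using less lob m hX by (simp add: marked_def)
 next
  fix p assume "p \<in> {p. turn ?R p ~= p}"
  then have moved: "turn ?R p ~= p" by simp
  obtain k where k: "fst p = sg k" using surj by blast
  have p: "p = ?h (k, snd p)" using k by (simp add: prod_eq_iff)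
  have "inv_into UNIV sg (sg k) = k" using permutes_inverses(2)[OF sg] by simp
  then have "turn ?R p = ?h (turn c (k, snd p))" by (subst p) (simp add: relabel_def)
  then have "turn c (k, snd p) ~= (k, snd p)" using moved p by auto
  then have "(k, snd p) \<in> X" using m by (auto simp: marked_def)
  then show "p \<in> ?h ` X" by (subst p) (rule imageI)
 qed
 have carR: "carries S ?R (?h ` X) x"
  unfolding carries_def
 proof (intro conjI allI impI mR)
  fix q assume q: "q < lobes ?R"
  obtain k where k: "q = sg k" using surj by blast
  then have "carried S (on_lobe X k) ((x \<circ> sg) k)" using X q less lob by (simp add: carries_def)
  then show "carried S (on_lobe (?h ` X) q) (x q)" by (simp add: k on)
 qed
 have cells: "lobe_cells S ?R (?h ` X) x \<circ> sg = lobe_cells S c X (x \<circ> sg)"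
  by (rule ext) (simp add: lobe_cells_def less lob on)
 have "smap S ?R (?h ` X) (lobe_cells S ?R (?h ` X) x) = smap S c X (lobe_cells S ?R (?h ` X) x \<circ> sg)"
  using eq c m sg lobe_cells_inputs[OF cyc carR] unfolding equivariant_smap_def spiny_iff by blast
 then have "smap S ?R (?h ` X) (lobe_cells S ?R (?h ` X) x) = smap S c X (lobe_cells S c X (x \<circ> sg))"
  unfolding cells .
 moreover have "card (?h ` X) = card X"
  using circuit_marks(2)[OF Rc mR] circuit_marks(2)[OF c m] onT by simp
 ultimately show ?thesis
  unfolding cactus_act_eq[OF S Rc carR] cactus_act_eq[OF S c X] value_at_def onT by simp
qed

text \<open>The path around the unit cactus is the identity of the circle, so the lengths along the
  path are those along the lobe.\<close>

lemma cactus_act_unit: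
 assumes S: "is_cactus_set S" and un: "unital_smap S" and x: "x 0 \<in> topspace (realization S)"
 shows "cactus_act S cactus_unit x = x 0"
proof -
 note cyc = cactus_setD(1)[OF S] and U = unit_cactus
 have lob: "lobes cactus_unit = 1" by (simp add: cactus_unit_def)
 obtain X where X: "carries S cactus_unit X x" by (rule ex_carries[OF cyc U(1), where x = x]) (use x lob in auto)
 have m: "marked cactus_unit X" using X by (simp add: carries_def)
 have "smap S cactus_unit X (lobe_cells S cactus_unit X x) = lobe_cells S cactus_unit X x 0"
  using un U(1) m lobe_cells_inputs[OF cyc X] unfolding unital_smap_def spiny_iff by blast
 then have sm: "smap S cactus_unit X (lobe_cells S cactus_unit X x) = cell_on S (on_lobe X 0) (x 0)"
  by (simp add: lobe_cells_def lob)
 have A: "mark_set (on_lobe X 0)" using lobe_marks[OF m, of 0] lob by simp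
 have onT: "on_circuit cactus_unit X = on_lobe X 0"
  using A by (auto simp: on_circuit_def U(2) on_lobe_def mark_set_def frac_id)
 have P: "carried S (on_lobe X 0) (x 0)" using X lob by (simp add: carries_def)
 have "card X = card (on_lobe X 0)" using circuit_marks(2)[OF U(1) m] onT by simp
 then show ?thesis
  unfolding cactus_act_eq[OF S U(1) X] value_at_def sm onT using carriedD(2)[OF cyc A P] by simp
qed

text \<open>\<open>g\<close> commutes with faces and degeneracies and so preserves the gluing; the
  union in \<open>realization_map\<close> is over a constant family.\<close>

lemma realization_map_rclass:
 assumes S: "is_cyclic_set S" and T: "is_cyclic_set T" and g: "is_cactus_set_hom S T g"
  and s: "s \<in> cells S n" and t: "t \<in> standard_simplex n"
 shows "realization_map T g (rclass S n s t) = rclass T n (g n s) t"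
proof -
 have gc_9: "g n s \<in> cells T n" if "s \<in> cells S n" for n s
  using g that by (auto simp: is_cactus_set_hom_def)
 have gact: "g m (op_act S m n ph s) = op_act T m n ph (g n s)" if "monotone_op m n ph" "s \<in> cells S n" for m n ph s
  using g that periodic_ext_cyc_hom[OF that(1)] unfolding is_cactus_set_hom_def op_act_def by blast
 let ?G = "%(n, s, t). (n, g n s, t)"
 have gl: "glued T (?G p) (?G q)" if "glued S p q" for p q
  using that
 proof cases
  case (glued_face s n i t)
  have "g n (face S n i s) = face T n i (g (Suc n) s)"
   using gact[OF monotone_skip_op, of s n i] glued_face(3) by (simp add: face_eq_op_act)
  then show ?thesis unfolding glued_face(1,2)
   using glued.glued_face[OF gc_9[OF glued_face(3)] glued_face(4,5)] by simp
 next
  case (glued_degeneracy s n i t)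
  have "g (Suc n) (degeneracy S n i s) = degeneracy T n i (g n s)"
   using gact[OF monotone_repeat_op[OF glued_degeneracy(4)] glued_degeneracy(3)] by (simp add: degeneracy_eq_op_act)
  then show ?thesis unfolding glued_degeneracy(1,2)
   using glued.glued_degeneracy[OF gc_9[OF glued_degeneracy(3)] glued_degeneracy(4,5)] by simp
 qed
 have equiv: "equivclp (glued T) (?G p) (?G q)" if "equivclp (glued S) p q" for p q
  using that
 proof (induction rule: equivclp_induct)
  case (step y z)
  have "equivclp (glued T) (?G y) (?G z)"
   using step(2)
  proof (elim disjE)
   assume "glued S y z"
   then show ?thesis by (intro r_into_equivclp gl)
  next
   assume "glued S z y"
   then show ?thesis by (intro equivclp_sym[OF r_into_equivclp] gl)
  qed
  then show ?case using step(3) by (rule equivclp_trans[rotated])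
 qed simp
 have eq: "rclass T n' (g n' s') t' = rclass T n (g n s) t" if "(n', s', t') \<in> rclass S n s t" for n' s' t'
  using equiv[of "(n, s, t)" "(n', s', t')"] that rclass_eqI[of T n "g n s" t n' "g n' s'" t']
  by (simp add: rclass_def)
 show ?thesis
  unfolding realization_map_def
 proof (rule SUP_eq_const)
  show "rclass S n s t ~= {}" using rclass_self[of n s t S] by blast
  fix p assume p: "p \<in> rclass S n s t"
  obtain n' s' t' where "p = (n', s', t')" by (cases p)
  then show "(case p of (n, s, t) => rclass T n (g n s) t) = rclass T n (g n s) t"
   using eq p by simp
 qed
qed

lemma cactus_act_natural:
 assumes S: "is_cactus_set S" and T: "is_cactus_set T" and g: "is_cactus_set_hom S T g"
  and c: "is_cactus c" and x: "!!k. k < lobes c ==> x k \<in> topspace (realization S)"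
 shows "realization_map T g (cactus_act S c x) =
  cactus_act T c (\<lambda>k\<in>{..<lobes c}. realization_map T g (x k))"
proof -
 note cS = cactus_setD(1)[OF S] and cT = cactus_setD(1)[OF T]
 obtain X where X: "carries S c X x" by (rule ex_carries[OF cS c x])
 have m: "marked c X" using X by (simp add: carries_def)
 have sp: "spiny c X" using c m by (simp add: spiny_iff)
 note lc = lobe_cells_inputs[OF cS X]
 define s where "s = lobe_cells S c X x"
 have s: "s k \<in> cells S (spines X k - 1)" if "k < lobes c" for k
  using lc that unfolding s_def inputs_def by (auto dest: PiE_mem)
 have xk: "x k = rclass S (spines X k - 1) (s k) (gaps (on_lobe X k))" if k: "k < lobes c" for k
  using carriedD(2)[OF cS lobe_marks[OF m k]] X k by (simp add: carries_def s_def lobe_cells_def spines_def)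
 have gx: "realization_map T g (x k) = rclass T (spines X k - 1) (g (spines X k - 1) (s k)) (gaps (on_lobe X k))"
  if k: "k < lobes c" for k
  unfolding xk[OF k] using gaps_simplex[OF lobe_marks[OF m k]]
  by (intro realization_map_rclass[OF cS cT g s[OF k]]) (simp add: spines_def)
 have gs: "g (spines X k - 1) (s k) \<in> cells T (spines X k - 1)" if "k < lobes c" for k
  using g s[OF that] by (auto simp: is_cactus_set_hom_def)
 have "cactus_act T c (\<lambda>k\<in>{..<lobes c}. realization_map T g (x k)) =
   rclass T (card X - 1) (smap T c X (\<lambda>k\<in>{..<lobes c}. g (spines X k - 1) (s k))) (gaps (on_circuit c X))"
  by (rule cactus_act_cells(1)[OF T c m gs]) (use gx in auto)
 also have "smap T c X (\<lambda>k\<in>{..<lobes c}. g (spines X k - 1) (s k)) = g (card X - 1) (smap S c X s)"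
  using g sp lc unfolding is_cactus_set_hom_def s_def by (elim conjE) metis
 also have "rclass T (card X - 1) ... (gaps (on_circuit c X)) =
   realization_map T g (rclass S (card X - 1) (smap S c X s) (gaps (on_circuit c X)))"
  using cactus_setD(2)[OF S sp lc] gaps_circuit_simplex[OF c m]
  by (intro realization_map_rclass[OF cS cT g, symmetric]) (simp_all add: s_def)
 also have "rclass S (card X - 1) (smap S c X s) (gaps (on_circuit c X)) = cactus_act S c x"
  unfolding cactus_act_eq[OF S c X] value_at_def s_def ..
 finally show ?thesis by (rule sym)
qed

section \<open>Degenerate segment lengths\<close>

text \<open>The piecewise linear map of the circle that takes the marks of \<open>A\<close> to those
  of \<open>B\<close> in order, for sets of equal size.\<close>

definition pl :: "real set => real set => real => real" where
 "pl A B t = (let i = segment_at (card A - 1) (gaps A) t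
   in nth_mark B i + (t - nth_mark A i) / gaps A i * gaps B i)"

lemma gaps_pos: "mark_set A ==> i < card A ==> 0 < gaps A i"
 using nth_mark_less[of A i "Suc i"] by (simp add: gaps_def)

lemma nth_mark_Suc: "i < card A ==> nth_mark A (Suc i) = nth_mark A i + gaps A i"
 by (simp add: gaps_def)

lemma pl_segment:
 assumes A: "mark_set A" and i: "i < card A" and e: "0 <= e" "e < 1"
 shows "pl A B (nth_mark A i + e * gaps A i) = nth_mark B i + e * gaps B i"
proof -
 note g = gaps_pos[OF A i]
 have "e * gaps A i < 1 * gaps A i" using e g by (intro mult_strict_right_mono) auto
 then have "segment_at (card A - 1) (gaps A) (nth_mark A i + e * gaps A i) = i"
  using e g by (intro segment_at_gaps[OF A i]) (simp_all add: nth_mark_Suc[OF i])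
 then show ?thesis using g by (simp add: pl_def Let_def)
qed

lemma segment_decomp:
 assumes A: "mark_set A" and t: "0 <= t" "t < 1"
 obtains i e where "i < card A" "0 <= e" "e < 1" "t = nth_mark A i + e * gaps A i"
proof -
 obtain a where a: "a \<in> A" "a <= t" "t < next_mark A a" using mark_below[OF A t] by blast
 define i where "i = mark_rank A a"
 note i = nth_mark_rank[OF A a(1), folded i_def]
 note g = gaps_pos[OF A i(2)]
 have "t < a + gaps A i" using a(3) next_mark_nth[OF A i(2)] nth_mark_Suc[OF i(2)] i(1) by simp
 then have "(t - a) / gaps A i < 1" using g by (simp add: pos_divide_less_eq)
 moreover have "0 <= (t - a) / gaps A i" using a(2) g by simp
 moreover have "t = nth_mark A i + (t - a) / gaps A i * gaps A i" using g i(1) by simp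
 ultimately show thesis using that i(2) by blast
qed

lemma segment_bounds:
 assumes A: "mark_set A" and i: "i < card A" and e: "0 <= e" "e < 1"
 shows "0 <= nth_mark A i + e * gaps A i" "nth_mark A i + e * gaps A i < nth_mark A (Suc i)"
  "nth_mark A i + e * gaps A i < 1"
proof -
 note g = gaps_pos[OF A i]
 have "e * gaps A i < 1 * gaps A i" using e g by (intro mult_strict_right_mono) auto
 then show lt: "nth_mark A i + e * gaps A i < nth_mark A (Suc i)" by (simp add: nth_mark_Suc[OF i])
 show "0 <= nth_mark A i + e * gaps A i" using nth_mark_range[OF A i] e g by simp
 show "nth_mark A i + e * gaps A i < 1"
  using lt nth_mark_le[OF A, of "Suc i" "card A"] i nth_mark_card[of A] by simp
qed

lemma pl_props:
 assumes A: "mark_set A" and B: "mark_set B" and c: "card A = card B" and t: "0 <= t" "t < 1"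
 shows "0 <= pl A B t" "pl A B t < 1" "pl B A (pl A B t) = t"
proof -
 obtain i e where i: "i < card A" "0 <= e" "e < 1" "t = nth_mark A i + e * gaps A i"
  using segment_decomp[OF A t] by blast
 have p: "pl A B t = nth_mark B i + e * gaps B i" unfolding i(4) by (rule pl_segment[OF A i(1-3)])
 show "0 <= pl A B t" "pl A B t < 1" unfolding p using segment_bounds[OF B _ i(2,3)] i(1) c by simp_all
 show "pl B A (pl A B t) = t" unfolding p using pl_segment[OF B _ i(2,3), of i A] i c by simp
qed

lemma pl_mono:
 assumes A: "mark_set A" and B: "mark_set B" and c: "card A = card B" and t: "0 <= t" "t < t'" "t' < 1"
 shows "pl A B t < pl A B t'"
proof -
 obtain i e where i: "i < card A" "0 <= e" "e < 1" "t = nth_mark A i + e * gaps A i"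
  using segment_decomp[OF A, of t] t by auto
 obtain j d where j: "j < card A" "0 <= d" "d < 1" "t' = nth_mark A j + d * gaps A j"
  using segment_decomp[OF A, of t'] t by auto
 have p: "pl A B t = nth_mark B i + e * gaps B i" unfolding i(4) by (rule pl_segment[OF A i(1-3)])
 have q: "pl A B t' = nth_mark B j + d * gaps B j" unfolding j(4) by (rule pl_segment[OF A j(1-3)])
 have "i <= j"
 proof (rule ccontr)
  assume "~ i <= j"
  then have "nth_mark A (Suc j) <= nth_mark A i" using i(1) by (intro nth_mark_le[OF A]) auto
  moreover have "0 <= e * gaps A i" using i(2) gaps_pos[OF A i(1)] by simp
  ultimately have "t' < t" using segment_bounds(2)[OF A j(1-3)] unfolding i(4) j(4) by linarith
  then show False using t by simp
 qed
 then consider "i = j" | "i < j" by linarith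
 then show ?thesis
 proof cases
  case 1
  then have "e < d" using i j t gaps_pos[OF A i(1)] by simp
  then show ?thesis unfolding p q 1 using gaps_pos[OF B, of j] j c by simp
 next
  case 2
  then have "nth_mark B (Suc i) <= nth_mark B j" using j c by (intro nth_mark_le[OF B]) auto
  moreover have "0 <= d * gaps B j" using j gaps_pos[OF B, of j] c by simp
  ultimately show ?thesis unfolding p q using segment_bounds(2)[OF B _ i(2,3), of i] i(1) c by simp
 qed
qed

lemma pl_mark:
 assumes "mark_set A" "i < card A"
 shows "pl A B (nth_mark A i) = nth_mark B i"
 using pl_segment[OF assms, of 0 B] by simp

text \<open>The lift of \<open>pl\<close> to the real line: the reparametrization demanded by
  equivalence of spiny cacti.\<close>

definition pl_period :: "real set => real set => real => real" where
 "pl_period A B s = of_int \<lfloor>s\<rfloor> + pl A B (frac s)"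

lemma pl_period_props:
 assumes A: "mark_set A" and B: "mark_set B" and c: "card A = card B"
 shows "strict_mono (pl_period A B)" "pl_period A B 0 = 0" "pl_period A B (s + 1) = pl_period A B s + 1"
  "continuous_on UNIV (pl_period A B)"
proof -
 have r: "0 <= pl A B (frac s)" "pl A B (frac s) < 1" for s
  using pl_props(1,2)[OF A B c, of "frac s"] frac_range[of s] by simp_all
 show mono: "strict_mono (pl_period A B)"
 proof (rule strict_monoI)
  fix s t :: real assume st: "s < t"
  show "pl_period A B s < pl_period A B t"
  proof (cases "\<lfloor>s\<rfloor> = \<lfloor>t\<rfloor>")
   case True
   then have "frac s < frac t" using st by (simp add: frac_def)
   then have "pl A B (frac s) < pl A B (frac t)"
    using frac_range[of s] frac_range[of t] by (intro pl_mono[OF A B c]) auto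
   then show ?thesis using True by (simp add: pl_period_def)
  next
   case False
   then have "\<lfloor>s\<rfloor> + 1 <= \<lfloor>t\<rfloor>" using floor_mono[of s t] st by simp
   then have "real_of_int \<lfloor>s\<rfloor> + 1 <= of_int \<lfloor>t\<rfloor>" by linarith
   then show ?thesis using r[of s] r[of t] by (simp add: pl_period_def)
  qed
 qed
 show "pl_period A B 0 = 0"
  using pl_mark[OF A, of 0 B] nth_mark_zero[OF A] nth_mark_zero[OF B] card_mark_set[OF A]
  by (simp add: pl_period_def)
 show "pl_period A B (s + 1) = pl_period A B s + 1" by (simp add: pl_period_def frac_def)
 have surj: "y \<in> range (pl_period A B)" for y
 proof -
  define s where "s = of_int \<lfloor>y\<rfloor> + pl B A (frac y)"
  note b = pl_props[OF B A c[symmetric], of "frac y"]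
  have fr: "0 <= frac y" "frac y < 1" using frac_range[of y] by simp_all
  have "\<lfloor>s\<rfloor> = \<lfloor>y\<rfloor>" unfolding s_def using b(1,2)[OF fr] by (intro floor_unique) auto
  then have "frac s = pl B A (frac y)" by (simp add: frac_def s_def)
  then have "pl_period A B s = y"
   using b(3)[OF fr] \<open>\<lfloor>s\<rfloor> = \<lfloor>y\<rfloor>\<close> by (simp add: pl_period_def) (simp add: frac_def)
  then show ?thesis by blast
 qed
 then have "range (pl_period A B) = UNIV" by blast
 \<comment> \<open>A monotone map of the line onto itself is continuous; no linear pieces have to be
   glued.\<close>
 then show "continuous_on UNIV (pl_period A B)"
  using mono by (intro continuous_onI_mono) (auto simp: strict_mono_less_eq)
qed

text \<open>\<open>c'\<close> has the combinatorial type of \<open>(c, X)\<close>, with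
  \<open>u\<close> as the lengths of the segments. Lengths 0 are allowed, and the condition on the
  path is vacuous for such segments; so \<open>c'\<close> may be a degeneration of the type, in
  which segments have been pinched.\<close>

definition realizes :: "cactus => point set => (nat => real) => cactus => bool" where
 "realizes c X u c' \<longleftrightarrow> lobes c' = lobes c & u \<in> standard_simplex (card X - 1) &
   (\<forall>k<lobes c. (\<Sum>i<spines X k. u (seg_index c X k i)) = radius c' k) &
   (\<forall>k<lobes c. \<forall>i<spines X k. \<forall>h. 0 <= h & h < u (seg_index c X k i) -->
    circuit c' (sum u {..<seg_index c X k i} + h) =
     (k, ((\<Sum>m<i. u (seg_index c X k m)) + h) / radius c' k))"

definition lobe_weights :: "cactus => point set => (nat => real) => cactus => nat => nat => real" where
 "lobe_weights c X u c' k i = (if i < spines X k then u (seg_index c X k i) / radius c' k else 0)"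

lemma spines_pos: "marked c X ==> k < lobes c ==> 0 < spines X k"
 using card_mark_set[OF lobe_marks] by (simp add: spines_def)

text \<open>If all lengths are positive, \<open>U\<close> and \<open>V\<close> are the times and the
  coordinates of the transported spines, in increasing order, and the piecewise linear maps between
  old and new marks provide the equivalence.\<close>

lemma realizes_positive:
 assumes c: "is_cactus c" and X: "marked c X" and c': "is_cactus c'" and re: "realizes c X u c'"
  and pos: "!!j. j < card X ==> 0 < u j"
 obtains X' where "marked c' X'" "spiny_equiv c X c' X'" "card X' = card X"
  "gaps (on_circuit c' X') = u" "!!k. k < lobes c ==> spines X' k = spines X k"
  "!!k. k < lobes c ==> gaps (on_lobe X' k) = lobe_weights c X u c' k"
proof -
 let ?N = "card X" and ?j = "seg_index c X"
 note gc_9 = cactus_circuit(1)[OF c] and gc' = cactus_circuit(1)[OF c']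
 have circ': "is_circuit c' (circuit c')" using gc' by (simp add: good_circuit_def)
 have lob: "lobes c' = lobes c" and us: "u \<in> standard_simplex (?N - 1)"
  and rad: "!!k. k < lobes c ==> (\<Sum>i<spines X k. u (?j k i)) = radius c' k"
  and trav: "!!k i h. k < lobes c ==> i < spines X k ==> 0 <= h ==> h < u (?j k i) ==>
    circuit c' (sum u {..<?j k i} + h) = (k, ((\<Sum>m<i. u (?j k m)) + h) / radius c' k)"
  using re by (auto simp: realizes_def)
 have N: "0 < ?N" by (rule marked_card[OF c X])
 define U where "U = (%j. sum u {..<j})"
 define V where "V = (%k i. (\<Sum>m<i. u (?j k m)) / radius c' k)"
 have USuc: "U (Suc j) = U j + u j" for j by (simp add: U_def)
 have U0: "U 0 = 0" by (simp add: U_def)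
 have UN: "U ?N = 1"
 proof -
  have "{..<?N} = {..?N - 1}" using N by auto
  then show ?thesis using simplexD(4)[OF us] by (simp add: U_def)
 qed
 have u0: "0 <= u j" for j by (rule simplexD(1)[OF us])
 have U_le: "U i <= U j" if "i <= j" for i j unfolding U_def by (rule partial_sum_mono[OF u0 that])
 have U_less: "U i < U j" if "i < j" "j < Suc ?N" for i j
  using U_le[of "Suc i" j] USuc[of i] pos[of i] that by simp
 have U_range: "0 <= U j" "U j < 1" if "j < ?N" for j
  using U_le[of 0 j] U_less[of j ?N] U0 UN that by simp_all
 have seg: "?j k i < ?N" if "k < lobes c" "i < spines X k" for k i
  using seg_index_props(1)[OF c X that] .
 have r': "0 < radius c' k" if "k < lobes c" for k
  using precactus_radius[OF cactus_pre[OF c']] that lob by simp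
 have travel: "circuit c' (U (?j k i) + h) = (k, V k i + h / radius c' k)"
  if "k < lobes c" "i < spines X k" "0 <= h" "h < u (?j k i)" for k i h
  using trav[OF that] by (simp add: U_def V_def add_divide_distrib)
 have start: "circuit c' (U (?j k i)) = (k, V k i)" if "k < lobes c" "i < spines X k" for k i
  using travel[OF that, of 0] pos[OF seg[OF that]] by simp
 have VSuc: "V k (Suc i) = V k i + u (?j k i) / radius c' k" for k i
  by (simp add: V_def add_divide_distrib)
 have V_last: "V k (spines X k) = 1" if "k < lobes c" for k
  using rad[OF that] r'[OF that] by (simp add: V_def)
 have V_less: "V k i < V k m" if "k < lobes c" "i < m" "m < Suc (spines X k)" for k i m
  using that(2,3)
 proof (induction m)
  case (Suc m)
  have "V k m < V k (Suc m)" using Suc.prems r'[OF that(1)] pos[OF seg[OF that(1), of m]] by (simp add: VSuc)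
  then show ?case using Suc by (cases "i = m") auto
 qed simp
 define X' where "X' = (%j. circuit c' (U j)) ` {..<?N}"
 have onT: "U ` {..<?N} = on_circuit c' X'"
 proof (intro equalityI subsetI)
  fix s assume "s \<in> U ` {..<?N}"
  then show "s \<in> on_circuit c' X'" using U_range by (auto simp: on_circuit_def X'_def)
 next
  fix s assume "s \<in> on_circuit c' X'"
  then have s: "0 <= s" "s < 1" "circuit c' s \<in> X'" by (simp_all add: on_circuit_def)
  then obtain j where j: "circuit c' s = circuit c' (U j)" "j < ?N" unfolding X'_def by blast
  have "s = U j" using s U_range[OF j(2)] by (intro good_circuit_inj[OF gc' j(1)]) auto
  then show "s \<in> U ` {..<?N}" using j by blast
 qed
 have onL: "V k ` {..<spines X k} = on_lobe X' k" if k: "k < lobes c" for k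
 proof (intro equalityI subsetI)
  fix t assume "t \<in> V k ` {..<spines X k}"
  then obtain i where i: "t = V k i" "i < spines X k" by auto
  have "(k, t) \<in> X'" unfolding i(1) start[OF k i(2), symmetric] X'_def by (rule imageI) (simp add: seg[OF k i(2)])
  then show "t \<in> on_lobe X' k" by (simp add: on_lobe_iff)
 next
  fix t assume "t \<in> on_lobe X' k"
  then obtain j where j: "(k, t) = circuit c' (U j)" "j < ?N" unfolding on_lobe_iff X'_def by blast
  obtain k2 i where ki: "k2 < lobes c" "i < spines X k2" "?j k2 i = j"
   by (rule seg_index_surj[OF c X j(2)])
  have "(k, t) = (k2, V k2 i)" using start[OF ki(1,2)] ki(3) j(1) by simp
  then show "t \<in> V k ` {..<spines X k}" using ki(2) by blast
 qed
 have T': "card (on_circuit c' X') = ?N" "!!j. j < ?N ==> nth_mark (on_circuit c' X') j = U j"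
  by (rule nth_mark_unique(1)[of ?N U, OF _ onT], rule U_less, assumption, simp)
   (rule nth_mark_unique(2)[of ?N U, OF _ onT], rule U_less, assumption, simp)
 have A'1: "card (on_lobe X' k) = spines X k" if "k < lobes c" for k
  by (rule nth_mark_unique(1)[of "spines X k" "V k", OF _ onL[OF that]]) (rule V_less[OF that], assumption, simp)
 have A'2: "nth_mark (on_lobe X' k) i = V k i" if "k < lobes c" "i < spines X k" for k i
  by (rule nth_mark_unique(2)[of "spines X k" "V k", OF _ onL[OF that(1)] that(2)]) (rule V_less[OF that(1)], assumption, simp)
 have X'p: "X' <= points c'" unfolding X'_def using circuit_points[OF circ'] by blast
 have decomp: "\<exists>k i h. k < lobes c & i < spines X k & 0 <= h & h < u (?j k i) & s = U (?j k i) + h"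
  if s: "0 <= s" "s < 1" for s
 proof -
  have "\<exists>j<?N. U j <= s & s < U (Suc j)"
  proof -
   note b = segment_at_bounds[OF us s]
   have "segment_at (?N - 1) u s < ?N" using b(1) N by linarith
   then show ?thesis using b(2,3) unfolding U_def by blast
  qed
  then obtain j where j: "j < ?N" "U j <= s" "s < U (Suc j)" by blast
  obtain k i where ki: "k < lobes c" "i < spines X k" "?j k i = j" by (rule seg_index_surj[OF c X j(1)])
  show ?thesis
   by (intro exI[of _ k] exI[of _ i] exI[of _ "s - U j"]) (use ki j USuc[of j] in simp)
 qed
 \<comment> \<open>Strictly inside a segment the path runs along the lobe, so the point of arrival
   equals the point of departure, and nothing turns.\<close>
 have moved: "q \<in> X'" if q: "turn c' q ~= q" for q
 proof -
  have "q \<in> points c'" using q cactus_pre[OF c'] unfolding precactus_def permutes_def by blast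
  then obtain s where s: "0 <= s" "s < 0 + 1" "circuit c' s = q" using good_circuit_surj[OF gc', of q 0] by blast
  then obtain k i h where h: "k < lobes c" "i < spines X k" "0 <= h" "h < u (?j k i)" "s = U (?j k i) + h"
   using decomp[of s] by auto
  show ?thesis
  proof (cases "h = 0")
   case True
   then show ?thesis using s(3) h seg[OF h(1,2)] by (auto simp: X'_def)
  next
   case False
   obtain e p where p: "e > 0" "p \<in> points c'" "circuit c' s = turn c' p"
    "!!h. 0 < h ==> h < e ==> circuit c' (s - h) = advance c' p (- h)"
    using circuit_left[OF circ', of s] by blast
   define x where "x = min (e / 2) (h / 2)"
   have x: "0 < x" "x < e" "x < h" using p(1) h(3) False by (auto simp: x_def min_less_iff_disj)
   have "circuit c' (s - x) = circuit c' (U (?j k i) + (h - x))" by (simp only: h(5) add_diff_eq)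
   also have "... = (k, V k i + (h - x) / radius c' k)" using h x by (intro travel) auto
   finally have e1: "circuit c' (s - x) = (k, V k i + (h - x) / radius c' k)" .
   have fs: "q = (k, V k i + h / radius c' k)" using travel[OF h(1-4)] s(3) h(5) by simp
   have "snd (circuit c' (s - x)) \<in> {0..<1}" using circuit_points[OF circ', of "s - x"] by (auto simp: points_def)
   then have "frac (V k i + (h - x) / radius c' k) = V k i + (h - x) / radius c' k"
    unfolding e1 by (intro frac_id) auto
   then have "advance c' q (- x) = circuit c' (s - x)"
    unfolding e1 fs by (simp add: advance_pair diff_divide_distrib algebra_simps)
   then have "advance c' p (- x) = advance c' q (- x)" using p(4)[OF x(1,2)] by simp
   then have "p = q" by (rule advance_inj[OF p(2) \<open>q \<in> points c'\<close>])
   then show ?thesis using p(3) s(3) q by simp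
  qed
 qed
 have mX': "marked c' X'"
  unfolding marked_def
 proof (intro conjI allI impI X'p)
  show "finite X'" by (simp add: X'_def)
  have "circuit c' 0 = origin c'" using circ' by (simp add: is_circuit_def)
  then show "origin c' \<in> X'" using N U0 unfolding X'_def by (metis imageI lessThan_iff)
  show "{p. turn c' p ~= p} <= X'" using moved by blast
  fix k assume "k < lobes c'"
  then have k: "k < lobes c" by (simp add: lob)
  have "V k 0 = 0" by (simp add: V_def)
  then have "0 \<in> on_lobe X' k" unfolding onL[OF k, symmetric] using spines_pos[OF X k] by (metis imageI lessThan_iff)
  then show "(k, 0) \<in> X'" by (simp add: on_lobe_iff)
 qed
 note TT = circuit_marks[OF c X] and TT' = circuit_marks[OF c' mX']
 let ?T = "on_circuit c X" and ?T' = "on_circuit c' X'"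
 have cT: "card ?T = card ?T'" using TT(2) T'(1) by simp
 have gT': "gaps ?T' = u"
 proof
  fix j
  show "gaps ?T' j = u j"
  proof (cases "j < ?N")
   case True
   then have "nth_mark ?T' (Suc j) = U (Suc j)"
    using T' nth_mark_card[of ?T'] UN by (cases "Suc j = ?N") auto
   then show ?thesis using True T' USuc[of j] by (simp add: gaps_def)
  next
   case False
   then have "?N - 1 < j" using N by simp
   then show ?thesis using False T'(1) simplexD(3)[OF us] by (simp add: gaps_def)
  qed
 qed
 have spX': "spines X' k = spines X k" if "k < lobes c" for k using A'1[OF that] by (simp add: spines_def)
 have V_mark: "nth_mark (on_lobe X' k) i = V k i" if "k < lobes c" "i <= spines X k" for k i
  using A'2[of k i] A'1[of k] V_last[of k] nth_mark_card[of "on_lobe X' k"] that by (cases "i = spines X k") auto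
 have gA': "gaps (on_lobe X' k) i = lobe_weights c X u c' k i" if "k < lobes c" for k i
  using V_mark[OF that, of i] V_mark[OF that, of "Suc i"] A'1[OF that] VSuc[of k i]
  by (simp add: gaps_def lobe_weights_def)
 have seg': "seg_index c' X' k i = ?j k i" if "k < lobes c" "i < spines X k" for k i
  using start[OF that] T'(2)[OF seg[OF that]] A'2[OF that] seg[OF that] TT'(2) T'(1)
  by (intro seg_index_eqI[OF c' mX']) simp_all
 \<comment> \<open>Piecewise linear on each lobe, as \<open>ph\<close> is in time. The two are
   compatible because on each segment both are linear and lengths along the path are proportional to
   those on the lobe.\<close>
 define h where "h = (%(k, t). (k :: nat, pl (on_lobe X k) (on_lobe X' k) t))"
 define ph where "ph = pl_period ?T ?T'"
 note php = pl_period_props[OF TT(1) TT'(1) cT, folded ph_def]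
 note A = lobe_marks[OF X] and A' = lobe_marks[OF mX', unfolded lob]
 have cA: "card (on_lobe X k) = card (on_lobe X' k)" if "k < lobes c" for k
  using A'1[OF that] by (simp add: spines_def)
 have follow0: "circuit c' (pl ?T ?T' s) = h (circuit c s)" if s: "0 <= s" "s < 1" for s
 proof -
  obtain j e where j: "j < card ?T" "0 <= e" "e < 1" "s = nth_mark ?T j + e * gaps ?T j"
   using segment_decomp[OF TT(1) s] by blast
  have jN: "j < ?N" using j(1) TT(2) by simp
  obtain k i where ki: "k < lobes c" "i < spines X k" "?j k i = j" by (rule seg_index_surj[OF c X jN])
  have ic: "i < card (on_lobe X k)" using ki(2) by (simp add: spines_def)
  have r: "0 < radius c k" by (rule precactus_radius[OF cactus_pre[OF c] ki(1)])
  have gj: "gaps ?T j = radius c k * gaps (on_lobe X k) i"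
   using gaps_on_circuit[OF c X ki(1,2)] ki(3) by simp
  have eg: "e * gaps ?T j < radius c k * (nth_mark (on_lobe X k) (Suc i) - nth_mark (on_lobe X k) i)"
  proof -
   have "e * gaps ?T j < 1 * gaps ?T j" using j(3) gaps_pos[OF TT(1) j(1)] by (intro mult_strict_right_mono) auto
   then show ?thesis using gj ic by (simp add: gaps_def)
  qed
  have "circuit c (nth_mark ?T j) = (k, nth_mark (on_lobe X k) i)"
   using seg_index_props(3)[OF c X ki(1,2)] ki(3) by simp
  then have "circuit c s = (k, nth_mark (on_lobe X k) i + e * gaps ?T j / radius c k)"
   unfolding j(4) using j(2) gaps_pos[OF TT(1) j(1)] eg by (intro seg_travel(1)[OF c X ki(1,2)]) auto
  also have "e * gaps ?T j / radius c k = e * gaps (on_lobe X k) i" using r by (simp add: gj)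
  finally have "h (circuit c s) = (k, nth_mark (on_lobe X' k) i + e * gaps (on_lobe X' k) i)"
   using pl_segment[OF A[OF ki(1)] ic j(2,3)] by (simp add: h_def)
  also have "... = (k, V k i + e * u j / radius c' k)"
   using A'2[OF ki(1,2)] gA'[OF ki(1), of i] ki by (simp add: lobe_weights_def)
  also have "... = circuit c' (U j + e * u j)"
   using travel[OF ki(1,2), of "e * u j"] ki(3) j(2,3) pos[OF jN] by simp
  also have "U j + e * u j = pl ?T ?T' s"
   unfolding j(4) pl_segment[OF TT(1) j(1-3)] using T'(2)[OF jN] gT' by simp
  finally show ?thesis by (rule sym)
 qed
 have follow: "circuit c' (ph s) = h (circuit c s)" for s
 proof -
  have "circuit c' (ph s) = circuit c' (pl ?T ?T' (frac s))"
   using good_circuit_int[OF gc', of "pl ?T ?T' (frac s)" "\<lfloor>s\<rfloor>"]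
   by (simp add: ph_def pl_period_def add.commute)
  also have "... = h (circuit c (frac s))" using frac_range[of s] by (intro follow0) auto
  finally show ?thesis by (simp add: good_circuit_frac[OF gc_9])
 qed
 have phU: "ph (nth_mark ?T j) = U j" if "j <= ?N" for j
 proof (cases "j = ?N")
  case True
  then have "nth_mark ?T j = 0 + 1" using TT(2) nth_mark_card[of ?T] by simp
  then show ?thesis using php(2) php(3)[of 0] UN True by simp
 next
  case False
  then have j: "j < card ?T" using that TT(2) by simp
  have "\<lfloor>nth_mark ?T j\<rfloor> = 0" "frac (nth_mark ?T j) = nth_mark ?T j"
   using nth_mark_range[OF TT(1) j] by (auto simp: frac_id floor_eq_iff)
  then show ?thesis using pl_mark[OF TT(1) j] T'(2)[of j] j TT(2) by (simp add: ph_def pl_period_def)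
 qed
 have hX: "h ` X = X'"
 proof -
  have Xim: "X = (%j. circuit c (nth_mark ?T j)) ` {..<?N}"
  proof (intro equalityI subsetI)
   fix p assume "p \<in> X"
   then have "p \<in> circuit c ` ?T" using TT(3) by (simp add: bij_betw_def)
   then obtain t where t: "p = circuit c t" "t \<in> ?T" by (rule imageE)
   obtain j where "j < card ?T" "nth_mark ?T j = t"
    using nth_mark_surj[of ?T t] t(2) TT(1) unfolding mark_set_def by blast
   then show "p \<in> (%j. circuit c (nth_mark ?T j)) ` {..<?N}" using t TT(2) by auto
  next
   fix p assume "p \<in> (%j. circuit c (nth_mark ?T j)) ` {..<?N}"
   then obtain j where j: "p = circuit c (nth_mark ?T j)" "j < ?N" by auto
   have "nth_mark ?T j \<in> ?T" using TT j by (intro nth_mark_in) (simp_all add: mark_set_def)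
   then show "p \<in> X" using j by (simp add: on_circuit_def)
  qed
  have "h ` X = (%j. h (circuit c (nth_mark ?T j))) ` {..<?N}"
   using arg_cong[OF Xim, of "image h"] unfolding image_image .
  also have "... = X'" unfolding X'_def
   by (rule image_cong[OF refl]) (simp add: follow[symmetric] phU)
  finally show ?thesis .
 qed
 have fst_h: "fst (h p) = fst p" for p by (cases p) (simp add: h_def)
 define h' where "h' = (%(k, t). (k :: nat, pl (on_lobe X' k) (on_lobe X k) t))"
 have hh: "h p \<in> points c' & h' (h p) = p" if p: "p \<in> points c" for p
  using pl_props[OF A A' cA, of "fst p" "snd p"] p by (cases p) (simp add: h_def h'_def points_iff lob)
 have hh': "h' p \<in> points c & h (h' p) = p" if p: "p \<in> points c'" for p
  using pl_props[OF A' A cA[symmetric], of "fst p" "snd p"] p by (cases p) (simp add: h_def h'_def points_iff lob)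
 have bij: "bij_betw h (points c) (points c')"
  by (rule bij_betw_byWitness[where f' = h']) (use hh hh' in auto)
 have turn: "h (turn c p) = turn c' (h p)" if p: "p \<in> points c" for p
 proof (cases "p \<in> X")
  case False
  then have tp: "turn c p = p" using X by (auto simp: marked_def)
  have "h p \<notin> X'"
  proof
   assume "h p \<in> X'"
   then obtain q where q: "h p = h q" "q \<in> X" unfolding hX[symmetric] by (rule imageE)
   have "q \<in> points c" using q(2) X by (auto simp: marked_def)
   then have "p = q" using hh[of p] hh[of q] p q(1) by metis
   then show False using q(2) False by simp
  qed
  then have "turn c' (h p) = h p" using mX' by (auto simp: marked_def)
  then show ?thesis using tp by simp
 next
  case True
  let ?k = "fst p" and ?A = "on_lobe X (fst p)"
  have k: "?k < lobes c" by (rule fst_points[OF p])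
  have "snd p \<in> ?A" using True by (simp add: on_lobe_iff)
  then have "frac (snd p) \<in> ?A" using p by (cases p) (simp add: points_iff frac_id)
  \<comment> \<open>The spine is regarded as the end of a segment, since the continuation of the
    path there shows where \<open>turn\<close> leads. The spine at coordinate 0 ends the last
    segment, hence \<open>frac\<close>.\<close>
  have "\<exists>i<spines X ?k. snd p = frac (nth_mark ?A (Suc i))"
  proof (cases "snd p = 0")
   case z: True
   have "Suc (spines X ?k - 1) = card ?A" using spines_pos[OF X k] by (simp add: spines_def)
   then have "frac (nth_mark ?A (Suc (spines X ?k - 1))) = 0" using nth_mark_card[of ?A] by simp
   then show ?thesis using z spines_pos[OF X k] by (intro exI[of _ "spines X ?k - 1"]) simp
  next
   case nz: False
   note m = nth_mark_rank[OF A[OF k] \<open>snd p \<in> ?A\<close>]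
   have "mark_rank ?A (snd p) ~= 0" using nz m(1) nth_mark_zero[OF A[OF k]] by metis
   then obtain i where i: "mark_rank ?A (snd p) = Suc i" by (cases "mark_rank ?A (snd p)") auto
   have "frac (snd p) = snd p" using p by (cases p) (simp add: points_iff frac_id)
   then show ?thesis using m i by (intro exI[of _ i]) (simp add: spines_def)
  qed
  then obtain i where i: "i < spines X ?k" "snd p = frac (nth_mark ?A (Suc i))" by blast
  let ?jj = "?j ?k i"
  note s1 = seg_index_props[OF c X k i(1)]
  have i': "i < spines X' ?k" using i(1) spX'[OF k] by simp
  have k': "?k < lobes c'" using k lob by simp
  note s2 = seg_index_props[OF c' mX' k' i', unfolded seg'[OF k i(1)]]
  have ic: "i < card ?A" "i < card (on_lobe X' ?k)" using i(1) i' by (simp_all add: spines_def)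
  have t1: "circuit c (nth_mark ?T (Suc ?jj)) = turn c p"
  proof -
   have jT: "?jj < card ?T" using s1(1) TT(2) by simp
   have gA: "gaps ?A i = nth_mark ?A (Suc i) - nth_mark ?A i" using ic(1) by (simp add: gaps_def)
   have e: "nth_mark ?T (Suc ?jj) = nth_mark ?T ?jj + radius c ?k * (nth_mark ?A (Suc i) - nth_mark ?A i)"
    unfolding nth_mark_Suc[OF jT] gaps_on_circuit[OF c X k i(1)] gA ..
   have "p = (?k, frac (nth_mark ?A (Suc i)))" using i(2) by (simp add: prod_eq_iff)
   then show ?thesis unfolding e using seg_travel(2)[OF c X k i(1) s1(3)] by simp
  qed
  have t2: "circuit c' (U (Suc ?jj)) = turn c' (?k, frac (nth_mark (on_lobe X' ?k) (Suc i)))"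
  proof -
   have gA: "gaps (on_lobe X' ?k) i = nth_mark (on_lobe X' ?k) (Suc i) - nth_mark (on_lobe X' ?k) i"
    using ic(2) by (simp add: gaps_def)
   have "u ?jj = radius c' ?k * (nth_mark (on_lobe X' ?k) (Suc i) - nth_mark (on_lobe X' ?k) i)"
    using gaps_on_circuit[OF c' mX' k' i'] unfolding seg'[OF k i(1)] gT' gA .
   then have e: "U (Suc ?jj) = nth_mark ?T' ?jj +
     radius c' ?k * (nth_mark (on_lobe X' ?k) (Suc i) - nth_mark (on_lobe X' ?k) i)"
    unfolding USuc T'(2)[OF s1(1)] by (rule arg_cong)
   show ?thesis unfolding e using seg_travel(2)[OF c' mX' k' i' s2(3)] .
  qed
  have "h p = (?k, frac (nth_mark (on_lobe X' ?k) (Suc i)))"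
  proof (cases "Suc i = spines X ?k")
   case True
   then have "nth_mark ?A (Suc i) = 1" "nth_mark (on_lobe X' ?k) (Suc i) = 1"
    using nth_mark_card[of ?A] nth_mark_card[of "on_lobe X' ?k"] A'1[OF k] by (simp_all add: spines_def)
   then show ?thesis
    using i(2) pl_mark[OF A[OF k], of 0] nth_mark_zero[OF A[OF k]] nth_mark_zero[OF A'[OF k]]
     card_mark_set[OF A[OF k]] by (cases p) (simp add: h_def)
  next
   case False
   then have si: "Suc i < card ?A" "Suc i < card (on_lobe X' ?k)" using i(1) A'1[OF k] by (simp_all add: spines_def)
   have "frac (nth_mark ?A (Suc i)) = nth_mark ?A (Suc i)"
    "frac (nth_mark (on_lobe X' ?k) (Suc i)) = nth_mark (on_lobe X' ?k) (Suc i)"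
    using nth_mark_range[OF A[OF k] si(1)] nth_mark_range[OF A'[OF k] si(2)] by (simp_all add: frac_id)
   then show ?thesis using i(2) pl_mark[OF A[OF k] si(1)] by (cases p) (simp add: h_def)
  qed
  then have "turn c' (h p) = circuit c' (U (Suc ?jj))" using t2 by simp
  also have "... = circuit c' (ph (nth_mark ?T (Suc ?jj)))" using phU[of "Suc ?jj"] s1(1) by simp
  also have "... = h (turn c p)" unfolding follow t1 ..
  finally show ?thesis by (rule sym)
 qed
 have h0: "h (k, 0) = (k, 0)" if "k < lobes c" for k
  using pl_mark[OF A[OF that], of 0] nth_mark_zero[OF A[OF that]] nth_mark_zero[OF A'[OF that]]
   card_mark_set[OF A[OF that]] by (simp add: h_def)
 have "spiny_equiv c X c' X'"
  unfolding spiny_equiv_def spiny_iff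
  using c X c' mX' lob php bij follow fst_h turn h0 hX
  by (intro conjI exI[of _ ph] exI[of _ h] allI ballI impI) simp_all
 then show thesis
  using that[of X'] mX' TT'(2) T'(1) gT' spX' gA' by (simp add: fun_eq_iff)
qed

lemma sum_skip:
 fixes u :: "nat => real"
 assumes "u j = 0"
 shows "(\<Sum>i<m. u (skip_op j i)) = sum u {..<skip_op j m}"
proof (induction m)
 case (Suc m)
 consider "Suc m < j" | "Suc m = j" | "j <= m" by linarith
 then show ?case using Suc assms by cases (auto simp: skip_op_def)
qed (use assms in \<open>auto simp: skip_op_def\<close>)

text \<open>Pinching a segment of length 0 changes neither side: on the lobe and along the path a
  coordinate 0 disappears, which the gluing allows, and the face axiom matches the cells. The
  induction is on the number of such segments; once there are none, \<open>c'\<close> with the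
  transported spines is equivalent to the type, and the structure maps agree.\<close>

theorem realizes_value:
 assumes S: "is_cactus_set S" and c': "is_cactus c'"
 shows "is_cactus c ==> marked c X ==> x \<in> inputs S c X ==> realizes c X u c' ==>
  cactus_act S c' (\<lambda>k\<in>{..<lobes c}. rclass S (spines X k - 1) (x k) (lobe_weights c X u c' k)) =
  rclass S (card X - 1) (smap S c X x) u"
proof (induction "card {j. j < card X & u j = 0}" arbitrary: c X x u rule: less_induct)
 case less
 note c = less.prems(1) and X = less.prems(2) and x = less.prems(3) and re = less.prems(4)
 note cyc = cactus_setD(1)[OF S]
 have lob: "lobes c' = lobes c" and us: "u \<in> standard_simplex (card X - 1)"
  and rad: "!!k. k < lobes c ==> (\<Sum>i<spines X k. u (seg_index c X k i)) = radius c' k"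
  and trav: "!!k i h. k < lobes c ==> i < spines X k ==> 0 <= h ==> h < u (seg_index c X k i) ==>
    circuit c' (sum u {..<seg_index c X k i} + h) =
    (k, ((\<Sum>m<i. u (seg_index c X k m)) + h) / radius c' k)"
  using re by (auto simp: realizes_def)
 have sp: "spiny c X" using c X by (simp add: spiny_iff)
 have xc: "x k \<in> cells S (spines X k - 1)" if "k < lobes c" for k
  using x that unfolding inputs_def by (auto dest: PiE_mem)
 have r': "0 < radius c' k" if "k < lobes c" for k
  using precactus_radius[OF cactus_pre[OF c']] that lob by simp
 have u0: "0 <= u j" for j by (rule simplexD(1)[OF us])
 show ?case
 proof (cases "\<exists>j<card X. u j = 0")
  case False
  have pos: "0 < u j" if "j < card X" for j using u0[of j] False that by (auto simp: less_le)
  obtain X' where X': "marked c' X'" "spiny_equiv c X c' X'" "card X' = card X"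
   "gaps (on_circuit c' X') = u" "!!k. k < lobes c ==> spines X' k = spines X k"
   "!!k. k < lobes c ==> gaps (on_lobe X' k) = lobe_weights c X u c' k"
   using realizes_positive[OF c X c' re pos] by blast
  have "(\<lambda>k\<in>{..<lobes c}. x k) = x"
   using x unfolding inputs_def by (auto simp: PiE_def extensional_restrict)
  moreover have "cactus_act S c' (\<lambda>k\<in>{..<lobes c}. rclass S (spines X k - 1) (x k) (lobe_weights c X u c' k)) =
    rclass S (card X' - 1) (smap S c' X' (\<lambda>k\<in>{..<lobes c'}. x k)) (gaps (on_circuit c' X'))"
   by (rule cactus_act_cells(1)[OF S c' X'(1)]) (use X'(5,6) xc lob in auto)
  ultimately show ?thesis using X'(3,4) cactus_setD(3)[OF S X'(2) x] lob by simp
 next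
  case True
  then obtain j where j: "j < card X" "u j = 0" by blast
  obtain k i where ki: "k < lobes c" "i < spines X k" "seg_index c X k i = j"
   by (rule seg_index_surj[OF c X j(1)])
  \<comment> \<open>A lobe of \<open>c'\<close> has positive length, so a segment of length 0 is
    never the only one on its lobe; this is what permits pinching.\<close>
  have two: "2 <= spines X k"
  proof (rule ccontr)
   assume "~ 2 <= spines X k"
   then have "spines X k = 1" "i = 0" using ki(2) by auto
   then have "radius c' k = 0" using rad[OF ki(1)] j(2) ki(3) by simp
   then show False using r'[OF ki(1)] by simp
  qed
  define Q where "Q = pinch c X k i"
  define Y where "Y = pinch_spines X k i"
  note Qc = pinch_cactus(1,2)[OF c X ki(1,2) two, folded Q_def Y_def]
  note seg = pinch_segments[OF c X ki(1,2) two, folded Q_def Y_def, unfolded ki(3)]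
  define v where "v = (%m. u (skip_op j m))"
  define y where "y = x(k := face S (spines X k - 2) i (x k))"
  have N: "card X = Suc (card Y)" "0 < card Y" using seg(2) j(1) marked_card[OF Qc] by simp_all
  have vs: "v \<in> standard_simplex (card Y - 1)"
  proof (rule simplexI)
   show "0 <= v m" for m by (simp add: v_def u0)
   show "v m = 0" if m: "card Y - 1 < m" for m
   proof -
    have "j <= m" "card X - 1 < Suc m" using m N j(1) by linarith+
    then show ?thesis using simplexD(3)[OF us, of "Suc m"] by (simp add: v_def skip_op_def)
   qed
   have "{..card Y - 1} = {..<card Y}" using N(2) by auto
   then have "(\<Sum>m\<le>card Y - 1. v m) = (\<Sum>m<card Y. u (skip_op j m))" by (simp add: v_def)
   also have "... = sum u {..<skip_op j (card Y)}" by (rule sum_skip[of u j, OF j(2)])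
   also have "skip_op j (card Y) = card X" using j(1) N by (simp add: skip_op_def)
   also have "{..<card X} = {..card X - 1}" using marked_card[OF c X] by auto
   finally show "(\<Sum>m\<le>card Y - 1. v m) = 1" using simplexD(4)[OF us] by simp
  qed
  have vseg: "v (seg_index Q Y l m) = u (seg_index c X l (if l = k then skip_op i m else m))"
   if "l < lobes c" "m < spines Y l" for l m
   unfolding v_def seg(4)[OF that] ..
  have vsum: "(\<Sum>m<n. v (seg_index Q Y l m)) = (\<Sum>m<(if l = k then skip_op i n else n). u (seg_index c X l m))"
   if l: "l < lobes c" and n: "n <= spines Y l" for l n
  proof -
   have "(\<Sum>m<n. v (seg_index Q Y l m)) = (\<Sum>m<n. u (seg_index c X l (if l = k then skip_op i m else m)))"
    using n by (intro sum.cong refl vseg[OF l]) auto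
   also have "... = (\<Sum>m<(if l = k then skip_op i n else n). u (seg_index c X l m))"
    using sum_skip[of "%m. u (seg_index c X k m)" i n] j(2) ki(3) by auto
   finally show ?thesis .
  qed
  have reQ: "realizes Q Y v c'"
   unfolding realizes_def
  proof (intro conjI allI impI)
   show "lobes c' = lobes Q" using lob seg(1) by simp
   show "v \<in> standard_simplex (card Y - 1)" by (rule vs)
  next
   fix l assume "l < lobes Q"
   then have l: "l < lobes c" by (simp add: seg(1))
   have "(if l = k then skip_op i (spines Y l) else spines Y l) = spines X l"
    using seg(3)[OF l] two ki(2) by (auto simp: skip_op_def)
   then show "(\<Sum>m<spines Y l. v (seg_index Q Y l m)) = radius c' l"
    using vsum[OF l le_refl] rad[OF l] by simp
  next
   fix l m h assume "l < lobes Q" and m: "m < spines Y l" and h: "0 <= h & h < v (seg_index Q Y l m)"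
   then have l: "l < lobes c" by (simp add: seg(1))
   let ?m = "if l = k then skip_op i m else m"
   have m': "?m < spines X l" using m seg(3)[OF l] two by (auto simp: skip_op_def split: if_splits)
   have "sum v {..<seg_index Q Y l m} = sum u {..<seg_index c X l ?m}"
    unfolding v_def sum_skip[of u j, OF j(2)] seg(4)[OF l m] ..
   then show "circuit c' (sum v {..<seg_index Q Y l m} + h) =
     (l, ((\<Sum>m<m. v (seg_index Q Y l m)) + h) / radius c' l)"
    using trav[OF l m', of h] h vseg[OF l m] vsum[OF l, of m] m by simp
  qed
  have yc: "y l \<in> cells S (spines Y l - 1)" if l: "l < lobes c" for l
  proof (cases "l = k")
   case True
   have "spines X k - 1 = Suc (spines X k - 2)" using two by simp
   then have "x k \<in> cells S (Suc (spines X k - 2))" using xc[OF ki(1)] by simp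
   then have "face S (spines X k - 2) i (x k) \<in> cells S (spines X k - 2)" by (rule face_cells[OF cyc])
   moreover have "spines Y k - 1 = spines X k - 2" using seg(3)[OF ki(1)] by simp
   ultimately show ?thesis by (simp add: y_def True)
  next
   case False
   then show ?thesis using xc[OF l] seg(3)[OF l] by (simp add: y_def)
  qed
  have yin: "y \<in> inputs S Q Y"
   unfolding inputs_def seg(1)
  proof (rule PiE_I)
   show "y l \<in> cells S (spines Y l - 1)" if "l \<in> {..<lobes c}" for l using yc that by simp
   show "y l = undefined" if "l \<notin> {..<lobes c}" for l
    using x that ki(1) unfolding inputs_def y_def by (auto dest: PiE_arb)
  qed
  have fewer: "card {m. m < card Y & v m = 0} < card {m. m < card X & u m = 0}"
  proof -
   have inj: "inj_on (skip_op j) {m. m < card Y & v m = 0}" by (auto simp: inj_on_def skip_op_def split: if_splits)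
   have sub: "skip_op j ` {m. m < card Y & v m = 0} \<subset> {m. m < card X & u m = 0}"
   proof
    show "skip_op j ` {m. m < card Y & v m = 0} <= {m. m < card X & u m = 0}"
     using N by (auto simp: v_def skip_op_def)
    have "j \<notin> skip_op j ` {m. m < card Y & v m = 0}" by (auto simp: skip_op_def split: if_splits)
    then show "skip_op j ` {m. m < card Y & v m = 0} ~= {m. m < card X & u m = 0}" using j by auto
   qed
   show ?thesis using psubset_card_mono[OF _ sub] card_image[OF inj] by simp
  qed
  have IH: "cactus_act S c' (\<lambda>l\<in>{..<lobes Q}. rclass S (spines Y l - 1) (y l) (lobe_weights Q Y v c' l)) =
    rclass S (card Y - 1) (smap S Q Y y) v"
   by (rule less.hyps[OF fewer Qc yin reQ])
  have sm: "smap S Q Y y = face S (card X - 2) j (smap S c X x)"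
   using cactus_setD(5)[OF S sp ki(1,2) two x] by (simp add: Q_def Y_def y_def ki(3))
  have skip_face: "simplical_face i' w = z" if "z i' = 0" "!!m. w m = z (skip_op i' m)" for w z :: "nat => real" and i'
  proof
   fix m
   show "simplical_face i' w m = z m"
    using that(1) that(2)[of m] that(2)[of "m - 1"] by (auto simp: simplical_face_def skip_op_def)
  qed
  have cX: "card X - 1 = Suc (card Y - 1)" "card X - 2 = card Y - 1" using N by simp_all
  have "rclass S (card Y - 1) (smap S Q Y y) v = rclass S (card X - 1) (smap S c X x) (simplical_face j v)"
   unfolding sm cX using j(1) N cactus_setD(2)[OF S sp x] vs cX(1)
   by (intro rclass_face) auto
  also have "simplical_face j v = u" by (rule skip_face[of u j, OF j(2)]) (simp add: v_def)
  finally have rhs: "rclass S (card Y - 1) (smap S Q Y y) v = rclass S (card X - 1) (smap S c X x) u" .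
  have lw: "rclass S (spines Y l - 1) (y l) (lobe_weights Q Y v c' l) =
    rclass S (spines X l - 1) (x l) (lobe_weights c X u c' l)" if l: "l < lobes c" for l
  proof (cases "l = k")
   case False
   have "lobe_weights Q Y v c' l = lobe_weights c X u c' l"
    using seg(3)[OF l] vseg[OF l] False by (auto simp: lobe_weights_def)
   then show ?thesis using seg(3)[OF l] False by (simp add: y_def)
  next
   case True
   let ?w = "lobe_weights Q Y v c' k"
   have sY: "spines Y k = spines X k - 1" using seg(3)[OF ki(1)] by simp
   have ws: "?w \<in> standard_simplex (spines X k - 2)"
   proof (rule simplexI)
    show "0 <= ?w m" for m using simplexD(1)[OF vs] r'[OF ki(1)] by (simp add: lobe_weights_def)
    show "?w m = 0" if "spines X k - 2 < m" for m using that sY by (simp add: lobe_weights_def)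
    have "{..spines X k - 2} = {..<spines Y k}" using two sY by auto
    then have "(\<Sum>m\<le>spines X k - 2. ?w m) = (\<Sum>m<spines Y k. v (seg_index Q Y k m)) / radius c' k"
     by (simp add: lobe_weights_def sum_divide_distrib)
    also have "... = 1" using reQ r'[OF ki(1)] ki(1) seg(1) by (simp add: realizes_def)
    finally show "(\<Sum>m\<le>spines X k - 2. ?w m) = 1" .
   qed
   have "simplical_face i ?w = lobe_weights c X u c' k"
   proof (rule skip_face)
    show "lobe_weights c X u c' k i = 0" using j(2) ki(3) by (simp add: lobe_weights_def)
    show "?w m = lobe_weights c X u c' k (skip_op i m)" for m
     using vseg[OF ki(1), of m] sY two ki(2) by (auto simp: lobe_weights_def skip_op_def)
   qed
   moreover have s1: "spines X k - 1 = Suc (spines X k - 2)" using two by simp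
   moreover have "rclass S (spines X k - 2) (face S (spines X k - 2) i (x k)) ?w =
     rclass S (Suc (spines X k - 2)) (x k) (simplical_face i ?w)"
    using xc[OF ki(1)] s1 ki(2) two ws by (intro rclass_face) auto
   moreover have "spines Y k - 1 = spines X k - 2" using sY by simp
   ultimately show ?thesis by (simp add: True y_def)
  qed
  have "cactus_act S c' (\<lambda>k\<in>{..<lobes c}. rclass S (spines X k - 1) (x k) (lobe_weights c X u c' k)) =
    cactus_act S c' (\<lambda>l\<in>{..<lobes Q}. rclass S (spines Y l - 1) (y l) (lobe_weights Q Y v c' l))"
   by (rule cactus_act_restrict) (use lw lob seg(1) in \<open>simp del: One_nat_def\<close>)
  then show ?thesis unfolding IH rhs .
 qed
qed

section \<open>The topology of the realization\<close>

lemma simplex_topology_eq: "simplex_topology n = top_of_set (standard_simplex n)"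
 by (simp add: euclidean_product_topology)

lemma compact_standard_simplex: "compact (standard_simplex n)"
 using compactin_standard_simplex[of n] by (simp add: euclidean_product_topology)

lemma closed_standard_simplex: "closed (standard_simplex n)"
 by (rule compact_imp_closed[OF compact_standard_simplex])

lemma tendsto_fun_iff:
 fixes u :: "'b => nat => real"
 shows "(u \<longlongrightarrow> v) F \<longleftrightarrow> (\<forall>i. ((%r. u r i) \<longlongrightarrow> v i) F)"
 using limitin_componentwise[of "%_. euclideanreal" UNIV u v F]
 by (simp add: euclidean_product_topology)

lemma tendsto_push_forward:
 "(u \<longlongrightarrow> v) F ==> ((%r. push_forward m ph (u r)) \<longlongrightarrow> push_forward m ph v) F"
 unfolding tendsto_fun_iff push_forward_def by (intro allI tendsto_sum) auto

lemma simplex_subseq: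
 assumes "!!r. u r \<in> standard_simplex m"
 obtains rh :: "nat => nat" and v where "strict_mono rh" "v \<in> standard_simplex m" "(u \<circ> rh) \<longlonglongrightarrow> v"
 using compact_imp_seq_compact[OF compact_standard_simplex[of m]] assms
 unfolding seq_compact_def by blast

lemma constant_subseq:
 fixes f :: "nat => 'b"
 assumes "finite (range f)"
 obtains rh :: "nat => nat" where "strict_mono rh" "!!r. f (rh r) = f (rh 0)"
proof -
 obtain a where a: "infinite {r \<in> UNIV. f r = f a}"
  using pigeonhole_infinite[OF infinite_UNIV_nat assms] by blast
 define rh where "rh = enumerate {r \<in> UNIV. f r = f a}"
 have "f (rh r) = f a" for r using enumerate_in_set[OF a, of r] by (simp add: rh_def)
 then show thesis using that[of rh] strict_mono_enumerate[OF a] by (simp add: rh_def)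
qed

lemma closedin_simplexI:
 assumes "C <= standard_simplex n"
  and "!!t l. (!!r. t r \<in> C) ==> t \<longlonglongrightarrow> l ==> l \<in> standard_simplex n ==> l \<in> C"
 shows "closedin (simplex_topology n) C"
proof -
 have "closed C"
  unfolding closed_sequential_limits
 proof (intro allI impI)
  fix t l assume t: "(\<forall>r. t r \<in> C) & t \<longlonglongrightarrow> l"
  then have tC: "t r \<in> C" and lim: "t \<longlonglongrightarrow> l" for r by simp_all
  have "l \<in> standard_simplex n"
   by (rule closed_sequentially[OF closed_standard_simplex _ lim]) (rule subsetD[OF assms(1) tC])
  with tC lim show "l \<in> C" by (rule assms(2))
 qed
 then show ?thesis unfolding simplex_topology_eq by (rule closed_subset[OF assms(1)])
qed

lemma closedin_simplexD:
 assumes "closedin (simplex_topology n) C" "!!r. t r \<in> C" "t \<longlonglongrightarrow> l"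
 shows "l \<in> C"
proof -
 have "closed C"
  using assms(1) unfolding simplex_topology_eq by (rule closedin_closed_trans[OF _ closed_standard_simplex])
 then show ?thesis using assms(2,3) by (rule closed_sequentially)
qed

text \<open>The vertices of \<open>t\<close> on the circle. Those at 1 are dropped, as they coincide
  with the vertex at 0, which is always present.\<close>

definition marks :: "nat => (nat => real) => real set" where
 "marks n t = (%j. sum t {..<j}) ` {..n} \<inter> {..<1}"

lemma marks_props:
 assumes t: "t \<in> standard_simplex n"
 shows "mark_set (marks n t)" "card (marks n t) <= Suc n"
  "!!j. j <= n ==> sum t {..<j} \<in> marks n t \<union> {1}"
proof -
 have ge: "0 <= sum t {..<j}" for j using simplexD(1)[OF t] by (simp add: sum_nonneg)
 have "0 \<in> marks n t" unfolding marks_def by (auto intro!: image_eqI[of _ _ 0])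
 then show "mark_set (marks n t)" using ge by (auto simp: mark_set_def marks_def)
 have "card (marks n t) <= card ((%j. sum t {..<j}) ` {..n})" unfolding marks_def by (intro card_mono) auto
 also have "... <= Suc n" using card_image_le[of "{..n}" "%j. sum t {..<j}"] by simp
 finally show "card (marks n t) <= Suc n" .
 fix j assume j: "j <= n"
 have "sum t {..<j} <= sum t {..<Suc n}" using j simplexD(1)[OF t] by (intro partial_sum_mono) auto
 also have "... = 1" using simplexD(4)[OF t] by (simp add: lessThan_Suc_atMost)
 finally show "sum t {..<j} \<in> marks n t \<union> {1}" using j by (auto simp: marks_def)
qed

lemma mark_set_Un: "mark_set A ==> mark_set B ==> mark_set (A \<union> B)"
 by (auto simp: mark_set_def)

lemma segment_at_le: "segment_at n t a <= n"
proof -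
 have "segment_at n t a <= card {1..n}" unfolding segment_at_def by (intro card_mono) auto
 then show ?thesis by simp
qed

text \<open>The equivalence relation is closed: the points of a common subdivision of \<open>t r\<close> and \<open>t' r\<close>
 can be chosen to converge, with constant combinatorial type.\<close>

lemma rclass_eq_limit:
 assumes S: "is_cyclic_set S" and s: "s \<in> cells S N" and s': "s' \<in> cells S M"
  and t: "!!r. t r \<in> standard_simplex N" "t \<longlonglongrightarrow> t0"
  and t': "!!r. t' r \<in> standard_simplex M" "t' \<longlonglongrightarrow> t0'"
  and eq: "!!r. rclass S N s (t r) = rclass S M s' (t' r)"
 shows "rclass S N s t0 = rclass S M s' t0'"
proof -
 define A where "A = (%r. marks N (t r) \<union> marks M (t' r))"
 let ?K = "N + M + 2"
 have A: "mark_set (A r)" for r unfolding A_def by (intro mark_set_Un marks_props(1) t(1) t'(1))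
 have cA: "card (A r) <= ?K" for r
  using card_Un_le[of "marks N (t r)" "marks M (t' r)"] marks_props(2)[OF t(1), of r] marks_props(2)[OF t'(1), of r]
  unfolding A_def by linarith
 define ph where "ph = (%r i. segment_at N (t r) (nth_mark (A r) i))"
 define ph' where "ph' = (%r i. segment_at M (t' r) (nth_mark (A r) i))"
 \<comment> \<open>The combinatorial type of the common subdivision. Restriction to indices up to
   \<open>?K\<close> leaves only finitely many types.\<close>
 define f where "f = (%r. (card (A r), restrict (ph r) {..?K}, restrict (ph' r) {..?K}))"
 have "range f <= {..?K} \<times> ({..?K} \<rightarrow>\<^sub>E {..N}) \<times> ({..?K} \<rightarrow>\<^sub>E {..M})"
 proof (rule image_subsetI)
  show "f r \<in> {..?K} \<times> ({..?K} \<rightarrow>\<^sub>E {..N}) \<times> ({..?K} \<rightarrow>\<^sub>E {..M})" for r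
   using cA[of r] by (simp add: f_def ph_def ph'_def segment_at_le PiE_iff)
 qed
 then have "finite (range f)" by (rule finite_subset) (intro finite_cartesian_product finite_PiE; simp)
 then obtain rh :: "nat => nat" where rh: "strict_mono rh" "!!r. f (rh r) = f (rh 0)" by (rule constant_subseq) blast
 define m where "m = card (A (rh 0)) - 1"
 have m: "card (A (rh r)) - 1 = m" for r using rh(2)[of r] by (simp add: m_def f_def)
 have mK: "m <= ?K" using cA[of "rh 0"] unfolding m_def by linarith
 have c1: "ph (rh r) i = ph (rh 0) i" and c2: "ph' (rh r) i = ph' (rh 0) i" if i: "i <= m" for r i
 proof -
  have "restrict (ph (rh r)) {..?K} i = restrict (ph (rh 0)) {..?K} i"
   "restrict (ph' (rh r)) {..?K} i = restrict (ph' (rh 0)) {..?K} i"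
   using rh(2)[of r] by (simp_all add: f_def)
  then show "ph (rh r) i = ph (rh 0) i" "ph' (rh r) i = ph' (rh 0) i" using i mK by simp_all
 qed
 have "gaps (A (rh r)) \<in> standard_simplex m" for r using gaps_simplex[OF A[of "rh r"]] m[of r] by simp
 then obtain \<tau> :: "nat => nat" and v where v: "strict_mono \<tau>" "v \<in> standard_simplex m" "((%r. gaps (A (rh r))) \<circ> \<tau>) \<longlonglongrightarrow> v"
  by (rule simplex_subseq)
 have sub: "strict_mono (rh \<circ> \<tau>)" using rh(1) v(1) by (rule strict_mono_o)
 have push: "t (rh r) = push_forward m (ph (rh 0)) (gaps (A (rh r)))"
  "t' (rh r) = push_forward m (ph' (rh 0)) (gaps (A (rh r)))" for r
 proof -
  have "push_forward m (ph (rh r)) (gaps (A (rh r))) = t (rh r)"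
   unfolding ph_def m[of r, symmetric] using marks_props(3)[OF t(1), of _ "rh r"]
   by (intro push_forward_segment_at[OF t(1) A]) (auto simp: A_def)
  then show "t (rh r) = push_forward m (ph (rh 0)) (gaps (A (rh r)))"
   using push_forward_cong[of m "ph (rh r)" "ph (rh 0)", OF c1] by simp
  have "push_forward m (ph' (rh r)) (gaps (A (rh r))) = t' (rh r)"
   unfolding ph'_def m[of r, symmetric] using marks_props(3)[OF t'(1), of _ "rh r"]
   by (intro push_forward_segment_at[OF t'(1) A]) (auto simp: A_def)
  then show "t' (rh r) = push_forward m (ph' (rh 0)) (gaps (A (rh r)))"
   using push_forward_cong[of m "ph' (rh r)" "ph' (rh 0)", OF c2] by simp
 qed
 have "(t \<circ> (rh \<circ> \<tau>)) \<longlonglongrightarrow> push_forward m (ph (rh 0)) v" "(t' \<circ> (rh \<circ> \<tau>)) \<longlonglongrightarrow> push_forward m (ph' (rh 0)) v"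
  using tendsto_push_forward[OF v(3), of m] by (simp_all add: push comp_def)
 then have lim: "t0 = push_forward m (ph (rh 0)) v" "t0' = push_forward m (ph' (rh 0)) v"
  using LIMSEQ_subseq_LIMSEQ[OF t(2) sub] LIMSEQ_subseq_LIMSEQ[OF t'(2) sub] LIMSEQ_unique by blast+
 note sm = sampling_marks[OF A, of "rh 0", folded m_def]
 have mon: "monotone_op m N (ph (rh 0))" "monotone_op m M (ph' (rh 0))"
  unfolding ph_def ph'_def by (rule monotone_segment_at[OF sm t(1)], rule monotone_segment_at[OF sm t'(1)])
 \<comment> \<open>Both operators compute the cell of one and the same point at the marks
   \<open>A (rh 0)\<close>, so chains of gluings need not be examined.\<close>
 have "op_act S m N (ph (rh 0)) s = eval S m (nth_mark (A (rh 0))) (rclass S N s (t (rh 0)))"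
  unfolding ph_def by (rule eval_rclass[OF S s t(1) sm, symmetric])
 also have "... = op_act S m M (ph' (rh 0)) s'"
  unfolding ph'_def eq by (rule eval_rclass[OF S s' t'(1) sm])
 finally have cell: "op_act S m N (ph (rh 0)) s = op_act S m M (ph' (rh 0)) s'" .
 have "rclass S N s t0 = rclass S m (op_act S m N (ph (rh 0)) s) v"
  unfolding lim by (rule rclass_op_act[OF S mon(1) s v(2), symmetric])
 also have "... = rclass S M s' t0'"
  unfolding lim cell by (rule rclass_op_act[OF S mon(2) s' v(2)])
 finally show ?thesis .
qed

section \<open>Closed cells and compact sets of the realization\<close>

lemma quotient_map_quotient_topology: "quotient_map X (quotient_topology X f) f"
 unfolding quotient_map_def by (auto simp: topspace_quotient_topology openin_quotient_topology)

lemma closedin_realization: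
 "closedin (realization S) C \<longleftrightarrow> C <= topspace (realization S) &
  (\<forall>n. \<forall>s\<in>cells S n. closedin (simplex_topology n) {t \<in> standard_simplex n. rclass S n s t \<in> C})"
proof -
 let ?X = "sum_topology (%(n, s). simplex_topology n) (SIGMA n:UNIV. cells S n)"
 let ?f = "%((n, s), t). rclass S n s t"
 define D where "D = {x \<in> topspace ?X. ?f x \<in> C}"
 have q: "quotient_map ?X (realization S) ?f"
  unfolding realization_def by (rule quotient_map_quotient_topology)
 have 1: "closedin (realization S) C \<longleftrightarrow> closedin ?X D" if "C <= topspace (realization S)"
  using q[unfolded quotient_map_closedin, THEN conjunct2, rule_format, OF that] unfolding D_def by (rule sym)
 have sub: "D <= Sigma (SIGMA n:UNIV. cells S n) (topspace \<circ> (%(n, s). simplex_topology n))"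
  unfolding D_def topspace_sum_topology by blast
 have 2: "closedin ?X D \<longleftrightarrow> (\<forall>i\<in>SIGMA n:UNIV. cells S n.
   closedin (case i of (n, s) => simplex_topology n) {x. (i, x) \<in> D})"
  using sub unfolding closedin_sum_topology by blast
 have 3: "{x. ((n, s), x) \<in> D} = {t \<in> standard_simplex n. rclass S n s t \<in> C}" if "s \<in> cells S n" for n s
  using that unfolding D_def topspace_sum_topology by auto
 have "closedin ?X D \<longleftrightarrow> (\<forall>n. \<forall>s\<in>cells S n. closedin (simplex_topology n) {x. ((n, s), x) \<in> D})"
  unfolding 2 by (simp add: split_paired_all Ball_def)
 also have "... \<longleftrightarrow> (\<forall>n. \<forall>s\<in>cells S n. closedin (simplex_topology n) {t \<in> standard_simplex n. rclass S n s t \<in> C})"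
  by (simp only: 3 cong: ball_cong)
 finally show ?thesis using 1 closedin_subset[of "realization S" C] by blast
qed

lemma continuous_map_rclass:
 assumes s: "s \<in> cells S n"
 shows "continuous_map (simplex_topology n) (realization S) (rclass S n s)"
 unfolding continuous_map_closedin topspace_simplex_topology
proof (intro conjI allI impI)
 show "rclass S n s \<in> standard_simplex n \<rightarrow> topspace (realization S)"
  unfolding topspace_realization using s by blast
next
 fix C assume "closedin (realization S) C"
 then show "closedin (simplex_topology n) {t \<in> standard_simplex n. rclass S n s t \<in> C}"
  using s unfolding closedin_realization by blast
qed

text \<open>The preimage of the image under any other cell is sequentially closed: the points chosen
  in \<open>C\<close> have a convergent subsequence, and equality of classes passes to the
  limit.\<close>

lemma closed_map_rclass:
 assumes S: "is_cyclic_set S" and s: "s \<in> cells S n"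
 shows "closed_map (simplex_topology n) (realization S) (rclass S n s)"
 unfolding closed_map_def
proof (intro allI impI)
 fix C assume C: "closedin (simplex_topology n) C"
 have Cn: "C <= standard_simplex n" using closedin_subset[OF C] by simp
 show "closedin (realization S) (rclass S n s ` C)"
  unfolding closedin_realization
 proof (intro conjI allI ballI)
  show "rclass S n s ` C <= topspace (realization S)" unfolding topspace_realization using s Cn by blast
  fix m s' assume s': "s' \<in> cells S m"
  show "closedin (simplex_topology m) {t \<in> standard_simplex m. rclass S m s' t \<in> rclass S n s ` C}"
  proof (rule closedin_simplexI)
   fix t l assume t: "!!r. t r \<in> {t \<in> standard_simplex m. rclass S m s' t \<in> rclass S n s ` C}"
    and lim: "t \<longlonglongrightarrow> l" and l: "l \<in> standard_simplex m"
   have "\<exists>u. u \<in> C & rclass S m s' (t r) = rclass S n s u" for r using t[of r] by blast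
   then obtain u where u: "!!r. u r \<in> C" "!!r. rclass S m s' (t r) = rclass S n s (u r)" by metis
   have un: "u r \<in> standard_simplex n" for r using u(1) Cn by (rule subsetD[rotated])
   obtain rh :: "nat => nat" and v where v: "strict_mono rh" "v \<in> standard_simplex n" "(u \<circ> rh) \<longlonglongrightarrow> v"
    by (rule simplex_subseq[OF un])
   have "v \<in> C" by (rule closedin_simplexD[OF C _ v(3)]) (simp add: u(1))
   moreover have "rclass S m s' l = rclass S n s v"
   proof (rule rclass_eq_limit[OF S s' s _ LIMSEQ_subseq_LIMSEQ[OF lim v(1)] _ v(3)])
    show "(t \<circ> rh) r \<in> standard_simplex m" for r using t[of "rh r"] by simp
    show "(u \<circ> rh) r \<in> standard_simplex n" for r using un by simp
    show "rclass S m s' ((t \<circ> rh) r) = rclass S n s ((u \<circ> rh) r)" for r using u(2)[of "rh r"] by simp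
   qed
   ultimately show "l \<in> {t \<in> standard_simplex m. rclass S m s' t \<in> rclass S n s ` C}" using l by auto
  qed auto
 qed
qed

lemma closedin_point_realization:
 assumes S: "is_cyclic_set S" and P: "P \<in> topspace (realization S)"
 shows "closedin (realization S) {P}"
proof -
 obtain n s t where nst: "P = rclass S n s t" "s \<in> cells S n" "t \<in> standard_simplex n"
  using P unfolding topspace_realization by blast
 have "closedin (simplex_topology n) {t}"
  unfolding simplex_topology_eq using nst(3) by (intro closed_subset) auto
 then have "closedin (realization S) (rclass S n s ` {t})"
  using closed_map_rclass[OF S nst(2)] unfolding closed_map_def by blast
 then show ?thesis by (simp add: nst(1))
qed

abbreviation closed_cell :: "('a, 'b) cyclic_set_scheme => nat => 'a => 'a rpoint set" where
 "closed_cell S n s \<equiv> rclass S n s ` standard_simplex n"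

lemma closedin_closed_cell:
 assumes "is_cyclic_set S" "s \<in> cells S n"
 shows "closedin (realization S) (closed_cell S n s)"
 using closed_map_rclass[OF assms] closedin_topspace[of "simplex_topology n"]
 unfolding closed_map_def topspace_simplex_topology by blast

text \<open>A closed continuous image of a normal space is normal, and points of the realization are
  closed.\<close>

lemma Hausdorff_closed_cell:
 assumes S: "is_cyclic_set S" and s: "s \<in> cells S n"
 shows "Hausdorff_space (subtopology (realization S) (closed_cell S n s))"
proof -
 let ?Y = "subtopology (realization S) (closed_cell S n s)"
 have sub: "closed_cell S n s <= topspace (realization S)"
  by (rule closedin_subset[OF closedin_closed_cell[OF S s]])
 have "normal_space (simplex_topology n)"
  unfolding simplex_topology_eq
  by (intro metrizable_imp_normal_space metrizable_space_subtopology metrizable_space_euclidean)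
 moreover have "continuous_map (simplex_topology n) ?Y (rclass S n s)"
  using continuous_map_rclass[OF s] by (simp add: continuous_map_in_subtopology)
 moreover have "closed_map (simplex_topology n) ?Y (rclass S n s)"
  by (rule closed_map_into_subtopology[OF closed_map_rclass[OF S s]]) auto
 moreover have "rclass S n s ` topspace (simplex_topology n) = topspace ?Y" using sub by auto
 ultimately have "normal_space ?Y" by (rule normal_space_continuous_closed_map_image)
 moreover have "t1_space ?Y"
  using closedin_point_realization[OF S]
  by (intro t1_space_subtopology) (simp add: t1_space_closedin_singleton)
 ultimately show ?thesis by (simp add: normal_t1_imp_Hausdorff_space)
qed

text \<open>A label for \<open>P\<close>: a representing cell of least dimension, with this
  dimension. On one closed cell only finitely many labels occur, since each arises from that cell by
  one of finitely many operators.\<close>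

definition cell_name :: "('a, 'b) cyclic_set_scheme => 'a rpoint => nat \<times> 'a" where
 "cell_name S P = (let A = arg_min card (%A. mark_set A & carried S A P) in (card A - 1, cell_on S A P))"

lemma cell_name_props:
 assumes S: "is_cyclic_set S" and s: "s \<in> cells S n" and t: "t \<in> standard_simplex n"
 shows "cell_name S (rclass S n s t) \<in> (SIGMA m:{..n}. (%ph. op_act S m n ph s) ` ({..n} \<rightarrow>\<^sub>E {..n}))"
  "\<exists>m y. cell_name S (rclass S n s t) = (m, y) & y \<in> cells S m & rclass S n s t \<in> closed_cell S m y"
proof -
 let ?P = "rclass S n s t"
 let ?Q = "%A. mark_set A & carried S A ?P"
 define A where "A = arg_min card ?Q"
 have Q: "?Q (marks n t)" using carriedI[OF S s t] marks_props[OF t] by blast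
 have A: "mark_set A" "carried S A ?P" using arg_min_natI[of ?Q, OF Q, of card] by (simp_all add: A_def)
 have "card A <= Suc n"
  using arg_min_nat_le[of ?Q, OF Q, of card] marks_props(2)[OF t] by (simp add: A_def)
 then have cn: "card A - 1 <= n" by simp
 have name: "cell_name S ?P = (card A - 1, cell_on S A ?P)" by (simp add: cell_name_def A_def Let_def)
 define ph where "ph = restrict (%i. segment_at n t (nth_mark A i)) {..n}"
 have "cell_on S A ?P = op_act S (card A - 1) n (%i. segment_at n t (nth_mark A i)) s"
  unfolding cell_on_def by (rule eval_rclass[OF S s t sampling_marks[OF A(1)]])
 also have "... = op_act S (card A - 1) n ph s"
  using cn op_act_cong[of "card A - 1" "%i. segment_at n t (nth_mark A i)" ph S n] by (simp add: ph_def)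
 finally have "cell_on S A ?P = op_act S (card A - 1) n ph s" .
 moreover have "ph \<in> {..n} \<rightarrow>\<^sub>E {..n}" by (auto simp: ph_def segment_at_le)
 ultimately show "cell_name S ?P \<in> (SIGMA m:{..n}. (%ph. op_act S m n ph s) ` ({..n} \<rightarrow>\<^sub>E {..n}))"
  unfolding name using cn by blast
 show "\<exists>m y. cell_name S ?P = (m, y) & y \<in> cells S m & ?P \<in> closed_cell S m y"
  using carriedD[OF S A] gaps_simplex[OF A(1)] name by blast
qed

text \<open>If there were infinitely many labels, choose one point of \<open>K\<close> for each.
  Every set of chosen points meets each closed cell in finitely many points and is therefore closed,
  so the chosen points have no accumulation point, contrary to compactness.\<close>

lemma compact_finite_cells:
 assumes S: "is_cyclic_set S" and K: "compactin (realization S) K"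
 shows "finite (cell_name S ` K)"
proof (rule ccontr)
 assume inf: "infinite (cell_name S ` K)"
 have KS: "K <= topspace (realization S)" by (rule compactin_subset_topspace[OF K])
 obtain Z where Z: "Z <= K" "inj_on (cell_name S) Z" "cell_name S ` Z = cell_name S ` K"
  using subset_image_inj[of "cell_name S ` K" "cell_name S" K] by auto
 have closed: "closedin (realization S) Z'" if Z': "Z' <= Z" for Z'
  unfolding closedin_realization
 proof (intro conjI allI ballI)
  show "Z' <= topspace (realization S)" using Z' Z(1) KS by blast
  fix n s assume s: "s \<in> cells S n"
  let ?W = "Z' \<inter> closed_cell S n s"
  have "cell_name S ` ?W <= (SIGMA m:{..n}. (%ph. op_act S m n ph s) ` ({..n} \<rightarrow>\<^sub>E {..n}))"
   using cell_name_props(1)[OF S s] by blast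
  moreover have "finite (SIGMA m:{..n}. (%ph. op_act S m n ph s) ` ({..n} \<rightarrow>\<^sub>E {..n}))"
   by (intro finite_SigmaI finite_imageI finite_PiE) auto
  ultimately have "finite (cell_name S ` ?W)" by (rule finite_subset)
  then have "finite ?W" by (rule finite_imageD) (use Z(2) Z' in \<open>auto intro: inj_on_subset\<close>)
  then have "closedin (realization S) (\<Union>P\<in>?W. {P})"
   using closedin_point_realization[OF S] Z' Z(1) KS by (intro closedin_Union) auto
  then have "closedin (realization S) ?W" by simp
  then have "closedin (simplex_topology n) {t \<in> standard_simplex n. rclass S n s t \<in> ?W}"
   using s unfolding closedin_realization by blast
  moreover have "{t \<in> standard_simplex n. rclass S n s t \<in> ?W} = {t \<in> standard_simplex n. rclass S n s t \<in> Z'}"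
   by auto
  ultimately show "closedin (simplex_topology n) {t \<in> standard_simplex n. rclass S n s t \<in> Z'}" by simp
 qed
 have "infinite Z" using inf Z(3) by (metis finite_imageI)
 then obtain x where x: "x \<in> realization S derived_set_of Z"
  using compactin_imp_Bolzano_Weierstrass[OF K, of Z] Z(1) by blast
 let ?T = "topspace (realization S) - (Z - {x})"
 have T: "openin (realization S) ?T" by (intro openin_diff closed) auto
 have "x \<in> topspace (realization S)" and lim: "\<forall>T. x \<in> T & openin (realization S) T --> (\<exists>y\<noteq>x. y \<in> Z & y \<in> T)"
  using x by (simp_all add: in_derived_set_of)
 then have "\<exists>y\<noteq>x. y \<in> Z & y \<in> ?T" using T by (intro lim[rule_format]) simp
 then show False by blast
qed

section \<open>Traces\<close>

lemma circuit_trace: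
 assumes tr: "traces c w l z" and l: "l \<in> standard_simplex (length w - 1)" and w: "w ~= []"
  and s: "0 <= s" "s < 1"
 obtains a where "a = segment_at (length w - 1) l s" "a < length w" "sum l {..<a} <= s" "s < sum l {..<Suc a}"
  "!!u. sum l {..<a} <= u ==> u < sum l {..<Suc a} ==> circuit c u =
   (w ! a, frac (z (w ! a) + ((\<Sum>b | b < a & w ! b = w ! a. l b) + (u - sum l {..<a})) / radius c (w ! a)))"
proof -
 define a where "a = segment_at (length w - 1) l s"
 note b = segment_at_bounds[OF l s, folded a_def]
 have a: "a < length w" using b(1) w by (cases w) auto
 show thesis
 proof (rule that[OF a_def a b(2,3)])
  fix u assume u: "sum l {..<a} <= u" "u < sum l {..<Suc a}"
  then have "u - sum l {..<a} \<in> {0..<l a}" by simp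
  then have "circuit c (sum l {..<a} + (u - sum l {..<a})) = (w ! a, frac (z (w ! a) +
    ((\<Sum>b | b < a & w ! b = w ! a. l b) + (u - sum l {..<a})) / radius c (w ! a)))"
   using tr a unfolding traces_def by blast
  then show "circuit c u = (w ! a, frac (z (w ! a) +
    ((\<Sum>b | b < a & w ! b = w ! a. l b) + (u - sum l {..<a})) / radius c (w ! a)))"
   by simp
 qed
qed

text \<open>In the interior of an arc the path runs along its lobe, so all moved points are reached
  at ends of arcs. This bounds the number of spines needed by the length of \<open>w\<close> and the
  number of lobes, uniformly in the cactus.\<close>

lemma marked_trace:
 assumes c: "is_cactus c" and tr: "traces c w l z" and l: "l \<in> standard_simplex (length w - 1)" and w: "w ~= []"
  and Y: "finite Y" "Y <= points c"
 shows "marked c (circuit c ` marks (length w - 1) l \<union> (%k. (k, 0)) ` {..<lobes c} \<union> Y)"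
proof -
 let ?M = "marks (length w - 1) l"
 note gc_9 = cactus_circuit(1)[OF c]
 have circ_9: "is_circuit c (circuit c)" using gc_9 by (simp add: good_circuit_def)
 have M: "finite ?M" "?M <= {0..<1}" "0 \<in> ?M" using marks_props(1)[OF l] by (simp_all add: mark_set_def)
 have "q \<in> circuit c ` ?M" if q: "turn c q ~= q" for q
 proof -
  have qp: "q \<in> points c" using q cactus_pre[OF c] unfolding precactus_def permutes_def by blast
  then obtain s where s: "0 <= s" "s < 0 + 1" "circuit c s = q" using good_circuit_surj[OF gc_9, of q 0] by blast
  have s1: "s < 1" using s(2) by simp
  obtain a where a: "a = segment_at (length w - 1) l s" "a < length w" "sum l {..<a} <= s" "s < sum l {..<Suc a}"
   "!!u. sum l {..<a} <= u ==> u < sum l {..<Suc a} ==> circuit c u =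
    (w ! a, frac (z (w ! a) + ((\<Sum>b | b < a & w ! b = w ! a. l b) + (u - sum l {..<a})) / radius c (w ! a)))"
   by (rule circuit_trace[OF tr l w s(1) s1]) blast
  show ?thesis
  proof (cases "s = sum l {..<a}")
   case True
   have "a <= length w - 1" using a(2) by simp
   then have "s \<in> ?M" using True s1 by (auto simp: marks_def)
   then show ?thesis using s(3) by blast
  next
   case False
   obtain e p where p: "e > 0" "p \<in> points c" "circuit c s = turn c p"
    "!!h. 0 < h ==> h < e ==> circuit c (s - h) = advance c p (- h)"
    using circuit_left[OF circ_9, of s] by blast
   define x where "x = min (e / 2) ((s - sum l {..<a}) / 2)"
   have x: "0 < x" "x < e" "x < s - sum l {..<a}"
    using p(1) a(3) False by (auto simp: x_def min_less_iff_disj)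
   have e1: "circuit c (s - x) = (w ! a, frac (z (w ! a) +
     ((\<Sum>b | b < a & w ! b = w ! a. l b) + (s - x - sum l {..<a})) / radius c (w ! a)))"
    using x a(4) by (intro a(5)) auto
   have "advance c q (- x) = circuit c (s - x)"
    unfolding e1 s(3)[symmetric] a(5)[OF a(3,4)] advance_pair frac_add_frac
    by (simp add: diff_divide_distrib add_divide_distrib algebra_simps)
   then have "advance c p (- x) = advance c q (- x)" using p(4)[OF x(1,2)] by simp
   then have "p = q" by (rule advance_inj[OF p(2) qp])
   then show ?thesis using p(3) s(3) q by simp
  qed
 qed
 moreover have "origin c \<in> circuit c ` ?M"
  using circ_9 M(3) unfolding is_circuit_def by (metis image_eqI)
 moreover have "circuit c ` ?M <= points c" using circuit_points[OF circ_9] by blast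
 ultimately show ?thesis
  using Y M(1) by (auto simp: marked_def points_def)
qed

lemma sum_gaps_lobe:
 assumes c: "is_cactus c" and X: "marked c X" and k: "k < lobes c" and i: "i <= spines X k"
 shows "(\<Sum>m<i. gaps (on_circuit c X) (seg_index c X k m)) = radius c k * nth_mark (on_lobe X k) i"
proof -
 have "(\<Sum>m<i. gaps (on_circuit c X) (seg_index c X k m)) = (\<Sum>m<i. radius c k * gaps (on_lobe X k) m)"
  using i by (intro sum.cong refl gaps_on_circuit[OF c X k]) auto
 also have "... = radius c k * sum (gaps (on_lobe X k)) {..<i}" by (simp add: sum_distrib_left)
 finally show ?thesis using sum_gaps[OF lobe_marks[OF X k], of i] i by (simp add: spines_def)
qed

text \<open>Spines at the ends of the arcs cut arcs and lobes into the same pieces; collecting the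
  pieces by lobe gives both sides. In particular the radii depend continuously on the lengths of the
  arcs.\<close>

lemma traces_radius:
 assumes c: "is_cactus c" and tr: "traces c w l z" and l: "l \<in> standard_simplex (length w - 1)" and w: "w ~= []"
  and k: "k < lobes c"
 shows "radius c k = (\<Sum>a | a <= length w - 1 & w ! a = k. l a)"
proof -
 let ?N = "length w - 1"
 define X where "X = circuit c ` marks ?N l \<union> (%k. (k, 0)) ` {..<lobes c}"
 have X: "marked c X" using marked_trace[OF c tr l w, of "{}"] by (simp add: X_def)
 note TT = circuit_marks[OF c X]
 let ?T = "on_circuit c X"
 define ph where "ph = (%i. segment_at ?N l (nth_mark ?T i))"
 have "marks ?N l <= ?T"
  using marks_props(1)[OF l] by (auto simp: on_circuit_def X_def mark_set_def)
 then have push: "push_forward (card ?T - 1) ph (gaps ?T) = l"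
  unfolding ph_def using marks_props(3)[OF l] by (intro push_forward_segment_at[OF l TT(1)]) blast
 have mon: "monotone_op (card ?T - 1) ?N ph"
  unfolding ph_def by (rule monotone_segment_at[OF sampling_marks[OF TT(1)] l])
 have wph: "w ! ph i = fst (circuit c (nth_mark ?T i))" if "i < card X" for i
 proof -
  have "0 <= nth_mark ?T i" "nth_mark ?T i < 1" using nth_mark_range[OF TT(1), of i] that TT(2) by simp_all
  then show ?thesis by (rule circuit_trace[OF tr l w]) (simp add: ph_def)
 qed
 have cT: "i <= card ?T - 1 \<longleftrightarrow> i < card X" for i using marked_card[OF c X] TT(2) by auto
 have bij: "bij_betw (seg_index c X k) {..<spines X k} {i. i <= card ?T - 1 & w ! ph i = k}"
  unfolding bij_betw_def
 proof (intro conjI equalityI subsetI)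
  show "inj_on (seg_index c X k) {..<spines X k}"
   using seg_index_inj(2)[OF c X k _ k] by (auto simp: inj_on_def)
  fix i assume "i \<in> seg_index c X k ` {..<spines X k}"
  then obtain m where m: "i = seg_index c X k m" "m < spines X k" by blast
  note p = seg_index_props[OF c X k m(2), folded m(1)]
  have "w ! ph i = k" using wph[OF p(1)] p(3) by simp
  then show "i \<in> {i. i <= card ?T - 1 & w ! ph i = k}" using p(1) cT by simp
 next
  fix i assume "i \<in> {i. i <= card ?T - 1 & w ! ph i = k}"
  then have i: "i < card X" "w ! ph i = k" using cT by simp_all
  obtain k' m where m: "k' < lobes c" "m < spines X k'" "seg_index c X k' m = i"
   by (rule seg_index_surj[OF c X i(1)])
  have "fst (circuit c (nth_mark ?T i)) = k'" using seg_index_props(3)[OF c X m(1,2)] m(3) by simp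
  then have "k' = k" using wph[OF i(1)] i(2) by simp
  then show "i \<in> seg_index c X k ` {..<spines X k}" using m by blast
 qed
 have "(\<Sum>a | a <= ?N & w ! a = k. l a) = (\<Sum>a | a <= ?N & w ! a = k. push_forward (card ?T - 1) ph (gaps ?T) a)"
  unfolding push ..
 also have "... = (\<Sum>i | i <= card ?T - 1 & w ! ph i = k. gaps ?T i)" by (rule sum_push_forward[OF mon])
 also have "... = (\<Sum>m<spines X k. gaps ?T (seg_index c X k m))" by (rule sum.reindex_bij_betw[OF bij, symmetric])
 also have "... = radius c k" using sum_gaps_lobe[OF c X k le_refl] by (simp add: spines_def nth_mark_card)
 finally show ?thesis by (rule sym)
qed

text \<open>The value of the path gives the outgoing point, and its germ just before gives the
  incoming one.\<close>

lemma circuit_determines_turn: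
 assumes c: "is_cactus c" and c': "is_cactus c'" and lob: "lobes c = lobes c'" and r: "radius c = radius c'"
  and f: "circuit c = circuit c'"
 shows "c = c'"
proof -
 note g = cactus_circuit(1)[OF c] and g' = cactus_circuit(1)[OF c']
 have circ_9: "is_circuit c (circuit c)" and circ': "is_circuit c' (circuit c')" using g g' by (simp_all add: good_circuit_def)
 have pts: "points c = points c'" by (simp add: points_def lob)
 have adv: "advance c = advance c'" by (simp add: advance_def r)
 have perm: "turn c permutes points c" "turn c' permutes points c'"
  using cactus_pre[OF c] cactus_pre[OF c'] by (simp_all add: precactus_def)
 have "turn c q = turn c' q" for q
 proof (cases "q \<in> points c")
  case False
  then show ?thesis using permutes_not_in[OF perm(1)] permutes_not_in[OF perm(2)] pts by simp
 next
  case True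
  then have "turn c q \<in> points c" using permutes_in_image[OF perm(1)] by simp
  then obtain s where s: "circuit c s = turn c q" using good_circuit_surj[OF g, of "turn c q" 0] by blast
  obtain e p where p: "e > 0" "p \<in> points c" "circuit c s = turn c p"
   "!!h. 0 < h ==> h < e ==> circuit c (s - h) = advance c p (- h)"
   using circuit_left[OF circ_9, of s] by blast
  obtain e' p' where p': "e' > 0" "p' \<in> points c'" "circuit c' s = turn c' p'"
   "!!h. 0 < h ==> h < e' ==> circuit c' (s - h) = advance c' p' (- h)"
   using circuit_left[OF circ', of s] by blast
  define h where "h = min e e' / 2"
  have h: "0 < h" "h < e" "h < e'" using p(1) p'(1) by (auto simp: h_def min_def)
  have "advance c p (- h) = advance c p' (- h)" using p(4)[OF h(1,2)] p'(4)[OF h(1,3)] f adv by simp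
  then have "p = p'" using p(2) p'(2) pts by (intro advance_inj[of p c p']) simp_all
  moreover have "p = q" using p(3) s permutes_inj[OF perm(1)] by (simp add: inj_eq)
  ultimately show ?thesis using p(3) p'(3) f by simp
 qed
 moreover have "origin c = origin c'" using circ_9 circ' f by (simp add: is_circuit_def)
 ultimately show ?thesis using lob r by (simp add: fun_eq_iff)
qed

lemma traces_unique:
 assumes c: "c \<in> cacti n" and c': "c' \<in> cacti n" and tr: "traces c w l z" "traces c' w l z"
  and l: "l \<in> standard_simplex (length w - 1)" and w: "w ~= []"
 shows "c = c'"
proof -
 have cc: "is_cactus c" "is_cactus c'" and lob: "lobes c = n" "lobes c' = n" using c c' by (simp_all add: cacti_def)
 have r: "radius c = radius c'"
 proof
  fix k
  show "radius c k = radius c' k"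
  proof (cases "k < n")
   case True
   then show ?thesis
    using traces_radius[OF cc(1) tr(1) l w, of k] traces_radius[OF cc(2) tr(2) l w, of k] lob by simp
  next
   case False
   then show ?thesis
    using cactus_pre[OF cc(1)] cactus_pre[OF cc(2)] lob by (simp add: precactus_def)
  qed
 qed
 have "circuit c s = circuit c' s" for s
 proof -
  have f: "0 <= frac s" "frac s < 1" using frac_range[of s] by simp_all
  have "circuit c (frac s) = circuit c' (frac s)"
  proof (rule circuit_trace[OF tr(1) l w f])
   fix a
   assume a: "a = segment_at (length w - 1) l (frac s)" "a < length w" "sum l {..<a} <= frac s" "frac s < sum l {..<Suc a}"
    "!!u. sum l {..<a} <= u ==> u < sum l {..<Suc a} ==> circuit c u =
    (w ! a, frac (z (w ! a) + ((\<Sum>b | b < a & w ! b = w ! a. l b) + (u - sum l {..<a})) / radius c (w ! a)))"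
   show ?thesis
   proof (rule circuit_trace[OF tr(2) l w f])
    fix a'
    assume a': "a' = segment_at (length w - 1) l (frac s)" "sum l {..<a'} <= frac s" "frac s < sum l {..<Suc a'}"
     "!!u. sum l {..<a'} <= u ==> u < sum l {..<Suc a'} ==> circuit c' u =
     (w ! a', frac (z (w ! a') + ((\<Sum>b | b < a' & w ! b = w ! a'. l b) + (u - sum l {..<a'})) / radius c' (w ! a')))"
    have "a' = a" by (simp only: a(1) a'(1))
    then show ?thesis unfolding a(5)[OF a(3,4)] a'(4)[OF a'(2,3)] r by simp
   qed
  qed
  then show ?thesis
   using good_circuit_frac[OF cactus_circuit(1)[OF cc(1)], of s] good_circuit_frac[OF cactus_circuit(1)[OF cc(2)], of s]
   by simp
 qed
 then show ?thesis using circuit_determines_turn[OF cc _ r] lob by (simp add: fun_eq_iff)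
qed

text \<open>The lengths of \<open>(c, X)\<close> itself, read in the numbering of another spiny
  cactus of the same combinatorial type. In this way one fixed type serves a whole sequence of
  cacti.\<close>

lemma realizes_same_type:
 assumes c: "is_cactus c" and X: "marked c X" and lob: "lobes c1 = lobes c" and card: "card X1 = card X"
  and sp: "!!k. k < lobes c ==> spines X1 k = spines X k"
  and seg: "!!k i. k < lobes c ==> i < spines X k ==> seg_index c1 X1 k i = seg_index c X k i"
 shows "realizes c1 X1 (gaps (on_circuit c X)) c"
  "k < lobes c ==> lobe_weights c1 X1 (gaps (on_circuit c X)) c k = gaps (on_lobe X k)"
proof -
 note TT = circuit_marks[OF c X]
 let ?T = "on_circuit c X"
 have r: "0 < radius c k" if "k < lobes c" for k by (rule precactus_radius[OF cactus_pre[OF c] that])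
 have part: "(\<Sum>m<i. gaps ?T (seg_index c1 X1 k m)) = radius c k * nth_mark (on_lobe X k) i"
  if k: "k < lobes c" and i: "i <= spines X k" for k i
 proof -
  have "(\<Sum>m<i. gaps ?T (seg_index c1 X1 k m)) = (\<Sum>m<i. gaps ?T (seg_index c X k m))"
   using i by (intro sum.cong refl arg_cong[of _ _ "gaps ?T"] seg[OF k]) auto
  then show ?thesis using sum_gaps_lobe[OF c X k i] by simp
 qed
 show "realizes c1 X1 (gaps ?T) c"
  unfolding realizes_def lob card
 proof (intro conjI allI impI refl)
  show "gaps ?T \<in> standard_simplex (card X - 1)" by (rule gaps_circuit_simplex[OF c X])
  show "(\<Sum>i<spines X1 k. gaps ?T (seg_index c1 X1 k i)) = radius c k" if k: "k < lobes c" for k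
   using part[OF k le_refl] sp[OF k] by (simp add: spines_def nth_mark_card)
  fix k i h assume k: "k < lobes c" and i1: "i < spines X1 k" and h: "0 <= h & h < gaps ?T (seg_index c1 X1 k i)"
  have i: "i < spines X k" using i1 sp[OF k] by simp
  note j = seg_index_props[OF c X k i]
  have gi: "gaps (on_lobe X k) i = nth_mark (on_lobe X k) (Suc i) - nth_mark (on_lobe X k) i"
   using i by (simp add: gaps_def spines_def)
  have h2: "h < radius c k * (nth_mark (on_lobe X k) (Suc i) - nth_mark (on_lobe X k) i)"
   using h gaps_on_circuit[OF c X k i] unfolding seg[OF k i] gi by simp
  have e: "sum (gaps ?T) {..<seg_index c X k i} = nth_mark ?T (seg_index c X k i)"
   using sum_gaps[OF TT(1), of "seg_index c X k i"] j(1) TT(2) by simp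
  have p: "(\<Sum>m<i. gaps ?T (seg_index c1 X1 k m)) = radius c k * nth_mark (on_lobe X k) i"
   using i by (intro part[OF k]) simp
  have "circuit c (nth_mark ?T (seg_index c X k i) + h) = (k, nth_mark (on_lobe X k) i + h / radius c k)"
   by (rule seg_travel(1)[OF c X k i j(3) _ h2]) (use h in simp)
  then show "circuit c (sum (gaps ?T) {..<seg_index c1 X1 k i} + h) =
    (k, ((\<Sum>m<i. gaps ?T (seg_index c1 X1 k m)) + h) / radius c k)"
   unfolding seg[OF k i] e p using r[OF k] by (simp add: add_divide_distrib)
 qed
 show "lobe_weights c1 X1 (gaps ?T) c k = gaps (on_lobe X k)" if k: "k < lobes c"
 proof
  fix i
  show "lobe_weights c1 X1 (gaps ?T) c k i = gaps (on_lobe X k) i"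
  proof (cases "i < spines X k")
   case True
   have "gaps ?T (seg_index c1 X1 k i) = radius c k * gaps (on_lobe X k) i"
    unfolding seg[OF k True] by (rule gaps_on_circuit[OF c X k True])
   then show ?thesis using True sp[OF k] r[OF k] by (simp add: lobe_weights_def)
  next
   case False
   then show ?thesis using sp[OF k] by (simp add: lobe_weights_def gaps_def spines_def)
  qed
 qed
qed

lemma lobe_weights_simplex:
 assumes re: "realizes c X u c'" and X: "marked c X" and c': "is_cactus c'" and k: "k < lobes c"
 shows "lobe_weights c X u c' k \<in> standard_simplex (spines X k - 1)"
proof -
 have u: "u \<in> standard_simplex (card X - 1)" and lob: "lobes c' = lobes c"
  and rad: "(\<Sum>i<spines X k. u (seg_index c X k i)) = radius c' k"
  using re k by (simp_all add: realizes_def)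
 have r: "0 < radius c' k" using precactus_radius[OF cactus_pre[OF c']] k lob by simp
 show ?thesis
 proof (rule simplexI)
  show "0 <= lobe_weights c X u c' k m" for m
   using simplexD(1)[OF u] r by (simp add: lobe_weights_def)
  show "lobe_weights c X u c' k m = 0" if "spines X k - 1 < m" for m using that by (simp add: lobe_weights_def)
  have "{..spines X k - 1} = {..<spines X k}" using spines_pos[OF X k] by auto
  then have "(\<Sum>m\<le>spines X k - 1. lobe_weights c X u c' k m) = (\<Sum>i<spines X k. u (seg_index c X k i)) / radius c' k"
   by (simp add: lobe_weights_def sum_divide_distrib)
  then show "(\<Sum>m\<le>spines X k - 1. lobe_weights c X u c' k m) = 1" using rad r by simp
 qed
qed

text \<open>The claim for time \<open>s\<close> is checked at a slightly later time
  \<open>s'\<close>, which lies strictly inside an arc and a segment of the limit and hence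
  eventually inside those of the sequence. There both descriptions of the path apply, so they name
  the same lobe and coordinates equal modulo 1, and this survives the limit because the integers are
  closed. Both coordinates move at the same speed, so they also agree at \<open>s\<close>.\<close>

lemma realizes_limit:
 assumes c: "is_cactus c" and X: "marked c1 X" and lob: "lobes c1 = lobes c"
  and cc: "!!r. is_cactus (cc r)" and re: "!!r. realizes c1 X (u r) (cc r)"
  and u: "u \<longlonglongrightarrow> v" and v: "v \<in> standard_simplex (card X - 1)"
  and tr: "!!r. traces (cc r) w (l r) (z r)" and tr0: "traces c w l0 z0" and w: "w ~= []"
  and l: "!!r. l r \<in> standard_simplex (length w - 1)" "l0 \<in> standard_simplex (length w - 1)" "l \<longlonglongrightarrow> l0"
  and z: "!!k. k < lobes c ==> (%r. z r k) \<longlonglongrightarrow> z0 k"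
 shows "realizes c1 X v c" "!!k. k < lobes c ==> (%r. radius (cc r) k) \<longlonglongrightarrow> radius c k"
proof -
 have lobc: "lobes (cc r) = lobes c" for r using re[of r] lob by (simp add: realizes_def)
 have ui: "(%r. u r i) \<longlonglongrightarrow> v i" for i using u by (simp add: tendsto_fun_iff)
 have li: "(%r. l r i) \<longlonglongrightarrow> l0 i" for i using l(3) by (simp add: tendsto_fun_iff)
 have usum: "(%r. \<Sum>i\<in>I. u r (g i)) \<longlonglongrightarrow> (\<Sum>i\<in>I. v (g i))" for I :: "nat set" and g by (intro tendsto_sum ui)
 have lsum: "(%r. sum (l r) I) \<longlonglongrightarrow> sum l0 I" for I :: "nat set" by (intro tendsto_sum li)
 have usum': "(%r. sum (u r) I) \<longlonglongrightarrow> sum v I" for I :: "nat set" by (intro tendsto_sum ui)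
 show rad: "(%r. radius (cc r) k) \<longlonglongrightarrow> radius c k" if k: "k < lobes c" for k
 proof -
  have "radius (cc r) k = (\<Sum>a | a <= length w - 1 & w ! a = k. l r a)" for r
   using traces_radius[OF cc tr l(1) w] k lobc by simp
  then show ?thesis using lsum traces_radius[OF c tr0 l(2) w k] by simp
 qed
 have rpos: "0 < radius c k" if "k < lobes c" for k by (rule precactus_radius[OF cactus_pre[OF c] that])
 have vr: "(\<Sum>i<spines X k. v (seg_index c1 X k i)) = radius c k" if k: "k < lobes c" for k
 proof (rule LIMSEQ_unique[OF usum])
  have "(\<Sum>i<spines X k. u r (seg_index c1 X k i)) = radius (cc r) k" for r
   using re[of r] k lob by (simp add: realizes_def)
  then show "(%r. \<Sum>i<spines X k. u r (seg_index c1 X k i)) \<longlonglongrightarrow> radius c k" using rad[OF k] by simp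
 qed
 have v0: "0 <= v i" for i by (rule simplexD(1)[OF v])
 have vsum1: "sum v {..<j} <= 1" for j
 proof -
  have "sum v {..<j} <= sum v {..<max j (Suc (card X - 1))}" by (intro partial_sum_mono v0) simp
  also have "... = sum v {..card X - 1}"
   using simplexD(3)[OF v] by (intro sum.mono_neutral_right) auto
  finally show ?thesis using simplexD(4)[OF v] by simp
 qed
 show "realizes c1 X v c"
  unfolding realizes_def lob
 proof (intro conjI allI impI refl v vr)
  fix k i h assume k: "k < lobes c" and i: "i < spines X k" and h': "0 <= h & h < v (seg_index c1 X k i)"
  define j where "j = seg_index c1 X k i"
  define s where "s = sum v {..<j} + h"
  define Sv where "Sv = (\<Sum>m<i. v (seg_index c1 X k m))"
  define R where "R = radius c k"
  have h: "0 <= h" "h < v j" using h' by (simp_all add: j_def)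
  have sj: "s < sum v {..<Suc j}" using h by (simp add: s_def)
  have s: "0 <= s" "s < 1" using h(1) v0 sj vsum1[of "Suc j"] by (simp_all add: s_def sum_nonneg)
  obtain a where a: "a = segment_at (length w - 1) l0 s" "a < length w" "sum l0 {..<a} <= s" "s < sum l0 {..<Suc a}"
   "!!u. sum l0 {..<a} <= u ==> u < sum l0 {..<Suc a} ==> circuit c u =
    (w ! a, frac (z0 (w ! a) + ((\<Sum>b | b < a & w ! b = w ! a. l0 b) + (u - sum l0 {..<a})) / radius c (w ! a)))"
   by (rule circuit_trace[OF tr0 l(2) w s]) blast
  have "circuit c s \<in> points c"
   using circuit_points cactus_circuit(1)[OF c] unfolding good_circuit_def by blast
  then have wa: "w ! a < lobes c" unfolding a(5)[OF a(3,4)] by (simp add: points_iff)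
  define dl where "dl = min (sum v {..<Suc j} - s) (sum l0 {..<Suc a} - s)"
  have dl: "0 < dl" "dl <= sum v {..<Suc j} - s" "dl <= sum l0 {..<Suc a} - s"
   using sj a(4) by (simp_all add: dl_def del: sum.lessThan_Suc)
  define s' where "s' = s + dl / 2"
  have s': "s < s'" "s' < sum v {..<Suc j}" "s' < sum l0 {..<Suc a}"
   using dl by (simp_all add: s'_def del: sum.lessThan_Suc)
  have below: "sum v {..<j} < s'" "sum l0 {..<a} < s'" using s'(1) h(1) a(3) by (simp_all add: s_def)
  have s'1: "0 <= s'" "s' < 1" using s s' vsum1[of "Suc j"] by simp_all
  define A where "A = (%r. ((\<Sum>m<i. u r (seg_index c1 X k m)) + (s' - sum (u r) {..<j})) / radius (cc r) k)"
  define Y where "Y = (%r. z r (w ! a) +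
   ((\<Sum>b | b < a & w ! b = w ! a. l r b) + (s' - sum (l r) {..<a})) / radius (cc r) (w ! a))"
  have ev: "\<forall>\<^sub>F r in sequentially. sum (u r) {..<j} < s' & s' < sum (u r) {..<Suc j} &
    sum (l r) {..<a} < s' & s' < sum (l r) {..<Suc a}"
   using order_tendstoD(2)[OF usum' below(1)] order_tendstoD(1)[OF usum' s'(2)]
    order_tendstoD(2)[OF lsum below(2)] order_tendstoD(1)[OF lsum s'(3)]
   by (simp add: eventually_conj_iff)
  have eq: "k = w ! a & A r = frac (Y r)"
   if "sum (u r) {..<j} < s' & s' < sum (u r) {..<Suc j} & sum (l r) {..<a} < s' & s' < sum (l r) {..<Suc a}" for r
  proof -
   have run: "\<forall>k<lobes c1. \<forall>i<spines X k. \<forall>h. 0 <= h & h < u r (seg_index c1 X k i) -->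
     circuit (cc r) (sum (u r) {..<seg_index c1 X k i} + h) =
      (k, ((\<Sum>m<i. u r (seg_index c1 X k m)) + h) / radius (cc r) k)"
    using re[of r] unfolding realizes_def by blast
   have "0 <= s' - sum (u r) {..<j} & s' - sum (u r) {..<j} < u r j" using that by simp
   then have "circuit (cc r) (sum (u r) {..<j} + (s' - sum (u r) {..<j})) = (k, A r)"
    unfolding A_def j_def by (intro run[rule_format]) (simp_all add: k i lob)
   then have 1: "circuit (cc r) s' = (k, A r)" by simp
   have "s' - sum (l r) {..<a} \<in> {0..<l r a}" using that by simp
   then have "circuit (cc r) (sum (l r) {..<a} + (s' - sum (l r) {..<a})) = (w ! a, frac (Y r))"
    using tr[of r] a(2) unfolding traces_def Y_def by blast
   then show ?thesis using 1 by simp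
  qed
  obtain r0 where "sum (u r0) {..<j} < s' & s' < sum (u r0) {..<Suc j} &
    sum (l r0) {..<a} < s' & s' < sum (l r0) {..<Suc a}"
   using eventually_happens'[OF sequentially_bot ev] by (rule exE)
  then have ka: "k = w ! a" using eq[of r0] by simp
  have "\<forall>\<^sub>F r in sequentially. Y r - A r \<in> \<int>"
   using ev by (rule eventually_mono) (use eq in \<open>auto simp: frac_def\<close>)
  moreover have "(%r. Y r - A r) \<longlonglongrightarrow> (z0 k + ((\<Sum>b | b < a & w ! b = w ! a. l0 b) + (s' - sum l0 {..<a})) / R) -
    (Sv + (s' - sum v {..<j})) / R"
   unfolding Y_def A_def R_def Sv_def ka[symmetric] using rpos[OF k]
   by (intro tendsto_intros z[OF k] rad[OF k] usum usum' lsum) simp_all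
  ultimately have "(z0 k + ((\<Sum>b | b < a & w ! b = w ! a. l0 b) + (s' - sum l0 {..<a})) / R) -
    (Sv + (s' - sum v {..<j})) / R \<in> \<int>"
   by (intro Lim_in_closed_set[OF closed_Ints]) simp_all
  then have "(z0 k + ((\<Sum>b | b < a & w ! b = w ! a. l0 b) + (s - sum l0 {..<a})) / R) - (Sv + h) / R \<in> \<int>"
   by (simp add: s_def diff_divide_distrib add_divide_distrib algebra_simps)
  then have fr: "frac (z0 k + ((\<Sum>b | b < a & w ! b = w ! a. l0 b) + (s - sum l0 {..<a})) / R) = frac ((Sv + h) / R)"
   unfolding frac_eq_frac_iff .
  have "Sv + h < R"
  proof -
   have "Sv + h < (\<Sum>m<Suc i. v (seg_index c1 X k m))" using h by (simp add: Sv_def j_def)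
   also have "... <= (\<Sum>m<spines X k. v (seg_index c1 X k m))"
    using i v0 by (intro sum_mono2) auto
   finally show ?thesis using vr[OF k] by (simp add: R_def)
  qed
  moreover have "0 <= Sv + h" using h v0 by (simp add: Sv_def sum_nonneg)
  ultimately have "frac ((Sv + h) / R) = (Sv + h) / R" using rpos[OF k] by (intro frac_id) (simp_all add: R_def)
  then have "circuit c s = (k, (Sv + h) / R)"
   unfolding a(5)[OF a(3,4)] using fr by (simp add: ka[symmetric] R_def)
  then show "circuit c (sum v {..<seg_index c1 X k i} + h) = (k, ((\<Sum>m<i. v (seg_index c1 X k m)) + h) / radius c k)"
   by (simp add: s_def j_def Sv_def R_def)
 qed
qed

section \<open>Continuity of the action\<close>

lemma card_on_lobe_le:
 assumes "finite X"
 shows "card (on_lobe X k) <= card X"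
proof -
 have "Pair k ` on_lobe X k <= X" by (auto simp: on_lobe_iff)
 then show ?thesis using assms by (intro card_inj_on_le[of "Pair k"]) (auto simp: inj_on_def)
qed

lemma act_sequence:
 assumes S: "is_cactus_set S" and s: "!!k. k < n ==> s k \<in> cells S (N k)"
  and cc: "!!r. cc r \<in> cacti n" and c: "c \<in> cacti n"
  and tr: "!!r. traces (cc r) w (l r) (z r)" and tr0: "traces c w l0 z0" and w: "w ~= []"
  and l: "!!r. l r \<in> standard_simplex (length w - 1)" "l0 \<in> standard_simplex (length w - 1)" "l \<longlonglongrightarrow> l0"
  and z: "!!k. k < n ==> (%r. z r k) \<longlonglongrightarrow> z0 k"
  and t: "!!r k. k < n ==> t r k \<in> standard_simplex (N k)" "!!k. k < n ==> (%r. t r k) \<longlonglongrightarrow> t0 k"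
  and C: "closedin (realization S) C"
  and inC: "!!r. cactus_act S (cc r) (\<lambda>k\<in>{..<n}. rclass S (N k) (s k) (t r k)) \<in> C"
 shows "cactus_act S c (\<lambda>k\<in>{..<n}. rclass S (N k) (s k) (t0 k)) \<in> C"
proof -
 note cyc = cactus_setD(1)[OF S]
 have cact: "is_cactus (cc r)" "lobes (cc r) = n" for r using cc[of r] by (simp_all add: cacti_def)
 have cact0: "is_cactus c" "lobes c = n" using c by (simp_all add: cacti_def)
 define M where "M = length w - 1"
 define B where "B = Suc M + n + (\<Sum>k<n. Suc (N k))"
 define Y where "Y = (%r. SIGMA k:{..<n}. marks (N k) (t r k))"
 \<comment> \<open>These spines contain the ends of all arcs and cut each lobe at the vertices of
   its simplex; their number is bounded by \<open>B\<close> independently of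
   \<open>r\<close>.\<close>
 define X where "X = (%r. circuit (cc r) ` marks M (l r) \<union> (%k. (k, 0)) ` {..<n} \<union> Y r)"
 have mk: "finite (marks (N k) (t r k))" "marks (N k) (t r k) <= {0..<1}" if "k < n" for k r
  using marks_props(1)[OF t(1)[OF that]] by (simp_all add: mark_set_def)
 have Yf: "finite (Y r)" for r unfolding Y_def using mk by (intro finite_SigmaI) auto
 have Yp: "Y r <= points (cc r)" for r unfolding Y_def points_def cact(2) using mk(2) by (intro Sigma_mono) auto
 have mX: "marked (cc r) (X r)" for r
  using marked_trace[OF cact(1) tr l(1) w Yf Yp] unfolding X_def M_def cact(2) .
 have cM: "finite (marks M (l r))" "card (marks M (l r)) <= Suc M" for r
  using marks_props[OF l(1), of r] by (simp_all add: M_def mark_set_def)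
 have cX: "card (X r) <= B" for r
 proof -
  have "card (Y r) = (\<Sum>k<n. card (marks (N k) (t r k)))"
   unfolding Y_def using mk(1) by (intro card_SigmaI) auto
  also have "... <= (\<Sum>k<n. Suc (N k))" using marks_props(2)[OF t(1)] by (intro sum_mono) auto
  finally have 1: "card (Y r) <= (\<Sum>k<n. Suc (N k))" .
  have 2: "card (circuit (cc r) ` marks M (l r)) <= Suc M" using card_image_le[OF cM(1)] cM(2) by (rule le_trans)
  have 3: "card ((%k. (k, 0 :: real)) ` {..<n}) <= n" using card_image_le[of "{..<n}" "%k. (k, 0 :: real)"] by simp
  have "card (X r) <= card (circuit (cc r) ` marks M (l r)) + card ((%k. (k, 0 :: real)) ` {..<n}) + card (Y r)"
   unfolding X_def by (intro order_trans[OF card_Un_le] add_mono card_Un_le le_refl)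
  then show ?thesis using 1 2 3 unfolding B_def by linarith
 qed
 have NB: "N k <= B" if "k < n" for k
 proof -
  have "Suc (N k) <= (\<Sum>k<n. Suc (N k))" using that by (intro member_le_sum) auto
  then show ?thesis unfolding B_def by linarith
 qed
 define ph where "ph = (%r k i. segment_at (N k) (t r k) (nth_mark (on_lobe (X r) k) i))"
 \<comment> \<open>All combinatorial data of the spines: their number, their distribution over the
   lobes, the order of the segments along the path, and the operators that express the simplices by
   the marks. Only finitely many values are possible.\<close>
 define F where "F = (%r. (card (X r), restrict (%(k, i). (spines (X r) k, seg_index (cc r) (X r) k i, ph r k i)) ({..<n} \<times> {..B})))"
 have "range F <= {..B} \<times> (({..<n} \<times> {..B}) \<rightarrow>\<^sub>E ({..B} \<times> {..B} \<times> {..B}))"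
 proof (rule image_subsetI)
  fix r
  have fX: "finite (X r)" using mX[of r] by (simp add: marked_def)
  have 1: "spines (X r) k <= B" for k using card_on_lobe_le[OF fX] cX[of r] unfolding spines_def by (rule le_trans)
  have T: "finite (on_circuit (cc r) (X r))" "card (on_circuit (cc r) (X r)) = card (X r)"
   using circuit_marks[OF cact(1) mX, of r] by (simp_all add: mark_set_def)
  have 2: "seg_index (cc r) (X r) k i <= B" for k i
  proof -
   have "seg_index (cc r) (X r) k i <= card (on_circuit (cc r) (X r))"
    unfolding seg_index_def using T(1) by (intro card_mono) auto
   then show ?thesis using T(2) cX[of r] by simp
  qed
  have 3: "ph r k i <= B" if "k < n" for k i
   unfolding ph_def using segment_at_le NB[OF that] by (rule le_trans)
  show "F r \<in> {..B} \<times> (({..<n} \<times> {..B}) \<rightarrow>\<^sub>E ({..B} \<times> {..B} \<times> {..B}))"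
   using cX[of r] 1 2 3 by (simp add: F_def PiE_iff split_beta)
 qed
 then have "finite (range F)" by (rule finite_subset) (intro finite_cartesian_product finite_PiE; simp)
 then obtain rh :: "nat => nat" where rh: "strict_mono rh" "!!r. F (rh r) = F (rh 0)" by (rule constant_subseq) blast
 define c1 where "c1 = cc (rh 0)"
 define X1 where "X1 = X (rh 0)"
 define ph0 where "ph0 = ph (rh 0)"
 have c1: "is_cactus c1" "lobes c1 = n" and mX1: "marked c1 X1" unfolding c1_def X1_def by (rule cact cact mX)+
 have cd: "card (X (rh r)) = card X1" for r using rh(2)[of r] by (simp add: F_def X1_def)
 have data: "spines (X (rh r)) k = spines X1 k" "seg_index (cc (rh r)) (X (rh r)) k i = seg_index c1 X1 k i"
  "ph (rh r) k i = ph0 k i" if "k < n" "i <= B" for r k i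
 proof -
  have "snd (F (rh r)) (k, i) = snd (F (rh 0)) (k, i)" unfolding rh(2)[of r] ..
  then show "spines (X (rh r)) k = spines X1 k" "seg_index (cc (rh r)) (X (rh r)) k i = seg_index c1 X1 k i"
   "ph (rh r) k i = ph0 k i"
   using that by (simp_all add: F_def X1_def c1_def ph0_def)
 qed
 have spB: "spines X1 k <= B" for k
  using card_on_lobe_le[of X1 k] cX[of "rh 0"] mX1 unfolding spines_def marked_def X1_def by linarith
 define u where "u = (%r. gaps (on_circuit (cc (rh r)) (X (rh r))))"
 have us: "u r \<in> standard_simplex (card X1 - 1)" for r
  unfolding u_def cd[of r, symmetric] by (rule gaps_circuit_simplex[OF cact(1) mX])
 have re: "realizes c1 X1 (u r) (cc (rh r))"
  and lw: "k < n ==> lobe_weights c1 X1 (u r) (cc (rh r)) k = gaps (on_lobe (X (rh r)) k)" for r k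
 proof -
  have a: "spines X1 k = spines (X (rh r)) k" if "k < lobes (cc (rh r))" for k
   using data(1)[of k 0 r] that cact(2) by simp
  have b: "seg_index c1 X1 k i = seg_index (cc (rh r)) (X (rh r)) k i"
   if "k < lobes (cc (rh r))" "i < spines (X (rh r)) k" for k i
  proof -
   have "i <= B" using that a[OF that(1)] spB[of k] by linarith
   then show ?thesis using data(2)[of k i r] that cact(2) by simp
  qed
  have lob: "lobes c1 = lobes (cc (rh r))" unfolding c1(2) cact(2) ..
  show "realizes c1 X1 (u r) (cc (rh r))"
   unfolding u_def by (rule realizes_same_type(1)[OF cact(1) mX lob cd[symmetric] a b])
  show "lobe_weights c1 X1 (u r) (cc (rh r)) k = gaps (on_lobe (X (rh r)) k)" if "k < n"
   unfolding u_def by (rule realizes_same_type(2)[OF cact(1) mX lob cd[symmetric] a b]) (use that cact(2) in simp_all)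
 qed
 have mon: "monotone_op (spines X1 k - 1) (N k) (ph0 k)" if k: "k < n" for k
  unfolding ph0_def ph_def spines_def X1_def
  using k cact(2) by (intro monotone_segment_at[OF sampling_marks[OF lobe_marks[OF mX]] t(1)]) simp_all
 have push: "t (rh r) k = push_forward (spines X1 k - 1) (ph0 k) (lobe_weights c1 X1 (u r) (cc (rh r)) k)"
  if k: "k < n" for r k
 proof -
  have sub: "marks (N k) (t (rh r) k) <= on_lobe (X (rh r)) k" using k by (auto simp: on_lobe_iff X_def Y_def)
  have lk: "k < lobes (cc (rh r))" using k cact(2) by simp
  have "push_forward (card (on_lobe (X (rh r)) k) - 1) (ph (rh r) k) (gaps (on_lobe (X (rh r)) k)) = t (rh r) k"
   unfolding ph_def using marks_props(3)[OF t(1)[OF k]] sub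
   by (intro push_forward_segment_at[OF t(1)[OF k] lobe_marks[OF mX lk]]) blast
  moreover have "card (on_lobe (X (rh r)) k) = spines X1 k" using data(1)[OF k, of 0 r] by (simp add: spines_def)
  moreover have "push_forward (spines X1 k - 1) (ph (rh r) k) v = push_forward (spines X1 k - 1) (ph0 k) v" for v
   using data(3)[OF k] spB[of k] by (intro push_forward_cong) simp
  ultimately show ?thesis unfolding lw[OF k] by simp
 qed
 define x where "x = (\<lambda>k\<in>{..<n}. op_act S (spines X1 k - 1) (N k) (ph0 k) (s k))"
 have x: "x \<in> inputs S c1 X1"
  unfolding inputs_def c1(2) x_def using op_act_cells[OF cyc mon s] by auto
 have sp: "spiny c1 X1" using c1 mX1 by (simp add: spiny_iff)
 \<comment> \<open>One formula for the subsequence and its limit: for every cactus that realizes the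
   fixed type, the value of the action is one fixed cell, with the lengths \<open>u'\<close> as
   coordinates.\<close>
 have val: "cactus_act S c' (\<lambda>k\<in>{..<n}. rclass S (N k) (s k) (t' k)) = rclass S (card X1 - 1) (smap S c1 X1 x) u'"
  if c': "is_cactus c'" and re': "realizes c1 X1 u' c'"
   and t': "!!k. k < n ==> t' k = push_forward (spines X1 k - 1) (ph0 k) (lobe_weights c1 X1 u' c' k)" for c' u' t'
 proof -
  have e: "rclass S (N k) (s k) (t' k) = rclass S (spines X1 k - 1) (x k) (lobe_weights c1 X1 u' c' k)" if k: "k < n" for k
  proof -
   have "lobe_weights c1 X1 u' c' k \<in> standard_simplex (spines X1 k - 1)"
    by (rule lobe_weights_simplex[OF re' mX1 c']) (use k c1(2) in simp)
   then have "rclass S (spines X1 k - 1) (op_act S (spines X1 k - 1) (N k) (ph0 k) (s k)) (lobe_weights c1 X1 u' c' k) =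
     rclass S (N k) (s k) (push_forward (spines X1 k - 1) (ph0 k) (lobe_weights c1 X1 u' c' k))"
    by (rule rclass_op_act[OF cyc mon[OF k] s[OF k]])
   then show ?thesis unfolding t'[OF k] x_def using k by simp
  qed
  have lob: "lobes c' = n" using re' c1(2) by (simp add: realizes_def)
  have "cactus_act S c' (\<lambda>k\<in>{..<n}. rclass S (N k) (s k) (t' k)) =
    cactus_act S c' (\<lambda>k\<in>{..<lobes c1}. rclass S (spines X1 k - 1) (x k) (lobe_weights c1 X1 u' c' k))"
   by (rule cactus_act_restrict) (simp only: lob restrict_apply c1(2) lessThan_iff if_True e)
  then show ?thesis unfolding realizes_value[OF S c' c1(1) mX1 x re'] .
 qed
 obtain \<tau> :: "nat => nat" and v where v: "strict_mono \<tau>" "v \<in> standard_simplex (card X1 - 1)" "(u \<circ> \<tau>) \<longlonglongrightarrow> v"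
  by (rule simplex_subseq[OF us])
 define sg where "sg = rh \<circ> \<tau>"
 have sg: "strict_mono sg" unfolding sg_def using rh(1) v(1) by (rule strict_mono_o)
 have resg: "realizes c1 X1 ((u \<circ> \<tau>) r) ((cc \<circ> sg) r)" for r using re[of "\<tau> r"] by (simp add: sg_def)
 have lob1: "lobes c1 = lobes c" using c1(2) cact0(2) by simp
 have "realizes c1 X1 v c & (\<forall>k<lobes c. (%r. radius ((cc \<circ> sg) r) k) \<longlonglongrightarrow> radius c k)"
 proof (intro conjI allI impI)
  show "realizes c1 X1 v c"
  proof (rule realizes_limit(1)[OF cact0(1) mX1 lob1 _ resg v(3,2) _ tr0 w _ l(2) LIMSEQ_subseq_LIMSEQ[OF l(3) sg]])
   show "(%r. (z \<circ> sg) r k) \<longlonglongrightarrow> z0 k" if "k < lobes c" for k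
    using LIMSEQ_subseq_LIMSEQ[OF z sg, of k] that cact0(2) by (simp add: comp_def)
  qed (simp_all add: cact tr l del: One_nat_def)
  show "(%r. radius ((cc \<circ> sg) r) k) \<longlonglongrightarrow> radius c k" if "k < lobes c" for k
  proof (rule realizes_limit(2)[OF cact0(1) mX1 lob1 _ resg v(3,2) _ tr0 w _ l(2) LIMSEQ_subseq_LIMSEQ[OF l(3) sg] _ that])
   show "(%r. (z \<circ> sg) r k) \<longlonglongrightarrow> z0 k" if "k < lobes c" for k
    using LIMSEQ_subseq_LIMSEQ[OF z sg, of k] that cact0(2) by (simp add: comp_def)
  qed (simp_all add: cact tr l del: One_nat_def)
 qed
 then have re0: "realizes c1 X1 v c" and rad: "!!k. k < n ==> (%r. radius (cc (sg r)) k) \<longlonglongrightarrow> radius c k"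
  using cact0(2) by simp_all
 \<comment> \<open>The barycentric coordinates on a lobe are lengths divided by the radius; they
   converge because the radius of the limit is positive.\<close>
 have t0: "t0 k = push_forward (spines X1 k - 1) (ph0 k) (lobe_weights c1 X1 v c k)" if k: "k < n" for k
 proof (rule LIMSEQ_unique)
  show "(%r. t (sg r) k) \<longlonglongrightarrow> t0 k" using LIMSEQ_subseq_LIMSEQ[OF t(2)[OF k] sg] by (simp add: comp_def)
  have rc: "radius c k ~= 0" using precactus_radius[OF cactus_pre[OF cact0(1)], of k] k cact0(2) by simp
  have "(%r. lobe_weights c1 X1 (u (\<tau> r)) (cc (sg r)) k) \<longlonglongrightarrow> lobe_weights c1 X1 v c k"
   unfolding tendsto_fun_iff
  proof
   fix i
   show "(%r. lobe_weights c1 X1 (u (\<tau> r)) (cc (sg r)) k i) \<longlonglongrightarrow> lobe_weights c1 X1 v c k i"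
   proof (cases "i < spines X1 k")
    case True
    have "(%r. u (\<tau> r) (seg_index c1 X1 k i)) \<longlonglongrightarrow> v (seg_index c1 X1 k i)"
     using v(3) by (simp add: tendsto_fun_iff comp_def)
    then show ?thesis using True tendsto_divide[OF _ rad[OF k] rc] by (simp add: lobe_weights_def)
   qed (simp add: lobe_weights_def)
  qed
  then have "(%r. push_forward (spines X1 k - 1) (ph0 k) (lobe_weights c1 X1 (u (\<tau> r)) (cc (sg r)) k)) \<longlonglongrightarrow>
    push_forward (spines X1 k - 1) (ph0 k) (lobe_weights c1 X1 v c k)" by (rule tendsto_push_forward)
  moreover have "t (sg r) k = push_forward (spines X1 k - 1) (ph0 k) (lobe_weights c1 X1 (u (\<tau> r)) (cc (sg r)) k)" for r
   using push[OF k, of "\<tau> r"] by (simp add: sg_def)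
  ultimately show "(%r. t (sg r) k) \<longlonglongrightarrow> push_forward (spines X1 k - 1) (ph0 k) (lobe_weights c1 X1 v c k)" by simp
 qed
 define D where "D = {u \<in> standard_simplex (card X1 - 1). rclass S (card X1 - 1) (smap S c1 X1 x) u \<in> C}"
 have "closedin (simplex_topology (card X1 - 1)) D"
  unfolding D_def using C cactus_setD(2)[OF S sp x] unfolding closedin_realization by blast
 moreover have "(u \<circ> \<tau>) r \<in> D" for r
  using val[OF cact(1) re push, of "\<tau> r"] inC[of "rh (\<tau> r)"] us[of "\<tau> r"] by (simp add: D_def)
 ultimately have "v \<in> D" using v(3) by (rule closedin_simplexD)
 then show ?thesis using val[OF cact0(1) re0 t0] by (simp add: D_def)
qed

section \<open>From sequences to continuity\<close>

lemma metrizable_simplex_topology: "metrizable_space (simplex_topology n)"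
 unfolding simplex_topology_eq by (intro metrizable_space_subtopology metrizable_space_euclidean)

lemma metrizable_finite_product:
 "finite I ==> (!!i. i \<in> I ==> metrizable_space (X i)) ==> metrizable_space (product_topology X I)"
 unfolding metrizable_space_product_topology by (intro disjI2 conjI ballI) (simp_all add: countable_finite)

lemma metrizable_trace_topology: "metrizable_space (trace_topology n w)"
proof -
 have "metrizable_space (powertop_real {..<n})"
  by (rule metrizable_finite_product) (simp_all add: metrizable_space_euclidean)
 then show ?thesis
  unfolding trace_topology_def
  using metrizable_simplex_topology by (intro metrizable_space_subtopology) (simp add: metrizable_space_prod_topology)
qed

abbreviation simplices :: "nat => (nat => nat) => (nat => nat => real) topology" where
 "simplices n N \<equiv> product_topology (%k. simplex_topology (N k)) {..<n}"

lemma simplices_props: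
 "metrizable_space (simplices n N)" "compact_space (simplices n N)"
 "topspace (simplices n N) = ({..<n} \<rightarrow>\<^sub>E {t. True}) \<inter> {t. \<forall>k<n. t k \<in> standard_simplex (N k)}"
proof -
 show "metrizable_space (simplices n N)"
  by (rule metrizable_finite_product) (simp_all add: metrizable_simplex_topology)
 have "compact_space (simplex_topology m)" for m
  by (rule compact_space_subtopology[OF compactin_standard_simplex])
 then show "compact_space (simplices n N)" by (simp add: compact_space_product_topology)
 show "topspace (simplices n N) = ({..<n} \<rightarrow>\<^sub>E {t. True}) \<inter> {t. \<forall>k<n. t k \<in> standard_simplex (N k)}"
  by (auto simp: PiE_iff)
qed

definition cell_point :: "('a, 'b) cyclic_set_scheme => nat => (nat => nat) => (nat => 'a) => (nat => nat => real) => nat => 'a rpoint" where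
 "cell_point S n N s t = (\<lambda>k\<in>{..<n}. rclass S (N k) (s k) (t k))"

lemma the_trace:
 assumes "c \<in> cacti n" "traces c w l z" "l \<in> standard_simplex (length w - 1)" "w ~= []"
 shows "(THE c. c \<in> cacti n & traces c w l z) = c"
proof (rule the_equality)
 show "c \<in> cacti n & traces c w l z" using assms by simp
 show "c' = c" if "c' \<in> cacti n & traces c' w l z" for c'
  using traces_unique[of c' n c w l z] assms that by simp
qed

text \<open>Parameter spaces and products of simplices are metrizable, so it suffices that preimages
  of closed sets are sequentially closed.\<close>

lemma continuous_map_act_trace:
 assumes S: "is_cactus_set S" and s: "!!k. k < n ==> s k \<in> cells S (N k)" and w: "w ~= []"
 shows "continuous_map (prod_topology (trace_topology n w) (simplices n N)) (realization S)
  (%((l, z), t). cactus_act S (THE c. c \<in> cacti n & traces c w l z) (cell_point S n N s t))"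
  (is "continuous_map ?P _ ?g")
proof -
 define g where "g = ?g"
 have top: "\<exists>c. c \<in> cacti n & traces c w (fst (fst p)) (snd (fst p)) &
   fst (fst p) \<in> standard_simplex (length w - 1) & (\<forall>k<n. snd p k \<in> standard_simplex (N k)) &
   g p = cactus_act S c (cell_point S n N s (snd p))" if p: "p \<in> topspace ?P" for p
 proof -
  obtain l z t where plzt: "p = ((l, z), t)" by (metis surj_pair)
  have lz: "(l, z) \<in> topspace (trace_topology n w)" and t: "t \<in> topspace (simplices n N)"
   using p unfolding plzt topspace_prod_topology by simp_all
  have l: "l \<in> standard_simplex (length w - 1)" and "\<exists>c\<in>cacti n. traces c w l z"
   using lz unfolding trace_topology_def by auto
  then obtain c where c: "c \<in> cacti n" "traces c w l z" by blast
  have "\<forall>k<n. t k \<in> standard_simplex (N k)" using t unfolding simplices_props(3) by blast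
  moreover have "g p = cactus_act S c (cell_point S n N s t)"
   unfolding plzt g_def by (simp add: the_trace[OF c l w])
  ultimately show ?thesis using c l unfolding plzt by (intro exI[of _ c]) simp
 qed
 have "metrizable_space ?P"
  unfolding metrizable_space_prod_topology using metrizable_trace_topology simplices_props(1) by blast
 then obtain M d where Md: "Metric_space M d" and P: "?P = Metric_space.mtopology M d"
  unfolding metrizable_space_def by blast
 have "continuous_map ?P (realization S) g"
  unfolding continuous_map_closedin
 proof (intro conjI allI impI)
  show "g \<in> topspace ?P \<rightarrow> topspace (realization S)"
  proof
   fix p assume "p \<in> topspace ?P"
   then obtain c where c: "c \<in> cacti n" "\<forall>k<n. snd p k \<in> standard_simplex (N k)"
    "g p = cactus_act S c (cell_point S n N s (snd p))" using top by blast
   have cc: "is_cactus c" "lobes c = n" using c(1) by (simp_all add: cacti_def)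
   have "cell_point S n N s (snd p) k \<in> topspace (realization S)" if "k < lobes c" for k
   proof -
    have k: "k < n" using that cc(2) by simp
    then have "rclass S (N k) (s k) (snd p k) \<in> topspace (realization S)"
     unfolding topspace_realization using s c(2) by blast
    then show ?thesis using k by (simp add: cell_point_def)
   qed
   then show "g p \<in> topspace (realization S)" unfolding c(3) by (rule cactus_act_topspace[OF S cc(1)])
  qed
  fix C assume C: "closedin (realization S) C"
  define D where "D = {p \<in> topspace ?P. g p \<in> C}"
  have seq: "p \<in> D" if sg: "range sg <= D" and lim: "limitin ?P sg p sequentially" for sg p
  proof -
   have p: "p \<in> topspace ?P" by (rule limitin_topspace[OF lim])
   obtain c where c: "c \<in> cacti n" "traces c w (fst (fst p)) (snd (fst p))" "fst (fst p) \<in> standard_simplex (length w - 1)"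
    "g p = cactus_act S c (cell_point S n N s (snd p))" using top[OF p] by blast
   have sgD: "sg r \<in> topspace ?P" "g (sg r) \<in> C" for r using sg unfolding D_def by auto
   have "\<forall>r. \<exists>c. c \<in> cacti n & traces c w (fst (fst (sg r))) (snd (fst (sg r))) &
     fst (fst (sg r)) \<in> standard_simplex (length w - 1) & (\<forall>k<n. snd (sg r) k \<in> standard_simplex (N k)) &
     g (sg r) = cactus_act S c (cell_point S n N s (snd (sg r)))"
    using top[OF sgD(1)] by blast
   then obtain cc where cc: "!!r. cc r \<in> cacti n" "!!r. traces (cc r) w (fst (fst (sg r))) (snd (fst (sg r)))"
     "!!r. fst (fst (sg r)) \<in> standard_simplex (length w - 1)"
     "!!r k. k < n ==> snd (sg r) k \<in> standard_simplex (N k)"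
     "!!r. g (sg r) = cactus_act S (cc r) (cell_point S n N s (snd (sg r)))" by metis
   have l1: "limitin (prod_topology (simplex_topology (length w - 1)) (powertop_real {..<n})) (fst \<circ> sg) (fst p) sequentially"
    and l2: "limitin (simplices n N) (snd \<circ> sg) (snd p) sequentially"
    using lim unfolding limitin_pairwise trace_topology_def limitin_subtopology by blast+
   have ll: "(%r. fst (fst (sg r))) \<longlonglongrightarrow> fst (fst p)"
    using l1 unfolding limitin_pairwise simplex_topology_eq limitin_subtopology by (simp add: comp_def)
   have lz: "(%r. snd (fst (sg r)) k) \<longlonglongrightarrow> snd (fst p) k" if "k < n" for k
    using l1 that unfolding limitin_pairwise limitin_componentwise by (simp add: comp_def)
   have lt: "(%r. snd (sg r) k) \<longlonglongrightarrow> snd p k" if "k < n" for k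
    using l2 that unfolding limitin_componentwise simplex_topology_eq limitin_subtopology by (simp add: comp_def)
   have "cactus_act S c (\<lambda>k\<in>{..<n}. rclass S (N k) (s k) (snd p k)) \<in> C"
   proof (rule act_sequence[OF S s cc(1) c(1) cc(2) c(2) w cc(3) c(3) ll lz cc(4) lt C])
    show "cactus_act S (cc r) (\<lambda>k\<in>{..<n}. rclass S (N k) (s k) (snd (sg r) k)) \<in> C" for r
     using sgD(2)[of r] unfolding cc(5) cell_point_def .
   qed assumption+
   then show ?thesis using p c(4) by (simp add: D_def cell_point_def)
  qed
  have DM: "D <= M"
   using Metric_space.topspace_mtopology[OF Md] unfolding P[symmetric] D_def by blast
  have "closedin ?P D"
   using Metric_space.metric_closedin_iff_sequentially_closed[OF Md, of D] DM seq unfolding P[symmetric] by blast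
  then show "closedin ?P {p \<in> topspace ?P. g p \<in> C}" unfolding D_def .
 qed
 then show ?thesis unfolding g_def .
qed

lemma continuous_map_prod_sum_topology:
 assumes "!!i. i \<in> I ==> continuous_map (prod_topology (X i) T) Y (%(x, t). g ((i, x), t))"
 shows "continuous_map (prod_topology (sum_topology X I) T) Y g"
 unfolding continuous_map
proof (intro conjI allI impI)
 show "g ` topspace (prod_topology (sum_topology X I) T) <= topspace Y"
 proof (rule image_subsetI)
  fix p assume "p \<in> topspace (prod_topology (sum_topology X I) T)"
  then obtain i x t where p: "p = ((i, x), t)" "i \<in> I" "x \<in> topspace (X i)" "t \<in> topspace T" by auto
  then show "g p \<in> topspace Y"
   using continuous_map_image_subset_topspace[OF assms[OF p(2)]] by fastforce
 qed
 fix U assume U: "openin Y U"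
 let ?W = "{p \<in> topspace (prod_topology (sum_topology X I) T). g p \<in> U}"
 show "openin (prod_topology (sum_topology X I) T) ?W"
  unfolding openin_prod_topology_alt
 proof (intro allI impI)
  fix q t assume qt: "(q, t) \<in> ?W"
  obtain i x where q: "q = (i, x)" by (cases q)
  have i: "i \<in> I" "x \<in> topspace (X i)" "t \<in> topspace T" "g ((i, x), t) \<in> U" using qt by (auto simp: q)
  have o: "openin (prod_topology (X i) T) {p \<in> topspace (prod_topology (X i) T). (case p of (x, t) => g ((i, x), t)) \<in> U}"
   by (rule openin_continuous_map_preimage[OF assms[OF i(1)] U])
  have "(x, t) \<in> {p \<in> topspace (prod_topology (X i) T). (case p of (x, t) => g ((i, x), t)) \<in> U}"
   using i by simp
  from o[unfolded openin_prod_topology_alt, rule_format, OF this]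
  obtain A V where A: "openin (X i) A" "openin T V" "x \<in> A" "t \<in> V"
   "A \<times> V <= {p \<in> topspace (prod_topology (X i) T). (case p of (x, t) => g ((i, x), t)) \<in> U}"
   by blast
  have "openin (sum_topology X I) (Pair i ` A)"
   using open_map_component_injection[OF i(1), of X] A(1) unfolding open_map_def by blast
  moreover have "Pair i ` A \<times> V <= ?W" using A(5) i(1) by auto
  ultimately show "\<exists>U V. openin (sum_topology X I) U & openin T V & q \<in> U & t \<in> V & U \<times> V <= ?W"
   using A q by blast
 qed
qed

lemma continuous_map_act_cells:
 assumes S: "is_cactus_set S" and s: "!!k. k < n ==> s k \<in> cells S (N k)"
 shows "continuous_map (prod_topology (cactus_space n) (simplices n N)) (realization S)
  (%(c, t). cactus_act S c (cell_point S n N s t))"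
proof -
 let ?I = "{w. w ~= [] & set w <= {..<n}}"
 let ?X = "sum_topology (trace_topology n) ?I"
 let ?f = "%(w, l, z). THE c. c \<in> cacti n & traces c w l z"
 have q: "quotient_map ?X (cactus_space n) ?f"
  unfolding cactus_space_def by (rule quotient_map_quotient_topology)
 show ?thesis
 proof (rule continuous_compose_quotient_map)
  show "quotient_map (prod_topology ?X (simplices n N)) (prod_topology (cactus_space n) (simplices n N)) (%(x, y). (?f x, y))"
   by (rule quotient_map_prod_left[OF compact_imp_locally_compact_space[OF simplices_props(2)]
      disjI1[OF metrizable_imp_Hausdorff_space[OF simplices_props(1)]] q])
  show "continuous_map (prod_topology ?X (simplices n N)) (realization S)
    ((%(c, t). cactus_act S c (cell_point S n N s t)) \<circ> (%(x, y). (?f x, y)))"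
  proof (rule continuous_map_prod_sum_topology)
   fix w assume "w \<in> ?I"
   then have w: "w ~= []" by simp
   show "continuous_map (prod_topology (trace_topology n w) (simplices n N)) (realization S)
     (%(x, t). ((%(c, t). cactus_act S c (cell_point S n N s t)) \<circ> (%(x, y). (?f x, y))) ((w, x), t))"
    by (rule continuous_map_eq[OF continuous_map_act_trace[OF S s w]]) (auto split: prod.split)
  qed
 qed
qed

text \<open>The product of simplices maps properly onto the product of closed cells, being a compact
  space mapped continuously to a Hausdorff one. Properness, unlike closedness, survives the product
  with the space of cacti; so the product is a quotient map and continuity descends.\<close>

lemma continuous_map_act_closed_cells:
 assumes S: "is_cactus_set S" and s: "!!k. k < n ==> s k \<in> cells S (N k)"
 shows "continuous_map (prod_topology (cactus_space n)
   (product_topology (%k. subtopology (realization S) (closed_cell S (N k) (s k))) {..<n})) (realization S)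
  (%(c, x). cactus_act S c x)"
proof -
 note cyc = cactus_setD(1)[OF S]
 let ?C = "%k. subtopology (realization S) (closed_cell S (N k) (s k))"
 let ?P = "product_topology ?C {..<n}"
 let ?E = "cell_point S n N s"
 have cell: "closed_cell S (N k) (s k) <= topspace (realization S)" if "k < n" for k
  by (rule closedin_subset[OF closedin_closed_cell[OF cyc s[OF that]]])
 have cont: "continuous_map (simplices n N) ?P ?E"
  unfolding continuous_map_componentwise
 proof (intro conjI ballI)
  show "?E ` topspace (simplices n N) <= extensional {..<n}" by (auto simp: cell_point_def)
  fix k assume "k \<in> {..<n}"
  then have k: "k < n" by simp
  have "continuous_map (simplex_topology (N k)) (?C k) (rclass S (N k) (s k))"
   using continuous_map_rclass[OF s[OF k]] by (simp add: continuous_map_in_subtopology)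
  then have "continuous_map (simplices n N) (?C k) (rclass S (N k) (s k) \<circ> (%t. t k))"
   using continuous_map_product_projection[of k "{..<n}" "%k. simplex_topology (N k)"] k
   by (intro continuous_map_compose[of _ "simplex_topology (N k)"]) simp_all
  then show "continuous_map (simplices n N) (?C k) (%t. ?E t k)"
   using k by (simp add: cell_point_def comp_def)
 qed
 have "Hausdorff_space ?P"
  unfolding Hausdorff_space_product_topology using Hausdorff_closed_cell[OF cyc s] by simp
 then have proper: "proper_map (simplices n N) ?P ?E"
  by (intro continuous_imp_proper_map[OF simplices_props(2) _ cont] Hausdorff_imp_kc_space)
 have surj: "?E ` topspace (simplices n N) = topspace ?P"
 proof (intro equalityI subsetI)
  show "x \<in> topspace ?P" if "x \<in> ?E ` topspace (simplices n N)" for x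
   using continuous_map_image_subset_topspace[OF cont] that by blast
  fix x assume x: "x \<in> topspace ?P"
  have "\<exists>t. t \<in> standard_simplex (N k) & x k = rclass S (N k) (s k) t" if k: "k < n" for k
   using x k by (auto simp: PiE_iff)
  then obtain t where t: "!!k. k < n ==> t k \<in> standard_simplex (N k) & x k = rclass S (N k) (s k) (t k)" by metis
  have "x = ?E (\<lambda>k\<in>{..<n}. t k)"
   using x t by (auto simp: cell_point_def PiE_iff extensional_def fun_eq_iff)
  moreover have "(\<lambda>k\<in>{..<n}. t k) \<in> topspace (simplices n N)" using t by auto
  ultimately show "x \<in> ?E ` topspace (simplices n N)" by blast
 qed
 let ?X = "prod_topology (cactus_space n) (simplices n N)" and ?Y = "prod_topology (cactus_space n) ?P"
 have "proper_map ?X ?Y (%(c, t). (c, ?E t))"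
  using proper proper_map_id[of "cactus_space n"]
   proper_map_prod[of "cactus_space n" "simplices n N" "cactus_space n" ?P "%c. c" ?E]
  by (simp add: id_def)
 then have "closed_map ?X ?Y (%(c, t). (c, ?E t))" by (rule proper_imp_closed_map)
 moreover have "continuous_map ?X ?Y (%(c, t). (c, ?E t))"
  unfolding continuous_map_prod_top using cont by simp
 moreover have "(%(c, t). (c, ?E t)) ` topspace ?X = topspace ?Y"
  unfolding topspace_prod_topology surj[symmetric] by force
 ultimately have "quotient_map ?X ?Y (%(c, t). (c, ?E t))"
  by (intro continuous_closed_imp_quotient_map)
 then show ?thesis
  by (rule continuous_compose_quotient_map)
   (rule continuous_map_eq[OF continuous_map_act_cells[where s = s and N = N, OF S s]], assumption, auto)
qed

lemma continuous_map_from_kificationI: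
 assumes "!!K. compactin X K ==> continuous_map (subtopology X K) Y f"
 shows "continuous_map (kification X) Y f"
 unfolding continuous_map
proof (intro conjI allI impI)
 have top: "topspace (kification X) = topspace X" by simp
 show "f ` topspace (kification X) <= topspace Y"
 proof (rule image_subsetI)
  fix x assume "x \<in> topspace (kification X)"
  then have x: "x \<in> topspace X" by simp
  then have "continuous_map (subtopology X {x}) Y f" by (intro assms) simp
  then show "f x \<in> topspace Y" using continuous_map_image_subset_topspace x by fastforce
 qed
 fix U assume U: "openin Y U"
 show "openin (kification X) {x \<in> topspace (kification X). f x \<in> U}"
  unfolding openin_kification top
 proof (intro conjI allI impI)
  fix K assume K: "compactin X K"
  have "openin (subtopology X K) {x \<in> topspace (subtopology X K). f x \<in> U}"
   by (rule openin_continuous_map_preimage[OF assms[OF K] U])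
  moreover have "{x \<in> topspace (subtopology X K). f x \<in> U} = K \<inter> {x \<in> topspace X. f x \<in> U}" by auto
  ultimately show "openin (subtopology X K) (K \<inter> {x \<in> topspace X. f x \<in> U})" by simp
 qed auto
qed

text \<open>A compact subset of the product lies over a finite union of products of closed cells.\<close>

lemma continuous_map_act:
 assumes S: "is_cactus_set S"
 shows "continuous_map (kification (prod_topology (cactus_space n) (product_topology (%_. realization S) {..<n})))
  (realization S) (%(c, x). cactus_act S c x)"
proof (rule continuous_map_from_kificationI)
 note cyc = cactus_setD(1)[OF S]
 let ?R = "product_topology (%_. realization S) {..<n}"
 let ?P = "prod_topology (cactus_space n) ?R"
 fix K assume K: "compactin ?P K"
 have KP: "K <= topspace ?P" by (rule compactin_subset_topspace[OF K])
 define F where "F = (%k. cell_name S ` (%p. snd p k) ` K)"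
 have F: "finite (F k)" if "k < n" for k
 proof -
  have "continuous_map ?P (realization S) ((%x. x k) \<circ> snd)"
   using that by (intro continuous_map_compose[OF continuous_map_snd] continuous_map_product_projection) simp
  then have "compactin (realization S) (((%x. x k) \<circ> snd) ` K)" by (rule image_compactin[OF K])
  then show ?thesis unfolding F_def using compact_finite_cells[OF cyc] by (simp add: comp_def)
 qed
 have name: "\<exists>m y. cell_name S (snd p k) = (m, y) & y \<in> cells S m & snd p k \<in> closed_cell S m y"
  if "p \<in> K" "k < n" for p k
 proof -
  have "snd p k \<in> topspace (realization S)" using KP that by (auto simp: PiE_iff)
  then obtain m s t where "snd p k = rclass S m s t" "s \<in> cells S m" "t \<in> standard_simplex m"
   unfolding topspace_realization by blast
  then show ?thesis using cell_name_props(2)[OF cyc] by metis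
 qed
 have Fc: "snd i \<in> cells S (fst i)" if "i \<in> F k" "k < n" for i k
  using that name unfolding F_def by force
 \<comment> \<open>These products of closed cells are closed, and those whose labels occur on
   \<open>K\<close> are finitely many and cover it, so that continuity can be pasted.\<close>
 define T where "T = (%i. topspace (cactus_space n) \<times> (\<Pi>\<^sub>E k\<in>{..<n}. closed_cell S (fst (i k)) (snd (i k))))"
 show "continuous_map (subtopology ?P K) (realization S) (%(c, x). cactus_act S c x)"
 proof (rule pasting_lemma_closed[where I = "PiE {..<n} F" and T = "%i. K \<inter> T i" and f = "%_ (c, x). cactus_act S c x"])
  show "finite (PiE {..<n} F)" using F by (intro finite_PiE) auto
  fix i assume i: "i \<in> PiE {..<n} F"
  have ic: "snd (i k) \<in> cells S (fst (i k))" if "k < n" for k using Fc[of "i k" k] i that by (auto simp: PiE_iff)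
  have "closedin ?R (\<Pi>\<^sub>E k\<in>{..<n}. closed_cell S (fst (i k)) (snd (i k)))"
   unfolding closedin_product_topology using closedin_closed_cell[OF cyc ic] by simp
  then have "closedin ?P (T i)" unfolding T_def by (simp add: closedin_prod_Times_iff)
  then show "closedin (subtopology ?P K) (K \<inter> T i)" by (rule closedin_subtopology_Int_closed)
  have "continuous_map (subtopology ?P (T i)) (realization S) (%(c, x). cactus_act S c x)"
   using continuous_map_act_closed_cells[where s = "%k. snd (i k)" and N = "%k. fst (i k)", OF S ic]
   unfolding T_def prod_topology_subtopology(2)[symmetric] subtopology_product_topology by simp
  then show "continuous_map (subtopology (subtopology ?P K) (K \<inter> T i)) (realization S) (%(c, x). cactus_act S c x)"
   unfolding subtopology_subtopology by (rule continuous_map_from_subtopology_mono) auto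
 next
  fix p assume "p \<in> topspace (subtopology ?P K)"
  then have p: "p \<in> K" "p \<in> topspace ?P" by auto
  define j where "j = (\<lambda>k\<in>{..<n}. cell_name S (snd p k))"
  have "j \<in> PiE {..<n} F" using p(1) by (auto simp: j_def F_def)
  moreover have "p \<in> T j"
  proof -
   have "snd p k \<in> closed_cell S (fst (j k)) (snd (j k))" if "k < n" for k
    using name[OF p(1) that] that by (auto simp: j_def)
   then show ?thesis using p(2) by (cases p) (auto simp: T_def PiE_iff)
  qed
  ultimately show "\<exists>j. j \<in> PiE {..<n} F & p \<in> K \<inter> T j &
    (case p of (c, x) => cactus_act S c x) = (case p of (c, x) => cactus_act S c x)"
   using p(1) by blast
 qed simp
qed

theorem proposition1p3:
  shows "\<exists>\<theta> :: 'a cactus_set \<Rightarrow> cactus \<Rightarrow> (nat \<Rightarrow> 'a rpoint) \<Rightarrow> 'a rpoint.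
    (\<forall>S. is_cactus_set S \<longrightarrow>
       cactus_action (realization S) (\<theta> S) \<and>
       induced_action S (\<theta> S) \<and>
       (equivariant_smap S \<longrightarrow> equivariant_action (realization S) (\<theta> S)) \<and>
       (unital_smap S \<longrightarrow> unital_action (realization S) (\<theta> S))) \<and>
    (\<forall>S T g. is_cactus_set S \<and> is_cactus_set T \<and> is_cactus_set_hom S T g \<longrightarrow>
       (\<forall>n\<ge>1. \<forall>c\<in>cacti n. \<forall>x \<in> {..<n} \<rightarrow>\<^sub>E topspace (realization S).
          realization_map T g (\<theta> S c x) =
          \<theta> T c (\<lambda>k\<in>{..<n}. realization_map T g (x k))))"
proof (intro exI[of _ cactus_act] conjI allI impI ballI)
 fix S :: "'a cactus_set" assume S: "is_cactus_set S"
 show "cactus_action (realization S) (cactus_act S)"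
  unfolding cactus_action_def
 proof (intro conjI allI impI ballI)
  show "continuous_map (kification (prod_topology (cactus_space n) (product_topology (%_. realization S) {..<n})))
    (realization S) (%(c, x). cactus_act S c x)" for n by (rule continuous_map_act[OF S])
  fix n c d x assume "c \<in> cacti n" and d: "\<forall>k<n. is_cactus (d k)"
   and x: "x \<in> {..<lobes (graft c d)} \<rightarrow>\<^sub>E topspace (realization S)"
  then have c: "is_cactus c" "lobes c = n" by (simp_all add: cacti_def)
  show "cactus_act S (graft c d) x =
    cactus_act S c (\<lambda>k\<in>{..<n}. cactus_act S (d k) (\<lambda>l\<in>{..<lobes (d k)}. x (flat (%a. lobes (d a)) (k, l))))"
   unfolding c(2)[symmetric] by (rule cactus_act_graft[OF S c(1)]) (use d c(2) x in \<open>auto simp: PiE_iff\<close>)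
 qed
 show "induced_action S (cactus_act S)" by (rule induced_cactus_act[OF S])
 show "equivariant_action (realization S) (cactus_act S)" if "equivariant_smap S"
  unfolding equivariant_action_def
 proof (intro allI impI ballI)
  fix n c sg x assume "c \<in> cacti n" "sg permutes {..<n}" "x \<in> {..<n} \<rightarrow>\<^sub>E topspace (realization S)"
  then show "cactus_act S (relabel sg c) x = cactus_act S c (x \<circ> sg)"
   by (intro cactus_act_relabel[OF S that]) (auto simp: cacti_def PiE_iff)
 qed
 show "unital_action (realization S) (cactus_act S)" if "unital_smap S"
  unfolding unital_action_def using cactus_act_unit[OF S that] by (auto simp: PiE_iff)
next
 fix S T :: "'a cactus_set" and g n c x
 assume g: "is_cactus_set S & is_cactus_set T & is_cactus_set_hom S T g"
  and "c \<in> cacti n" and x: "x \<in> {..<n} \<rightarrow>\<^sub>E topspace (realization S)"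
 then have c: "is_cactus c" "lobes c = n" by (simp_all add: cacti_def)
 show "realization_map T g (cactus_act S c x) = cactus_act T c (\<lambda>k\<in>{..<n}. realization_map T g (x k))"
  unfolding c(2)[symmetric] using g x c by (intro cactus_act_natural) (auto simp: PiE_iff)
qed

end
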